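(* Let $0<a<b$ and $k\in\mathbb{N}$. Fix $c>1$ and $\alpha\in(0,\alpha_c)$. Then there exist a positive constant $\eta_0$, a function $\lambda(\eta)\in C^\infty([-\eta_0,\eta_0])$ and $$\zeta(\cdot,\eta)\in C^\infty\bigl([-\eta_0,\eta_0];H^k_\alpha(\mathbb{R})\times H^{k-1}_\alpha(\mathbb{R})\bigr),\qquad \zeta^*(\cdot,\eta)\in C^\infty\bigl([-\eta_0,\eta_0];H^k_{-\alpha}(\mathbb{R})\times H^{k-1}_{-\alpha}(\mathbb{R})\bigr)$$ such that $$\mathcal{L}(\eta)\zeta(z,\pm\eta)=\lambda(\pm\eta)\zeta(z,\pm\eta),\qquad \mathcal{L}(\eta)^*\zeta^*(z,\pm\eta)=\lambda(\mp\eta)\zeta^*(z,\pm\eta),$$ $$\lambda(\eta)=i\lambda_1\eta-\lambda_2\eta^2+O(\eta^3),$$ $$\zeta(\cdot,\eta)=\zeta_1+i\lambda_1\eta\,\zeta_2+O(\eta^2)\quad\text{in } H^k_\alpha(\mathbb{R})\times H^{k-1}_\alpha(\mathbb{R}),$$ $$\zeta^*(\cdot,\eta)=\zeta_2^*-i\lambda_1\eta\,\zeta_1^*+O(\eta^2)\quad\text{in } H^k_{-\alpha}(\mathbb{R})\times H^{k-1}_{-\alpha}(\mathbb{R}),$$ $$\overline{\lambda(\eta)}=\lambda(-\eta),\quad \overline{\zeta(z,\eta)}=\zeta(z,-\eta),\quad \overline{\zeta^*(z,\eta)}=\zeta^*(z,-\eta)\quad\text{for }\eta\in[-\eta_0,\eta_0],\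 z\in\mathbb{R},$$ where $\lambda_1$ and $\lambda_2$ are positive constants, $A_0=1-a\partial_z^2$, $B_0=1-b\partial_z^2$ and $$\zeta_1=\begin{pmatrix} q_c\\ r_c'\end{pmatrix},\qquad \zeta_2=\begin{pmatrix}\int_z^\infty\partial_cq_c\\ -\partial_cr_c\end{pmatrix},$$ $$\zeta_1^*=c\begin{pmatrix}-B_0\partial_cr_c-2q_c\partial_cq_c-q_c'\int_{-\infty}^z\partial_cq_c\\ B_0\int_{-\infty}^z\partial_cq_c\end{pmatrix},\qquad \zeta_2^*=\begin{pmatrix}A_0q_c'\\ -B_0r_c\end{pmatrix}.$$
   Context: For $c>1$ and $0<a<b$ put $\alpha_c=\sqrt{\frac{c^2-1}{bc^2-a}}$, $q_c(z)=\frac{c^2-1}{c}\operatorname{sech}^2\bigl(\frac{\alpha_cz}{2}\bigr)$ and $r_c(z)=-cq_c(z)$; here $'$ is $d/dz$ and $\partial_c$ is the derivative in the parameter $c$. (The function $\varphi_c$ with $\varphi_c'=q_c$ gives the line solitary wave $\varphi_c(x-ct)$ of the Benney-Luke equation $\partial_t^2\Phi-\Delta\Phi+a\Delta^2\Phi-b\Delta\partial_t^2\Phi+(\partial_t\Phi)(\Delta\Phi)+\partial_t(|\nabla\Phi|^2)=0$ on $\mathbb{R}\times\mathbb{R}^2$.) Weighted spaces: $L^2_\alpha(\mathbb{R})=L^2(\mathbb{R};e^{2\alpha x}dx)$, and $H^k_\alpha(\mathbb{R})$ has norm $\|u\|_{H^k_\alpha(\mathbb{R})}=(\|\partial_x^ku\|_{L^2_\alpha}^2+\|u\|_{L^2_\alpha}^2)^{1/2}$.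 For $\eta\in\mathbb{R}$ set $A(\eta)=1+a\eta^2-a\partial_z^2$, $B(\eta)=1+b\eta^2-b\partial_z^2$ and $$\mathcal{L}(\eta)=\begin{pmatrix} c\partial_z & 1\\ B(\eta)^{-1}A(\eta)(\partial_z^2-\eta^2) & c\partial_z\end{pmatrix}-B(\eta)^{-1}\begin{pmatrix}0&0\\ v_{1,c}(\eta)&v_{2,c}(\eta)\end{pmatrix},$$ $$v_{1,c}(\eta)=2r_c'\partial_z+r_c(\partial_z^2-\eta^2),\qquad v_{2,c}(\eta)=2q_c\partial_z+q_c'.$$ This is the Fourier fibre at transverse frequency $\eta$ (i.e. $\mathcal{L}(\eta)u(z)=e^{-iy\eta}\mathcal{L}(e^{iy\eta}u(z))$) of the linearization $\mathcal{L}$ of the Benney-Luke equation, written as a first-order system in the moving coordinate $z=x-ct$, around the line solitary wave. The operator $\mathcal{L}(\eta)$ acts on functions in the space with weight $e^{2\alpha z}$, and $\mathcal{L}(\eta)^*$ is its adjoint with respect to the pairing $\langle f,g\rangle=\sum_j\int_{\mathbb{R}}f_j(z)\overline{g_j(z)}\,dz$, acting on functions in the space with weight $e^{-2\alpha z}$. *)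

theory Defs
  imports "HOL-Analysis.Analysis" "HOL-Library.Landau_Symbols"
begin

section \<open>The solitary wave profile\<close>

definition alpha_c :: "real \<Rightarrow> real \<Rightarrow> real \<Rightarrow> real" where
  "alpha_c a b c = sqrt ((c\<^sup>2 - 1) / (b * c\<^sup>2 - a))"

definition q_c :: "real \<Rightarrow> real \<Rightarrow> real \<Rightarrow> real \<Rightarrow> real" where
  "q_c a b c z = (c\<^sup>2 - 1) / c * (1 / cosh (alpha_c a b c * z / 2))\<^sup>2"

definition r_c :: "real \<Rightarrow> real \<Rightarrow> real \<Rightarrow> real \<Rightarrow> real" where
  "r_c a b c z = - c * q_c a b c z"

definition dc_q :: "real \<Rightarrow> real \<Rightarrow> real \<Rightarrow> real \<Rightarrow> real" where
  "dc_q a b c z = deriv (\<lambda>s. q_c a b s z) c"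

definition dc_r :: "real \<Rightarrow> real \<Rightarrow> real \<Rightarrow> real \<Rightarrow> real" where
  "dc_r a b c z = deriv (\<lambda>s. r_c a b s z) c"


section \<open>Distributions on the real line\<close>

text \<open>Complex-valued distributions are represented by their values on real-valued test
  functions, which determine them by linearity.  Only these values matter: all equations between
  distributions below are required on \<open>test_fun\<close> only.\<close>

type_synonym distr = "(real \<Rightarrow> real) \<Rightarrow> complex"

definition test_fun :: "(real \<Rightarrow> real) set" where
  "test_fun = {\<phi>. (\<forall>n x. (deriv ^^ n) \<phi> field_differentiable at x) \<and>
                   (\<exists>R. \<forall>x. \<bar>x\<bar> > R \<longrightarrow> \<phi> x = 0)}"

definition distr_of :: "(real \<Rightarrow> complex) \<Rightarrow> distr" where
  "distr_of u \<phi> = (LINT x|lborel. u x * complex_of_real (\<phi> x))"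

definition distr_eq :: "distr \<Rightarrow> distr \<Rightarrow> bool" where
  "distr_eq S T \<longleftrightarrow> (\<forall>\<phi>\<in>test_fun. S \<phi> = T \<phi>)"

definition ddz :: "distr \<Rightarrow> distr" where
  "ddz T \<phi> = - T (deriv \<phi>)"

definition mult_distr :: "(real \<Rightarrow> real) \<Rightarrow> distr \<Rightarrow> distr" where
  "mult_distr m T \<phi> = T (\<lambda>x. m x * \<phi> x)"


section \<open>Weighted Sobolev spaces\<close>

text \<open>Elements of the function spaces are actual functions; equality in the spaces is equality
  almost everywhere.\<close>

definition L2w :: "real \<Rightarrow> (real \<Rightarrow> complex) set" where
  "L2w \<alpha> = {u \<in> borel_measurable lborel.
              integrable lborel (\<lambda>x. exp (2 * \<alpha> * x) * (norm (u x))\<^sup>2)}"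

definition L2w_norm :: "real \<Rightarrow> (real \<Rightarrow> complex) \<Rightarrow> real" where
  "L2w_norm \<alpha> u = sqrt (LINT x|lborel. exp (2 * \<alpha> * x) * (norm (u x))\<^sup>2)"

definition L1loc :: "(real \<Rightarrow> complex) set" where
  "L1loc = {u \<in> borel_measurable lborel. \<forall>R. set_integrable lborel {-R..R} u}"

definition is_wderiv :: "nat \<Rightarrow> (real \<Rightarrow> complex) \<Rightarrow> (real \<Rightarrow> complex) \<Rightarrow> bool" where
  "is_wderiv k u g \<longleftrightarrow> distr_eq ((ddz ^^ k) (distr_of u)) (distr_of g)"

definition wderiv :: "nat \<Rightarrow> (real \<Rightarrow> complex) \<Rightarrow> real \<Rightarrow> complex" where
  "wderiv k u = (SOME g. g \<in> L1loc \<and> is_wderiv k u g)"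

definition Hw :: "nat \<Rightarrow> real \<Rightarrow> (real \<Rightarrow> complex) set" where
  "Hw k \<alpha> = {u \<in> L2w \<alpha>. \<exists>g \<in> L2w \<alpha>. is_wderiv k u g}"

definition Hw_norm :: "nat \<Rightarrow> real \<Rightarrow> (real \<Rightarrow> complex) \<Rightarrow> real" where
  "Hw_norm k \<alpha> u = sqrt ((L2w_norm \<alpha> (wderiv k u))\<^sup>2 + (L2w_norm \<alpha> u)\<^sup>2)"

text \<open>The product spaces with Sobolev indices \<open>k\<close> and \<open>k - 1\<close>; used for \<open>k \<ge> 1\<close> only.\<close>

definition HHw :: "nat \<Rightarrow> real \<Rightarrow> (real \<Rightarrow> complex \<times> complex) set" where
  "HHw k \<alpha> = {u. (\<lambda>z. fst (u z)) \<in> Hw k \<alpha> \<and> (\<lambda>z. snd (u z)) \<in> Hw (k - 1) \<alpha>}"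

definition HHw_norm :: "nat \<Rightarrow> real \<Rightarrow> (real \<Rightarrow> complex \<times> complex) \<Rightarrow> real" where
  "HHw_norm k \<alpha> u =
     sqrt ((Hw_norm k \<alpha> (\<lambda>z. fst (u z)))\<^sup>2 + (Hw_norm (k - 1) \<alpha> (\<lambda>z. snd (u z)))\<^sup>2)"

text \<open>Infinite differentiability on an interval \<open>I\<close> (one-sided at end points), with values in
  \<open>\<complex>\<close> and in the norm of the product space; \<open>F n\<close> is the \<open>n\<close>-th derivative.\<close>

definition smooth_scalar :: "real set \<Rightarrow> (real \<Rightarrow> complex) \<Rightarrow> bool" where
  "smooth_scalar I f \<longleftrightarrow> (\<exists>F :: nat \<Rightarrow> real \<Rightarrow> complex. F 0 = f \<and>
     (\<forall>n. \<forall>\<eta>\<in>I. (F n has_vector_derivative F (Suc n) \<eta>) (at \<eta> within I)))"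

definition smooth_HHw ::
  "nat \<Rightarrow> real \<Rightarrow> real set \<Rightarrow> (real \<Rightarrow> real \<Rightarrow> complex \<times> complex) \<Rightarrow> bool" where
  "smooth_HHw k \<alpha> I f \<longleftrightarrow> (\<exists>F :: nat \<Rightarrow> real \<Rightarrow> real \<Rightarrow> complex \<times> complex. F 0 = f \<and>
     (\<forall>n. \<forall>\<eta>\<in>I. F n \<eta> \<in> HHw k \<alpha> \<and>
        ((\<lambda>s. HHw_norm k \<alpha> (\<lambda>z. (F n s z - F n \<eta> z) /\<^sub>R (s - \<eta>) - F (Suc n) \<eta> z)) \<longlongrightarrow> 0)
          (at \<eta> within I)))"

fun cscale :: "complex \<Rightarrow> complex \<times> complex \<Rightarrow> complex \<times> complex" where
  "cscale s (x, y) = (s * x, s * y)"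


section \<open>The linearized operator at transverse frequency \<open>\<eta>\<close>\<close>

text \<open>\<open>ellip a \<eta>\<close> is \<open>A(\<eta>)\<close> and \<open>ellip b \<eta>\<close> is \<open>B(\<eta>)\<close>.\<close>

definition ellip :: "real \<Rightarrow> real \<Rightarrow> distr \<Rightarrow> distr" where
  "ellip a \<eta> T \<phi> = (1 + a * \<eta>\<^sup>2) * T \<phi> - a * ddz (ddz T) \<phi>"

definition lap :: "real \<Rightarrow> distr \<Rightarrow> distr" where
  "lap \<eta> T \<phi> = ddz (ddz T) \<phi> - \<eta>\<^sup>2 * T \<phi>"

text \<open>\<open>B(\<eta>)\<inverse>\<close> in the space with weight \<open>e\<^sup>2\<^sup>\<alpha>\<^sup>z\<close>, as a map from distributions (of Sobolev order
  \<open>-2\<close>) to weighted square-integrable functions.  The solution is unique up to null sets since the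
  nonzero homogeneous solutions are exponential sums, none of which is in \<open>L2w \<alpha>\<close>.\<close>

definition Binv :: "real \<Rightarrow> real \<Rightarrow> real \<Rightarrow> distr \<Rightarrow> real \<Rightarrow> complex" where
  "Binv b \<alpha> \<eta> T = (SOME g. g \<in> L2w \<alpha> \<and> distr_eq (ellip b \<eta> (distr_of g)) T)"

definition v1 :: "real \<Rightarrow> real \<Rightarrow> real \<Rightarrow> real \<Rightarrow> distr \<Rightarrow> distr" where
  "v1 a b c \<eta> T \<phi> =
     2 * mult_distr (deriv (r_c a b c)) (ddz T) \<phi> + mult_distr (r_c a b c) (lap \<eta> T) \<phi>"

definition v2 :: "real \<Rightarrow> real \<Rightarrow> real \<Rightarrow> distr \<Rightarrow> distr" where
  "v2 a b c T \<phi> =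
     2 * mult_distr (q_c a b c) (ddz T) \<phi> + mult_distr (deriv (q_c a b c)) T \<phi>"

definition Lop ::
  "real \<Rightarrow> real \<Rightarrow> real \<Rightarrow> real \<Rightarrow> real \<Rightarrow> (real \<Rightarrow> complex \<times> complex) \<Rightarrow> real \<Rightarrow> complex \<times> complex"
where
  "Lop a b c \<alpha> \<eta> u =
     (let u1 = (\<lambda>z. fst (u z)); u2 = (\<lambda>z. snd (u z)) in
      (\<lambda>z. (c * wderiv 1 u1 z + u2 z,
            Binv b \<alpha> \<eta> (ellip a \<eta> (lap \<eta> (distr_of u1))) z + c * wderiv 1 u2 z
            - Binv b \<alpha> \<eta> (\<lambda>\<phi>. v1 a b c \<eta> (distr_of u1) \<phi> + v2 a b c (distr_of u2) \<phi>) z)))"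

text \<open>On the space \<open>HHw k \<alpha>\<close> the operator has order one: \<open>A(\<eta>)\<close> and \<open>B(\<eta>)\<close> have the same order,
  so its domain is \<open>HHw (k + 1) \<alpha>\<close>.  \<open>L_eq k a b c \<alpha> \<eta> u w\<close> says that \<open>u\<close> is in the domain and is
  mapped to \<open>w\<close>.\<close>

definition L_eq ::
  "nat \<Rightarrow> real \<Rightarrow> real \<Rightarrow> real \<Rightarrow> real \<Rightarrow> real \<Rightarrow> (real \<Rightarrow> complex \<times> complex)
     \<Rightarrow> (real \<Rightarrow> complex \<times> complex) \<Rightarrow> bool" where
  "L_eq k a b c \<alpha> \<eta> u w \<longleftrightarrow> u \<in> HHw (k + 1) \<alpha> \<and> (AE z in lborel. Lop a b c \<alpha> \<eta> u z = w z)"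

definition pairing ::
  "(real \<Rightarrow> complex \<times> complex) \<Rightarrow> (real \<Rightarrow> complex \<times> complex) \<Rightarrow> complex" where
  "pairing f g = (LINT z|lborel. fst (f z) * cnj (fst (g z)))
               + (LINT z|lborel. snd (f z) * cnj (snd (g z)))"

text \<open>\<open>Lstar_eq k a b c \<alpha> \<eta> v w\<close>: the adjoint of the operator above maps \<open>v\<close> to \<open>w\<close>, for \<open>v\<close> and
  \<open>w\<close> in the space with the dual weight.\<close>

definition Lstar_eq ::
  "nat \<Rightarrow> real \<Rightarrow> real \<Rightarrow> real \<Rightarrow> real \<Rightarrow> real \<Rightarrow> (real \<Rightarrow> complex \<times> complex)
     \<Rightarrow> (real \<Rightarrow> complex \<times> complex) \<Rightarrow> bool" where
  "Lstar_eq k a b c \<alpha> \<eta> v w \<longleftrightarrow> v \<in> HHw k (- \<alpha>) \<and> w \<in> HHw k (- \<alpha>) \<and>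
     (\<forall>u \<in> HHw (k + 1) \<alpha>. pairing (Lop a b c \<alpha> \<eta> u) v = pairing u w)"


section \<open>The generalized kernels at \<open>\<eta> = 0\<close>\<close>

text \<open>\<open>ellip0 a\<close> is \<open>A\<^sub>0\<close> and \<open>ellip0 b\<close> is \<open>B\<^sub>0\<close>, on smooth functions.\<close>

definition ellip0 :: "real \<Rightarrow> (real \<Rightarrow> real) \<Rightarrow> real \<Rightarrow> real" where
  "ellip0 a f z = f z - a * (deriv ^^ 2) f z"

definition int_left_dc_q :: "real \<Rightarrow> real \<Rightarrow> real \<Rightarrow> real \<Rightarrow> real" where
  "int_left_dc_q a b c z = (LBINT y:{..z}. dc_q a b c y)"

definition int_right_dc_q :: "real \<Rightarrow> real \<Rightarrow> real \<Rightarrow> real \<Rightarrow> real" where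
  "int_right_dc_q a b c z = (LBINT y:{z..}. dc_q a b c y)"

definition zeta1 :: "real \<Rightarrow> real \<Rightarrow> real \<Rightarrow> real \<Rightarrow> complex \<times> complex" where
  "zeta1 a b c z = (of_real (q_c a b c z), of_real (deriv (r_c a b c) z))"

definition zeta2 :: "real \<Rightarrow> real \<Rightarrow> real \<Rightarrow> real \<Rightarrow> complex \<times> complex" where
  "zeta2 a b c z = (of_real (int_right_dc_q a b c z), of_real (- dc_r a b c z))"

definition zeta1_star :: "real \<Rightarrow> real \<Rightarrow> real \<Rightarrow> real \<Rightarrow> complex \<times> complex" where
  "zeta1_star a b c z =
     (of_real (c * (- ellip0 b (dc_r a b c) z - 2 * q_c a b c z * dc_q a b c z
                    - deriv (q_c a b c) z * int_left_dc_q a b c z)),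
      of_real (c * ellip0 b (int_left_dc_q a b c) z))"

definition zeta2_star :: "real \<Rightarrow> real \<Rightarrow> real \<Rightarrow> real \<Rightarrow> complex \<times> complex" where
  "zeta2_star a b c z =
     (of_real (ellip0 a (deriv (q_c a b c)) z), of_real (- ellip0 b (r_c a b c) z))"

end

(* Eliminating the second component of the eigenvalue problem gives a scalar fourth-order equation
   P u = 0 whose coefficients are polynomials in eps = i eta and lambda.  With lambda = eps mu and
   u = q + eps mu u1 + eps^2 v, where u1(z) is the integral of d_c q over (z, oo), it becomes
   P0 v = - f, P0 = D (m D^2 - (c^2 - 1) + 3 c q) D, m = b c^2 - a, with f affine in v and
   polynomial in eps and mu.  P0 has an explicit right inverse (variation of constants and tail
   integrals) on the functions orthogonal to q that are bounded by exp (- alpha z - delta |z|).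
   The orthogonality condition reads A (mu^2 - mu0^2) + O(eps) = 0, where A < 0 and mu0 > 0 come
   from explicit integrals, so that (mu, f) is the fixed point of a contraction on holomorphic
   families.  Cauchy's estimates give the smoothness in eta and the expansions, and the reality of
   the data gives the conjugation symmetry.  The reflection z -> - z turns P into its transpose,
   hence the same solution produces the adjoint modes.  Finally lambda_2 = mu'(0) is obtained by
   pairing with the reflected u1, and its sign reduces to a polynomial inequality in 1 / c^2 and
   b alpha_c^2. *)

theory Submission
 imports Defs "HOL-Complex_Analysis.Complex_Analysis"
begin

text \<open>At \<open>\<eta> = 0\<close> the eigenvalue 0 is defective, \<open>zeta1\<close> and
  \<open>zeta2\<close> forming a Jordan chain, so the two eigenvalues emerging from it coalesce
  there. Dividing by \<open>\<epsilon>\<close> separates them: the limiting equation for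
  \<open>\<mu>\<close> has distinct roots, and near the positive one a Newton step with frozen
  derivative contracts.

  The weight cannot be dropped because \<open>u1\<close> tends to the nonzero constant
  \<open>2 * j0\<close> at minus infinity. It fixes a window of exponents:
  \<open>\<alpha> - \<delta> > 0\<close> for the tail integrals, and
  \<open>\<alpha> + \<delta>\<close> below the decay rate of the soliton for the variation of
  constants.

  Regularity in the parameter is treated at each fixed \<open>z\<close>: the families are scalar
  holomorphic functions with bounds uniform relative to the weight, so Cauchy's estimates bound all
  parameter derivatives by the same weight. Derivatives in \<open>z\<close> of every order come from
  a class closed under differentiation, generated by three explicit functions, the four functions
  \<open>KK j f\<close> and polynomials in \<open>tanh\<close>. The fixed point equation closes this
  class, since it expresses \<open>f\<close> through \<open>KK j f\<close>.\<close>

abbreviation (input) cx :: "real => complex" where "cx \<equiv> complex_of_real"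

abbreviation (input) bmeas :: "(real => 'a::topological_space) => bool" where
 "bmeas f \<equiv> f \<in> borel_measurable borel"

abbreviation (input) intg :: "(real => 'a::{banach,second_countable_topology}) => bool" where
 "intg f \<equiv> integrable lborel f"

abbreviation (input) tint :: "(real => complex) => (real => real) => complex" where
 "tint u \<phi> \<equiv> (LINT x|lborel. u x * cx (\<phi> x))"

section \<open>Calculus of smooth real functions\<close>

primrec diffn :: "nat => (real => real) => bool" where
 "diffn 0 f = True"
| "diffn (Suc n) f = (\<exists>f'. (\<forall>x. (f has_real_derivative f' x) (at x)) \<and> diffn n f')"

text \<open>With existentially quantified derivatives in \<open>diffn\<close>, closure under sums,
  products and compositions is an induction on the order; \<open>smooth_iff\<close> gives the link
  to the iterated \<open>deriv\<close> in \<open>test_fun\<close>.\<close>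

definition smooth :: "(real => real) => bool" where
 "smooth f \<longleftrightarrow> (\<forall>n. diffn n f)"

lemma diffn_Suc_D: "diffn (Suc n) f ==> diffn n f"
 by (induction n arbitrary: f) auto

lemma diffn_add: "diffn n f ==> diffn n g ==> diffn n (\<lambda>x. f x + g x)"
proof (induction n arbitrary: f g)
 case (Suc n)
 then obtain f' g' where "\<forall>x. (f has_real_derivative f' x) (at x)" "diffn n f'"
  "\<forall>x. (g has_real_derivative g' x) (at x)" "diffn n g'" by auto
 then show ?case using Suc.IH by (auto intro!: exI[of _ "\<lambda>x. f' x + g' x"] derivative_eq_intros)
qed simp

lemma diffn_mult: "diffn n f ==> diffn n g ==> diffn n (\<lambda>x. f x * g x)"
proof (induction n arbitrary: f g)
 case (Suc n)
 then obtain f' g' where 1: "\<forall>x. (f has_real_derivative f' x) (at x)" "diffn n f'"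
  "\<forall>x. (g has_real_derivative g' x) (at x)" "diffn n g'" unfolding diffn.simps by blast
 have 2: "diffn n f" "diffn n g" using Suc.prems by (blast intro: diffn_Suc_D)+
 have "\<forall>x. ((\<lambda>x. f x * g x) has_real_derivative (f' x * g x + g' x * f x)) (at x)"
  using 1 by (intro allI DERIV_mult) auto
 moreover have "diffn n (\<lambda>x. f' x * g x + g' x * f x)"
  by (intro diffn_add Suc.IH 1 2)
 ultimately show ?case unfolding diffn.simps
  by (intro exI[of _ "\<lambda>x. f' x * g x + g' x * f x"] conjI)
qed simp

lemma diffn_compose: "diffn n f ==> diffn n g ==> diffn n (\<lambda>x. f (g x))"
proof (induction n arbitrary: f g)
 case (Suc n)
 then obtain f' g' where 1: "\<forall>x. (f has_real_derivative f' x) (at x)" "diffn n f'"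
  "\<forall>x. (g has_real_derivative g' x) (at x)" "diffn n g'" by auto
 have 2: "diffn n g" using Suc.prems by (blast intro: diffn_Suc_D)
 have "\<forall>x. ((\<lambda>x. f (g x)) has_real_derivative (f' (g x) * g' x)) (at x)"
  using 1 DERIV_chain2 by blast
 moreover have "diffn n (\<lambda>x. f' (g x) * g' x)"
  using 1 2 Suc.IH diffn_mult by blast
 ultimately show ?case by auto
qed simp

lemma diffn_const: "diffn n (\<lambda>x. k)"
 by (induction n arbitrary: k) (auto intro!: exI[of _ "\<lambda>x. 0"])

lemma diffn_ident: "diffn n (\<lambda>x. x)"
 by (cases n) (auto intro!: exI[of _ "\<lambda>x. 1"] diffn_const derivative_eq_intros)

lemma smooth_add: "smooth f ==> smooth g ==> smooth (\<lambda>x. f x + g x)"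
 and smooth_mult: "smooth f ==> smooth g ==> smooth (\<lambda>x. f x * g x)"
 and smooth_compose: "smooth f ==> smooth g ==> smooth (\<lambda>x. f (g x))"
 and smooth_const: "smooth (\<lambda>x. k)"
 and smooth_ident: "smooth (\<lambda>x. x)"
 unfolding smooth_def by (simp_all add: diffn_add diffn_mult diffn_compose diffn_const diffn_ident)

lemma smooth_cmult: "smooth f ==> smooth (\<lambda>x. k * f x)"
 by (intro smooth_mult smooth_const)

lemma smooth_uminus: "smooth f ==> smooth (\<lambda>x. - f x)"
 using smooth_cmult[of f "-1"] by simp

lemma smooth_diff: "smooth f ==> smooth g ==> smooth (\<lambda>x. f x - g x)"
 using smooth_add[OF _ smooth_uminus] by simp

lemma smooth_has_deriv: "smooth f ==> (f has_real_derivative deriv f x) (at x)"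
 unfolding smooth_def by (metis DERIV_imp_deriv diffn.simps(2))

lemma smooth_deriv:
 assumes "smooth f" shows "smooth (deriv f)"
 unfolding smooth_def
proof
 fix n
 obtain f' where "\<forall>x. (f has_real_derivative f' x) (at x)" "diffn n f'"
  using assms unfolding smooth_def by (meson diffn.simps(2))
 moreover from this have "deriv f = f'" by (auto intro: DERIV_imp_deriv)
 ultimately show "diffn n (deriv f)" by simp
qed

lemma smooth_deriv_n: "smooth f ==> smooth ((deriv ^^ n) f)"
 by (induction n) (auto intro: smooth_deriv)

text \<open>Coinduction spares formulas for higher derivatives: it suffices to find a class in which
  every member has its derivative in the class again. Convolutions and members of derivative
  sequences are handled this way.\<close>

lemma smooth_coinduct:
 assumes "P f" and "!!f. P f ==> \<exists>f'. (\<forall>x. (f has_real_derivative f' x) (at x)) \<and> P f'"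
 shows "smooth f"
proof -
 have "P f ==> diffn n f" for n f
  by (induction n arbitrary: f) (use assms(2) in \<open>auto, blast\<close>)
 then show ?thesis using assms(1) by (simp add: smooth_def)
qed

lemma smooth_iff: "smooth f \<longleftrightarrow> (\<forall>n x. (deriv ^^ n) f field_differentiable at x)"
proof
 assume "smooth f"
 then show "\<forall>n x. (deriv ^^ n) f field_differentiable at x"
  using smooth_deriv_n smooth_has_deriv field_differentiable_def by blast
next
 assume f: "\<forall>n x. (deriv ^^ n) f field_differentiable at x"
 show "smooth f"
 proof (rule smooth_coinduct[where P = "\<lambda>g. \<exists>n. g = (deriv ^^ n) f"])
  show "\<exists>n. f = (deriv ^^ n) f" by (rule exI[of _ 0]) simp
  fix g assume "\<exists>n. g = (deriv ^^ n) f"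
  then obtain n where "g = (deriv ^^ n) f" ..
  then have "(\<forall>x. (g has_real_derivative deriv g x) (at x)) \<and> deriv g = (deriv ^^ Suc n) f"
   using f by (auto simp: DERIV_deriv_iff_field_differentiable)
  then show "\<exists>g'. (\<forall>x. (g has_real_derivative g' x) (at x)) \<and> (\<exists>n. g' = (deriv ^^ n) f)" by blast
 qed
qed

lemma smooth_continuous: "smooth f ==> continuous_on A f"
 by (meson DERIV_isCont continuous_at_imp_continuous_on smooth_has_deriv)

section \<open>The flat function behind all cutoffs\<close>

definition flat :: "real => real" where
 "flat x = (if x > 0 then exp (- 1 / x) else 0)"

text \<open>Multiplying \<open>flat\<close> by powers of \<open>1/x\<close> gives a family closed
  under differentiation, which is all that smoothness of \<open>flat\<close> requires. The
  convention \<open>1/0 = 0\<close> is harmless because \<open>flat 0 = 0\<close>.\<close>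

lemma flat_deriv:
 "((\<lambda>x. (1/x) ^ k * flat x) has_real_derivative
   (- real k * ((1/x) ^ Suc k * flat x) + (1/x) ^ (k + 2) * flat x)) (at x)"
proof -
 consider "x > 0" | "x < 0" | "x = 0" by linarith
 then show ?thesis
 proof cases
  case 1
  have "((\<lambda>x. (1/x) ^ k * exp (- 1 / x)) has_real_derivative
    (- real k * ((1/x) ^ Suc k * flat x) + (1/x) ^ (k + 2) * flat x)) (at x)"
   using 1 by (cases k) (auto intro!: derivative_eq_intros simp: flat_def field_simps power2_eq_square,
     metis One_nat_def Suc_pred power_Suc neq0_conv)
  then show ?thesis
   by (rule has_field_derivative_transform_within_open[where S = "{0<..}"]) (use 1 in \<open>auto simp: flat_def\<close>)
 next
  case 2
  have "((\<lambda>x::real. 0) has_real_derivative 0) (at x)" by simp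
  then have "((\<lambda>x. (1/x) ^ k * flat x) has_real_derivative 0) (at x)"
   by (rule has_field_derivative_transform_within_open[where S = "{..<0}"]) (use 2 in \<open>auto simp: flat_def\<close>)
  then show ?thesis using 2 by (simp add: flat_def)
 next
  case 3
  \<comment> \<open>At the origin the right difference quotient is
    \<open>(1/h) ^ Suc k * exp (- 1 / h)\<close>; after the substitution \<open>y = 1/h\<close> the
    exponential beats the power.\<close>
  have *: "((\<lambda>y::real. y ^ Suc k * exp (- y)) \<longlongrightarrow> 0) at_top"
   using tendsto_power_div_exp_0[of "Suc k"] by (simp add: exp_minus divide_inverse)
  have "((\<lambda>h. (inverse h) ^ Suc k * exp (- (inverse h))) \<longlongrightarrow> 0) (at_right (0::real))"
   by (rule filterlim_compose[OF * filterlim_inverse_at_top_right])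
  then have r: "((\<lambda>h. ((1/h) ^ k * flat h) / h) \<longlongrightarrow> 0) (at_right (0::real))"
   by (rule Lim_transform_eventually)
    (auto simp: eventually_at_right_less flat_def field_simps intro!: eventually_at_right_less[THEN eventually_mono])
  have l: "((\<lambda>h. ((1/h) ^ k * flat h) / h) \<longlongrightarrow> 0) (at_left (0::real))"
   by (rule tendsto_eventually) (auto simp: eventually_at_filter flat_def)
  have "((\<lambda>h. ((1/h) ^ k * flat h) / h) \<longlongrightarrow> 0) (at (0::real))"
   using l r by (rule filterlim_split_at)
  then show ?thesis using 3 by (simp add: has_field_derivative_iff flat_def)
 qed
qed

lemma smooth_flat: "smooth flat"
proof -
 have "diffn n (\<lambda>x. (1/x) ^ k * flat x)" for n k
 proof (induction n arbitrary: k)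
  case (Suc n)
  have "diffn n (\<lambda>x. - real k * ((1/x) ^ Suc k * flat x) + (1/x) ^ (k + 2) * flat x)"
   by (intro diffn_add diffn_mult[OF diffn_const] Suc)
  then show ?case unfolding diffn.simps
   by (intro exI[of _ "\<lambda>x. - real k * ((1/x) ^ Suc k * flat x) + (1/x) ^ (k + 2) * flat x"] conjI allI flat_deriv)
 qed simp
 from this[of _ 0] show ?thesis by (simp add: smooth_def)
qed

section \<open>Test functions\<close>

lemma test_fun_iff: "\<phi> \<in> test_fun \<longleftrightarrow> smooth \<phi> \<and> (\<exists>R. \<forall>x. abs x > R \<longrightarrow> \<phi> x = 0)"
 by (simp add: test_fun_def smooth_iff)

lemma test_fun_smooth: "\<phi> \<in> test_fun ==> smooth \<phi>"
 by (simp add: test_fun_iff)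

lemma test_fun_has_deriv: "\<phi> \<in> test_fun ==> (\<phi> has_real_derivative deriv \<phi> x) (at x)"
 by (simp add: test_fun_smooth smooth_has_deriv)

lemma test_fun_deriv: assumes "\<phi> \<in> test_fun" shows "deriv \<phi> \<in> test_fun"
proof -
 obtain R where R: "!!x. abs x > R ==> \<phi> x = 0" using assms by (auto simp: test_fun_iff)
 have "deriv \<phi> x = 0" if "abs x > R" for x
 proof -
  have "((\<lambda>_. 0) has_real_derivative 0) (at x)" by simp
  then have "(\<phi> has_real_derivative 0) (at x)"
   by (rule has_field_derivative_transform_within_open[where S = "{y. abs y > R}"])
    (use that R in \<open>auto intro!: open_Collect_less continuous_intros\<close>)
  then show ?thesis by (rule DERIV_imp_deriv)
 qed
 then show ?thesis using assms by (auto simp: test_fun_iff intro: smooth_deriv)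
qed

lemma test_fun_mult: "smooth m ==> \<phi> \<in> test_fun ==> (\<lambda>x. m x * \<phi> x) \<in> test_fun"
 by (force simp: test_fun_iff intro: smooth_mult)

lemma test_fun_cmult: "\<phi> \<in> test_fun ==> (\<lambda>x. k * \<phi> x) \<in> test_fun"
 by (rule test_fun_mult[OF smooth_const])

lemma test_fun_uminus: "\<phi> \<in> test_fun ==> (\<lambda>x. - \<phi> x) \<in> test_fun"
 using test_fun_cmult[of \<phi> "-1"] by simp

lemma test_fun_add: assumes "\<phi> \<in> test_fun" "\<psi> \<in> test_fun" shows "(\<lambda>x. \<phi> x + \<psi> x) \<in> test_fun"
proof -
 obtain R R' where "!!x. abs x > R ==> \<phi> x = 0" "!!x. abs x > R' ==> \<psi> x = 0"
  using assms by (auto simp: test_fun_iff)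
 then have "\<forall>x. abs x > max R R' \<longrightarrow> \<phi> x + \<psi> x = 0" by simp
 then show ?thesis using assms unfolding test_fun_iff by (blast intro: smooth_add)
qed

lemma test_fun_diff: "\<phi> \<in> test_fun ==> \<psi> \<in> test_fun ==> (\<lambda>x. \<phi> x - \<psi> x) \<in> test_fun"
 using test_fun_add[OF _ test_fun_uminus] by simp

lemma test_fun_shift: assumes "\<phi> \<in> test_fun" shows "(\<lambda>x. \<phi> (x - t)) \<in> test_fun"
proof -
 obtain R where R: "!!x. abs x > R ==> \<phi> x = 0" using assms by (auto simp: test_fun_iff)
 have "smooth (\<lambda>x. \<phi> (x - t))"
  using assms by (intro smooth_compose[of \<phi> "\<lambda>x. x - t"] smooth_diff smooth_ident smooth_const)
   (simp add: test_fun_iff)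
 moreover have "\<forall>x. abs x > R + abs t \<longrightarrow> \<phi> (x - t) = 0" using R by auto
 ultimately show ?thesis unfolding test_fun_iff by blast
qed

lemma test_fun_bounded: assumes "\<phi> \<in> test_fun" obtains C where "C >= 0" "!!x. abs (\<phi> x) <= C"
proof -
 obtain R where R: "!!x. abs x > R ==> \<phi> x = 0" using assms by (auto simp: test_fun_iff)
 have "compact (\<phi> ` {-R..R})"
  using assms by (intro compact_continuous_image smooth_continuous) (auto simp: test_fun_iff)
 then have "\<exists>C. \<forall>x\<in>{-R..R}. abs (\<phi> x) <= C"
  by (auto dest!: compact_imp_bounded simp: bounded_iff)
 then obtain C where C: "!!x. x \<in> {-R..R} ==> abs (\<phi> x) <= C" by blast
 have "abs (\<phi> x) <= max C 0" for x
  using C[of x] R[of x] by (smt (verit, best) atLeastAtMost_iff max_def)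
 then show ?thesis using that[of "max C 0"] by simp
qed

lemma test_fun_measurable [measurable_dest]: "\<phi> \<in> test_fun ==> \<phi> \<in> borel_measurable borel"
 by (intro borel_measurable_continuous_onI smooth_continuous) (simp add: test_fun_iff)

lemma deriv_shift: "\<phi> \<in> test_fun ==> deriv (\<lambda>x. \<phi> (x - t)) = (\<lambda>x. deriv \<phi> (x - t))"
 using DERIV_chain2[OF test_fun_has_deriv, of \<phi> "\<lambda>x. x - t" _ 1 UNIV]
 by (auto intro!: DERIV_imp_deriv DERIV_chain2[OF test_fun_has_deriv, of \<phi> "\<lambda>x. x - t" 1, simplified] derivative_eq_intros)

lemma deriv_cmult': "\<phi> \<in> test_fun ==> deriv (\<lambda>x. k * \<phi> x) = (\<lambda>x. k * deriv \<phi> x)"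
 by (auto intro!: DERIV_imp_deriv derivative_eq_intros test_fun_has_deriv)

lemma deriv_add': "\<phi> \<in> test_fun ==> \<psi> \<in> test_fun ==>
  deriv (\<lambda>x. \<phi> x + \<psi> x) = (\<lambda>x. deriv \<phi> x + deriv \<psi> x)"
 by (auto intro!: DERIV_imp_deriv derivative_eq_intros test_fun_has_deriv)

lemma test_fun_deriv_n: "\<phi> \<in> test_fun ==> (deriv ^^ n) \<phi> \<in> test_fun"
 by (induction n) (auto intro: test_fun_deriv)

lemma L1loc_integrable_test:
 assumes "u \<in> L1loc" "\<phi> \<in> test_fun"
 shows "intg (\<lambda>x. u x * cx (\<phi> x))"
proof -
 obtain R where R: "!!x. abs x > R ==> \<phi> x = 0" using assms by (auto simp: test_fun_iff)
 obtain C where C: "C >= 0" "!!x. abs (\<phi> x) <= C" using test_fun_bounded assms(2) by blast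
 have [measurable]: "bmeas u" "bmeas \<phi>"
  using assms test_fun_measurable by (auto simp: L1loc_def)
 have "set_integrable lborel {-R..R} u" using assms by (auto simp: L1loc_def)
 then have "intg (\<lambda>x. C * norm (indicator {-R..R} x *\<^sub>R u x))"
  by (intro integrable_mult_right integrable_norm) (simp add: set_integrable_def)
 then show ?thesis
 proof (rule Bochner_Integration.integrable_bound)
  show "(\<lambda>x. u x * cx (\<phi> x)) \<in> borel_measurable lborel" by measurable
  have "cmod (u x * cx (\<phi> x)) <= norm (C * cmod (indicat_real {- R..R} x *\<^sub>R u x))" for x
  proof (cases "abs x > R")
   case False
   then have "x \<in> {-R..R}" by auto
   then have "indicat_real {- R..R} x = 1" by (simp only: indicator_simps)
   then show ?thesis using C by (simp add: norm_mult mult.commute mult_right_mono)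
  qed (use R in simp)
  then show "AE x in lborel. cmod (u x * cx (\<phi> x)) <= norm (C * cmod (indicat_real {- R..R} x *\<^sub>R u x))"
   by simp
 qed
qed

text \<open>Functions bounded by \<open>C * wt \<alpha> \<delta>\<close> lie in \<open>L2w \<alpha>\<close>: the factor \<open>exp (- \<delta> * \<bar>x\<bar>)\<close> makes
 their weighted squares integrable.\<close>

definition wt :: "real => real => real => real" where
 "wt \<alpha> \<delta> x = exp (- \<alpha> * x - \<delta> * abs x)"

lemma wt_pos: "wt \<alpha> \<delta> x > 0"
 by (simp add: wt_def)

lemma wt_measurable [measurable]: "wt \<alpha> \<delta> \<in> borel_measurable borel"
 unfolding wt_def by measurable

lemma exp_abs_integral:
 assumes "\<delta> > 0"
 shows "has_bochner_integral lborel (\<lambda>x::real. exp (- \<delta> * abs x)) (2 / \<delta>)"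
proof -
 have lim: "((\<lambda>x. - exp (- \<delta> * x) / \<delta>) \<longlongrightarrow> - 0 / \<delta>) at_top"
  using assms by (intro tendsto_intros filterlim_compose[OF exp_at_bot]
   filterlim_tendsto_neg_mult_at_bot[of _ "-\<delta>"] filterlim_ident) auto
 have "(\<integral>\<^sup>+x. ennreal (exp (- \<delta> * x)) * indicator {0..} x \<partial>lborel) = - 0 / \<delta> - (- exp (- \<delta> * 0) / \<delta>)"
  by (rule nn_integral_FTC_atLeast[OF _ _ _ lim])
   (use assms in \<open>auto intro!: derivative_eq_intros\<close>)
 then have "has_bochner_integral lborel (\<lambda>x. exp (- \<delta> * x) * indicator {0..} x) (1 / \<delta>)"
  using assms by (intro has_bochner_integral_nn_integral)
   (auto simp: ennreal_mult' ennreal_indicator)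
 note h = this
 then have "has_bochner_integral lborel (\<lambda>x. exp (- \<delta> * (0 + (- 1) * x)) * indicator {0..} (0 + (-1) * x)) ((1 / \<delta>) /\<^sub>R \<bar>-1\<bar>)"
  by (subst lborel_has_bochner_integral_real_affine_iff[symmetric]) auto
 from has_bochner_integral_add[OF h this]
 have "has_bochner_integral lborel (\<lambda>x. exp (- \<delta> * x) * indicator {0..} x
   + exp (- \<delta> * (0 + (- 1) * x)) * indicator {0..} (0 + (-1) * x)) (2 / \<delta>)" by simp
 then show ?thesis
 proof (rule has_bochner_integral_cong_AE[THEN iffD1, rotated -1])
  show "AE x in lborel. exp (- \<delta> * x) * indicator {0..} x
   + exp (- \<delta> * (0 + (- 1) * x)) * indicator {0..} (0 + (-1) * x) = exp (- \<delta> * abs x)"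
   using AE_lborel_singleton[of 0] by eventually_elim (auto simp: indicator_def)
 qed auto
qed

lemma exp_abs_integrable: "\<delta> > 0 ==> intg (\<lambda>x::real. exp (- \<delta> * abs x))"
 using exp_abs_integral by (auto simp: has_bochner_integral_iff)

lemma exp_abs_shift:
 assumes "\<delta> > 0"
 shows "has_bochner_integral lborel (\<lambda>s::real. exp (- \<delta> * \<bar>z - s\<bar>)) (2 / \<delta>)"
proof -
 have "has_bochner_integral lborel (\<lambda>s. exp (- \<delta> * \<bar>z + (-1) * s\<bar>)) ((2 / \<delta>) /\<^sub>R \<bar>-1\<bar>)"
  using exp_abs_integral[OF assms] by (subst lborel_has_bochner_integral_real_affine_iff[symmetric]) auto
 then show ?thesis by simp
qed

section \<open>Weighted square-integrable functions\<close>

lemma L2w_measurable: "u \<in> L2w \<alpha> ==> u \<in> borel_measurable borel"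
 by (simp add: L2w_def)

lemma L2w_integrable: "u \<in> L2w \<alpha> ==> intg (\<lambda>x. exp (2 * \<alpha> * x) * (norm (u x))\<^sup>2)"
 by (simp add: L2w_def)

lemma L2w_bound:
 assumes u: "u \<in> L2w \<alpha>" and [measurable]: "bmeas v"
  and le: "AE x in lborel. norm (v x) <= C * norm (u x)"
 shows "v \<in> L2w \<alpha>"
proof -
 note [measurable] = L2w_measurable[OF u]
 have "intg (\<lambda>x. C\<^sup>2 * (exp (2 * \<alpha> * x) * (norm (u x))\<^sup>2))"
  using L2w_integrable[OF u] by simp
 then have "intg (\<lambda>x. exp (2 * \<alpha> * x) * (norm (v x))\<^sup>2)"
 proof (rule Bochner_Integration.integrable_bound)
  show "AE x in lborel. norm (exp (2 * \<alpha> * x) * (norm (v x))\<^sup>2)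
    <= norm (C\<^sup>2 * (exp (2 * \<alpha> * x) * (norm (u x))\<^sup>2))"
   using le
  proof eventually_elim
   case (elim x)
   have "(norm (v x))\<^sup>2 <= (C * norm (u x))\<^sup>2" by (rule power_mono[OF elim]) simp
   then show ?case by (simp add: power_mult_distrib mult.left_commute)
  qed
 qed measurable
 then show ?thesis by (simp add: L2w_def)
qed

lemma L2w_add:
 assumes u: "u \<in> L2w \<alpha>" and v: "v \<in> L2w \<alpha>" shows "(\<lambda>x. u x + v x) \<in> L2w \<alpha>"
proof -
 note [measurable] = L2w_measurable[OF u] L2w_measurable[OF v]
 have "intg (\<lambda>x. 2 * (exp (2 * \<alpha> * x) * (norm (u x))\<^sup>2) + 2 * (exp (2 * \<alpha> * x) * (norm (v x))\<^sup>2))"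
  using L2w_integrable[OF u] L2w_integrable[OF v] by simp
 then have "intg (\<lambda>x. exp (2 * \<alpha> * x) * (norm (u x + v x))\<^sup>2)"
 proof (rule Bochner_Integration.integrable_bound)
  show "AE x in lborel. norm (exp (2 * \<alpha> * x) * (norm (u x + v x))\<^sup>2) <=
   norm (2 * (exp (2 * \<alpha> * x) * (norm (u x))\<^sup>2) + 2 * (exp (2 * \<alpha> * x) * (norm (v x))\<^sup>2))"
  proof (rule AE_I2)
   fix x
   have "(norm (u x + v x))\<^sup>2 <= (norm (u x) + norm (v x))\<^sup>2"
    by (intro power_mono norm_triangle_ineq) simp
   also have "\<dots> <= 2 * (norm (u x))\<^sup>2 + 2 * (norm (v x))\<^sup>2"
    using sum_squares_bound[of "norm (u x)" "norm (v x)"] by (simp add: power2_sum)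
   finally have "exp (2 * \<alpha> * x) * (norm (u x + v x))\<^sup>2 <= exp (2 * \<alpha> * x) * (2 * (norm (u x))\<^sup>2 + 2 * (norm (v x))\<^sup>2)"
    by (intro mult_left_mono) auto
   then show "norm (exp (2 * \<alpha> * x) * (norm (u x + v x))\<^sup>2) <=
    norm (2 * (exp (2 * \<alpha> * x) * (norm (u x))\<^sup>2) + 2 * (exp (2 * \<alpha> * x) * (norm (v x))\<^sup>2))"
    by (simp add: algebra_simps)
  qed
 qed measurable
 then show ?thesis by (simp add: L2w_def)
qed

lemma L2w_mult_bounded:
 assumes u: "u \<in> L2w \<alpha>" and m: "bmeas m" "!!x. norm (m x) <= C"
 shows "(\<lambda>x. m x * u x) \<in> L2w \<alpha>"
proof (rule L2w_bound[OF u, where C = C])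
 note [measurable] = L2w_measurable[OF u] m(1)
 show "bmeas (\<lambda>x. m x * u x)" by measurable
 show "AE x in lborel. norm (m x * u x) <= C * norm (u x)"
  using m(2) by (intro AE_I2) (simp add: norm_mult mult_right_mono)
qed

lemma L2w_cmult: "u \<in> L2w \<alpha> ==> (\<lambda>x. k * u x) \<in> L2w \<alpha>"
 by (rule L2w_mult_bounded[where C = "norm k"]) auto

lemma L2w_uminus: "u \<in> L2w \<alpha> ==> (\<lambda>x. - u x) \<in> L2w \<alpha>"
 using L2w_cmult[of u \<alpha> "-1"] by simp

lemma L2w_diff: "u \<in> L2w \<alpha> ==> v \<in> L2w \<alpha> ==> (\<lambda>x. u x - v x) \<in> L2w \<alpha>"
 using L2w_add[OF _ L2w_uminus] by simp

lemma L2w_wt: 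
 assumes "\<delta> > 0" shows "(\<lambda>x. cx (wt \<alpha> \<delta> x)) \<in> L2w \<alpha>"
proof -
 have "exp (2 * \<alpha> * x) * (norm (cx (wt \<alpha> \<delta> x)))\<^sup>2 = exp (- (2 * \<delta>) * abs x)" for x
  by (simp add: wt_def power2_eq_square flip: exp_add)
 then show ?thesis using exp_abs_integrable[of "2 * \<delta>"] assms by (simp add: L2w_def)
qed

lemma L2w_wt_bound:
 assumes "\<delta> > 0" "bmeas v" "!!x. norm (v x) <= C * wt \<alpha> \<delta> x"
 shows "v \<in> L2w \<alpha>"
 by (rule L2w_bound[OF L2w_wt[OF assms(1)] assms(2), where C = C])
  (use assms(3) wt_pos in \<open>auto simp: less_imp_le\<close>)

lemma L2w_norm_wt_bound:
 assumes "\<delta> > 0" "bmeas v" "!!x. norm (v x) <= C * wt \<alpha> \<delta> x" "C >= 0"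
 shows "L2w_norm \<alpha> v <= C * sqrt (1 / \<delta>)"
proof -
 have "(LINT x|lborel. exp (2 * \<alpha> * x) * (norm (v x))\<^sup>2) <= (LINT x|lborel. C\<^sup>2 * exp (- (2 * \<delta>) * abs x))"
 proof (rule integral_mono)
  show "intg (\<lambda>x. exp (2 * \<alpha> * x) * (norm (v x))\<^sup>2)"
   by (rule L2w_integrable[OF L2w_wt_bound[OF assms(1-3)]])
  show "intg (\<lambda>x. C\<^sup>2 * exp (- (2 * \<delta>) * abs x))"
   using exp_abs_integrable[of "2 * \<delta>"] assms(1) by simp
  fix x
  have "(norm (v x))\<^sup>2 <= (C * wt \<alpha> \<delta> x)\<^sup>2" by (rule power_mono[OF assms(3)]) simp
  then have "exp (2 * \<alpha> * x) * (norm (v x))\<^sup>2 <= exp (2 * \<alpha> * x) * (C * wt \<alpha> \<delta> x)\<^sup>2"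
   by (intro mult_left_mono) auto
  also have "\<dots> = C\<^sup>2 * exp (- (2 * \<delta>) * abs x)"
   by (simp add: wt_def power2_eq_square flip: exp_add)
  finally show "exp (2 * \<alpha> * x) * (norm (v x))\<^sup>2 <= C\<^sup>2 * exp (- (2 * \<delta>) * abs x)" .
 qed
 also have "\<dots> = C\<^sup>2 * (1 / \<delta>)"
  using exp_abs_integral[of "2 * \<delta>"] assms(1) by (simp add: has_bochner_integral_iff)
 finally have "L2w_norm \<alpha> v <= sqrt (C\<^sup>2 * (1 / \<delta>))"
  unfolding L2w_norm_def by (rule real_sqrt_le_mono)
 then show ?thesis using assms(4) by (simp only: real_sqrt_mult real_sqrt_abs abs_of_nonneg)
qed

lemma mult_le_sum_squares: "a * b <= a\<^sup>2 + b\<^sup>2" for a b :: real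
proof -
 have "0 <= (a - b)\<^sup>2" "0 <= (a + b)\<^sup>2" by simp_all
 then show ?thesis unfolding power2_diff power2_sum by linarith
qed

text \<open>The factors \<open>exp (\<alpha> * x)\<close> and \<open>exp (- \<alpha> * x)\<close>
  cancel in the product, and \<open>s * t <= s^2 + t^2\<close> bounds it by the two weighted
  squares. This duality of opposite weights underlies every pairing below.\<close>

lemma L2w_prod_integrable:
 assumes u: "u \<in> L2w \<alpha>" and v: "v \<in> L2w (- \<alpha>)"
 shows "intg (\<lambda>x. u x * v x)"
proof -
 note [measurable] = L2w_measurable[OF u] L2w_measurable[OF v]
 have "intg (\<lambda>x. exp (2 * \<alpha> * x) * (norm (u x))\<^sup>2 + exp (2 * (- \<alpha>) * x) * (norm (v x))\<^sup>2)"
  using L2w_integrable[OF u] L2w_integrable[OF v] by simp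
 then show ?thesis
 proof (rule Bochner_Integration.integrable_bound)
  show "AE x in lborel. norm (u x * v x) <= norm (exp (2 * \<alpha> * x) * (norm (u x))\<^sup>2 + exp (2 * (- \<alpha>) * x) * (norm (v x))\<^sup>2)"
  proof (rule AE_I2)
   fix x
   have "norm (u x * v x) = (exp (\<alpha> * x) * norm (u x)) * (exp (- \<alpha> * x) * norm (v x))"
    by (simp add: norm_mult exp_minus)
   also have "\<dots> <= (exp (\<alpha> * x) * norm (u x))\<^sup>2 + (exp (- \<alpha> * x) * norm (v x))\<^sup>2"
    by (rule mult_le_sum_squares)
   also have "\<dots> = exp (2 * \<alpha> * x) * (norm (u x))\<^sup>2 + exp (2 * (- \<alpha>) * x) * (norm (v x))\<^sup>2"
    by (simp add: power_mult_distrib flip: exp_of_nat_mult) (simp add: algebra_simps)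
   finally show "norm (u x * v x) <= norm (exp (2 * \<alpha> * x) * (norm (u x))\<^sup>2 + exp (2 * (- \<alpha>) * x) * (norm (v x))\<^sup>2)"
    by simp
  qed
 qed measurable
qed

text \<open>Indicators of bounded intervals lie in \<open>L2w (- \<alpha>)\<close>, so local
  integrability is a case of the product estimate for opposite weights.\<close>

lemma L2w_L1loc: assumes u: "u \<in> L2w \<alpha>" shows "u \<in> L1loc"
proof -
 note [measurable] = L2w_measurable[OF u]
 have "set_integrable lborel {-R..R} u" for R
 proof -
  have b: "norm (cx (indicator {-R..R} x)) <= exp (abs \<alpha> * R + R) * wt (- \<alpha>) 1 x" for x
  proof (cases "x \<in> {-R..R}")
   case True
   then have "abs x <= R" by auto
   then have "\<bar>\<alpha> * x\<bar> <= \<bar>\<alpha>\<bar> * R" by (simp add: abs_mult mult_left_mono)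
   then have "- (\<alpha> * x) <= abs \<alpha> * R" by linarith
   then have "0 <= abs \<alpha> * R + R + (\<alpha> * x - abs x)" using \<open>\<bar>x\<bar> <= R\<close> by simp
   then show ?thesis using True by (simp add: wt_def flip: exp_add)
  qed (simp add: wt_pos less_imp_le)
  have "(\<lambda>x. cx (indicator {-R..R} x)) \<in> L2w (- \<alpha>)"
   by (rule L2w_wt_bound[where \<delta> = 1 and C = "exp (abs \<alpha> * R + R)"]) (use b in auto)
  from L2w_prod_integrable[OF u this] show ?thesis
   by (simp add: set_integrable_def scaleR_conv_of_real mult.commute)
 qed
 then show ?thesis by (simp add: L1loc_def)
qed

lemma L2w_test: assumes "\<phi> \<in> test_fun" shows "(\<lambda>x. cx (\<phi> x)) \<in> L2w \<alpha>"
proof -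
 note [measurable] = test_fun_measurable[OF assms]
 obtain R where R: "!!x. abs x > R ==> \<phi> x = 0" using assms by (auto simp: test_fun_iff)
 obtain C where C: "C >= 0" "!!x. abs (\<phi> x) <= C" using test_fun_bounded assms by blast
 have "norm (cx (\<phi> x)) <= (C * exp (abs \<alpha> * R + R)) * wt \<alpha> 1 x" for x
 proof (cases "abs x > R")
  case False
  then have "abs x <= R" by auto
  then have "\<bar>\<alpha> * x\<bar> <= \<bar>\<alpha>\<bar> * R" by (simp add: abs_mult mult_left_mono)
  then have "\<alpha> * x <= abs \<alpha> * R" by linarith
  then have "0 <= abs \<alpha> * R + R + (- \<alpha> * x - abs x)" using \<open>\<bar>x\<bar> <= R\<close> by simp
  then have "1 <= exp (abs \<alpha> * R + R) * wt \<alpha> 1 x" by (simp add: wt_def flip: exp_add)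
  then have "C * 1 <= C * (exp (abs \<alpha> * R + R) * wt \<alpha> 1 x)" using C by (intro mult_left_mono)
  then show ?thesis using C(2)[of x] by (simp add: mult.assoc)
 qed (use R C wt_pos[of \<alpha> 1 x] in simp)
 then show ?thesis by (intro L2w_wt_bound[where \<delta> = 1]) auto
qed

section \<open>The fundamental lemma of the calculus of variations\<close>

text \<open>For \<open>a < b\<close> the number \<open>t = (x - a) * (b - x)\<close> is positive
  exactly inside the interval. There \<open>flat (n * t) = exp (- 1 / (n * t))\<close> tends to 1 as
  \<open>n\<close> grows, and elsewhere it vanishes.\<close>

lemma test_fun_interval:
 obtains \<phi> :: "nat => real => real" where "!!n. \<phi> n \<in> test_fun" "!!n x. 0 <= \<phi> n x \<and> \<phi> n x <= indicator {a<..<b} x"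
  "!!x. (\<lambda>n. \<phi> n x) \<longlonglongrightarrow> indicator {a<..<b} x"
proof
 define \<phi> where "\<phi> n x = (if a < b then flat (real (Suc n) * ((x - a) * (b - x))) else 0)" for n x
 show "\<phi> n \<in> test_fun" for n
 proof (cases "a < b")
  case True
  have "smooth (\<phi> n)" using True unfolding \<phi>_def
   by (simp del: of_nat_Suc) (intro smooth_compose[OF smooth_flat] smooth_mult smooth_diff smooth_const smooth_ident)
  moreover have "\<phi> n x = 0" if "abs x > max (abs a) (abs b)" for x
  proof -
   have "x < a \<and> x < b \<or> x > a \<and> x > b" using that by auto
   then have "(x - a) * (b - x) < 0"
    by (elim disjE) (simp_all add: mult_neg_pos mult_pos_neg)
   then have "real (Suc n) * ((x - a) * (b - x)) <= 0"
    by (intro mult_nonneg_nonpos less_imp_le) simp_all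
   then show ?thesis by (simp add: \<phi>_def flat_def)
  qed
  ultimately show ?thesis unfolding test_fun_iff by blast
 next
  case False
  then have "\<phi> n = (\<lambda>x. 0)" by (simp add: \<phi>_def fun_eq_iff)
  then show ?thesis by (simp add: test_fun_iff smooth_const)
 qed
 have pos: "real (Suc n) * ((x - a) * (b - x)) > 0 \<longleftrightarrow> x \<in> {a<..<b}" if "a < b" for n x
  using that by (auto simp: zero_less_mult_iff)
 show "0 <= \<phi> n x \<and> \<phi> n x <= indicator {a<..<b} x" for n x
  using pos[of n x] by (cases "x \<in> {a<..<b}") (auto simp: \<phi>_def flat_def simp del: of_nat_Suc)
 show "(\<lambda>n. \<phi> n x) \<longlonglongrightarrow> indicator {a<..<b} x" for x
 proof (cases "a < b \<and> x \<in> {a<..<b}")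
  case True
  define t where "t = (x - a) * (b - x)"
  have t: "t > 0" using True by (simp add: t_def)
  have "(\<lambda>n. exp (- (1 / t) * (1 / real (Suc n)))) \<longlonglongrightarrow> exp (- (1 / t) * 0)"
   by (intro tendsto_intros LIMSEQ_Suc lim_1_over_n)
  moreover have "\<phi> n x = exp (- (1 / t) * (1 / real (Suc n)))" for n
   using True t by (simp add: \<phi>_def flat_def flip: t_def)
  ultimately show ?thesis using True by simp
 next
  case False
  then have "\<phi> n x = 0" for n using pos[of n x] by (auto simp: \<phi>_def flat_def simp del: of_nat_Suc)
  then show ?thesis using False by (auto simp: indicator_def)
 qed
qed

text \<open>The positive and negative parts are densities of two finite measures that agree on all
  half lines \<open>{x<..}\<close> and hence coincide; uniqueness of densities makes the two parts
  equal.\<close>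

lemma real_AE_zero:
 fixes g :: "real => real"
 assumes g: "intg g" and z: "!!x. (LINT y:{x<..}|lborel. g y) = 0"
 shows "AE x in lborel. g x = 0"
proof -
 note [measurable] = borel_measurable_integrable[OF g]
 define p where "p = (\<lambda>x. max 0 (g x))"
 define m where "m = (\<lambda>x. max 0 (- g x))"
 have [measurable]: "bmeas p" "bmeas m"
  unfolding p_def m_def by simp_all
 have ip: "intg p" and im: "intg m"
  using g unfolding p_def m_def by (auto intro!: integrable_max)
 have si: "set_integrable lborel A p" "set_integrable lborel A m" if "A \<in> sets borel" for A
  using ip im that unfolding set_integrable_def by (auto simp del: real_scaleR_def intro!: integrable_mult_indicator)
 have em: "emeasure (density lborel (\<lambda>x. ennreal (f x))) {x<..} = ennreal (LINT y:{x<..}|lborel. f y)"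
  if [measurable]: "bmeas f" and "intg f" "!!x. f x >= 0"
  for f :: "real => real" and x
 proof -
  have "emeasure (density lborel (\<lambda>x. ennreal (f x))) {x<..} = (\<integral>\<^sup>+y. ennreal (f y) * indicator {x<..} y \<partial>lborel)"
   by (rule emeasure_density) auto
  also have "\<dots> = (\<integral>\<^sup>+y. ennreal (indicator {x<..} y *\<^sub>R f y) \<partial>lborel)"
   by (intro nn_integral_cong) (auto simp: indicator_def)
  also have "\<dots> = ennreal (LINT y|lborel. indicator {x<..} y *\<^sub>R f y)"
   using that by (intro nn_integral_eq_integral integrable_mult_indicator) (auto intro!: AE_I2)
  finally show ?thesis by (simp add: set_lebesgue_integral_def)
 qed
 have "density lborel (\<lambda>x. ennreal (p x)) = density lborel (\<lambda>x. ennreal (m x))"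
 proof (rule measure_eqI_lessThan)
  fix x
  have ep: "emeasure (density lborel (\<lambda>x. ennreal (p x))) {x<..} = ennreal (LINT y:{x<..}|lborel. p y)"
   by (rule em) (use ip in \<open>auto simp: p_def\<close>)
  have emm: "emeasure (density lborel (\<lambda>x. ennreal (m x))) {x<..} = ennreal (LINT y:{x<..}|lborel. m y)"
   by (rule em) (use im in \<open>auto simp: m_def\<close>)
  show "emeasure (density lborel (\<lambda>x. ennreal (p x))) {x<..} < \<infinity>" by (simp add: ep)
  have "(LINT y:{x<..}|lborel. p y) - (LINT y:{x<..}|lborel. m y) = (LINT y:{x<..}|lborel. p y - m y)"
   by (rule set_integral_diff(2)[symmetric]; rule si; simp)
  also have "(\<lambda>y. p y - m y) = g" by (auto simp: p_def m_def)
  finally show "emeasure (density lborel (\<lambda>x. ennreal (p x))) {x<..} = emeasure (density lborel (\<lambda>x. ennreal (m x))) {x<..}"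
   using z[of x] by (simp add: ep emm)
 qed auto
 then have "AE x in lborel. ennreal (p x) = ennreal (m x)"
  by (rule sigma_finite_measure.density_unique[OF sigma_finite_lborel, rotated 2]) auto
 then show ?thesis
  by eventually_elim (auto simp: p_def m_def max_def split: if_splits)
qed

text \<open>Approximating indicators by test functions makes \<open>f\<close> integrate to 0 over
  every bounded interval. Truncated to \<open>{-R<..<R}\<close>, it then has vanishing half-line
  integrals, so its real and imaginary parts vanish almost everywhere; \<open>R\<close> runs through
  the naturals.\<close>

lemma AE_zero_of_test:
 assumes f: "f \<in> L1loc" and z: "!!\<phi>. \<phi> \<in> test_fun ==> tint f \<phi> = 0"
 shows "AE x in lborel. f x = 0"
proof -
 have [measurable]: "bmeas f" using f by (simp add: L1loc_def)
 have si: "intg (\<lambda>x. indicator {-R<..<R} x *\<^sub>R f x)" for R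
 proof -
  have "set_integrable lborel {-R..R} f" using f by (simp add: L1loc_def)
  then have "set_integrable lborel {-R<..<R} f" by (rule set_integrable_subset) auto
  then show ?thesis by (simp add: set_integrable_def)
 qed
 have iv: "(LINT x|lborel. indicator {a<..<b} x *\<^sub>R f x) = 0" if "-R <= a" "b <= R" for a b R
 proof -
  obtain \<phi> where \<phi>: "!!n. \<phi> n \<in> test_fun" "!!n x. 0 <= \<phi> n x \<and> \<phi> n x <= indicator {a<..<b} x"
   "!!x. (\<lambda>n. \<phi> n x) \<longlonglongrightarrow> indicator {a<..<b} x" using test_fun_interval[where a = a and b = b] by blast
  have [measurable]: "\<phi> n \<in> borel_measurable borel" for n using \<phi>(1) by (rule test_fun_measurable)
  have "(\<lambda>n. LINT x|lborel. f x * cx (\<phi> n x)) \<longlonglongrightarrow> (LINT x|lborel. indicator {a<..<b} x *\<^sub>R f x)"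
  proof (rule integral_dominated_convergence[where w = "\<lambda>x. norm (indicator {-R<..<R} x *\<^sub>R f x)"])
   show "AE x in lborel. (\<lambda>n. f x * cx (\<phi> n x)) \<longlonglongrightarrow> indicat_real {a<..<b} x *\<^sub>R f x"
    by (intro AE_I2) (auto simp: scaleR_conv_of_real mult.commute[of "f _"] intro!: tendsto_intros \<phi>)
   show "AE x in lborel. norm (f x * cx (\<phi> n x)) <= norm (indicat_real {- R<..<R} x *\<^sub>R f x)" for n
   proof (rule AE_I2)
    fix x
    have "abs (\<phi> n x) <= indicat_real {-R<..<R} x"
     using \<phi>(2)[of n x] that by (cases "x \<in> {a<..<b}") auto
    then show "norm (f x * cx (\<phi> n x)) <= norm (indicat_real {- R<..<R} x *\<^sub>R f x)"
     by (simp add: norm_mult mult.commute mult_left_mono)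
   qed
   show "intg (\<lambda>x. norm (indicat_real {- R<..<R} x *\<^sub>R f x))"
    by (rule integrable_norm[OF si])
  qed auto
  then show ?thesis using z[OF \<phi>(1)] by (simp add: LIMSEQ_const_iff)
 qed
 have "AE x in lborel. indicator {-R<..<R} x *\<^sub>R f x = 0" for R
 proof -
  define F where "F x = indicator {-R<..<R} x *\<^sub>R f x" for x
  have F: "intg F" unfolding F_def by (rule si)
  have e: "(LINT y|lborel. indicator {x<..} y *\<^sub>R F y) = 0" for x
  proof -
   have "(LINT y|lborel. indicator {x<..} y *\<^sub>R F y) = (LINT y|lborel. indicator {max x (-R)<..<R} y *\<^sub>R f y)"
    by (intro Bochner_Integration.integral_cong) (auto simp: F_def indicator_def)
   then show ?thesis using iv[of R "max x (-R)" R] by simp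
  qed
  have ii: "intg (\<lambda>y. indicator {x<..} y *\<^sub>R F y)" for x
   using F by (intro integrable_mult_indicator) auto
  have "AE x in lborel. Re (F x) = 0"
  proof (rule real_AE_zero)
   show "(LINT y:{x<..}|lborel. Re (F y)) = 0" for x
    using integral_Re[OF ii[of x]] e[of x] by (simp add: set_lebesgue_integral_def)
  qed (use F in auto)
  moreover have "AE x in lborel. Im (F x) = 0"
  proof (rule real_AE_zero)
   show "(LINT y:{x<..}|lborel. Im (F y)) = 0" for x
    using integral_Im[OF ii[of x]] e[of x] by (simp add: set_lebesgue_integral_def)
  qed (use F in auto)
  ultimately show ?thesis by eventually_elim (simp add: F_def complex_eq_iff)
 qed
 then have "AE x in lborel. \<forall>n. indicator {-real n<..<real n} x *\<^sub>R f x = 0"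
  by (subst AE_all_countable) blast
 then show ?thesis
 proof eventually_elim
  case (elim x)
  obtain n where "real n > abs x" using reals_Archimedean2 by blast
  then have "x \<in> {-real n<..<real n}" by auto
  then show ?case using elim[rule_format, of n] by simp
 qed
qed

section \<open>Weak derivatives\<close>

lemma ddz_pow: "(ddz ^^ k) T \<phi> = (-1) ^ k * T ((deriv ^^ k) \<phi>)"
 by (induction k arbitrary: \<phi>) (simp_all add: ddz_def funpow_swap1[of deriv])

lemma is_wderiv_iff:
 "is_wderiv k u g \<longleftrightarrow> (\<forall>\<phi>\<in>test_fun. (-1) ^ k * tint u ((deriv ^^ k) \<phi>)
   = tint g \<phi>)"
 by (simp add: is_wderiv_def distr_eq_def ddz_pow distr_of_def)

lemma L1loc_diff: assumes "u \<in> L1loc" "v \<in> L1loc" shows "(\<lambda>x. u x - v x) \<in> L1loc"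
proof -
 have "set_integrable lborel {-R..R} (\<lambda>x. u x - v x)" for R
  using assms by (intro set_integral_diff) (auto simp: L1loc_def)
 then show ?thesis using assms by (auto simp: L1loc_def)
qed

lemma AE_eq_of_test:
 assumes f: "f \<in> L1loc" "g \<in> L1loc"
  and z: "!!\<phi>. \<phi> \<in> test_fun ==> tint f \<phi> = tint g \<phi>"
 shows "AE x in lborel. f x = g x"
proof -
 have "AE x in lborel. f x - g x = 0"
 proof (rule AE_zero_of_test[OF L1loc_diff[OF f]])
  fix \<phi> assume p: "\<phi> \<in> test_fun"
  show "(LINT x|lborel. (f x - g x) * cx (\<phi> x)) = 0"
   using z[OF p] L1loc_integrable_test[OF f(1) p] L1loc_integrable_test[OF f(2) p]
   by (simp add: left_diff_distrib)
 qed
 then show ?thesis by eventually_elim simp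
qed

text \<open>Since \<open>wderiv\<close> is chosen by \<open>SOME\<close>, one locally integrable
  weak derivative must be exhibited before anything is known of it; the choice then agrees with the
  exhibited one almost everywhere.\<close>

lemma wderiv_AE:
 assumes "g \<in> L1loc" "is_wderiv k u g"
 shows "wderiv k u \<in> L1loc" "is_wderiv k u (wderiv k u)" "AE x in lborel. wderiv k u x = g x"
proof -
 have *: "wderiv k u \<in> L1loc \<and> is_wderiv k u (wderiv k u)"
  unfolding wderiv_def by (rule someI[of _ g]) (use assms in simp)
 then show "wderiv k u \<in> L1loc" "is_wderiv k u (wderiv k u)" by auto
 show "AE x in lborel. wderiv k u x = g x"
  by (rule AE_eq_of_test) (use * assms in \<open>auto simp: is_wderiv_iff\<close>)
qed

lemma L2w_norm_cong_AE:
 assumes "bmeas u" "bmeas v" "AE x in lborel. v x = u x"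
 shows "L2w_norm \<alpha> v = L2w_norm \<alpha> u"
proof -
 note [measurable] = assms(1,2)
 have "(LINT x|lborel. exp (2 * \<alpha> * x) * (norm (v x))\<^sup>2) = (LINT x|lborel. exp (2 * \<alpha> * x) * (norm (u x))\<^sup>2)"
  by (rule integral_cong_AE) (use assms(3) in auto)
 then show ?thesis by (simp add: L2w_norm_def)
qed

section \<open>Convolution in weighted spaces\<close>

text \<open>The decay rate beats the weight exponent in both directions, so such kernels act on
  \<open>L2w \<alpha>\<close> and on its dual \<open>L2w (- \<alpha>)\<close> alike.\<close>

definition kdecay :: "real => (real => real) => bool" where
 "kdecay \<alpha> k \<longleftrightarrow> k \<in> borel_measurable borel \<and> (\<exists>C \<rho>. \<rho> > abs \<alpha> \<and> (\<forall>t. abs (k t) <= C * exp (- \<rho> * abs t)))"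

definition convr :: "(real => real) => (real => complex) => real => complex" where
 "convr k u x = (LINT t|lborel. cx (k t) * u (x + t))"

text \<open>\<open>convr\<close> acts on weighted functions and \<open>convl\<close> on test
  functions; they are transposes of each other by \<open>conv_adj\<close>, which explains the
  opposite signs of the shift.\<close>

definition convl :: "(real => real) => (real => real) => real => real" where
 "convl k \<phi> x = (LINT t|lborel. k t * \<phi> (x - t))"

lemma kdecay_minus: "kdecay (- \<alpha>) k = kdecay \<alpha> k"
 by (simp add: kdecay_def)

lemma kdecay_weighted:
 assumes "kdecay \<alpha> k"
 shows "intg (\<lambda>t. abs (k t) * exp (\<alpha> * t))"
proof -
 obtain C \<rho> where C: "\<rho> > abs \<alpha>" "!!t. abs (k t) <= C * exp (- \<rho> * abs t)"
  and [measurable]: "bmeas k" using assms by (auto simp: kdecay_def)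
 have "intg (\<lambda>t. C * exp (- (\<rho> - abs \<alpha>) * abs t))"
  using exp_abs_integrable[of "\<rho> - abs \<alpha>"] C(1) by simp
 then show ?thesis
 proof (rule Bochner_Integration.integrable_bound)
  show "AE t in lborel. norm (abs (k t) * exp (\<alpha> * t)) <= norm (C * exp (- (\<rho> - abs \<alpha>) * abs t))"
  proof (rule AE_I2)
   fix t :: real
   have "\<alpha> * t <= abs \<alpha> * abs t" by (simp flip: abs_mult)
   then have "abs (k t) * exp (\<alpha> * t) <= (C * exp (- \<rho> * abs t)) * exp (abs \<alpha> * abs t)"
    using order_trans[OF abs_ge_zero C(2)[of t]] by (intro mult_mono C) auto
   also have "\<dots> = C * exp (- (\<rho> - abs \<alpha>) * abs t)"
    by (simp add: algebra_simps flip: exp_add)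
   finally show "norm (abs (k t) * exp (\<alpha> * t)) <= norm (C * exp (- (\<rho> - abs \<alpha>) * abs t))"
    by simp
  qed
 qed measurable
qed

lemma kdecay_integrable: assumes k: "kdecay \<alpha> k" shows "intg k"
proof -
 from k have "kdecay 0 k" unfolding kdecay_def
  by (metis abs_ge_zero abs_zero order.strict_trans1)
 then have "intg (\<lambda>t. abs (k t))" using kdecay_weighted[of 0 k] by simp
 then show ?thesis using k by (simp add: integrable_abs_iff kdecay_def)
qed

text \<open>The sign \<open>s\<close> covers the double integral before and after the change of
  variable; in the second case \<open>u\<close> and \<open>v\<close> exchange roles and weights.
  Splitting off \<open>exp (- \<alpha> * s * t)\<close> leaves two weighted squares whose integrals
  do not depend on \<open>t\<close>.\<close>

lemma conv_pair_integrable: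
 fixes s :: real
 assumes k: "kdecay \<alpha> k" and u: "u \<in> L2w \<alpha>" and v: "v \<in> L2w (- \<alpha>)" and s: "abs s = 1"
 shows "integrable (lborel \<Otimes>\<^sub>M lborel) (\<lambda>(t, x). cx (k t) * (u (x + s * t) * v x))"
proof -
 note [measurable] = L2w_measurable[OF u] L2w_measurable[OF v]
 have [measurable]: "bmeas k" using k by (simp add: kdecay_def)
 define U where "U = (LINT x|lborel. exp (2 * \<alpha> * x) * (norm (u x))\<^sup>2)"
 define V where "V = (LINT x|lborel. exp (2 * (- \<alpha>) * x) * (norm (v x))\<^sup>2)"
 have iu: "has_bochner_integral lborel (\<lambda>x. exp (2 * \<alpha> * (x + s * t)) * (norm (u (x + s * t)))\<^sup>2) U" for t
  using lborel_has_bochner_integral_real_affine_iff[of 1 "\<lambda>x. exp (2 * \<alpha> * x) * (norm (u x))\<^sup>2" U "s * t"]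
   L2w_integrable[OF u] by (simp add: has_bochner_integral_iff U_def add.commute)
 have b: "norm (u (x + s * t) * v x) <= exp (- \<alpha> * s * t) *
  (exp (2 * \<alpha> * (x + s * t)) * (norm (u (x + s * t)))\<^sup>2 + exp (2 * (- \<alpha>) * x) * (norm (v x))\<^sup>2)" for t x
 proof -
  have "norm (u (x + s * t) * v x) = exp (- \<alpha> * s * t) * ((exp (\<alpha> * (x + s * t)) * norm (u (x + s * t))) * (exp (- \<alpha> * x) * norm (v x)))"
   by (simp add: norm_mult algebra_simps flip: exp_add)
  also have "\<dots> <= exp (- \<alpha> * s * t) * ((exp (\<alpha> * (x + s * t)) * norm (u (x + s * t)))\<^sup>2 + (exp (- \<alpha> * x) * norm (v x))\<^sup>2)"
   by (intro mult_left_mono mult_le_sum_squares) simp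
  also have "\<dots> = exp (- \<alpha> * s * t) *
   (exp (2 * \<alpha> * (x + s * t)) * (norm (u (x + s * t)))\<^sup>2 + exp (2 * (- \<alpha>) * x) * (norm (v x))\<^sup>2)"
   by (simp add: power_mult_distrib exp_double[symmetric] mult.assoc)
  finally show ?thesis .
 qed
 have ib: "has_bochner_integral lborel (\<lambda>x. exp (- \<alpha> * s * t) *
  (exp (2 * \<alpha> * (x + s * t)) * (norm (u (x + s * t)))\<^sup>2 + exp (2 * (- \<alpha>) * x) * (norm (v x))\<^sup>2))
  (exp (- \<alpha> * s * t) * (U + V))" for t
  using iu[of t] L2w_integrable[OF v]
  by (intro has_bochner_integral_mult_right has_bochner_integral_add) (auto simp: has_bochner_integral_iff V_def)
 have iv: "intg (\<lambda>x. u (x + s * t) * v x)" for t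
  by (rule Bochner_Integration.integrable_bound[OF ib[of t, THEN integrable.intros]])
   (measurable, rule AE_I2, rule order_trans[OF b], simp only: real_norm_def abs_ge_self)
 have kd: "intg (\<lambda>t. abs (k t) * exp (- \<alpha> * s * t))"
  using kdecay_weighted[of "- \<alpha> * s" k] k s by (simp add: kdecay_def abs_mult)
 show ?thesis
 proof (rule lborel_pair.Fubini_integrable)
  show "(\<lambda>(t, x). cx (k t) * (u (x + s * t) * v x)) \<in> borel_measurable (lborel \<Otimes>\<^sub>M lborel)"
   by measurable
  show "AE t in lborel. intg (\<lambda>x. case (t, x) of (t, x) => cx (k t) * (u (x + s * t) * v x))"
   using iv by simp
  show "intg (\<lambda>t. LINT x|lborel. norm (case (t, x) of (t, x) => cx (k t) * (u (x + s * t) * v x)))"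
  proof (rule Bochner_Integration.integrable_bound)
   show "intg (\<lambda>t. abs (k t) * exp (- \<alpha> * s * t) * (U + V))" using kd by simp
   show "AE t in lborel. norm (LINT x|lborel. norm (case (t, x) of (t, x) => cx (k t) * (u (x + s * t) * v x)))
     <= norm (abs (k t) * exp (- \<alpha> * s * t) * (U + V))"
   proof (rule AE_I2)
    fix t
    have "(LINT x|lborel. norm (u (x + s * t) * v x)) <= exp (- \<alpha> * s * t) * (U + V)"
     using integral_mono[OF integrable_norm[OF iv[of t]] ib[of t, THEN integrable.intros] b]
      has_bochner_integral_integral_eq[OF ib[of t]] by simp
    then have "abs (k t) * (LINT x|lborel. norm (u (x + s * t) * v x)) <= abs (k t) * (exp (- \<alpha> * s * t) * (U + V))"
     by (rule mult_left_mono) simp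
    moreover have "(LINT x|lborel. norm (case (t, x) of (t, x) => cx (k t) * (u (x + s * t) * v x)))
     = abs (k t) * (LINT x|lborel. norm (u (x + s * t) * v x))"
     by (simp add: norm_mult)
    moreover have "0 <= (LINT x|lborel. norm (u (x + s * t) * v x))" by simp
    ultimately show "norm (LINT x|lborel. norm (case (t, x) of (t, x) => cx (k t) * (u (x + s * t) * v x)))
     <= norm (abs (k t) * exp (- \<alpha> * s * t) * (U + V))"
     by (simp add: mult.assoc)
   qed
  qed measurable
 qed
qed

lemma conv_adj:
 assumes k: "kdecay \<alpha> k" and u: "u \<in> L2w \<alpha>" and v: "v \<in> L2w (- \<alpha>)"
 shows "(LINT x|lborel. convr k u x * v x) = (LINT y|lborel. u y * (LINT t|lborel. cx (k t) * v (y - t)))"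
proof -
 note [measurable] = L2w_measurable[OF u] L2w_measurable[OF v]
 have [measurable]: "bmeas k" using k by (simp add: kdecay_def)
 have i1: "integrable (lborel \<Otimes>\<^sub>M lborel) (\<lambda>(t, x). cx (k t) * (u (x + t) * v x))"
  using conv_pair_integrable[OF k u v, of 1] by simp
 have i2: "integrable (lborel \<Otimes>\<^sub>M lborel) (\<lambda>(t, x). cx (k t) * (v (x - t) * u x))"
  using conv_pair_integrable[of "-\<alpha>" k v u "-1"] k u v by (simp add: kdecay_minus)
 have "(LINT x|lborel. convr k u x * v x) = (LINT x|lborel. LINT t|lborel. cx (k t) * (u (x + t) * v x))"
  by (intro Bochner_Integration.integral_cong refl) (simp add: convr_def flip: mult.assoc)
 also have "\<dots> = (LINT t|lborel. LINT x|lborel. cx (k t) * (u (x + t) * v x))"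
  using lborel_pair.Fubini_integral[OF i1] by simp
 also have "\<dots> = (LINT t|lborel. LINT x|lborel. cx (k t) * (v (x - t) * u x))"
 proof (rule Bochner_Integration.integral_cong[OF refl])
  fix t
  show "(LINT x|lborel. cx (k t) * (u (x + t) * v x)) = (LINT x|lborel. cx (k t) * (v (x - t) * u x))"
   using lborel_integral_real_affine[of 1 "\<lambda>x. cx (k t) * (v (x - t) * u x)" t]
   by (auto simp: add.commute mult.commute)
 qed
 also have "\<dots> = (LINT x|lborel. LINT t|lborel. cx (k t) * (v (x - t) * u x))"
  using lborel_pair.Fubini_integral[OF i2] by simp
 also have "\<dots> = (LINT y|lborel. u y * (LINT t|lborel. cx (k t) * v (y - t)))"
  by (rule Bochner_Integration.integral_cong[OF refl],
    subst mult.commute, subst integral_mult_left_zero[symmetric]) (simp add: mult.assoc)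
 finally show ?thesis .
qed

text \<open>Expand the nonnegative integral of \<open>r * (F - l)^2\<close> at
  \<open>l = I1 / K\<close>. Working with an upper bound \<open>K > 0\<close> of the total mass
  instead of the mass itself avoids a division by zero.\<close>

lemma integral_cauchy_schwarz:
 fixes r F :: "real => real"
 assumes r: "intg r" "!!t. r t >= 0" and F [measurable]: "bmeas F" 
  and rF: "intg (\<lambda>t. r t * (F t)\<^sup>2)" and K: "(LINT t|lborel. r t) <= K" "K > 0"
 shows "intg (\<lambda>t. r t * F t)"
  and "(LINT t|lborel. r t * F t)\<^sup>2 <= K * (LINT t|lborel. r t * (F t)\<^sup>2)"
proof -
 note [measurable] = borel_measurable_integrable[OF r(1)]
 have "\<bar>r t * F t\<bar> <= \<bar>r t + r t * (F t)\<^sup>2\<bar>" for t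
 proof -
  have "abs (F t) <= 1 + (F t)\<^sup>2" using mult_le_sum_squares[of "abs (F t)" 1] by simp
  then have "r t * abs (F t) <= r t * (1 + (F t)\<^sup>2)" using r(2) by (rule mult_left_mono)
  then show ?thesis using r(2)[of t] by (simp add: abs_mult algebra_simps)
 qed
 then show i: "intg (\<lambda>t. r t * F t)"
  by (intro Bochner_Integration.integrable_bound[OF Bochner_Integration.integrable_add[OF r(1) rF]]) auto
 define I0 I1 I2 where "I0 = (LINT t|lborel. r t)" and "I1 = (LINT t|lborel. r t * F t)"
  and "I2 = (LINT t|lborel. r t * (F t)\<^sup>2)"
 define l where "l = I1 / K"
 have "0 <= (LINT t|lborel. r t * (F t - l)\<^sup>2)" using r(2) by simp
 also have "\<dots> = (LINT t|lborel. r t * (F t)\<^sup>2 - 2 * l * (r t * F t) + l\<^sup>2 * r t)"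
  by (intro Bochner_Integration.integral_cong refl) (simp add: power2_eq_square algebra_simps)
 also have "\<dots> = I2 - 2 * l * I1 + l\<^sup>2 * I0"
  using i rF r(1) by (simp add: I0_def I1_def I2_def)
 also have "\<dots> <= I2 - 2 * l * I1 + l\<^sup>2 * K"
  using K(1) by (simp add: I0_def mult_left_mono)
 also have "\<dots> = I2 - I1\<^sup>2 / K" using K(2) by (simp add: l_def power2_eq_square field_simps)
 finally have "I1\<^sup>2 / K <= I2" by simp
 then show "(LINT t|lborel. r t * F t)\<^sup>2 <= K * (LINT t|lborel. r t * (F t)\<^sup>2)"
  using K(2) unfolding I1_def I2_def by (simp add: field_simps)
qed

text \<open>Young's inequality in weighted form: writing \<open>exp (\<alpha> * x)\<close> as
  \<open>exp (\<alpha> * (x + t)) * exp (- \<alpha> * t)\<close> moves the weight onto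
  \<open>u\<close> and turns the kernel into the integrable \<open>r\<close>. Cauchy-Schwarz with
  respect to \<open>r\<close> and Fubini finish the estimate.\<close>

lemma convr_L2w:
 assumes k: "kdecay \<alpha> k" and u: "u \<in> L2w \<alpha>"
 shows "convr k u \<in> L2w \<alpha>"
proof -
 note [measurable] = L2w_measurable[OF u]
 have [measurable]: "bmeas k" using k by (simp add: kdecay_def)
 have [measurable]: "convr k u \<in> borel_measurable borel"
  unfolding convr_def[abs_def] by measurable
 define r where "r t = abs (k t) * exp (- \<alpha> * t)" for t
 have [measurable]: "bmeas r" unfolding r_def[abs_def] by measurable
 have r: "intg r" "!!t. r t >= 0"
  using kdecay_weighted[of "-\<alpha>" k] k by (simp_all add: kdecay_minus r_def[abs_def])
 \<comment> \<open>Adding 1 keeps \<open>K\<close> positive even if the kernel vanishes.\<close>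
 define K where "K = (LINT t|lborel. r t) + 1"
 have K: "(LINT t|lborel. r t) <= K" "K > 0" using r(2) by (simp_all add: K_def add_nonneg_pos)
 define G where "G y = exp (2 * \<alpha> * y) * (norm (u y))\<^sup>2" for y
 have [measurable]: "bmeas G" unfolding G_def[abs_def] by measurable
 have G: "intg G" "!!y. G y >= 0"
  using L2w_integrable[OF u] by (simp_all add: G_def[abs_def])
 have Gs: "has_bochner_integral lborel (\<lambda>x. G (x + t)) (LINT x|lborel. G x)" for t
  using lborel_has_bochner_integral_real_affine_iff[of 1 G "LINT x|lborel. G x" t] G
  by (simp add: has_bochner_integral_iff add.commute)
 have "integrable (lborel \<Otimes>\<^sub>M lborel) (\<lambda>(t, x). r t * G (x + t))"
 proof (rule lborel_pair.Fubini_integrable)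
  show "AE t in lborel. intg (\<lambda>x. case (t, x) of (t, x) => r t * G (x + t))"
   using Gs by (auto simp: has_bochner_integral_iff)
  have "(LINT x|lborel. norm (case (t, x) of (t, x) => r t * G (x + t))) = r t * (LINT x|lborel. G x)" for t
   using Gs[of t] r(2) G(2) by (simp add: has_bochner_integral_iff abs_mult)
  then show "intg (\<lambda>t. LINT x|lborel. norm (case (t, x) of (t, x) => r t * G (x + t)))"
   using r(1) by simp
 qed measurable
 then have I: "integrable (lborel \<Otimes>\<^sub>M lborel) (\<lambda>(x, t). r t * G (x + t))"
  using lborel_pair.integrable_product_swap_iff[of "\<lambda>(x, t). r t * G (x + t)"] by (simp add: case_prod_beta')
 have a: "AE x in lborel. intg (\<lambda>t. r t * G (x + t))"
  using lborel_pair.AE_integrable_fst'[OF I] by simp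
 have H: "intg (\<lambda>x. LINT t|lborel. r t * G (x + t))"
  using lborel_pair.integrable_fst'[OF I] by simp
 have "intg (\<lambda>x. K * (LINT t|lborel. r t * G (x + t)))" using H by simp
 then have "intg (\<lambda>x. exp (2 * \<alpha> * x) * (norm (convr k u x))\<^sup>2)"
 proof (rule Bochner_Integration.integrable_bound)
  show "AE x in lborel. norm (exp (2 * \<alpha> * x) * (norm (convr k u x))\<^sup>2) <= norm (K * (LINT t|lborel. r t * G (x + t)))"
   using a
  proof eventually_elim
   case (elim x)
   define F where "F t = exp (\<alpha> * (x + t)) * norm (u (x + t))" for t
   have [measurable]: "bmeas F" unfolding F_def[abs_def] by measurable
   have F2: "(F t)\<^sup>2 = G (x + t)" for t
    by (simp add: F_def G_def power_mult_distrib exp_double[symmetric] mult.assoc)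
   have e: "norm (cx (k t) * u (x + t)) = exp (- \<alpha> * x) * (r t * F t)" for t
    by (simp add: norm_mult r_def F_def algebra_simps flip: exp_add)
   note cs = integral_cauchy_schwarz[OF r, of F K, unfolded F2, OF _ elim K]
   have "norm (convr k u x) <= (LINT t|lborel. norm (cx (k t) * u (x + t)))"
    unfolding convr_def by (rule integral_norm_bound)
   also have "\<dots> = exp (- \<alpha> * x) * (LINT t|lborel. r t * F t)"
    unfolding e by simp
   finally have "(norm (convr k u x))\<^sup>2 <= (exp (- \<alpha> * x) * (LINT t|lborel. r t * F t))\<^sup>2"
    by (rule power_mono) simp
   then have "exp (2 * \<alpha> * x) * (norm (convr k u x))\<^sup>2 <= exp (2 * \<alpha> * x) * (exp (- \<alpha> * x) * (LINT t|lborel. r t * F t))\<^sup>2"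
    by (rule mult_left_mono) simp
   also have "\<dots> = (LINT t|lborel. r t * F t)\<^sup>2"
    by (simp add: power_mult_distrib exp_double[symmetric] mult.assoc flip: exp_add)
   also have "\<dots> <= K * (LINT t|lborel. r t * G (x + t))" by (rule cs(2)) simp
   finally show ?case by simp
  qed
 qed measurable
 then show ?thesis by (simp add: L2w_def)
qed

text \<open>Differentiation under the integral by dominated convergence: the difference quotients of
  \<open>\<phi>\<close> are bounded by a bound of \<open>deriv \<phi>\<close>.\<close>

lemma convl_deriv:
 assumes k: "intg k" and p: "\<phi> \<in> test_fun"
 shows "(convl k \<phi> has_real_derivative convl k (deriv \<phi>) x) (at x)"
proof -
 note [measurable] = test_fun_measurable[OF p] test_fun_measurable[OF test_fun_deriv[OF p]] borel_measurable_integrable[OF k]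
 obtain C where C: "C >= 0" "!!x. abs (deriv \<phi> x) <= C" using test_fun_bounded[OF test_fun_deriv[OF p]] by blast
 obtain C0 where C0: "C0 >= 0" "!!x. abs (\<phi> x) <= C0" using test_fun_bounded[OF p] by blast
 have ik: "intg (\<lambda>t. k t * \<phi> (y - t))" for y
 proof (rule Bochner_Integration.integrable_bound)
  show "intg (\<lambda>t. C0 * k t)" using k by simp
  show "AE t in lborel. norm (k t * \<phi> (y - t)) <= norm (C0 * k t)"
   using mult_left_mono[OF C0(2) abs_ge_zero] C0(1) by (intro AE_I2) (simp add: abs_mult mult.commute[of C0])
 qed measurable
 have lip: "\<bar>\<phi> y - \<phi> z\<bar> <= C * \<bar>y - z\<bar>" for y z
  using field_differentiable_bound[of UNIV \<phi> "deriv \<phi>" C y z] C(2) test_fun_has_deriv[OF p] by auto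
 have "((\<lambda>h. (convl k \<phi> (x + h) - convl k \<phi> x) / h) \<longlongrightarrow> convl k (deriv \<phi>) x) (at 0)"
  unfolding tendsto_at_iff_sequentially
 proof (intro allI impI)
  fix X :: "nat => real" assume X: "\<forall>i. X i \<in> UNIV - {0}" "X \<longlonglongrightarrow> 0"
  have "(\<lambda>n. LINT t|lborel. k t * ((\<phi> (x + X n - t) - \<phi> (x - t)) / X n)) \<longlonglongrightarrow> (LINT t|lborel. k t * deriv \<phi> (x - t))"
  proof (rule integral_dominated_convergence[where w = "\<lambda>t. C * abs (k t)"])
   show "intg (\<lambda>t. C * abs (k t))" using k by simp
   show "AE t in lborel. (\<lambda>n. k t * ((\<phi> (x + X n - t) - \<phi> (x - t)) / X n)) \<longlonglongrightarrow> k t * deriv \<phi> (x - t)"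
   proof (intro AE_I2 tendsto_mult tendsto_const)
    fix t
    have "((\<lambda>h. (\<phi> (x - t + h) - \<phi> (x - t)) / h) \<longlongrightarrow> deriv \<phi> (x - t)) (at 0)"
     using test_fun_has_deriv[OF p, of "x - t"] by (simp add: DERIV_def)
    then show "(\<lambda>n. (\<phi> (x + X n - t) - \<phi> (x - t)) / X n) \<longlonglongrightarrow> deriv \<phi> (x - t)"
     using X unfolding tendsto_at_iff_sequentially comp_def by (simp add: algebra_simps)
   qed
   show "AE t in lborel. norm (k t * ((\<phi> (x + X n - t) - \<phi> (x - t)) / X n)) <= C * abs (k t)" for n
   proof (rule AE_I2)
    fix t
    have le: "\<bar>(\<phi> (x + X n - t) - \<phi> (x - t)) / X n\<bar> <= C"
     using lip[of "x + X n - t" "x - t"] X(1) by (simp add: abs_divide field_simps)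
    show "norm (k t * ((\<phi> (x + X n - t) - \<phi> (x - t)) / X n)) <= C * abs (k t)"
     using mult_left_mono[OF le abs_ge_zero[of "k t"]] by (simp only: real_norm_def abs_mult mult.commute[of C])
   qed
  qed measurable
  moreover have e: "(LINT t|lborel. k t * ((\<phi> (x + X n - t) - \<phi> (x - t)) / X n)) = (convl k \<phi> (x + X n) - convl k \<phi> x) / X n" for n
   using ik[of "x + X n"] ik[of x] by (simp add: convl_def right_diff_distrib diff_divide_distrib)
  ultimately show "((\<lambda>h. (convl k \<phi> (x + h) - convl k \<phi> x) / h) \<circ> X) \<longlonglongrightarrow> convl k (deriv \<phi>) x"
   by (simp only: e comp_def convl_def[of k "deriv \<phi>"])
 qed
 then show ?thesis by (simp add: DERIV_def)
qed

lemma convl_smooth: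
 assumes k: "intg k" and p: "\<phi> \<in> test_fun"
 shows "smooth (convl k \<phi>)"
 by (rule smooth_coinduct[where P = "\<lambda>f. \<exists>\<psi>\<in>test_fun. f = convl k \<psi>"])
  (use p convl_deriv[OF k] test_fun_deriv in blast)+

lemma convl_test:
 assumes k: "intg k" and p: "\<phi> \<in> test_fun" and z: "!!t. t \<notin> {0..1} ==> k t = 0"
 shows "convl k \<phi> \<in> test_fun"
proof -
 obtain R where R: "!!x. abs x > R ==> \<phi> x = 0" using p by (auto simp: test_fun_iff)
 have "convl k \<phi> x = 0" if "abs x > R + 1" for x
 proof -
  have "k t * \<phi> (x - t) = 0" for t
  proof (cases "t \<in> {0..1}")
   case True
   then have "0 <= t" "t <= 1" by auto
   then have "\<bar>x - t\<bar> > R" using that by linarith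
   then show ?thesis using R by simp
  qed (simp add: z)
  then have "(\<lambda>t. k t * \<phi> (x - t)) = (\<lambda>t. 0)" by (rule ext)
  then show ?thesis unfolding convl_def by simp
 qed
 then show ?thesis using convl_smooth[OF k p] unfolding test_fun_iff by blast
qed

lemma deriv_convl: "intg k ==> \<phi> \<in> test_fun ==> deriv (convl k \<phi>) = convl k (deriv \<phi>)"
 by (auto intro!: DERIV_imp_deriv convl_deriv)

section \<open>Intermediate weak derivatives\<close>

text \<open>The second clause says that the transpose of \<open>K\<close> maps
  \<open>L2w \<alpha>\<close> into itself. Together with the commutation with \<open>deriv\<close>,
  an identity between such operators on test functions can be read as one between weak derivatives
  of weighted functions.\<close>

definition good_op :: "real => ((real => real) => real => real) => bool" where
 "good_op \<alpha> K \<longleftrightarrow> (\<forall>\<phi>\<in>test_fun. K \<phi> \<in> test_fun \<and> deriv (K \<phi>) = K (deriv \<phi>)) \<and>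
   (\<forall>u\<in>L2w \<alpha>. \<exists>v\<in>L2w \<alpha>. \<forall>\<phi>\<in>test_fun.
    (tint u (K \<phi>)) = tint v \<phi>)"

lemma good_op_test: "good_op \<alpha> K ==> \<phi> \<in> test_fun ==> K \<phi> \<in> test_fun"
 and good_op_deriv: "good_op \<alpha> K ==> \<phi> \<in> test_fun ==> deriv (K \<phi>) = K (deriv \<phi>)"
 by (auto simp: good_op_def)

lemma good_op_deriv_n: "good_op \<alpha> K ==> \<phi> \<in> test_fun ==> (deriv ^^ n) (K \<phi>) = K ((deriv ^^ n) \<phi>)"
 by (induction n) (auto simp: good_op_deriv test_fun_deriv_n)

lemma good_op_id: "good_op \<alpha> (\<lambda>\<phi>. \<phi>)"
 by (auto simp: good_op_def)

lemma good_op_zero: "good_op \<alpha> (\<lambda>\<phi> x. 0)"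
proof -
 have z: "(\<lambda>x. 0) \<in> L2w \<alpha>" by (simp add: L2w_def)
 show ?thesis unfolding good_op_def
  by (intro conjI ballI bexI[OF _ z]) (auto simp: test_fun_iff smooth_const)
qed

lemma good_op_comp: "good_op \<alpha> K ==> good_op \<alpha> K' ==> good_op \<alpha> (\<lambda>\<phi>. K (K' \<phi>))"
 unfolding good_op_def
proof (intro conjI ballI; elim conjE)
 fix u assume "u \<in> L2w \<alpha>" and K: "\<forall>u\<in>L2w \<alpha>. \<exists>v\<in>L2w \<alpha>. \<forall>\<phi>\<in>test_fun.
    (tint u (K \<phi>)) = tint v \<phi>"
  and K': "\<forall>u\<in>L2w \<alpha>. \<exists>v\<in>L2w \<alpha>. \<forall>\<phi>\<in>test_fun.
    (tint u (K' \<phi>)) = tint v \<phi>"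
  and t: "\<forall>\<phi>\<in>test_fun. K' \<phi> \<in> test_fun \<and> deriv (K' \<phi>) = K' (deriv \<phi>)"
 then obtain v where v: "v \<in> L2w \<alpha>" "\<forall>\<phi>\<in>test_fun.
    (tint u (K \<phi>)) = tint v \<phi>" by blast
 with K' obtain v' where v': "v' \<in> L2w \<alpha>" "\<forall>\<phi>\<in>test_fun.
    (tint v (K' \<phi>)) = tint v' \<phi>" by blast
 show "\<exists>v\<in>L2w \<alpha>. \<forall>\<phi>\<in>test_fun.
    (tint u (K (K' \<phi>))) = tint v \<phi>"
  using v v' t by (intro bexI[of _ v'] ballI) simp_all
qed simp_all

lemma good_op_add:
 assumes K: "good_op \<alpha> K" "good_op \<alpha> K'"
 shows "good_op \<alpha> (\<lambda>\<phi> x. K \<phi> x + s * K' \<phi> x)"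
 unfolding good_op_def
proof (intro conjI ballI)
 fix \<phi> assume p: "\<phi> \<in> test_fun"
 note t = good_op_test[OF K(1) p] good_op_test[OF K(2) p]
 show "(\<lambda>x. K \<phi> x + s * K' \<phi> x) \<in> test_fun" by (intro test_fun_add test_fun_cmult t)
 show "deriv (\<lambda>x. K \<phi> x + s * K' \<phi> x) = (\<lambda>x. K (deriv \<phi>) x + s * K' (deriv \<phi>) x)"
  using K p t by (simp add: deriv_add' test_fun_cmult deriv_cmult' good_op_deriv)
next
 fix u assume u: "u \<in> L2w \<alpha>"
 obtain v where v: "v \<in> L2w \<alpha>" "\<forall>\<phi>\<in>test_fun. tint u (K \<phi>) = tint v \<phi>"
  using K(1) u by (auto simp: good_op_def)
 obtain v' where v': "v' \<in> L2w \<alpha>" "\<forall>\<phi>\<in>test_fun. tint u (K' \<phi>) = tint v' \<phi>"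
  using K(2) u by (auto simp: good_op_def)
 show "\<exists>v\<in>L2w \<alpha>. \<forall>\<phi>\<in>test_fun. (LINT x|lborel. u x * cx (K \<phi> x + s * K' \<phi> x)) = tint v \<phi>"
 proof (intro bexI ballI)
  fix \<phi> assume p: "\<phi> \<in> test_fun"
  note i = L2w_L1loc[OF u, THEN L1loc_integrable_test] L2w_L1loc[OF v(1), THEN L1loc_integrable_test]
   L2w_L1loc[OF v'(1), THEN L1loc_integrable_test]
  have "(LINT x|lborel. u x * cx (K \<phi> x + s * K' \<phi> x)) =
   (LINT x|lborel. u x * cx (K \<phi> x) + cx s * (u x * cx (K' \<phi> x)))"
   by (intro Bochner_Integration.integral_cong) (auto simp: algebra_simps)
  also have "\<dots> = tint v \<phi> + cx s * tint v' \<phi>"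
   using i(1)[OF good_op_test[OF K(1) p]] i(1)[OF good_op_test[OF K(2) p]] v(2) v'(2) p by simp
  also have "\<dots> = (LINT x|lborel. v x * cx (\<phi> x) + cx s * (v' x * cx (\<phi> x)))"
   using i(2)[OF p] i(3)[OF p] by simp
  also have "\<dots> = (LINT x|lborel. (v x + cx s * v' x) * cx (\<phi> x))"
   by (intro Bochner_Integration.integral_cong) (auto simp: algebra_simps)
  finally show "(LINT x|lborel. u x * cx (K \<phi> x + s * K' \<phi> x)) = (LINT x|lborel. (v x + cx s * v' x) * cx (\<phi> x))" .
 next
  show "(\<lambda>x. v x + cx s * v' x) \<in> L2w \<alpha>" by (intro L2w_add L2w_cmult v v')
 qed
qed

lemma good_op_convl:
 assumes k [measurable]: "bmeas k" and z: "!!t. t \<notin> {0..1} ==> k t = 0" and b: "!!t. abs (k t) <= 1"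
 shows "good_op \<alpha> (convl k)"
proof -
 have kd: "kdecay \<alpha> k"
  unfolding kdecay_def
 proof (intro conjI exI allI)
  show "abs (k t) <= exp (abs \<alpha> + 1) * exp (- (abs \<alpha> + 1) * abs t)" for t
  proof (cases "t \<in> {0..1}")
   case True
   then have "(abs \<alpha> + 1) * abs t <= (abs \<alpha> + 1) * 1" by (intro mult_left_mono) auto
   then have "0 <= (abs \<alpha> + 1) + (- (abs \<alpha> + 1) * abs t)" by (simp only: mult_minus_left mult_1_right)
   then have "exp 0 <= exp ((abs \<alpha> + 1) + (- (abs \<alpha> + 1) * abs t))" by (simp only: exp_le_cancel_iff)
   then have "1 <= exp (abs \<alpha> + 1) * exp (- (abs \<alpha> + 1) * abs t)" by (simp only: exp_add exp_zero)
   then show ?thesis using b[of t] by linarith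
  qed (simp add: z)
 qed (use k in auto)
 note ki = kdecay_integrable[OF kd]
 show ?thesis
  unfolding good_op_def
 proof (intro conjI ballI)
  fix \<phi> assume p: "\<phi> \<in> test_fun"
  show "convl k \<phi> \<in> test_fun" by (rule convl_test[OF ki p z])
  show "deriv (convl k \<phi>) = convl k (deriv \<phi>)" by (rule deriv_convl[OF ki p])
 next
  fix u assume u: "u \<in> L2w \<alpha>"
  have "tint u (convl k \<phi>) = (LINT x|lborel. convr k u x * cx (\<phi> x))" 
   if "\<phi> \<in> test_fun" for \<phi>
   using conv_adj[OF kd u L2w_test[OF that]] unfolding convl_def
   by (simp flip: of_real_mult)
  then show "\<exists>v\<in>L2w \<alpha>. \<forall>\<phi>\<in>test_fun. tint u (convl k \<phi>) = tint v \<phi>"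
   using convr_L2w[OF kd u] by blast
 qed
qed

text \<open>\<open>kM\<close> averages over a unit interval and so turns \<open>deriv \<phi>\<close>
  into a difference of values; \<open>kN\<close> is the kernel of the second-order Taylor remainder
  over the same interval.\<close>

definition kM :: "real => real" where "kM t = indicator {0..1} t"
definition kN :: "real => real" where "kN t = (1 - t) * indicator {0..1} t"

lemma good_op_kM: "good_op \<alpha> (convl kM)"
 by (rule good_op_convl) (auto simp: kM_def[abs_def])

lemma good_op_kN: "good_op \<alpha> (convl kN)"
 by (rule good_op_convl) (auto simp: kN_def[abs_def] indicator_def)

lemma test_fun_isCont: "\<phi> \<in> test_fun ==> isCont \<phi> x"
 using test_fun_has_deriv DERIV_isCont by blast

lemma convl_kM: assumes p: "\<phi> \<in> test_fun" shows "convl kM (deriv \<phi>) x = \<phi> x - \<phi> (x - 1)"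
proof -
 have "(LINT t|lborel. deriv \<phi> (x - t) * indicator {0..1} t) = - \<phi> (x - 1) - (- \<phi> (x - 0))"
 proof (rule integral_FTC_Icc_real)
  show "((\<lambda>t. - \<phi> (x - t)) has_real_derivative deriv \<phi> (x - t)) (at t)" for t
   by (auto intro!: derivative_eq_intros DERIV_chain2[OF test_fun_has_deriv[OF p], of "\<lambda>t. x - t"])
  show "isCont (\<lambda>t. deriv \<phi> (x - t)) t" for t
   by (rule isCont_o2[of t "\<lambda>t. x - t"]) (auto intro!: test_fun_isCont test_fun_deriv p)
 qed simp
 then show ?thesis by (simp add: convl_def kM_def mult.commute)
qed

text \<open>Taylor's formula with integral remainder for \<open>\<phi> (x - 1)\<close> around
  \<open>x\<close>, solved for \<open>deriv \<phi> x\<close>.\<close>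

lemma convl_kN: assumes p: "\<phi> \<in> test_fun"
 shows "deriv \<phi> x = \<phi> x - \<phi> (x - 1) + convl kN (deriv (deriv \<phi>)) x"
proof -
 note p' = test_fun_deriv[OF p]
 have "(LINT t|lborel. ((1 - t) * deriv (deriv \<phi>) (x - t)) * indicator {0..1} t)
  = (- (1 - 1) * deriv \<phi> (x - 1) + \<phi> (x - 1)) - (- (1 - 0) * deriv \<phi> (x - 0) + \<phi> (x - 0))"
 proof (rule integral_FTC_Icc_real)
  show "((\<lambda>t. - (1 - t) * deriv \<phi> (x - t) + \<phi> (x - t)) has_real_derivative (1 - t) * deriv (deriv \<phi>) (x - t)) (at t)" for t
   by (auto intro!: derivative_eq_intros DERIV_chain2[OF test_fun_has_deriv[OF p], of "\<lambda>t. x - t"]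
      DERIV_chain2[OF test_fun_has_deriv[OF p'], of "\<lambda>t. x - t"] simp: algebra_simps)
  show "isCont (\<lambda>t. (1 - t) * deriv (deriv \<phi>) (x - t)) t" for t
   by (intro continuous_intros isCont_o2[of t "\<lambda>t. x - t"]) (auto intro!: test_fun_isCont test_fun_deriv p)
 qed simp
 moreover have "convl kN (deriv (deriv \<phi>)) x = (LINT t|lborel. ((1 - t) * deriv (deriv \<phi>) (x - t)) * indicator {0..1} t)"
  unfolding convl_def kN_def by (intro Bochner_Integration.integral_cong) auto
 ultimately show ?thesis by simp
qed

lemma good_op_shift: "good_op \<alpha> (\<lambda>\<phi> x. \<phi> (x - 1))"
 unfolding good_op_def
proof (intro conjI ballI)
 fix \<phi> assume p: "\<phi> \<in> test_fun"
 show "(\<lambda>x. \<phi> (x - 1)) \<in> test_fun" by (rule test_fun_shift[OF p])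
 show "deriv (\<lambda>x. \<phi> (x - 1)) = (\<lambda>x. deriv \<phi> (x - 1))" by (rule deriv_shift[OF p])
next
 fix u assume u: "u \<in> L2w \<alpha>"
 note [measurable] = L2w_measurable[OF u]
 have "intg (\<lambda>x. exp (2 * \<alpha> * (1 + 1 * x)) * (norm (u (1 + 1 * x)))\<^sup>2)"
  using L2w_integrable[OF u] by (subst lborel_integrable_real_affine_iff) auto
 then have "intg (\<lambda>x. exp (- 2 * \<alpha>) * (exp (2 * \<alpha> * (1 + 1 * x)) * (norm (u (1 + 1 * x)))\<^sup>2))"
  by simp
 moreover have "exp (- 2 * \<alpha>) * (exp (2 * \<alpha> * (1 + 1 * x)) * (norm (u (1 + 1 * x)))\<^sup>2) = exp (2 * \<alpha> * x) * (norm (u (1 + x)))\<^sup>2" for x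
 proof -
  have "exp (- 2 * \<alpha>) * exp (2 * \<alpha> * (1 + 1 * x)) = exp (2 * \<alpha> * x)"
   by (simp add: distrib_left flip: exp_add)
  then show ?thesis by (simp only: mult_1 flip: mult.assoc)
 qed
 ultimately have "intg (\<lambda>x. exp (2 * \<alpha> * x) * (norm (u (1 + x)))\<^sup>2)"
  by (simp only:)
 then have "(\<lambda>x. u (1 + x)) \<in> L2w \<alpha>"
  by (simp add: L2w_def)
 moreover have "(LINT x|lborel. u x * cx (\<phi> (x - 1))) = (LINT x|lborel. u (1 + x) * cx (\<phi> x))" for \<phi>
  using lborel_integral_real_affine[of 1 "\<lambda>x. u x * cx (\<phi> (x - 1))" 1] by simp
 ultimately show "\<exists>v\<in>L2w \<alpha>. \<forall>\<phi>\<in>test_fun. (LINT x|lborel. u x * cx (\<phi> (x - 1))) = tint v \<phi>"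
  by (intro bexI[of _ "\<lambda>x. u (1 + x)"] ballI)
qed

text \<open>Taylor's formula with unit step writes a derivative as bounded operators applied to the function
 and to its next derivative; by duality \<open>u\<close> and its weak derivative of order \<open>n + 1\<close> in \<open>L2w \<alpha>\<close>
 control the one of order \<open>n\<close>.\<close>

lemma good_op_split:
 "\<exists>A B. good_op \<alpha> A \<and> good_op \<alpha> B \<and> (\<forall>\<phi>\<in>test_fun. \<forall>x. (deriv ^^ n) \<phi> x = A \<phi> x + (deriv ^^ Suc n) (B \<phi>) x)"
proof (induction n)
 case 0
 show ?case
  by (rule exI[of _ "\<lambda>\<phi>. \<phi>"], rule exI[of _ "\<lambda>\<phi> x. 0"]) (auto simp: good_op_id good_op_zero)
next
 case (Suc n)
 then obtain A B where AB: "good_op \<alpha> A" "good_op \<alpha> B"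
  "!!\<phi> x. \<phi> \<in> test_fun ==> (deriv ^^ n) \<phi> x = A \<phi> x + (deriv ^^ Suc n) (B \<phi>) x" by blast
 \<comment> \<open>The backward difference, written as a sum so that \<open>good_op_add\<close>
   applies. On test functions it averages the derivative by \<open>kM\<close>, which supplies the
   additional derivative in the induction step.\<close>
 define D where "D = (\<lambda>\<phi> x. \<phi> x + (-1) * \<phi> (x - 1 :: real) :: real)"
 have D: "good_op \<alpha> D" unfolding D_def by (intro good_op_add good_op_id good_op_shift)
 have DM: "D \<phi> = convl kM (deriv \<phi>)" if "\<phi> \<in> test_fun" for \<phi>
  using convl_kM[OF that] by (auto simp: D_def)
 define B' where "B' = (\<lambda>\<phi> x. B (convl kM \<phi>) x + 1 * convl kN \<phi> x)"
 have B': "good_op \<alpha> B'" unfolding B'_def by (intro good_op_add good_op_comp[OF AB(2)] good_op_kM good_op_kN)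
 have "(deriv ^^ Suc n) \<phi> x = A (D \<phi>) x + (deriv ^^ Suc (Suc n)) (B' \<phi>) x" if p: "\<phi> \<in> test_fun" for \<phi> x
 proof -
  note pn = test_fun_deriv_n[OF p]
  have Dp: "D \<phi> \<in> test_fun" by (rule good_op_test[OF D p])
  have "(deriv ^^ Suc n) \<phi> x = D ((deriv ^^ n) \<phi>) x + convl kN ((deriv ^^ Suc (Suc n)) \<phi>) x"
   using convl_kN[OF pn, of n x] by (simp add: D_def)
  also have "D ((deriv ^^ n) \<phi>) x = (deriv ^^ n) (D \<phi>) x" using good_op_deriv_n[OF D p] by simp
  also have "\<dots> = A (D \<phi>) x + (deriv ^^ Suc n) (B (D \<phi>)) x" by (rule AB(3)[OF Dp])
  also have "(deriv ^^ Suc n) (B (D \<phi>)) = B ((deriv ^^ Suc n) (convl kM (deriv \<phi>)))"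
   by (subst good_op_deriv_n[OF AB(2) Dp]) (simp only: DM[OF p])
  also have "(deriv ^^ Suc n) (convl kM (deriv \<phi>)) = convl kM ((deriv ^^ Suc (Suc n)) \<phi>)"
   using good_op_deriv_n[OF good_op_kM test_fun_deriv[OF p], of "Suc n"]
   by (simp only: funpow_Suc_right comp_apply)
  finally have "(deriv ^^ Suc n) \<phi> x = A (D \<phi>) x + B' ((deriv ^^ Suc (Suc n)) \<phi>) x" by (simp add: B'_def)
  then show ?thesis using good_op_deriv_n[OF B' p, of "Suc (Suc n)"] by simp
 qed
 then show ?case
  by (intro exI[of _ "\<lambda>\<phi>. A (D \<phi>)"] exI[of _ B'] conjI good_op_comp[OF AB(1) D] B') blast
qed

lemma weak_deriv_lower:
 assumes u: "u \<in> L2w \<alpha>" and g: "g \<in> L2w \<alpha>" and w: "is_wderiv (Suc n) u g"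
 shows "\<exists>v\<in>L2w \<alpha>. is_wderiv n u v"
proof -
 obtain A B where AB: "good_op \<alpha> A" "good_op \<alpha> B"
  "!!\<phi> x. \<phi> \<in> test_fun ==> (deriv ^^ n) \<phi> x = A \<phi> x + (deriv ^^ Suc n) (B \<phi>) x"
  using good_op_split[of \<alpha> n] by blast
 obtain v where v: "v \<in> L2w \<alpha>" "!!\<phi>. \<phi> \<in> test_fun ==> tint u (A \<phi>) = tint v \<phi>"
  using AB(1) u unfolding good_op_def by metis
 obtain h where h: "h \<in> L2w \<alpha>" "!!\<phi>. \<phi> \<in> test_fun ==> tint g (B \<phi>) = tint h \<phi>"
  using AB(2) g unfolding good_op_def by metis
 have "is_wderiv n u (\<lambda>x. (-1) ^ n * v x - h x)"
  unfolding is_wderiv_iff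
 proof
  fix \<phi> assume p: "\<phi> \<in> test_fun"
  note i = L2w_L1loc[OF u, THEN L1loc_integrable_test] L2w_L1loc[OF v(1), THEN L1loc_integrable_test]
   L2w_L1loc[OF h(1), THEN L1loc_integrable_test]
  have Bp: "B \<phi> \<in> test_fun" by (rule good_op_test[OF AB(2) p])
  have "tint u ((deriv ^^ n) \<phi>)
   = (LINT x|lborel. u x * cx (A \<phi> x) + u x * cx ((deriv ^^ Suc n) (B \<phi>) x))"
   by (intro Bochner_Integration.integral_cong refl) (simp only: AB(3)[OF p] of_real_add distrib_left)
  also have "\<dots> = tint u (A \<phi>) + tint u ((deriv ^^ Suc n) (B \<phi>))"
   by (intro Bochner_Integration.integral_add i(1) good_op_test[OF AB(1) p] test_fun_deriv_n Bp)
  finally have e: "tint u ((deriv ^^ n) \<phi>) =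
   tint v \<phi> + tint u ((deriv ^^ Suc n) (B \<phi>))"
   by (simp only: v(2)[OF p])
  have e2: "(-1) ^ n * tint u ((deriv ^^ Suc n) (B \<phi>)) = - tint h \<phi>"
  proof -
   have "(-1) ^ Suc n * tint u ((deriv ^^ Suc n) (B \<phi>)) = tint h \<phi>"
    using w Bp unfolding is_wderiv_iff h(2)[OF p, symmetric] by blast
   then show ?thesis by (simp only: power_Suc mult_minus_left mult_1 minus_equation_iff[of "_ * _"])
  qed
  have "(LINT x|lborel. ((-1) ^ n * v x - h x) * cx (\<phi> x)) =
   (LINT x|lborel. (-1) ^ n * (v x * cx (\<phi> x)) - h x * cx (\<phi> x))"
   by (intro Bochner_Integration.integral_cong refl) (simp add: algebra_simps)
  also have "\<dots> = (-1) ^ n * tint v \<phi> - tint h \<phi>"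
   using i(2)[OF p] i(3)[OF p] by simp
  finally show "(-1) ^ n * tint u ((deriv ^^ n) \<phi>) = (LINT x|lborel. ((-1) ^ n * v x - h x) * cx (\<phi> x))"
   unfolding e by (simp only: distrib_left e2 add_uminus_conv_diff)
 qed
 then show ?thesis using L2w_diff[OF L2w_cmult[OF v(1), of "(-1)^n"] h(1)] by blast
qed

lemma weak_deriv_all:
 assumes u: "u \<in> L2w \<alpha>" and g: "g \<in> L2w \<alpha>" "is_wderiv n u g" and j: "j <= n"
 shows "\<exists>v\<in>L2w \<alpha>. is_wderiv j u v"
 using j by (induction rule: inc_induct) (use g weak_deriv_lower[OF u] in blast)+

section \<open>Weighted smooth functions as test functions\<close>

text \<open>All derivatives are listed as one sequence, each dominated by the weight with the extra
  decay \<open>exp (- \<delta> * abs x)\<close>. For \<open>\<delta> > 0\<close> such functions lie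
  in every \<open>Hw k \<beta>\<close>, and with \<open>\<beta> = - \<alpha>\<close> they serve as
  test functions against \<open>L2w \<alpha>\<close>.\<close>

definition wsmooth :: "real => real => (nat => real => complex) => bool" where
 "wsmooth \<beta> \<delta> D \<longleftrightarrow> (\<forall>n x. (D n has_vector_derivative D (Suc n) x) (at x)) \<and>
   (\<forall>n. \<exists>C. \<forall>x. norm (D n x) <= C * wt \<beta> \<delta> x)"

lemma wsmooth_deriv: "wsmooth \<beta> \<delta> D ==> (D n has_vector_derivative D (Suc n) x) (at x)"
 and wsmooth_bound: "wsmooth \<beta> \<delta> D ==> \<exists>C. \<forall>x. norm (D n x) <= C * wt \<beta> \<delta> x"
 by (auto simp: wsmooth_def)

lemma wsmooth_measurable: "wsmooth \<beta> \<delta> D ==> D n \<in> borel_measurable borel"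
 by (intro borel_measurable_continuous_onI continuous_at_imp_continuous_on)
  (auto intro: has_vector_derivative_continuous wsmooth_deriv)

lemma wsmooth_L2w: "wsmooth \<beta> \<delta> D ==> \<delta> > 0 ==> D n \<in> L2w \<beta>"
 using wsmooth_bound[of \<beta> \<delta> D n] L2w_wt_bound[OF _ wsmooth_measurable] by blast

lemma smooth_seq:
 assumes "!!n x. (F n has_real_derivative F (Suc n) x) (at x)"
 shows "smooth (F n)"
proof (rule smooth_coinduct[where P = "\<lambda>f. \<exists>n. f = F n"])
 fix f assume "\<exists>n. f = F n"
 then obtain n where "f = F n" ..
 then show "\<exists>f'. (\<forall>x. (f has_real_derivative f' x) (at x)) \<and> (\<exists>n. f' = F n)"
  using assms by (intro exI[of _ "F (Suc n)"]) auto
qed auto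

lemma wsmooth_smooth_Re:
 assumes "wsmooth \<beta> \<delta> D" shows "smooth (\<lambda>x. Re (D n x))" "smooth (\<lambda>x. Im (D n x))"
proof -
 have 1: "((\<lambda>x. Re (D n x)) has_real_derivative Re (D (Suc n) x)) (at x)"
  and 2: "((\<lambda>x. Im (D n x)) has_real_derivative Im (D (Suc n) x)) (at x)" for n x
  using wsmooth_deriv[OF assms, of n x]
  by (auto simp: has_real_derivative_iff_has_vector_derivative
    intro: bounded_linear.has_vector_derivative[OF bounded_linear_Re] bounded_linear.has_vector_derivative[OF bounded_linear_Im])
 show "smooth (\<lambda>x. Re (D n x))" by (rule smooth_seq[of "\<lambda>n x. Re (D n x)", OF 1])
 show "smooth (\<lambda>x. Im (D n x))" by (rule smooth_seq[of "\<lambda>n x. Im (D n x)", OF 2])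
qed

text \<open>The factor \<open>exp 1\<close> normalizes the value at 0 to 1.\<close>

definition cutoff :: "real => real" where
 "cutoff x = exp 1 * flat (1 - x * x)"

lemma cutoff_test: "cutoff \<in> test_fun"
proof -
 have "smooth cutoff" unfolding cutoff_def[abs_def]
  by (intro smooth_cmult smooth_compose[OF smooth_flat] smooth_diff smooth_mult smooth_const smooth_ident)
 moreover have "cutoff x = 0" if "abs x > 1" for x
 proof -
  have "1 < abs x * abs x" using that by (rule less_1_mult[OF that])
  then show ?thesis by (simp add: cutoff_def flat_def)
 qed
 ultimately show ?thesis unfolding test_fun_iff by blast
qed

text \<open>The cutoffs \<open>cutoff (s n * x)\<close> spread out as \<open>s n\<close> tends to 0.
  Their derivatives carry factors \<open>s n <= 1\<close>, so the products stay within a common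
  multiple of \<open>w\<close> and converge pointwise together with two derivatives.\<close>

lemma real_test_approx:
 assumes f: "smooth f" and w: "!!x. abs (f x) <= C0 * w x" "!!x. abs (deriv f x) <= C1 * w x"
  "!!x. \<bar>deriv (deriv f) x\<bar> <= C2 * w x" "!!x. w x > 0"
 shows "\<exists>\<phi> C. (\<forall>n::nat. \<phi> n \<in> test_fun \<and> (\<forall>x. abs (\<phi> n x) <= C * w x \<and> \<bar>deriv (\<phi> n) x\<bar> <= C * w x \<and> \<bar>deriv (deriv (\<phi> n)) x\<bar> <= C * w x))
  \<and> (\<forall>x. (\<lambda>n. \<phi> n x) \<longlonglongrightarrow> f x \<and> (\<lambda>n. deriv (\<phi> n) x) \<longlonglongrightarrow> deriv f x \<and> (\<lambda>n. deriv (deriv (\<phi> n)) x) \<longlonglongrightarrow> deriv (deriv f) x)"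
proof -
 note ct = cutoff_test test_fun_deriv[OF cutoff_test] test_fun_deriv[OF test_fun_deriv[OF cutoff_test]]
 obtain A0 where A0: "A0 >= 0" "!!x. abs (cutoff x) <= A0" using test_fun_bounded[OF ct(1)] by blast
 obtain A1 where A1: "A1 >= 0" "!!x. abs (deriv cutoff x) <= A1" using test_fun_bounded[OF ct(2)] by blast
 obtain A2 where A2: "A2 >= 0" "!!x. \<bar>deriv (deriv cutoff) x\<bar> <= A2" using test_fun_bounded[OF ct(3)] by blast
 define s where "s n = 1 / real (Suc n)" for n
 have s: "0 < s n" "s n <= 1" for n by (simp_all add: s_def)
 have s0: "s \<longlonglongrightarrow> 0" unfolding s_def[abs_def] by (rule LIMSEQ_Suc[OF lim_1_over_n])
 define c0 where "c0 n x = cutoff (s n * x)" for n x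
 define c1 where "c1 n x = s n * deriv cutoff (s n * x)" for n x
 define c2 where "c2 n x = s n * (s n * deriv (deriv cutoff) (s n * x))" for n x
 have lin: "((\<lambda>x. s n * x) has_real_derivative s n) (at x)" for n x
  by (auto intro!: derivative_eq_intros)
 have d0: "(c0 n has_real_derivative c1 n x) (at x)" for n x
  unfolding c0_def[abs_def] c1_def
  using DERIV_chain2[OF test_fun_has_deriv[OF ct(1)] lin, of n x] by (simp only: mult.commute[of _ "s n"])
 have d1: "(c1 n has_real_derivative c2 n x) (at x)" for n x
  unfolding c1_def[abs_def] c2_def
  using DERIV_chain2[OF test_fun_has_deriv[OF ct(2)] lin, of n x]
  by (intro DERIV_cmult) (simp only: mult.commute[of _ "s n"])
 have b0: "abs (c0 n x) <= A0" for n x using A0(2) by (simp add: c0_def)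
 have b1: "abs (c1 n x) <= A1" for n x
 proof -
  have "s n * \<bar>deriv cutoff (s n * x)\<bar> <= 1 * A1" using s[of n] A1 by (intro mult_mono) auto
  then show ?thesis using s(1)[of n] by (simp add: c1_def abs_mult)
 qed
 have b2: "abs (c2 n x) <= A2" for n x
 proof -
  have "s n * (s n * \<bar>deriv (deriv cutoff) (s n * x)\<bar>) <= 1 * (1 * A2)"
   using s[of n] A2 by (intro mult_mono mult_nonneg_nonneg) auto
  then show ?thesis using s(1)[of n] by (simp add: c2_def abs_mult)
 qed
 have t: "(\<lambda>n. h (s n * x)) \<longlonglongrightarrow> h 0" if "h \<in> test_fun" for h and x :: real
 proof -
  have "(\<lambda>n. s n * x) \<longlonglongrightarrow> 0" using tendsto_mult_left_zero[OF s0] by blast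
  then show ?thesis by (rule isCont_tendsto_compose[OF test_fun_isCont[OF that]])
 qed
 have l0: "(\<lambda>n. c0 n x) \<longlonglongrightarrow> 1" for x
  using t[OF ct(1), of x] by (simp add: c0_def cutoff_def flat_def flip: exp_add)
 have l1: "(\<lambda>n. c1 n x) \<longlonglongrightarrow> 0" for x
  using tendsto_mult[OF s0 t[OF ct(2), of x]] by (simp add: c1_def)
 have l2: "(\<lambda>n. c2 n x) \<longlonglongrightarrow> 0" for x
  using tendsto_mult[OF s0 tendsto_mult[OF s0 t[OF ct(3), of x]]] by (simp add: c2_def)
 define \<phi> where "\<phi> n x = c0 n x * f x" for n x
 define p1 where "p1 n x = c1 n x * f x + c0 n x * deriv f x" for n x
 define p2 where "p2 n x = c2 n x * f x + 2 * (c1 n x * deriv f x) + c0 n x * deriv (deriv f) x" for n x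
 note fd = smooth_has_deriv[OF f] smooth_has_deriv[OF smooth_deriv[OF f]]
 have e1: "deriv (\<phi> n) = p1 n" for n
  unfolding \<phi>_def[abs_def] p1_def[abs_def]
  by (rule ext, rule DERIV_imp_deriv) (auto intro!: derivative_eq_intros d0 fd)
 have e2: "deriv (deriv (\<phi> n)) = p2 n" for n
  unfolding e1 unfolding p1_def[abs_def] p2_def[abs_def]
  by (rule ext, rule DERIV_imp_deriv) (auto intro!: derivative_eq_intros d0 d1 fd)
 define C where "C = max (A0 * C0) (max (A1 * C0 + A0 * C1) (A2 * C0 + 2 * (A1 * C1) + A0 * C2))"
 have bb: "\<bar>x * y\<bar> <= (A * C) * W" if "abs x <= A" "abs y <= C * W" for x y A C W :: real
 proof -
  have "0 <= A" using that(1) abs_ge_zero order_trans by blast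
  then have "abs x * abs y <= A * (C * W)" using that by (intro mult_mono) auto
  then show ?thesis by (simp add: abs_mult mult.assoc)
 qed
 have tf: "\<phi> n \<in> test_fun" for n
 proof -
  have "c0 n \<in> test_fun"
  proof -
   have "smooth (c0 n)" unfolding c0_def[abs_def]
    by (intro smooth_compose[OF test_fun_smooth[OF ct(1)]] smooth_cmult smooth_ident)
   moreover obtain R where R: "!!x. abs x > R ==> cutoff x = 0" using ct(1) by (auto simp: test_fun_iff)
   moreover have "c0 n x = 0" if "abs x > R / s n" for x
    using that s(1)[of n] R[of "s n * x"] by (simp add: c0_def abs_mult field_simps)
   ultimately show ?thesis unfolding test_fun_iff by blast
  qed
  from test_fun_mult[OF f this] show ?thesis by (simp add: \<phi>_def[abs_def] mult.commute)
 qed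
 have B0: "abs (\<phi> n x) <= C * w x" for n x
 proof -
  have "abs (\<phi> n x) <= (A0 * C0) * w x" unfolding \<phi>_def by (rule bb[OF b0 w(1)])
  also have "\<dots> <= C * w x" using w(4)[of x] by (intro mult_right_mono) (auto simp: C_def)
  finally show ?thesis .
 qed
 have B1: "abs (p1 n x) <= C * w x" for n x
 proof -
  have "abs (p1 n x) <= (A1 * C0) * w x + (A0 * C1) * w x" unfolding p1_def
   by (intro order_trans[OF abs_triangle_ineq] add_mono bb b0 b1 w)
  also have "\<dots> = (A1 * C0 + A0 * C1) * w x" by (simp add: algebra_simps)
  also have "\<dots> <= C * w x" using w(4)[of x] by (intro mult_right_mono) (auto simp: C_def)
  finally show ?thesis .
 qed
 have B2: "abs (p2 n x) <= C * w x" for n x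
 proof -
  have "\<bar>2 * (c1 n x * deriv f x)\<bar> <= 2 * ((A1 * C1) * w x)" using bb[OF b1 w(2), of n x x] by (simp add: abs_mult)
  then have "abs (p2 n x) <= (A2 * C0) * w x + 2 * ((A1 * C1) * w x) + (A0 * C2) * w x" unfolding p2_def
   by (intro order_trans[OF abs_triangle_ineq] add_mono bb b0 b2 w)
  also have "\<dots> = (A2 * C0 + 2 * (A1 * C1) + A0 * C2) * w x" by (simp add: algebra_simps)
  also have "\<dots> <= C * w x" using w(4)[of x] by (intro mult_right_mono) (auto simp: C_def)
  finally show ?thesis .
 qed
 have L0: "(\<lambda>n. \<phi> n x) \<longlonglongrightarrow> f x" for x
  using tendsto_mult[OF l0 tendsto_const, of x "f x"] by (simp add: \<phi>_def)
 have L1: "(\<lambda>n. p1 n x) \<longlonglongrightarrow> deriv f x" for x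
  using tendsto_add[OF tendsto_mult[OF l1 tendsto_const, of x "f x"] tendsto_mult[OF l0 tendsto_const, of x "deriv f x"]]
  by (simp add: p1_def)
 have L2: "(\<lambda>n. p2 n x) \<longlonglongrightarrow> deriv (deriv f) x" for x
  using tendsto_add[OF tendsto_add[OF tendsto_mult[OF l2 tendsto_const, of x "f x"] 
    tendsto_mult[OF tendsto_const tendsto_mult[OF l1 tendsto_const, of x "deriv f x"], of 2]]
    tendsto_mult[OF l0 tendsto_const, of x "deriv (deriv f) x"]]
  by (simp add: p2_def)
 show ?thesis
  by (rule exI[of _ \<phi>], rule exI[of _ C]) (simp add: e1 e2[unfolded e1] tf B0 B1 B2 L0 L1 L2)
qed

text \<open>Dominated convergence along truncations of \<open>f\<close>: the majorant is a multiple
  of \<open>wt (- \<alpha>) \<delta>\<close> times \<open>p0\<close>, \<open>p1\<close> or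
  \<open>p2\<close>, integrable by the duality of opposite weights.\<close>

lemma extend_test_real:
 assumes p: "p0 \<in> L2w \<alpha>" "p1 \<in> L2w \<alpha>" "p2 \<in> L2w \<alpha>" and d: "\<delta> > 0"
  and t: "!!\<phi>. \<phi> \<in> test_fun ==> tint p0 \<phi> + tint p1 (deriv \<phi>)
   + tint p2 (deriv (deriv \<phi>)) = 0"
  and f: "smooth f" and w: "!!x. abs (f x) <= C0 * wt (- \<alpha>) \<delta> x" "!!x. abs (deriv f x) <= C1 * wt (- \<alpha>) \<delta> x"
  "!!x. \<bar>deriv (deriv f) x\<bar> <= C2 * wt (- \<alpha>) \<delta> x"
 shows "tint p0 f + tint p1 (deriv f)
   + tint p2 (deriv (deriv f)) = 0"
proof -
 obtain \<phi> :: "nat => real => real" and C where \<phi>: "!!n. \<phi> n \<in> test_fun"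
  "!!n x. abs (\<phi> n x) <= C * wt (- \<alpha>) \<delta> x" "!!n x. \<bar>deriv (\<phi> n) x\<bar> <= C * wt (- \<alpha>) \<delta> x"
  "!!n x. \<bar>deriv (deriv (\<phi> n)) x\<bar> <= C * wt (- \<alpha>) \<delta> x"
  "!!x. (\<lambda>n. \<phi> n x) \<longlonglongrightarrow> f x" "!!x. (\<lambda>n. deriv (\<phi> n) x) \<longlonglongrightarrow> deriv f x"
  "!!x. (\<lambda>n. deriv (deriv (\<phi> n)) x) \<longlonglongrightarrow> deriv (deriv f) x"
  using real_test_approx[OF f w wt_pos] by blast
 have lim: "(\<lambda>n. LINT x|lborel. p x * cx (g n x)) \<longlonglongrightarrow> (tint p h)"
  if pL: "p \<in> L2w \<alpha>" and g: "!!n. g n \<in> test_fun" "!!n x. abs (g n x) <= C * wt (- \<alpha>) \<delta> x" "!!x. (\<lambda>n. g n x) \<longlonglongrightarrow> h x" 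
   and h: "smooth h" for p g h
 proof (rule integral_dominated_convergence[where w = "\<lambda>x. norm (cx C * (p x * cx (wt (- \<alpha>) \<delta> x)))"])
  note [measurable] = L2w_measurable[OF pL] test_fun_measurable[OF g(1)]
  have [measurable]: "bmeas h"
   by (intro borel_measurable_continuous_onI smooth_continuous h)
  show "(\<lambda>x. p x * cx (h x)) \<in> borel_measurable lborel" by measurable
  show "(\<lambda>x. p x * cx (g n x)) \<in> borel_measurable lborel" for n by measurable
  show "intg (\<lambda>x. norm (cx C * (p x * cx (wt (- \<alpha>) \<delta> x))))"
   using L2w_prod_integrable[OF pL L2w_wt[OF d, of "-\<alpha>"]] by (intro integrable_norm) simp
  show "AE x in lborel. (\<lambda>n. p x * cx (g n x)) \<longlonglongrightarrow> p x * cx (h x)"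
   by (intro AE_I2 tendsto_intros g)
  show "AE x in lborel. norm (p x * cx (g n x)) <= norm (cx C * (p x * cx (wt (- \<alpha>) \<delta> x)))" for n
  proof (rule AE_I2)
   fix x
   have "norm (p x) * abs (g n x) <= norm (p x) * (abs C * \<bar>wt (- \<alpha>) \<delta> x\<bar>)"
    using g(2)[of n x] by (intro mult_left_mono) (simp_all flip: abs_mult)
   then show "norm (p x * cx (g n x)) <= norm (cx C * (p x * cx (wt (- \<alpha>) \<delta> x)))"
    by (simp add: norm_mult algebra_simps)
  qed
 qed
 have "(\<lambda>n. (tint p0 (\<phi> n)) + tint p1 (deriv (\<phi> n))
   + tint p2 (deriv (deriv (\<phi> n)))) \<longlonglongrightarrow>
  (tint p0 f) + tint p1 (deriv f)
   + tint p2 (deriv (deriv f))"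
  by (intro tendsto_add lim p \<phi> test_fun_deriv f smooth_deriv)
 then show ?thesis using t[OF \<phi>(1)] by (simp add: LIMSEQ_const_iff)
qed

text \<open>Splitting into real and imaginary parts passes from real to complex dual functions. This
  makes distributional identities usable with adjoint modes and with Green functions, which are not
  compactly supported.\<close>

lemma extend_test:
 assumes p: "p0 \<in> L2w \<alpha>" "p1 \<in> L2w \<alpha>" "p2 \<in> L2w \<alpha>" and d: "\<delta> > 0"
  and t: "!!\<phi>. \<phi> \<in> test_fun ==> tint p0 \<phi> + tint p1 (deriv \<phi>)
   + tint p2 (deriv (deriv \<phi>)) = 0"
  and D: "wsmooth (- \<alpha>) \<delta> D"
 shows "(LINT x|lborel. p0 x * D 0 x) + (LINT x|lborel. p1 x * D 1 x) + (LINT x|lborel. p2 x * D 2 x) = 0"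
proof -
 have dr: "deriv (\<lambda>x. Re (D n x)) = (\<lambda>x. Re (D (Suc n) x))" "deriv (\<lambda>x. Im (D n x)) = (\<lambda>x. Im (D (Suc n) x))" for n
  by (rule ext, rule DERIV_imp_deriv, simp add: has_real_derivative_iff_has_vector_derivative,
    rule bounded_linear.has_vector_derivative[OF bounded_linear_Re wsmooth_deriv[OF D]],
    rule ext, rule DERIV_imp_deriv, simp add: has_real_derivative_iff_has_vector_derivative,
    rule bounded_linear.has_vector_derivative[OF bounded_linear_Im wsmooth_deriv[OF D]])
 obtain C where C: "!!n x. norm (D n x) <= C n * wt (- \<alpha>) \<delta> x" using wsmooth_bound[OF D] by metis
 have re: "(LINT x|lborel. p0 x * cx (Re (D 0 x))) + (LINT x|lborel. p1 x * cx (Re (D 1 x)))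
   + (LINT x|lborel. p2 x * cx (Re (D 2 x))) = 0"
  using extend_test_real[OF p d t wsmooth_smooth_Re(1)[OF D, of 0], of "C 0" "C 1" "C 2"]
   order_trans[OF abs_Re_le_cmod C] by (simp add: dr numeral_2_eq_2)
 have im: "(LINT x|lborel. p0 x * cx (Im (D 0 x))) + (LINT x|lborel. p1 x * cx (Im (D 1 x)))
   + (LINT x|lborel. p2 x * cx (Im (D 2 x))) = 0"
  using extend_test_real[OF p d t wsmooth_smooth_Re(2)[OF D, of 0], of "C 0" "C 1" "C 2"]
   order_trans[OF abs_Im_le_cmod C] by (simp add: dr numeral_2_eq_2)
 have split: "(LINT x|lborel. q x * D n x) = (LINT x|lborel. q x * cx (Re (D n x))) + \<i> * (LINT x|lborel. q x * cx (Im (D n x)))"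
  if q: "q \<in> L2w \<alpha>" for q n
 proof -
  note [measurable] = wsmooth_measurable[OF D, of n]
  have "(\<lambda>x. cx (Re (D n x))) \<in> L2w (- \<alpha>)" "(\<lambda>x. cx (Im (D n x))) \<in> L2w (- \<alpha>)"
   by (rule L2w_bound[OF wsmooth_L2w[OF D d, of n], where C = 1]; simp add: abs_Re_le_cmod abs_Im_le_cmod)+
  then have i: "intg (\<lambda>x. q x * cx (Re (D n x)))" "intg (\<lambda>x. q x * cx (Im (D n x)))"
   by (auto intro: L2w_prod_integrable[OF q])
  have "(LINT x|lborel. q x * D n x) = (LINT x|lborel. q x * cx (Re (D n x)) + \<i> * (q x * cx (Im (D n x))))"
   by (intro Bochner_Integration.integral_cong refl, subst complex_eq[of "D n _"]) (simp add: algebra_simps)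
  also have "\<dots> = (LINT x|lborel. q x * cx (Re (D n x))) + \<i> * (LINT x|lborel. q x * cx (Im (D n x)))"
   using i by simp
  finally show ?thesis .
 qed
 have "(LINT x|lborel. p0 x * D 0 x) + (LINT x|lborel. p1 x * D 1 x) + (LINT x|lborel. p2 x * D 2 x) =
   ((LINT x|lborel. p0 x * cx (Re (D 0 x))) + (LINT x|lborel. p1 x * cx (Re (D 1 x)))
   + (LINT x|lborel. p2 x * cx (Re (D 2 x)))) + \<i> * ((LINT x|lborel. p0 x * cx (Im (D 0 x))) + (LINT x|lborel. p1 x * cx (Im (D 1 x)))
   + (LINT x|lborel. p2 x * cx (Im (D 2 x))))"
  by (simp only: split[OF p(1)] split[OF p(2)] split[OF p(3)]) (simp add: algebra_simps)
 then show ?thesis by (simp only: re im mult_zero_right add_0)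
qed

lemma weak_ibp:
 assumes "u \<in> L2w \<alpha>" "g \<in> L2w \<alpha>" "is_wderiv 1 u g" "wsmooth (- \<alpha>) \<delta> D" "\<delta> > 0"
 shows "(LINT x|lborel. g x * D n x) = - (LINT x|lborel. u x * D (Suc n) x)"
proof -
 have D: "wsmooth (- \<alpha>) \<delta> (\<lambda>j. D (n + j))" using assms(4) by (auto simp: wsmooth_def)
 have z: "(\<lambda>x. 0) \<in> L2w \<alpha>" by (simp add: L2w_def)
 have "(LINT x|lborel. g x * D (n + 0) x) + (LINT x|lborel. u x * D (n + 1) x) + (LINT x|lborel. 0 * D (n + 2) x) = 0"
  by (rule extend_test[OF assms(2,1) z assms(5) _ D])
   (use assms(3) in \<open>force simp: is_wderiv_iff minus_equation_iff add_eq_0_iff\<close>)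
 then show ?thesis by (simp add: add_eq_0_iff2)
qed

section \<open>The inverse of the elliptic operator\<close>

text \<open>Up to the factor \<open>1 / (2 * \<kappa>)\<close> this is the Green function of
  \<open>\<kappa>^2 - D^2\<close> on the line.\<close>

definition kG :: "real => real => real" where "kG \<kappa> t = exp (- \<kappa> * abs t)"

lemma kG_kdecay: "\<kappa> > abs \<alpha> ==> kdecay \<alpha> (kG \<kappa>)"
 unfolding kdecay_def kG_def[abs_def]
 by (intro conjI exI[of _ 1] exI[of _ \<kappa>] allI) simp_all

lemma kG_test_integrable:
 assumes k: "\<kappa> > 0" and h: "h \<in> test_fun"
 shows "intg (\<lambda>t. kG \<kappa> t * h (x - t))"
proof -
 note [measurable] = test_fun_measurable[OF h]
 have ki: "intg (kG \<kappa>)" using kdecay_integrable[OF kG_kdecay[of 0 \<kappa>]] k by simp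
 note [measurable] = borel_measurable_integrable[OF ki]
 obtain C where C: "C >= 0" "!!x. abs (h x) <= C" using test_fun_bounded[OF h] by blast
 have "intg (\<lambda>t. C * kG \<kappa> t)" using ki by simp
 then show ?thesis
 proof (rule Bochner_Integration.integrable_bound)
  show "AE t in lborel. norm (kG \<kappa> t * h (x - t)) <= norm (C * kG \<kappa> t)"
   using C by (intro AE_I2) (simp add: abs_mult kG_def)
 qed measurable
qed

lemma continuous_integrable_Icc:
 fixes g :: "real => real"
 assumes "!!t. isCont g t"
 shows "intg (\<lambda>t. g t * indicator {a..b} t)"
proof -
 have "intg (\<lambda>t. indicator {a..b} t *\<^sub>R g t)"
  by (rule borel_integrable_compact) (auto intro: continuous_at_imp_continuous_on assms)
 then show ?thesis by (simp only: real_scaleR_def mult.commute)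
qed

lemma test_fun_integrable:
 assumes f: "f \<in> test_fun" shows "intg f"
proof -
 obtain R where R: "!!x. abs x > R ==> f x = 0" using f by (auto simp: test_fun_iff)
 have e: "f x * indicator {-R..R} x = f x" for x
 proof (cases "abs x > R")
  case False
  then have "x \<in> {-R..R}" by auto
  then show ?thesis by simp
 qed (simp add: R)
 then show ?thesis using continuous_integrable_Icc[OF test_fun_isCont[OF f], of "-R" R] by (simp only: e)
qed

text \<open>Away from 0 the kernel solves the homogeneous equation; integration by parts on both
  sides of 0 leaves only the jump of its derivative there, the term
  \<open>2 * \<kappa> * \<psi> x\<close>. Cutting at a large \<open>R\<close> loses nothing because
  \<open>\<psi>\<close> has compact support.\<close>

lemma convl_kG:
 assumes k: "\<kappa> > 0" and p: "\<psi> \<in> test_fun"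
 shows "convl (kG \<kappa>) (deriv (deriv \<psi>)) x = \<kappa>\<^sup>2 * convl (kG \<kappa>) \<psi> x - 2 * \<kappa> * \<psi> x"
proof -
 note p1 = test_fun_deriv[OF p] and p2 = test_fun_deriv[OF test_fun_deriv[OF p]]
 obtain R0 where R0: "!!x. abs x > R0 ==> \<psi> x = 0" using p by (auto simp: test_fun_iff)
 obtain R1 where R1: "!!x. abs x > R1 ==> deriv \<psi> x = 0" using p1 by (auto simp: test_fun_iff)
 obtain R2 where R2: "!!x. abs x > R2 ==> deriv (deriv \<psi>) x = 0" using p2 by (auto simp: test_fun_iff)
 define R where "R = abs R0 + abs R1 + abs R2 + abs x + 1"
 have Rp: "R > 0" by (simp add: R_def)
 have z: "\<psi> (x - t) = 0" "deriv \<psi> (x - t) = 0" "deriv (deriv \<psi>) (x - t) = 0" if "abs t >= R" for t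
  using that R0[of "x - t"] R1[of "x - t"] R2[of "x - t"] by (auto simp: R_def)
 have chain: "((\<lambda>t. \<psi> (x - t)) has_real_derivative - deriv \<psi> (x - t)) (at t)"
  "((\<lambda>t. deriv \<psi> (x - t)) has_real_derivative - deriv (deriv \<psi>) (x - t)) (at t)" for t
 proof -
  have lin: "((\<lambda>t. x - t) has_real_derivative - 1) (at t)" by (auto intro!: derivative_eq_intros)
  show "((\<lambda>t. \<psi> (x - t)) has_real_derivative - deriv \<psi> (x - t)) (at t)"
   "((\<lambda>t. deriv \<psi> (x - t)) has_real_derivative - deriv (deriv \<psi>) (x - t)) (at t)"
   using DERIV_chain2[OF test_fun_has_deriv[OF p] lin] DERIV_chain2[OF test_fun_has_deriv[OF p1] lin] by simp_all
 qed
 define F where "F t = deriv (deriv \<psi>) (x - t) - \<kappa>\<^sup>2 * \<psi> (x - t)" for t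
 have Fc: "isCont F t" for t unfolding F_def[abs_def]
  by (intro continuous_intros isCont_o2[of t "\<lambda>t. x - t"]) (auto intro!: test_fun_isCont p p2)
 have I1: "(LINT t|lborel. (exp (- \<kappa> * t) * F t) * indicator {0..R} t) =
   exp (- \<kappa> * R) * (- deriv \<psi> (x - R) + \<kappa> * \<psi> (x - R)) - exp (- \<kappa> * 0) * (- deriv \<psi> (x - 0) + \<kappa> * \<psi> (x - 0))"
 proof (rule integral_FTC_Icc_real)
  show "((\<lambda>t. exp (- \<kappa> * t) * (- deriv \<psi> (x - t) + \<kappa> * \<psi> (x - t))) has_real_derivative exp (- \<kappa> * t) * F t) (at t)" for t
   by (rule derivative_eq_intros chain refl | simp add: F_def algebra_simps power2_eq_square)+
  show "isCont (\<lambda>t. exp (- \<kappa> * t) * F t) t" for t by (intro continuous_intros Fc)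
 qed (use Rp in simp)
 have I2: "(LINT t|lborel. (exp (\<kappa> * t) * F t) * indicator {-R..0} t) =
   exp (\<kappa> * 0) * (- deriv \<psi> (x - 0) - \<kappa> * \<psi> (x - 0)) - exp (\<kappa> * (-R)) * (- deriv \<psi> (x - (-R)) - \<kappa> * \<psi> (x - (-R)))"
 proof (rule integral_FTC_Icc_real)
  show "((\<lambda>t. exp (\<kappa> * t) * (- deriv \<psi> (x - t) - \<kappa> * \<psi> (x - t))) has_real_derivative exp (\<kappa> * t) * F t) (at t)" for t
   by (rule derivative_eq_intros chain refl | simp add: F_def algebra_simps power2_eq_square)+
  show "isCont (\<lambda>t. exp (\<kappa> * t) * F t) t" for t by (intro continuous_intros Fc)
 qed (use Rp in simp)
 have [measurable]: "bmeas F"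
  by (intro borel_measurable_continuous_onI continuous_at_imp_continuous_on ballI Fc)
 have i1: "intg (\<lambda>t. (exp (- \<kappa> * t) * F t) * indicator {0..R} t)"
  by (rule continuous_integrable_Icc) (intro continuous_intros Fc)
 have i2: "intg (\<lambda>t. (exp (\<kappa> * t) * F t) * indicator {-R..0} t)"
  by (rule continuous_integrable_Icc) (intro continuous_intros Fc)
 have "(LINT t|lborel. kG \<kappa> t * F t) = (LINT t|lborel. (exp (- \<kappa> * t) * F t) * indicator {0..R} t + (exp (\<kappa> * t) * F t) * indicator {-R..0} t)"
 proof (rule integral_cong_AE)
  show "AE t in lborel. kG \<kappa> t * F t = (exp (- \<kappa> * t) * F t) * indicator {0..R} t + (exp (\<kappa> * t) * F t) * indicator {-R..0} t"
   using AE_lborel_singleton[of 0]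
  proof eventually_elim
   case (elim t)
   have "F t = 0" if "abs t >= R" using z[OF that] by (simp add: F_def)
   then show ?case using elim Rp by (cases "abs t >= R"; cases "t > 0") (auto simp: kG_def indicator_def)
  qed
 qed (auto simp: kG_def[abs_def])
 also have "\<dots> = - 2 * \<kappa> * \<psi> x"
  using z[of R] z[of "-R"] Rp i1 i2 by (subst Bochner_Integration.integral_add) (simp_all add: I1[simplified] I2[simplified])
 finally have eq: "(LINT t|lborel. kG \<kappa> t * F t) = - 2 * \<kappa> * \<psi> x" .
 note kf = kG_test_integrable[OF k]
 have "(LINT t|lborel. kG \<kappa> t * F t) = (LINT t|lborel. kG \<kappa> t * deriv (deriv \<psi>) (x - t) - \<kappa>\<^sup>2 * (kG \<kappa> t * \<psi> (x - t)))"
  by (intro Bochner_Integration.integral_cong refl) (simp add: F_def algebra_simps)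
 also have "\<dots> = convl (kG \<kappa>) (deriv (deriv \<psi>)) x - \<kappa>\<^sup>2 * convl (kG \<kappa>) \<psi> x"
  using kf[OF p] kf[OF p2] by (simp add: convl_def)
 finally show ?thesis using eq by simp
qed

text \<open>The convolution inherits the decay \<open>exp (- \<kappa> * abs x)\<close> of the
  kernel, and the surplus \<open>\<kappa> - abs \<alpha>\<close> over the weight makes it an
  admissible dual function in the uniqueness proof for the elliptic operator.\<close>

lemma wsmooth_convl_kG:
 assumes k: "\<kappa> > abs \<alpha>" and p: "\<psi> \<in> test_fun"
 shows "wsmooth (- \<alpha>) (\<kappa> - abs \<alpha>) (\<lambda>n x. cx (convl (kG \<kappa>) ((deriv ^^ n) \<psi>) x))"
proof -
 have ki: "intg (kG \<kappa>)" using kdecay_integrable[OF kG_kdecay[OF k]] .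
 have b: "\<exists>C. \<forall>x. \<bar>convl (kG \<kappa>) f x\<bar> <= C * wt (- \<alpha>) (\<kappa> - abs \<alpha>) x" if f: "f \<in> test_fun" for f
 proof -
  note [measurable] = test_fun_measurable[OF f]
  obtain R where R: "!!x. abs x > R ==> f x = 0" using f by (auto simp: test_fun_iff)
  have i: "intg (\<lambda>x. abs (f x))" using test_fun_integrable[OF f] by simp
  define C where "C = exp (\<kappa> * R) * (LINT x|lborel. abs (f x))"
  have "\<bar>convl (kG \<kappa>) f x\<bar> <= C * wt (- \<alpha>) (\<kappa> - abs \<alpha>) x" for x
  proof -
   have iis: "has_bochner_integral lborel (\<lambda>t. \<bar>f (x - t)\<bar>) (LINT x|lborel. abs (f x))"
    using lborel_has_bochner_integral_real_affine_iff[of "-1" "\<lambda>x. abs (f x)" "LINT x|lborel. abs (f x)" x] i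
    by (simp add: has_bochner_integral_iff)
   have "norm (convl (kG \<kappa>) f x) <= (LINT t|lborel. (exp (- \<kappa> * abs x) * exp (\<kappa> * R)) * \<bar>f (x - t)\<bar>)"
    unfolding convl_def
   proof (rule order_trans[OF Bochner_Integration.integral_norm_bound], rule integral_mono)
    show "intg (\<lambda>t. (exp (- \<kappa> * abs x) * exp (\<kappa> * R)) * \<bar>f (x - t)\<bar>)"
     using iis by (auto simp: has_bochner_integral_iff)
    have *: "\<bar>kG \<kappa> t * f (x - t)\<bar> <= (exp (- \<kappa> * abs x) * exp (\<kappa> * R)) * \<bar>f (x - t)\<bar>" for t
    proof (cases "\<bar>x - t\<bar> > R")
     case False
     then have "\<kappa> * abs x <= \<kappa> * (abs t + R)" using k by (intro mult_left_mono) auto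
     then have "kG \<kappa> t <= exp (- \<kappa> * abs x) * exp (\<kappa> * R)"
      by (simp add: kG_def distrib_left flip: exp_add)
     then show ?thesis by (simp add: abs_mult mult_right_mono kG_def)
    qed (use R in simp)
    then show "norm (kG \<kappa> t * f (x - t)) <= (exp (- \<kappa> * abs x) * exp (\<kappa> * R)) * \<bar>f (x - t)\<bar>" for t by simp
    show "intg (\<lambda>t. norm (kG \<kappa> t * f (x - t)))"
     by (rule integrable_norm, rule Bochner_Integration.integrable_bound[where f = "\<lambda>t. (exp (- \<kappa> * abs x) * exp (\<kappa> * R)) * \<bar>f (x - t)\<bar>"])
      (use iis * in \<open>auto simp: has_bochner_integral_iff kG_def[abs_def]\<close>)
   qed
   also have "\<dots> = C * exp (- \<kappa> * abs x)"
    using has_bochner_integral_integral_eq[OF iis] by (simp add: C_def)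
   also have "\<dots> <= C * wt (- \<alpha>) (\<kappa> - abs \<alpha>) x"
   proof (rule mult_left_mono)
    have "\<bar>\<alpha> * x\<bar> = abs \<alpha> * abs x" by (rule abs_mult)
    then show "exp (- \<kappa> * abs x) <= wt (- \<alpha>) (\<kappa> - abs \<alpha>) x"
     by (simp add: wt_def left_diff_distrib)
   qed (simp add: C_def)
   finally show ?thesis by (simp only: real_norm_def)
  qed
  then show ?thesis by blast
 qed
 show ?thesis unfolding wsmooth_def
 proof (intro conjI allI)
  show "((\<lambda>x. cx (convl (kG \<kappa>) ((deriv ^^ n) \<psi>) x)) has_vector_derivative
   cx (convl (kG \<kappa>) ((deriv ^^ Suc n) \<psi>) x)) (at x)" for n x
   using convl_deriv[OF ki test_fun_deriv_n[OF p, of n], of x]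
   by (simp add: has_vector_derivative_of_real flip: has_real_derivative_iff_has_vector_derivative)
  show "\<exists>C. \<forall>x. norm (cx (convl (kG \<kappa>) ((deriv ^^ n) \<psi>) x)) <= C * wt (- \<alpha>) (\<kappa> - abs \<alpha>) x" for n
   using b[OF test_fun_deriv_n[OF p, of n]] by simp
 qed
qed

lemma convl_B:
 assumes k: "\<kappa> > 0" and p: "\<psi> \<in> test_fun" and b: "b * \<kappa>\<^sup>2 = e"
 shows "convl (kG \<kappa>) (\<lambda>x. e * \<psi> x - b * deriv (deriv \<psi>) x) x = 2 * b * \<kappa> * \<psi> x"
  and "e * convl (kG \<kappa>) \<psi> x - b * convl (kG \<kappa>) (deriv (deriv \<psi>)) x = 2 * b * \<kappa> * \<psi> x"
proof -
 note kf = kG_test_integrable[OF k]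
 show 2: "e * convl (kG \<kappa>) \<psi> x - b * convl (kG \<kappa>) (deriv (deriv \<psi>)) x = 2 * b * \<kappa> * \<psi> x"
  unfolding convl_kG[OF k p] b[symmetric] by (simp add: algebra_simps)
 have "convl (kG \<kappa>) (\<lambda>x. e * \<psi> x - b * deriv (deriv \<psi>) x) x =
  (LINT t|lborel. e * (kG \<kappa> t * \<psi> (x - t)) - b * (kG \<kappa> t * deriv (deriv \<psi>) (x - t)))"
  unfolding convl_def by (intro Bochner_Integration.integral_cong refl) (simp add: algebra_simps)
 also have "\<dots> = e * convl (kG \<kappa>) \<psi> x - b * convl (kG \<kappa>) (deriv (deriv \<psi>)) x"
  using kf[OF p] kf[OF test_fun_deriv[OF test_fun_deriv[OF p]]] by (simp add: convl_def)
 finally show "convl (kG \<kappa>) (\<lambda>x. e * \<psi> x - b * deriv (deriv \<psi>) x) x = 2 * b * \<kappa> * \<psi> x"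
  using 2 by simp
qed

definition tst :: "(real => complex) => (real => real) => complex" where
 "tst g \<phi> = tint g \<phi>"

lemma distr_of_eq_tst: "distr_of = tst"
 by (auto simp: fun_eq_iff distr_of_def tst_def)

lemma tst_lin:
 assumes "g \<in> L2w \<alpha>" "\<phi> \<in> test_fun" "\<psi> \<in> test_fun"
 shows "tst g (\<lambda>x. e * \<phi> x - b * \<psi> x) = cx e * tst g \<phi> - cx b * tst g \<psi>"
proof -
 have "tst g (\<lambda>x. e * \<phi> x - b * \<psi> x) = (LINT x|lborel. cx e * (g x * cx (\<phi> x)) - cx b * (g x * cx (\<psi> x)))"
  unfolding tst_def by (intro Bochner_Integration.integral_cong refl) (simp add: algebra_simps)
 then show ?thesis
  using L1loc_integrable_test[OF L2w_L1loc[OF assms(1)] assms(2)] L1loc_integrable_test[OF L2w_L1loc[OF assms(1)] assms(3)]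
  by (simp add: tst_def)
qed

lemma tst_add:
 assumes "f \<in> L2w \<alpha>" "g \<in> L2w \<alpha>" "\<phi> \<in> test_fun"
 shows "tst (\<lambda>x. s * f x + r * g x) \<phi> = s * tst f \<phi> + r * tst g \<phi>"
proof -
 have "tst (\<lambda>x. s * f x + r * g x) \<phi> = (LINT x|lborel. s * (f x * cx (\<phi> x)) + r * (g x * cx (\<phi> x)))"
  unfolding tst_def by (intro Bochner_Integration.integral_cong refl) (simp add: algebra_simps)
 then show ?thesis
  using L1loc_integrable_test[OF L2w_L1loc[OF assms(1)] assms(3)] L1loc_integrable_test[OF L2w_L1loc[OF assms(2)] assms(3)]
  by (simp add: tst_def)
qed

lemma ellip_tst: "ellip b \<eta> (tst g) \<phi> = cx (1 + b * \<eta>\<^sup>2) * tst g \<phi> - cx b * tst g (deriv (deriv \<phi>))"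
 by (simp add: ellip_def ddz_def)

text \<open>With \<open>b * \<kappa>^2 = 1 + b * \<eta>^2\<close> the operator is
  \<open>b * (\<kappa>^2 - D^2)\<close>, and \<open>\<kappa> >= sqrt (1 / b) > abs \<alpha>\<close>
  makes convolution with its Green function act on \<open>L2w \<alpha>\<close>. The equation is
  checked by moving the convolution onto the test function.\<close>

lemma ellip_inverse_exists:
 assumes f: "f \<in> L2w \<alpha>" and b: "b > 0" and k: "abs \<alpha> < sqrt (1 / b)"
 shows "\<exists>g\<in>L2w \<alpha>. \<forall>\<phi>\<in>test_fun. ellip b \<eta> (tst g) \<phi> = tst f \<phi>"
proof -
 define \<kappa> where "\<kappa> = sqrt ((1 + b * \<eta>\<^sup>2) / b)"
 have bk: "b * \<kappa>\<^sup>2 = 1 + b * \<eta>\<^sup>2" using b by (simp add: \<kappa>_def add_nonneg_nonneg)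
 have "sqrt (1 / b) <= \<kappa>" unfolding \<kappa>_def using b by (intro real_sqrt_le_mono divide_right_mono) auto
 then have \<kappa>: "\<kappa> > abs \<alpha>" using k by linarith
 then have k0: "\<kappa> > 0" by linarith
 note kd = kG_kdecay[OF \<kappa>]
 define g where "g x = cx (1 / (2 * b * \<kappa>)) * convr (kG \<kappa>) f x" for x
 have g: "g \<in> L2w \<alpha>" unfolding g_def[abs_def] by (intro L2w_cmult convr_L2w kd f)
 have "ellip b \<eta> (tst g) \<phi> = tst f \<phi>" if p: "\<phi> \<in> test_fun" for \<phi>
 proof -
  define B where "B x = (1 + b * \<eta>\<^sup>2) * \<phi> x - b * deriv (deriv \<phi>) x" for x
  have Bt: "B \<in> test_fun" unfolding B_def[abs_def] by (intro test_fun_diff test_fun_cmult test_fun_deriv p)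
  have "ellip b \<eta> (tst g) \<phi> = tst g B"
   unfolding ellip_tst B_def[abs_def] by (rule tst_lin[OF g p test_fun_deriv[OF test_fun_deriv[OF p]], symmetric])
  also have "\<dots> = cx (1 / (2 * b * \<kappa>)) * (LINT x|lborel. convr (kG \<kappa>) f x * cx (B x))"
   by (simp add: tst_def g_def mult.assoc del: of_real_divide)
  also have "\<dots> = cx (1 / (2 * b * \<kappa>)) * tint f (convl (kG \<kappa>) B)"
   using conv_adj[OF kd f L2w_test[OF Bt]] by (simp add: convl_def flip: of_real_mult)
  also have "\<dots> = cx (1 / (2 * b * \<kappa>)) * (LINT y|lborel. f y * cx (2 * b * \<kappa> * \<phi> y))"
   using convl_B(1)[OF k0 p bk] by (simp add: B_def[abs_def])
  also have "\<dots> = cx (1 / (2 * b * \<kappa>)) * (LINT y|lborel. cx (2 * b * \<kappa>) * (f y * cx (\<phi> y)))"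
   by (simp add: ac_simps)
  also have "\<dots> = tst f \<phi>" using b k0 by (simp add: tst_def)
  finally show ?thesis .
 qed
 with g show ?thesis by blast
qed

text \<open>Testing the equation with the Green function convolved with an arbitrary
  \<open>\<psi>\<close> returns the integral of \<open>g\<close> against \<open>\<psi>\<close>. That
  dual function has no compact support, hence the use of \<open>extend_test\<close>.\<close>

lemma ellip_inverse_unique:
 assumes g: "g \<in> L2w \<alpha>" and b: "b > 0" and k: "abs \<alpha> < sqrt (1 / b)"
  and z: "!!\<phi>. \<phi> \<in> test_fun ==> ellip b \<eta> (tst g) \<phi> = 0"
 shows "AE x in lborel. g x = 0"
proof (rule AE_zero_of_test[OF L2w_L1loc[OF g]])
 fix \<psi> assume p: "\<psi> \<in> test_fun"
 define \<kappa> where "\<kappa> = sqrt ((1 + b * \<eta>\<^sup>2) / b)"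
 have bk: "b * \<kappa>\<^sup>2 = 1 + b * \<eta>\<^sup>2" using b by (simp add: \<kappa>_def add_nonneg_nonneg)
 have "sqrt (1 / b) <= \<kappa>" unfolding \<kappa>_def using b by (intro real_sqrt_le_mono divide_right_mono) auto
 then have \<kappa>: "\<kappa> > abs \<alpha>" using k by linarith
 then have k0: "\<kappa> > 0" and d: "\<kappa> - abs \<alpha> > 0" by linarith+
 let ?D = "\<lambda>n x. cx (convl (kG \<kappa>) ((deriv ^^ n) \<psi>) x)"
 have D: "wsmooth (- \<alpha>) (\<kappa> - abs \<alpha>) ?D" by (rule wsmooth_convl_kG[OF \<kappa> p])
 define e where "e = cx (1 + b * \<eta>\<^sup>2)"
 have z0: "(\<lambda>x. 0) \<in> L2w \<alpha>" by (simp add: L2w_def)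
 have "(LINT x|lborel. (e * g x) * ?D 0 x) + (LINT x|lborel. 0 * ?D 1 x) + (LINT x|lborel. (- cx b * g x) * ?D 2 x) = 0"
 proof (rule extend_test[OF _ z0 _ d _ D])
  show "(\<lambda>x. e * g x) \<in> L2w \<alpha>" "(\<lambda>x. - cx b * g x) \<in> L2w \<alpha>" by (intro L2w_cmult g)+
  fix \<phi> assume "\<phi> \<in> test_fun"
  from z[OF this] show "(LINT x|lborel. e * g x * cx (\<phi> x)) + (LINT x|lborel. 0 * cx (deriv \<phi> x)) +
    (LINT x|lborel. - cx b * g x * cx (deriv (deriv \<phi>) x)) = 0"
   by (simp add: ellip_tst tst_def e_def mult.assoc)
 qed
 then have "(LINT x|lborel. e * (g x * ?D 0 x)) - (LINT x|lborel. cx b * (g x * ?D 2 x)) = 0"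
  by (simp add: mult.assoc)
 moreover have i: "intg (\<lambda>x. g x * ?D n x)" for n
  by (rule L2w_prod_integrable[OF g wsmooth_L2w[OF D d]])
 ultimately have "(LINT x|lborel. e * (g x * ?D 0 x) - cx b * (g x * ?D 2 x)) = 0"
  using i[of 0] i[of 2] by simp
 moreover have "e * (g x * ?D 0 x) - cx b * (g x * ?D 2 x) = cx (2 * b * \<kappa>) * (g x * cx (\<psi> x))" for x
 proof -
  have "e * ?D 0 x - cx b * ?D 2 x = cx (2 * b * \<kappa> * \<psi> x)"
   using convl_B(2)[OF k0 p bk, of x, symmetric] by (simp add: e_def numeral_2_eq_2)
  then have "g x * (e * ?D 0 x - cx b * ?D 2 x) = g x * cx (2 * b * \<kappa> * \<psi> x)" by (rule arg_cong)
  then show ?thesis by (simp add: algebra_simps)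
 qed
 ultimately show "tint g \<psi> = 0" using b k0 by simp
qed

text \<open>The datum may have order 2, so convolution does not apply to it directly. The identity
  \<open>A(\<eta>) = (a/b) * B(\<eta>) + (1 - a/b)\<close> peels off \<open>(a/b) * f\<close> and
  leaves a right-hand side in \<open>L2w \<alpha>\<close>.\<close>

lemma Binv_spec:
 assumes f: "f \<in> L2w \<alpha>" "f2 \<in> L2w \<alpha>" and b: "b > 0" and k: "abs \<alpha> < sqrt (1 / b)"
  and T: "!!\<phi>. \<phi> \<in> test_fun ==> T \<phi> = ellip a \<eta> (tst f) \<phi> + tst f2 \<phi>"
 shows "Binv b \<alpha> \<eta> T \<in> L2w \<alpha>" "!!\<phi>. \<phi> \<in> test_fun ==> ellip b \<eta> (tst (Binv b \<alpha> \<eta> T)) \<phi> = T \<phi>"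
proof -
 define s where "s = cx (a / b)"
 have "(\<lambda>x. (1 - s) * f x + 1 * f2 x) \<in> L2w \<alpha>" by (intro L2w_add L2w_cmult f)
 from ellip_inverse_exists[OF this b k, of \<eta>] obtain h where h: "h \<in> L2w \<alpha>"
  "!!\<phi>. \<phi> \<in> test_fun ==> ellip b \<eta> (tst h) \<phi> = tst (\<lambda>x. (1 - s) * f x + 1 * f2 x) \<phi>" by blast
 define g where "g x = s * f x + 1 * h x" for x
 have "g \<in> L2w \<alpha> \<and> distr_eq (ellip b \<eta> (distr_of g)) T"
 proof
  show "g \<in> L2w \<alpha>" unfolding g_def[abs_def] by (intro L2w_add L2w_cmult f h)
  show "distr_eq (ellip b \<eta> (distr_of g)) T" unfolding distr_eq_def distr_of_eq_tst
  proof
   fix \<phi> assume p: "\<phi> \<in> test_fun"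
   note p2 = test_fun_deriv[OF test_fun_deriv[OF p]]
   have "ellip b \<eta> (tst g) \<phi> = s * ellip b \<eta> (tst f) \<phi> + ellip b \<eta> (tst h) \<phi>"
    unfolding ellip_tst g_def[abs_def] tst_add[OF f(1) h(1) p] tst_add[OF f(1) h(1) p2] by (simp add: algebra_simps)
   also have "\<dots> = s * ellip b \<eta> (tst f) \<phi> + ((1 - s) * tst f \<phi> + tst f2 \<phi>)"
    using h(2)[OF p] tst_add[OF f p, of "1 - s" 1] by simp
   also have "\<dots> = ellip a \<eta> (tst f) \<phi> + tst f2 \<phi>"
   proof -
    have "cx a = s * cx b" using b by (simp add: s_def)
    then show ?thesis unfolding ellip_tst by (simp add: algebra_simps)
   qed
   finally show "ellip b \<eta> (tst g) \<phi> = T \<phi>" by (simp only: T[OF p])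
  qed
 qed
 then have "Binv b \<alpha> \<eta> T \<in> L2w \<alpha> \<and> distr_eq (ellip b \<eta> (distr_of (Binv b \<alpha> \<eta> T))) T"
  unfolding Binv_def by (rule someI[where P = "\<lambda>g. g \<in> L2w \<alpha> \<and> distr_eq (ellip b \<eta> (distr_of g)) T"])
 then show "Binv b \<alpha> \<eta> T \<in> L2w \<alpha>" "!!\<phi>. \<phi> \<in> test_fun ==> ellip b \<eta> (tst (Binv b \<alpha> \<eta> T)) \<phi> = T \<phi>"
  by (auto simp: distr_eq_def distr_of_eq_tst)
qed

section \<open>Classical and weak derivatives of weighted smooth functions\<close>

lemma wsmooth_shift: "wsmooth \<beta> \<delta> D ==> wsmooth \<beta> \<delta> (\<lambda>n. D (n + j))"
 by (auto simp: wsmooth_def)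

lemma wsmooth_add:
 assumes "wsmooth \<beta> \<delta> D" "wsmooth \<beta> \<delta> E"
 shows "wsmooth \<beta> \<delta> (\<lambda>n x. s * D n x + r * E n x)"
 unfolding wsmooth_def
proof (intro conjI allI)
 show "((\<lambda>x. s * D n x + r * E n x) has_vector_derivative s * D (Suc n) x + r * E (Suc n) x) (at x)" for n x
  using wsmooth_deriv[OF assms(1), of n x] wsmooth_deriv[OF assms(2), of n x]
  by (auto intro!: derivative_eq_intros)
 fix n
 obtain C where C: "!!x. norm (D n x) <= C * wt \<beta> \<delta> x" using wsmooth_bound[OF assms(1)] by blast
 obtain C' where C': "!!x. norm (E n x) <= C' * wt \<beta> \<delta> x" using wsmooth_bound[OF assms(2)] by blast
 have "norm (s * D n x + r * E n x) <= (norm s * C + norm r * C') * wt \<beta> \<delta> x" for x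
 proof -
  have "norm (s * D n x + r * E n x) <= norm s * norm (D n x) + norm r * norm (E n x)"
   by (metis norm_mult norm_triangle_ineq)
  also have "\<dots> <= norm s * (C * wt \<beta> \<delta> x) + norm r * (C' * wt \<beta> \<delta> x)"
   by (intro add_mono mult_left_mono C C') auto
  finally show ?thesis by (simp add: algebra_simps)
 qed
 then show "\<exists>C. \<forall>x. norm (s * D n x + r * E n x) <= C * wt \<beta> \<delta> x" by blast
qed

lemma wsmooth_chain_exists:
 assumes "P f" and "!!f. P f ==> (\<exists>C. \<forall>x. norm (f x) <= C * wt \<beta> \<delta> x) \<and> (\<exists>f'. P f' \<and> (\<forall>x. (f has_vector_derivative f' x) (at x)))"
 shows "\<exists>D. D 0 = f \<and> wsmooth \<beta> \<delta> D"
proof -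
 define next' where "next' f = (SOME f'. P f' \<and> (\<forall>x. (f has_vector_derivative f' x) (at x)))" for f :: "real => complex"
 have nx: "P (next' f) \<and> (\<forall>x. (f has_vector_derivative next' f x) (at x))" if "P f" for f
  unfolding next'_def using someI_ex[of "\<lambda>f'. P f' \<and> (\<forall>x. (f has_vector_derivative f' x) (at x))"] assms(2)[OF that] by blast
 define D where "D n = (next' ^^ n) f" for n
 have "P (D n)" for n by (induction n) (use assms(1) nx in \<open>auto simp: D_def\<close>)
 then show ?thesis using nx assms(2)
  by (intro exI[of _ D]) (simp add: wsmooth_def D_def)
qed

definition bsmooth :: "(nat => real => real) => bool" where
 "bsmooth M \<longleftrightarrow> (\<forall>n x. (M n has_real_derivative M (Suc n) x) (at x)) \<and> (\<forall>n. \<exists>C. \<forall>x. abs (M n x) <= C)"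

text \<open>Finite sums of products of derivatives are closed under differentiation, which replaces
  the Leibniz formula for the derivatives of a product.\<close>

inductive prod_span :: "(nat => real => real) => (nat => real => complex) => (real => complex) => bool"
 for M D where
 "prod_span M D (\<lambda>x. cx (M i x) * D j x)"
| "prod_span M D f ==> prod_span M D g ==> prod_span M D (\<lambda>x. f x + g x)"

lemma has_vector_derivative_of_real':
 "(f has_real_derivative d) (at x) ==> ((\<lambda>x. cx (f x)) has_vector_derivative cx d) (at x)"
 by (simp add: has_vector_derivative_of_real flip: has_real_derivative_iff_has_vector_derivative)

lemma wsmooth_mult:
 assumes M: "bsmooth M" and D: "wsmooth \<beta> \<delta> D"
 shows "\<exists>E. E 0 = (\<lambda>x. cx (M 0 x) * D 0 x) \<and> wsmooth \<beta> \<delta> E"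
proof (rule wsmooth_chain_exists[where P = "prod_span M D"])
 show "prod_span M D (\<lambda>x. cx (M 0 x) * D 0 x)" by (rule prod_span.intros)
 fix f assume "prod_span M D f"
 then show "(\<exists>C. \<forall>x. norm (f x) <= C * wt \<beta> \<delta> x) \<and> (\<exists>f'. prod_span M D f' \<and> (\<forall>x. (f has_vector_derivative f' x) (at x)))"
 proof induction
  case (1 i j)
  obtain C where C: "!!x. abs (M i x) <= C" using M unfolding bsmooth_def by blast
  obtain C' where C': "!!x. norm (D j x) <= C' * wt \<beta> \<delta> x" using wsmooth_bound[OF D] by blast
  have "norm (cx (M i x) * D j x) <= (C * C') * wt \<beta> \<delta> x" for x
   using mult_mono[OF C C', of x x] order_trans[OF abs_ge_zero C] by (simp add: norm_mult mult.assoc)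
  moreover have "prod_span M D (\<lambda>x. cx (M (Suc i) x) * D j x + cx (M i x) * D (Suc j) x)"
   by (intro prod_span.intros)
  moreover have "((\<lambda>x. cx (M i x) * D j x) has_vector_derivative
   (cx (M (Suc i) x) * D j x + cx (M i x) * D (Suc j) x)) (at x)" for x
   using has_vector_derivative_mult[OF has_vector_derivative_of_real'[of "M i" "M (Suc i) x" x] wsmooth_deriv[OF D, of j x]] M
   by (simp add: bsmooth_def add.commute)
  ultimately show ?case by blast
 next
  case (2 f g)
  then obtain C C' f' g' where *: "!!x. norm (f x) <= C * wt \<beta> \<delta> x" "!!x. norm (g x) <= C' * wt \<beta> \<delta> x"
   "prod_span M D f'" "!!x. (f has_vector_derivative f' x) (at x)" "prod_span M D g'" "!!x. (g has_vector_derivative g' x) (at x)"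
   by blast
  have "norm (f x + g x) <= (C + C') * wt \<beta> \<delta> x" for x
   using order_trans[OF norm_triangle_ineq add_mono[OF *(1) *(2)], of x x] by (simp add: algebra_simps)
  moreover have "prod_span M D (\<lambda>x. f' x + g' x)" using * by (intro prod_span.intros)
  moreover have "((\<lambda>x. f x + g x) has_vector_derivative f' x + g' x) (at x)" for x
   by (intro has_vector_derivative_add *)
  ultimately show ?case by blast
 qed
qed

lemma wsmooth_ibp_test:
 assumes D: "wsmooth \<beta> \<delta> D" "\<delta> > 0" and p: "\<phi> \<in> test_fun"
 shows "tst (D n) (deriv \<phi>) = - tst (D (Suc n)) \<phi>"
proof -
 note pd = test_fun_deriv[OF p]
 obtain R0 where R0: "!!x. abs x > R0 ==> \<phi> x = 0" using p by (auto simp: test_fun_iff)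
 obtain R1 where R1: "!!x. abs x > R1 ==> deriv \<phi> x = 0" using pd by (auto simp: test_fun_iff)
 define R where "R = abs R0 + abs R1 + 1"
 define F where "F x = D (Suc n) x * cx (\<phi> x) + D n x * cx (deriv \<phi> x)" for x
 have z: "\<phi> x = 0" "deriv \<phi> x = 0" if "abs x >= R" for x
  using that R0[of x] R1[of x] by (auto simp: R_def)
 have c: "continuous_on A (D n)" for n A
  by (rule continuous_at_imp_continuous_on) (blast intro: has_vector_derivative_continuous wsmooth_deriv[OF D(1)])
 have cp: "continuous_on A \<phi>" "continuous_on A (deriv \<phi>)" for A
  by (intro smooth_continuous test_fun_smooth p pd)+
 have der: "((\<lambda>x. D n x * cx (\<phi> x)) has_vector_derivative F x) (at x within S)" for x S
  by (rule has_vector_derivative_at_within)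
   (use has_vector_derivative_mult[OF wsmooth_deriv[OF D(1), of n x] has_vector_derivative_of_real'[OF test_fun_has_deriv[OF p, of x]]]
    in \<open>simp add: F_def add.commute\<close>)
 have Fc: "continuous_on A F" for A
  unfolding F_def[abs_def] by (intro continuous_on_add continuous_on_mult continuous_on_of_real c cp)
 have "(LINT x|lborel. indicator {-R..R} x *\<^sub>R F x) = D n R * cx (\<phi> R) - D n (-R) * cx (\<phi> (-R))"
 proof (rule integral_FTC_Icc)
  show "-R <= R" by (simp add: R_def)
  show "continuous_on {-R..R} F" by (rule Fc)
 qed (rule der)
 moreover have "indicator {-R..R} x *\<^sub>R F x = F x" for x
 proof (cases "x \<in> {-R..R}")
  case False
  then have "abs x >= R" by auto
  then show ?thesis using z by (simp add: F_def)
 qed simp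
 moreover have "\<phi> R = 0" "\<phi> (-R) = 0" by (auto intro!: z)
 ultimately have "(LINT x|lborel. F x) = 0" by simp
 moreover have "(LINT x|lborel. F x) = tst (D (Suc n)) \<phi> + tst (D n) (deriv \<phi>)"
  unfolding F_def tst_def
  by (intro Bochner_Integration.integral_add L1loc_integrable_test[OF L2w_L1loc[OF wsmooth_L2w[OF D]]] p pd)
 ultimately show ?thesis by (simp add: eq_neg_iff_add_eq_0 add.commute)
qed

lemma wsmooth_is_wderiv:
 assumes D: "wsmooth \<beta> \<delta> D" "\<delta> > 0"
 shows "is_wderiv j (D n) (D (n + j))"
proof -
 have "(-1) ^ j * tst (D n) ((deriv ^^ j) \<phi>) = tst (D (n + j)) \<phi>" if "\<phi> \<in> test_fun" for \<phi>
  using that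
 proof (induction j arbitrary: \<phi>)
  case (Suc j)
  have "(-1) ^ Suc j * tst (D n) ((deriv ^^ Suc j) \<phi>) = - ((-1) ^ j * tst (D n) ((deriv ^^ j) (deriv \<phi>)))"
   by (simp add: funpow_swap1)
  also have "\<dots> = - tst (D (n + j)) (deriv \<phi>)" using Suc.IH[OF test_fun_deriv[OF Suc.prems]] by simp
  also have "\<dots> = tst (D (n + Suc j)) \<phi>" using wsmooth_ibp_test[OF D Suc.prems, of "n + j"] by simp
  finally show ?case .
 qed simp
 then show ?thesis by (simp add: is_wderiv_iff tst_def)
qed

lemma wsmooth_Hw: "wsmooth \<beta> \<delta> D ==> \<delta> > 0 ==> D 0 \<in> Hw k \<beta>"
 using wsmooth_is_wderiv[of \<beta> \<delta> D k 0] wsmooth_L2w[of \<beta> \<delta> D]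
 by (auto simp: Hw_def)

lemma wsmooth_HHw:
 assumes "wsmooth \<beta> \<delta> D" "wsmooth \<beta> \<delta> E" "\<delta> > 0"
 shows "(\<lambda>z. (D 0 z, E 0 z)) \<in> HHw k \<beta>"
 using wsmooth_Hw assms by (auto simp: HHw_def)

lemma wsmooth_wderiv:
 assumes D: "wsmooth \<beta> \<delta> D" "\<delta> > 0"
 shows "AE x in lborel. wderiv j (D n) x = D (n + j) x"
 by (rule wderiv_AE(3)[OF L2w_L1loc[OF wsmooth_L2w[OF D]] wsmooth_is_wderiv[OF D]])

lemma Hw_norm_wsmooth:
 assumes D: "wsmooth \<beta> \<delta> D" "\<delta> > 0" and C: "C >= 0" "!!x. norm (D 0 x) <= C * wt \<beta> \<delta> x" "!!x. norm (D k x) <= C * wt \<beta> \<delta> x"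
 shows "Hw_norm k \<beta> (D 0) <= 2 * C * sqrt (1 / \<delta>)"
proof -
 have m: "wderiv k (D 0) \<in> borel_measurable borel"
  using wderiv_AE(1)[OF L2w_L1loc[OF wsmooth_L2w[OF D]] wsmooth_is_wderiv[OF D, of k 0]] by (simp add: L1loc_def)
 have "L2w_norm \<beta> (wderiv k (D 0)) = L2w_norm \<beta> (D k)"
  using wsmooth_wderiv[OF D, of k 0] by (intro L2w_norm_cong_AE wsmooth_measurable[OF D(1)] m) simp
 also have "\<dots> <= C * sqrt (1 / \<delta>)"
  by (rule L2w_norm_wt_bound[OF D(2) wsmooth_measurable[OF D(1)] C(3,1)])
 finally have 1: "L2w_norm \<beta> (wderiv k (D 0)) <= C * sqrt (1 / \<delta>)" .
 have 2: "L2w_norm \<beta> (D 0) <= C * sqrt (1 / \<delta>)"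
  by (rule L2w_norm_wt_bound[OF D(2) wsmooth_measurable[OF D(1)] C(2,1)])
 have p: "0 <= L2w_norm \<beta> f" for f by (simp add: L2w_norm_def)
 have "Hw_norm k \<beta> (D 0) <= \<bar>L2w_norm \<beta> (wderiv k (D 0))\<bar> + \<bar>L2w_norm \<beta> (D 0)\<bar>"
  unfolding Hw_norm_def by (rule sqrt_sum_squares_le_sum_abs)
 then show ?thesis using 1 2 p by simp
qed

text \<open>All later norm estimates pass through this reduction to pointwise weighted bounds;
  \<open>sqrt (1 / \<delta>)\<close> is the unweighted \<open>L2\<close> norm of
  \<open>exp (- \<delta> * abs x)\<close>.\<close>

lemma HHw_norm_wsmooth:
 assumes D: "wsmooth \<beta> \<delta> D" "wsmooth \<beta> \<delta> E" "\<delta> > 0" and C: "C >= 0" "!!x. norm (D 0 x) <= C * wt \<beta> \<delta> x" "!!x. norm (D k x) <= C * wt \<beta> \<delta> x"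
   "!!x. norm (E 0 x) <= C * wt \<beta> \<delta> x" "!!x. norm (E (k - 1) x) <= C * wt \<beta> \<delta> x"
 shows "HHw_norm k \<beta> (\<lambda>z. (D 0 z, E 0 z)) <= 4 * C * sqrt (1 / \<delta>)"
proof -
 have p: "0 <= Hw_norm j \<beta> f" for j f by (simp add: Hw_norm_def)
 have "HHw_norm k \<beta> (\<lambda>z. (D 0 z, E 0 z)) <= \<bar>Hw_norm k \<beta> (D 0)\<bar> + \<bar>Hw_norm (k - 1) \<beta> (E 0)\<bar>"
  unfolding HHw_norm_def fst_conv snd_conv by (rule sqrt_sum_squares_le_sum_abs)
 then show ?thesis using Hw_norm_wsmooth[OF D(1,3) C(1-3)] Hw_norm_wsmooth[OF D(2,3) C(1,4,5)] p by simp
qed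

section \<open>The operator on the weighted Sobolev space\<close>

text \<open>Membership only prescribes the derivative of top order; \<open>weak_deriv_all\<close>
  supplies those in between. The bound on \<open>k\<close> guarantees two derivatives of the first
  component and one of the second.\<close>

lemma HHw_weak:
 assumes u: "u \<in> HHw (k + 1) \<alpha>" and k: "k >= 1"
 obtains d1 d2 e1 where "(\<lambda>z. fst (u z)) \<in> L2w \<alpha>" "(\<lambda>z. snd (u z)) \<in> L2w \<alpha>"
  "d1 \<in> L2w \<alpha>" "d2 \<in> L2w \<alpha>" "e1 \<in> L2w \<alpha>"
  "is_wderiv 1 (\<lambda>z. fst (u z)) d1" "is_wderiv 1 d1 d2" "is_wderiv 1 (\<lambda>z. snd (u z)) e1"
proof -
 define u1 u2 where "u1 = (\<lambda>z. fst (u z))" and "u2 = (\<lambda>z. snd (u z))"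
 obtain g where g: "u1 \<in> L2w \<alpha>" "g \<in> L2w \<alpha>" "is_wderiv (k + 1) u1 g"
  using u by (auto simp: HHw_def Hw_def u1_def)
 obtain h where h: "u2 \<in> L2w \<alpha>" "h \<in> L2w \<alpha>" "is_wderiv k u2 h"
  using u by (auto simp: HHw_def Hw_def u2_def)
 obtain d1 where d1: "d1 \<in> L2w \<alpha>" "is_wderiv 1 u1 d1" using weak_deriv_all[OF g, of 1] by auto
 obtain d2 where d2: "d2 \<in> L2w \<alpha>" "is_wderiv 2 u1 d2" using weak_deriv_all[OF g, of 2] k by auto
 obtain e1 where e1: "e1 \<in> L2w \<alpha>" "is_wderiv 1 u2 e1" using weak_deriv_all[OF h, of 1] k by auto
 have "is_wderiv 1 d1 d2"
  unfolding is_wderiv_iff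
 proof
  fix \<phi> assume p: "\<phi> \<in> test_fun"
  show "(-1) ^ 1 * tint d1 ((deriv ^^ 1) \<phi>) = tint d2 \<phi>"
   using bspec[OF d1(2)[unfolded is_wderiv_iff] test_fun_deriv[OF p]] bspec[OF d2(2)[unfolded is_wderiv_iff] p]
   by (simp add: numeral_2_eq_2) (metis minus_minus)
 qed
 then show ?thesis using that g h d1 d2 e1 unfolding u1_def u2_def by blast
qed

lemma is_wderiv_1_tst: "is_wderiv 1 u g ==> \<phi> \<in> test_fun ==> tst u (deriv \<phi>) = - tst g \<phi>"
 by (auto simp: is_wderiv_iff tst_def minus_equation_iff)

lemma mult_tst: "mult_distr m (tst u) \<phi> = tst (\<lambda>x. cx (m x) * u x) \<phi>"
 by (simp add: mult_distr_def tst_def algebra_simps)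

text \<open>Replaces the choices hidden in \<open>wderiv\<close> and \<open>Binv\<close> by
  functions characterized through test functions: \<open>G1\<close> is the inverse of
  \<open>B(\<eta>)\<close> applied to \<open>A(\<eta>) (D^2 - \<eta>^2) u1\<close>, and
  \<open>G2\<close> the inverse applied to the terms of \<open>v1\<close> and
  \<open>v2\<close>.\<close>

lemma Lop_parts:
 assumes u: "(\<lambda>z. fst (u z)) \<in> L2w \<alpha>" "(\<lambda>z. snd (u z)) \<in> L2w \<alpha>"
  and d: "d1 \<in> L2w \<alpha>" "d2 \<in> L2w \<alpha>" "e1 \<in> L2w \<alpha>"
  "is_wderiv 1 (\<lambda>z. fst (u z)) d1" "is_wderiv 1 d1 d2" "is_wderiv 1 (\<lambda>z. snd (u z)) e1"
  and b: "b > 0" "abs \<alpha> < sqrt (1 / b)"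
  and Q: "bsmooth Q" "Q 0 = q_c a b c"
 shows "\<exists>G1\<in>L2w \<alpha>. \<exists>G2\<in>L2w \<alpha>. (AE z in lborel. Lop a b c \<alpha> \<eta> u z = (c * d1 z + snd (u z), G1 z + c * e1 z - G2 z)) \<and>
  (\<lambda>z. fst (Lop a b c \<alpha> \<eta> u z)) \<in> borel_measurable borel \<and> (\<lambda>z. snd (Lop a b c \<alpha> \<eta> u z)) \<in> borel_measurable borel \<and>
  (\<forall>\<phi>\<in>test_fun. ellip b \<eta> (tst G1) \<phi> = ellip a \<eta> (tst (\<lambda>x. d2 x - cx (\<eta>\<^sup>2) * fst (u x))) \<phi>) \<and>
  (\<forall>\<phi>\<in>test_fun. ellip b \<eta> (tst G2) \<phi> = tst (\<lambda>x. - c * (2 * Q 1 x * d1 x + Q 0 x * (d2 x - cx (\<eta>\<^sup>2) * fst (u x))) + 2 * Q 0 x * e1 x + Q 1 x * snd (u x)) \<phi>)"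
proof -
 define u1 u2 where "u1 = (\<lambda>z. fst (u z))" and "u2 = (\<lambda>z. snd (u z))"
 define f where "f x = d2 x - cx (\<eta>\<^sup>2) * u1 x" for x
 have f: "f \<in> L2w \<alpha>" unfolding f_def[abs_def] u1_def by (intro L2w_diff L2w_cmult d u)
 have Qd: "(Q n has_real_derivative Q (Suc n) x) (at x)" for n x using Q by (simp add: bsmooth_def)
 have Qs: "smooth (Q n)" for n by (rule smooth_seq[of Q, OF Qd])
 have q': "deriv (q_c a b c) = Q 1" using Qd[of 0] Q(2) by (auto intro!: DERIV_imp_deriv)
 have r: "r_c a b c = (\<lambda>x. - c * Q 0 x)" by (simp add: r_c_def Q(2) fun_eq_iff)
 have r': "deriv (r_c a b c) = (\<lambda>x. - c * Q 1 x)" unfolding r using Qd[of 0] 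
  by (intro ext DERIV_imp_deriv) (auto intro!: derivative_eq_intros)
 have lapf: "lap \<eta> (tst u1) \<phi> = tst f \<phi>" if p: "\<phi> \<in> test_fun" for \<phi>
 proof -
  have "ddz (ddz (tst u1)) \<phi> = tst d2 \<phi>"
   using is_wderiv_1_tst[OF d(4) test_fun_deriv[OF p]] is_wderiv_1_tst[OF d(5) p] by (simp add: ddz_def u1_def)
  moreover have "tst f \<phi> = tst d2 \<phi> - cx (\<eta>\<^sup>2) * tst u1 \<phi>"
   using tst_add[OF d(2) u(1) p, of 1 "- cx (\<eta>\<^sup>2)"] by (simp add: f_def[abs_def] u1_def)
  ultimately show ?thesis by (simp add: lap_def)
 qed
 define T1 where "T1 = ellip a \<eta> (lap \<eta> (distr_of u1))"
 have T1: "T1 \<phi> = ellip a \<eta> (tst f) \<phi>" if p: "\<phi> \<in> test_fun" for \<phi>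
  using lapf[OF p] lapf[OF test_fun_deriv[OF test_fun_deriv[OF p]]]
  by (simp add: T1_def distr_of_eq_tst ellip_def ddz_def)
 define F where "F x = - c * (2 * Q 1 x * d1 x + Q 0 x * f x) + 2 * Q 0 x * e1 x + Q 1 x * u2 x" for x
 have bm: "\<exists>C. \<forall>x. norm (cx (Q n x)) <= C" for n using Q by (simp add: bsmooth_def)
 have QL: "(\<lambda>x. cx (Q n x) * v x) \<in> L2w \<alpha>" if "v \<in> L2w \<alpha>" for v n
 proof -
  obtain C where "!!x. norm (cx (Q n x)) <= C" using bm by blast
  then show ?thesis using that
   by (intro L2w_mult_bounded) (auto intro!: borel_measurable_continuous_onI smooth_continuous Qs)
 qed
 have e: "F x = (- cx c) * (2 * (cx (Q 1 x) * d1 x) + cx (Q 0 x) * f x)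
   + (2 * (cx (Q 0 x) * e1 x) + cx (Q 1 x) * u2 x)" for x
  by (simp add: F_def algebra_simps)
 have F: "F \<in> L2w \<alpha>" unfolding e[abs_def] u2_def by (intro L2w_add L2w_cmult QL f d u)
 define T2 where "T2 = (\<lambda>\<phi>. v1 a b c \<eta> (distr_of u1) \<phi> + v2 a b c (distr_of u2) \<phi>)"
 have T2: "T2 \<phi> = ellip a \<eta> (tst (\<lambda>x. 0)) \<phi> + tst F \<phi>" if p: "\<phi> \<in> test_fun" for \<phi>
 proof -
  have Qp: "(\<lambda>x. Q n x * \<phi> x) \<in> test_fun" "(\<lambda>x. - c * Q n x * \<phi> x) \<in> test_fun" for n
   using test_fun_mult[OF Qs p, of n] test_fun_mult[OF smooth_cmult[OF Qs] p, of "-c" n] by simp_all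
  have d1': "ddz (tst u1) \<psi> = tst d1 \<psi>" if "\<psi> \<in> test_fun" for \<psi>
   using is_wderiv_1_tst[OF d(4) that] by (simp add: ddz_def u1_def)
  have e1': "ddz (tst u2) \<psi> = tst e1 \<psi>" if "\<psi> \<in> test_fun" for \<psi>
   using is_wderiv_1_tst[OF d(6) that] by (simp add: ddz_def u2_def)
  have "mult_distr (deriv (r_c a b c)) (ddz (tst u1)) \<phi> = tst d1 (\<lambda>x. - c * Q 1 x * \<phi> x)"
   unfolding mult_distr_def r' by (rule d1'[OF Qp(2)])
  also have "\<dots> = (- cx c) * tst (\<lambda>x. cx (Q 1 x) * d1 x) \<phi>"
   unfolding tst_def by (subst integral_mult_right_zero[symmetric]) (simp add: algebra_simps)
  finally have 1: "mult_distr (deriv (r_c a b c)) (ddz (tst u1)) \<phi> = (- cx c) * tst (\<lambda>x. cx (Q 1 x) * d1 x) \<phi>" .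
  have "mult_distr (r_c a b c) (lap \<eta> (tst u1)) \<phi> = tst f (\<lambda>x. - c * Q 0 x * \<phi> x)"
   unfolding mult_distr_def r by (rule lapf[OF Qp(2)])
  also have "\<dots> = (- cx c) * tst (\<lambda>x. cx (Q 0 x) * f x) \<phi>"
   unfolding tst_def by (subst integral_mult_right_zero[symmetric]) (simp add: algebra_simps)
  finally have 2: "mult_distr (r_c a b c) (lap \<eta> (tst u1)) \<phi> = (- cx c) * tst (\<lambda>x. cx (Q 0 x) * f x) \<phi>" .
  have "mult_distr (q_c a b c) (ddz (tst u2)) \<phi> = tst e1 (\<lambda>x. Q 0 x * \<phi> x)"
   unfolding mult_distr_def Q(2)[symmetric] by (rule e1'[OF Qp(1)])
  then have 3: "mult_distr (q_c a b c) (ddz (tst u2)) \<phi> = tst (\<lambda>x. cx (Q 0 x) * e1 x) \<phi>"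
   by (simp add: tst_def algebra_simps)
  have 4: "mult_distr (deriv (q_c a b c)) (tst u2) \<phi> = tst (\<lambda>x. cx (Q 1 x) * u2 x) \<phi>"
   unfolding q' by (rule mult_tst)
  have "tst F \<phi> = (- cx c) * tst (\<lambda>x. 2 * (cx (Q 1 x) * d1 x) + 1 * (cx (Q 0 x) * f x)) \<phi>
    + 1 * tst (\<lambda>x. 2 * (cx (Q 0 x) * e1 x) + 1 * (cx (Q 1 x) * u2 x)) \<phi>"
   unfolding e[abs_def] using tst_add[of "\<lambda>x. 2 * (cx (Q 1 x) * d1 x) + 1 * (cx (Q 0 x) * f x)" \<alpha>
     "\<lambda>x. 2 * (cx (Q 0 x) * e1 x) + 1 * (cx (Q 1 x) * u2 x)" \<phi> "- cx c" 1, OF _ _ p]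
     L2w_add[OF L2w_cmult[OF QL[OF d(1), of 1], of 2] QL[OF f, of 0]]
     L2w_add[OF L2w_cmult[OF QL[OF d(3), of 0], of 2] QL[OF u(2), of 1]] unfolding u2_def by simp
  also have "\<dots> = T2 \<phi>"
   unfolding tst_add[OF QL[OF d(1)] QL[OF f] p] tst_add[OF QL[OF d(3)] QL[OF u(2)[folded u2_def]] p]
   unfolding T2_def v1_def v2_def distr_of_eq_tst 1 2 3 4 by (simp add: algebra_simps)
  finally show ?thesis by (simp add: ellip_tst) (simp add: tst_def)
 qed
 have z0: "(\<lambda>x. 0) \<in> L2w \<alpha>" by (simp add: L2w_def)
 have T1': "T1 \<phi> = ellip a \<eta> (tst f) \<phi> + tst (\<lambda>x. 0) \<phi>" if "\<phi> \<in> test_fun" for \<phi>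
  using T1[OF that] by (simp add: tst_def)
 note S1 = Binv_spec[OF f z0 b T1'] and S2 = Binv_spec[OF z0 F b T2]
 have "AE z in lborel. Lop a b c \<alpha> \<eta> u z = (c * d1 z + snd (u z), Binv b \<alpha> \<eta> T1 z + c * e1 z - Binv b \<alpha> \<eta> T2 z)"
  using wderiv_AE(3)[OF L2w_L1loc[OF d(1)] d(4)] wderiv_AE(3)[OF L2w_L1loc[OF d(3)] d(6)]
  by eventually_elim (simp add: Lop_def Let_def T1_def T2_def u1_def u2_def)
 moreover have "bmeas (\<lambda>z. fst (Lop a b c \<alpha> \<eta> u z))" "bmeas (\<lambda>z. snd (Lop a b c \<alpha> \<eta> u z))"
 proof -
  have [measurable]: "wderiv 1 u1 \<in> borel_measurable borel" "wderiv 1 u2 \<in> borel_measurable borel"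
   using wderiv_AE(1)[OF L2w_L1loc[OF d(1)] d(4)] wderiv_AE(1)[OF L2w_L1loc[OF d(3)] d(6)]
   by (auto simp: L1loc_def u1_def u2_def)
  note [measurable] = L2w_measurable[OF S1(1)] L2w_measurable[OF S2(1)] L2w_measurable[OF u(2), folded u2_def]
  have e1: "(\<lambda>z. fst (Lop a b c \<alpha> \<eta> u z)) = (\<lambda>z. c * wderiv 1 u1 z + u2 z)"
   and e2: "(\<lambda>z. snd (Lop a b c \<alpha> \<eta> u z)) = (\<lambda>z. Binv b \<alpha> \<eta> T1 z + c * wderiv 1 u2 z - Binv b \<alpha> \<eta> T2 z)"
   by (auto simp: Lop_def Let_def T1_def T2_def u1_def u2_def)
  show "bmeas (\<lambda>z. fst (Lop a b c \<alpha> \<eta> u z))" unfolding e1 by measurable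
  show "bmeas (\<lambda>z. snd (Lop a b c \<alpha> \<eta> u z))" unfolding e2 by measurable
 qed
 moreover have "tst F = tst (\<lambda>x. - c * (2 * Q 1 x * d1 x + Q 0 x * (d2 x - cx (\<eta>\<^sup>2) * fst (u x))) + 2 * Q 0 x * e1 x + Q 1 x * snd (u x))"
  by (simp add: F_def[abs_def] f_def u1_def u2_def)
 moreover have "tst f = tst (\<lambda>x. d2 x - cx (\<eta>\<^sup>2) * fst (u x))" by (simp add: f_def[abs_def] u1_def)
 moreover have "tst (\<lambda>x. 0) \<phi> = 0" for \<phi> by (simp add: tst_def)
 ultimately show ?thesis using S1 S2 T1 T2
  by (intro bexI[OF _ S1(1)] bexI[OF _ S2(1)]) (auto simp: ellip_tst)
qed

section \<open>Bilinear pairing and linear combinations\<close>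

definition ip :: "(real => complex) => (real => complex) => complex" where
 "ip f g = (LINT x|lborel. f x * g x)"

text \<open>Linear combinations are kept as lists so that integrability and linearity of the pairing
  are proved once and long combinations are evaluated by simplification.\<close>

definition lc :: "(complex \<times> (real => complex)) list => real => complex" where
 "lc xs x = (\<Sum>(s, f)\<leftarrow>xs. s * f x)"

lemma ip_commute: "ip f g = ip g f"
 by (simp add: ip_def mult.commute)

lemma lc_L2w: "\<forall>p\<in>set xs. snd p \<in> L2w \<alpha> ==> lc xs \<in> L2w \<alpha>"
proof (induction xs)
 case Nil
 then show ?case by (simp add: lc_def[abs_def] L2w_def)
next
 case (Cons a xs)
 then have "(\<lambda>x. fst a * snd a x + lc xs x) \<in> L2w \<alpha>"
  by (intro L2w_add L2w_cmult) simp_all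
 then show ?case by (simp add: lc_def[abs_def] case_prod_beta')
qed

lemma ip_lc:
 assumes "\<forall>p\<in>set xs. snd p \<in> L2w \<alpha>" and v: "v \<in> L2w (- \<alpha>)"
 shows "ip (lc xs) v = (\<Sum>(s, f)\<leftarrow>xs. s * ip f v)"
 using assms(1)
proof (induction xs)
 case (Cons a xs)
 obtain s f where a: "a = (s, f)" by (cases a)
 have "intg (\<lambda>x. f x * v x)" "intg (\<lambda>x. lc xs x * v x)"
  using Cons.prems a by (auto intro!: L2w_prod_integrable[OF _ v] lc_L2w)
 moreover have "ip (lc (a # xs)) v = (LINT x|lborel. s * (f x * v x) + lc xs x * v x)"
  unfolding ip_def by (intro Bochner_Integration.integral_cong refl) (simp add: lc_def a algebra_simps)
 moreover have "ip (lc xs) v = (\<Sum>(s, f)\<leftarrow>xs. s * ip f v)" using Cons by simp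
 ultimately show ?case by (simp add: ip_def a)
qed (simp add: ip_def lc_def)

lemma ip_lc_right:
 assumes "\<forall>p\<in>set xs. snd p \<in> L2w (- \<alpha>)" and v: "v \<in> L2w \<alpha>"
 shows "ip v (lc xs) = (\<Sum>(s, f)\<leftarrow>xs. s * ip v f)"
 using ip_lc[of xs "- \<alpha>" v] assms by (simp add: ip_commute[of v])

lemma ip_test: "ip g (\<lambda>x. cx (\<phi> x)) = tst g \<phi>"
 by (simp add: ip_def tst_def)

text \<open>The last two hypotheses are the rows of the eigenvalue equation, the second multiplied
  by \<open>B(\<eta>)\<close> to become differential; injectivity of \<open>B(\<eta>)\<close> on
  \<open>L2w \<alpha>\<close> undoes the multiplication.\<close>

lemma L_eq_of_ode:
 fixes c :: real and lam :: complex and U V :: "nat => real => complex"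
 assumes U: "wsmooth \<alpha> \<delta> U" "wsmooth \<alpha> \<delta> V" "\<delta> > 0"
  and b: "b > 0" "abs \<alpha> < sqrt (1 / b)"
  and Q: "bsmooth Q" "Q 0 = q_c a b c"
  and e1: "!!z. c * U 1 z + V 0 z = lam * U 0 z"
  and e2: "!!z. (1 + a * \<eta>\<^sup>2) * (U 2 z - \<eta>\<^sup>2 * U 0 z) - a * (U 4 z - \<eta>\<^sup>2 * U 2 z)
    + c * ((1 + b * \<eta>\<^sup>2) * V 1 z - b * V 3 z)
    - (- c * (2 * Q 1 z * U 1 z + Q 0 z * (U 2 z - cx (\<eta>\<^sup>2) * U 0 z)) + 2 * Q 0 z * V 1 z + Q 1 z * V 0 z)
    = lam * ((1 + b * \<eta>\<^sup>2) * V 0 z - b * V 2 z)"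
 shows "L_eq k a b c \<alpha> \<eta> (\<lambda>z. (U 0 z, V 0 z)) (\<lambda>z. cscale lam (U 0 z, V 0 z))"
proof -
 have UL: "U n \<in> L2w \<alpha>" "V n \<in> L2w \<alpha>" for n using U wsmooth_L2w by blast+
 have w: "is_wderiv 1 (U n) (U (Suc n))" "is_wderiv 1 (V n) (V (Suc n))" for n
  using wsmooth_is_wderiv[OF U(1,3), of 1 n] wsmooth_is_wderiv[OF U(2,3), of 1 n] by simp_all
 define F where "F x = - c * (2 * Q 1 x * U 1 x + Q 0 x * (U 2 x - cx (\<eta>\<^sup>2) * U 0 x)) + 2 * Q 0 x * V 1 x + Q 1 x * V 0 x" for x
 obtain G1 G2 where G: "G1 \<in> L2w \<alpha>" "G2 \<in> L2w \<alpha>"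
  and L: "AE z in lborel. Lop a b c \<alpha> \<eta> (\<lambda>z. (U 0 z, V 0 z)) z = (c * U 1 z + V 0 z, G1 z + c * V 1 z - G2 z)"
  and G1: "!!\<phi>. \<phi> \<in> test_fun ==> ellip b \<eta> (tst G1) \<phi> = ellip a \<eta> (tst (\<lambda>x. U 2 x - cx (\<eta>\<^sup>2) * U 0 x)) \<phi>"
  and G2: "!!\<phi>. \<phi> \<in> test_fun ==> ellip b \<eta> (tst G2) \<phi> = tst F \<phi>"
  using Lop_parts[of "\<lambda>z. (U 0 z, V 0 z)" \<alpha> "U 1" "U 2" "V 1" b Q a c \<eta>] UL w[of 0] w(1)[of 1] b Q
  by (auto simp: F_def[abs_def] numeral_2_eq_2)
 \<comment> \<open>The defect of the second row before the multiplication by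
   \<open>B(\<eta>)\<close>, using \<open>e1\<close> only implicitly through
   \<open>V\<close>.\<close>
 define X where "X = lc [(1, G1), (-1, G2), (- lam, V 0), (cx c, V 1)]"
 have X: "X \<in> L2w \<alpha>" unfolding X_def by (rule lc_L2w) (use G UL in auto)
 have "AE x in lborel. X x = 0"
 proof (rule ellip_inverse_unique[OF X b])
  fix \<phi> assume p: "\<phi> \<in> test_fun"
  note p2 = test_fun_deriv[OF test_fun_deriv[OF p]]
  have tX: "tst X \<psi> = tst G1 \<psi> - tst G2 \<psi> - lam * tst (V 0) \<psi> + c * tst (V 1) \<psi>" if "\<psi> \<in> test_fun" for \<psi>
   using ip_lc[of "[(1, G1), (-1, G2), (- lam, V 0), (cx c, V 1)]" \<alpha>, OF _ L2w_test[OF that]] G UL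
   by (simp add: ip_test X_def)
  have dd: "tst (U n) (deriv (deriv \<phi>)) = tst (U (n + 2)) \<phi>" "tst (V n) (deriv (deriv \<phi>)) = tst (V (n + 2)) \<phi>" for n
   using wsmooth_ibp_test[OF U(1,3) test_fun_deriv[OF p], of n] wsmooth_ibp_test[OF U(1,3) p, of "Suc n"]
    wsmooth_ibp_test[OF U(2,3) test_fun_deriv[OF p], of n] wsmooth_ibp_test[OF U(2,3) p, of "Suc n"] by simp_all
  have f: "tst (\<lambda>x. U 2 x - cx (\<eta>\<^sup>2) * U 0 x) \<psi> = tst (U 2) \<psi> - \<eta>\<^sup>2 * tst (U 0) \<psi>" if "\<psi> \<in> test_fun" for \<psi>
   using tst_add[OF UL(1)[of 2] UL(1)[of 0] that, of 1 "- cx (\<eta>\<^sup>2)"] by simp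
  define xs where "xs = [(cx (1 + a * \<eta>\<^sup>2), U 2), (- cx ((1 + a * \<eta>\<^sup>2) * \<eta>\<^sup>2), U 0), (- cx a, U 4), (cx (a * \<eta>\<^sup>2), U 2),
   (cx (c * (1 + b * \<eta>\<^sup>2)), V 1), (- cx (c * b), V 3), (- lam * cx (1 + b * \<eta>\<^sup>2), V 0), (lam * cx b, V 2)]"
  have "F = lc xs"
  proof
   fix z
   have "F z = (1 + a * \<eta>\<^sup>2) * (U 2 z - \<eta>\<^sup>2 * U 0 z) - a * (U 4 z - \<eta>\<^sup>2 * U 2 z)
    + c * ((1 + b * \<eta>\<^sup>2) * V 1 z - b * V 3 z) - lam * ((1 + b * \<eta>\<^sup>2) * V 0 z - b * V 2 z)"
    using e2[of z] unfolding F_def by (simp add: algebra_simps)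
   then show "F z = lc xs z" by (simp add: lc_def xs_def algebra_simps)
  qed
  then have "tst F \<phi> = (\<Sum>(s, f)\<leftarrow>xs. s * tst f \<phi>)"
   using ip_lc[of xs \<alpha>, OF _ L2w_test[OF p]] UL by (simp add: ip_test xs_def)
  then have F: "tst F \<phi> = (1 + a * \<eta>\<^sup>2) * (tst (U 2) \<phi> - \<eta>\<^sup>2 * tst (U 0) \<phi>) - a * (tst (U 4) \<phi> - \<eta>\<^sup>2 * tst (U 2) \<phi>)
    + c * ((1 + b * \<eta>\<^sup>2) * tst (V 1) \<phi> - b * tst (V 3) \<phi>) - lam * ((1 + b * \<eta>\<^sup>2) * tst (V 0) \<phi> - b * tst (V 2) \<phi>)"
   by (simp add: xs_def algebra_simps)
  have "ellip b \<eta> (tst X) \<phi> = ellip b \<eta> (tst G1) \<phi> - ellip b \<eta> (tst G2) \<phi> - lam * ellip b \<eta> (tst (V 0)) \<phi> + c * ellip b \<eta> (tst (V 1)) \<phi>"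
   unfolding ellip_tst tX[OF p] tX[OF p2] by (simp add: algebra_simps)
  also have "\<dots> = 0"
   unfolding G1[OF p] G2[OF p] F unfolding ellip_tst f[OF p] f[OF p2] dd by (simp add: algebra_simps numeral_eq_Suc)
  finally show "ellip b \<eta> (tst X) \<phi> = 0" .
 qed
 with L have "AE z in lborel. Lop a b c \<alpha> \<eta> (\<lambda>z. (U 0 z, V 0 z)) z = cscale lam (U 0 z, V 0 z)"
 proof eventually_elim
  case (elim z)
  then have "G1 z + c * V 1 z - G2 z = lam * V 0 z" by (simp add: X_def lc_def algebra_simps)
  then show ?case using elim(1) e1[of z] by simp
 qed
 then show ?thesis unfolding L_eq_def using wsmooth_HHw[OF U] by blast
qed

lemma ellip_extend:
 assumes L: "G \<in> L2w \<alpha>" "f \<in> L2w \<alpha>" "F \<in> L2w \<alpha>" and H: "wsmooth (- \<alpha>) \<delta> H" "\<delta> > 0"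
  and e: "!!\<phi>. \<phi> \<in> test_fun ==> ellip b \<eta> (tst G) \<phi> = ellip a \<eta> (tst f) \<phi> + tst F \<phi>"
 shows "(1 + b * \<eta>\<^sup>2) * ip G (H 0) - b * ip G (H 2) = (1 + a * \<eta>\<^sup>2) * ip f (H 0) - a * ip f (H 2) + ip F (H 0)"
proof -
 have z0: "(\<lambda>x. 0) \<in> L2w \<alpha>" by (simp add: L2w_def)
 define p0 where "p0 = lc [(cx (1 + b * \<eta>\<^sup>2), G), (- cx (1 + a * \<eta>\<^sup>2), f), (-1, F)]"
 define p2 where "p2 = lc [(- cx b, G), (cx a, f)]"
 have p: "p0 \<in> L2w \<alpha>" "p2 \<in> L2w \<alpha>" unfolding p0_def p2_def by (rule lc_L2w; use L in auto)+
 have i0: "ip p0 v = (1 + b * \<eta>\<^sup>2) * ip G v - (1 + a * \<eta>\<^sup>2) * ip f v - ip F v"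
  and i2: "ip p2 v = - b * ip G v + a * ip f v" if "v \<in> L2w (- \<alpha>)" for v
  using ip_lc[of "[(cx (1 + b * \<eta>\<^sup>2), G), (- cx (1 + a * \<eta>\<^sup>2), f), (-1, F)]" \<alpha>, OF _ that]
   ip_lc[of "[(- cx b, G), (cx a, f)]" \<alpha>, OF _ that] L
  by (simp_all add: p0_def p2_def algebra_simps)
 have "ip p0 (H 0) + ip (\<lambda>x. 0) (H 1) + ip p2 (H 2) = 0"
  unfolding ip_def
 proof (rule extend_test[OF p(1) z0 p(2) H(2) _ H(1)])
  fix \<phi> assume t: "\<phi> \<in> test_fun"
  have "tst p0 \<phi> + tst p2 (deriv (deriv \<phi>)) = ellip b \<eta> (tst G) \<phi> - (ellip a \<eta> (tst f) \<phi> + tst F \<phi>)"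
   unfolding i0[OF L2w_test[OF t], unfolded ip_test] i2[OF L2w_test[OF test_fun_deriv[OF test_fun_deriv[OF t]]], unfolded ip_test] ellip_tst
   by (simp add: algebra_simps)
  then have "tst p0 \<phi> + tst p2 (deriv (deriv \<phi>)) = 0" by (simp only: e[OF t] diff_self)
  then show "tint p0 \<phi> + (LINT x|lborel. 0 * cx (deriv \<phi> x)) +
     (tint p2 (deriv (deriv \<phi>))) = 0" by (simp add: tst_def)
 qed
 moreover have "ip (\<lambda>x. 0) (H 1) = 0" by (simp add: ip_def)
 ultimately show ?thesis
  using i0[OF wsmooth_L2w[OF H]] i2[OF wsmooth_L2w[OF H]] by (simp add: algebra_simps)
qed

lemma wsmooth_cnj: "wsmooth \<beta> \<delta> D ==> wsmooth \<beta> \<delta> (\<lambda>n x. cnj (D n x))"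
 by (auto simp: wsmooth_def intro: bounded_linear.has_vector_derivative[OF bounded_linear_cnj])

text \<open>Taking the second component of the adjoint mode as \<open>g2 = B(\<eta>) H\<close>
  cancels the nonlocal inverse: pairing \<open>G1\<close> or \<open>G2\<close> with
  \<open>g2\<close> becomes a pairing of local terms with \<open>H\<close>. The equations for
  \<open>K\<close> are then the rows of the transposed differential system, and the conjugates
  compensate the sesquilinear pairing.\<close>

lemma Lstar_eq_of_ode:
 fixes c :: real and lam :: complex and H K g2 :: "nat => real => complex"
 assumes H: "wsmooth (- \<alpha>) \<delta> H" "wsmooth (- \<alpha>) \<delta> K" "\<delta> > 0" and k: "k >= 1"
  and b: "b > 0" "abs \<alpha> < sqrt (1 / b)"
  and Q: "bsmooth Q" "Q 0 = q_c a b c"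
  and g2: "!!n z. g2 n z = (1 + b * \<eta>\<^sup>2) * H n z - b * H (n + 2) z"
  and e1: "!!z. K 0 z = lam * g2 0 z + c * g2 1 z - 2 * Q 0 z * H 1 z - Q 1 z * H 0 z"
  and e2: "!!z. - c * K 1 z + (1 + a * \<eta>\<^sup>2) * (H 2 z - \<eta>\<^sup>2 * H 0 z) - a * (H 4 z - \<eta>\<^sup>2 * H 2 z)
    + c * (- Q 2 z * H 0 z + Q 0 z * H 2 z - \<eta>\<^sup>2 * Q 0 z * H 0 z) = lam * K 0 z"
 shows "Lstar_eq k a b c \<alpha> \<eta> (\<lambda>z. (cnj (K 0 z), cnj (g2 0 z))) (\<lambda>z. cscale (cnj lam) (cnj (K 0 z), cnj (g2 0 z)))"
proof -
 have "wsmooth (- \<alpha>) \<delta> (\<lambda>n z. cx (1 + b * \<eta>\<^sup>2) * H n z + (- cx b) * H (n + 2) z)"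
  by (rule wsmooth_add[OF H(1) wsmooth_shift[OF H(1)]])
 then have g2w: "wsmooth (- \<alpha>) \<delta> g2"
  by (rule back_subst[of "wsmooth (- \<alpha>) \<delta>"]) (simp add: g2 fun_eq_iff)
 have HL: "H n \<in> L2w (- \<alpha>)" "K n \<in> L2w (- \<alpha>)" "g2 n \<in> L2w (- \<alpha>)" for n
  using H g2w wsmooth_L2w by blast+
 have Qd: "(Q n has_real_derivative Q (Suc n) x) (at x)" for n x using Q by (simp add: bsmooth_def)
 have QL: "(\<lambda>x. cx (Q n x) * v x) \<in> L2w \<beta>" if "v \<in> L2w \<beta>" for v n \<beta>
 proof -
  obtain C where "!!x. norm (cx (Q n x)) <= C" using Q unfolding bsmooth_def by (metis norm_of_real)
  then show ?thesis using that smooth_seq[of Q, OF Qd]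
   by (intro L2w_mult_bounded) (auto intro!: borel_measurable_continuous_onI smooth_continuous)
 qed
 have memb: "(\<lambda>z. (cnj (K 0 z), cnj (g2 0 z))) \<in> HHw k (- \<alpha>)"
  by (rule wsmooth_HHw[OF wsmooth_cnj[OF H(2)] wsmooth_cnj[OF g2w] H(3)])
 have memb2: "(\<lambda>z. cscale (cnj lam) (cnj (K 0 z), cnj (g2 0 z))) \<in> HHw k (- \<alpha>)"
  using wsmooth_HHw[OF wsmooth_add[OF wsmooth_cnj[OF H(2)] wsmooth_cnj[OF H(2)], of "cnj lam" 0]
    wsmooth_add[OF wsmooth_cnj[OF g2w] wsmooth_cnj[OF g2w], of "cnj lam" 0] H(3)] by simp
 have "pairing (Lop a b c \<alpha> \<eta> u) (\<lambda>z. (cnj (K 0 z), cnj (g2 0 z))) =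
   pairing u (\<lambda>z. cscale (cnj lam) (cnj (K 0 z), cnj (g2 0 z)))" if u: "u \<in> HHw (k + 1) \<alpha>" for u
 proof -
  define u1 u2 where "u1 = (\<lambda>z. fst (u z))" and "u2 = (\<lambda>z. snd (u z))"
  obtain d1 d2 e1' where d: "u1 \<in> L2w \<alpha>" "u2 \<in> L2w \<alpha>"
   "d1 \<in> L2w \<alpha>" "d2 \<in> L2w \<alpha>" "e1' \<in> L2w \<alpha>"
   "is_wderiv 1 u1 d1" "is_wderiv 1 d1 d2" "is_wderiv 1 u2 e1'"
   unfolding u1_def u2_def by (rule HHw_weak[OF u k])
  define f where "f = lc [(1, d2), (- cx (\<eta>\<^sup>2), u1)]"
  define F where "F = lc [(-2 * cx c, \<lambda>x. cx (Q 1 x) * d1 x), (- cx c, \<lambda>x. cx (Q 0 x) * d2 x),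
    (cx (c * \<eta>\<^sup>2), \<lambda>x. cx (Q 0 x) * u1 x), (2, \<lambda>x. cx (Q 0 x) * e1' x), (1, \<lambda>x. cx (Q 1 x) * u2 x)]"
  have fe: "f = (\<lambda>x. d2 x - cx (\<eta>\<^sup>2) * u1 x)" by (simp add: f_def lc_def fun_eq_iff)
  have Fe: "F = (\<lambda>x. - cx c * (2 * cx (Q 1 x) * d1 x + cx (Q 0 x) * (d2 x - cx (\<eta>\<^sup>2) * u1 x))
    + 2 * cx (Q 0 x) * e1' x + cx (Q 1 x) * u2 x)"
   by (simp add: F_def lc_def fun_eq_iff algebra_simps)
  have fL: "f \<in> L2w \<alpha>" unfolding f_def by (rule lc_L2w) (use d in auto)
  have FL: "F \<in> L2w \<alpha>" unfolding F_def by (rule lc_L2w) (use d QL in auto)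
  have "\<exists>G1\<in>L2w \<alpha>. \<exists>G2\<in>L2w \<alpha>. (AE z in lborel. Lop a b c \<alpha> \<eta> u z = (c * d1 z + u2 z, G1 z + c * e1' z - G2 z)) \<and>
   (\<lambda>z. fst (Lop a b c \<alpha> \<eta> u z)) \<in> borel_measurable borel \<and> (\<lambda>z. snd (Lop a b c \<alpha> \<eta> u z)) \<in> borel_measurable borel \<and>
   (\<forall>\<phi>\<in>test_fun. ellip b \<eta> (tst G1) \<phi> = ellip a \<eta> (tst f) \<phi>) \<and> (\<forall>\<phi>\<in>test_fun. ellip b \<eta> (tst G2) \<phi> = tst F \<phi>)"
   unfolding fe Fe u1_def u2_def
   by (rule Lop_parts[OF d(1,2)[unfolded u1_def u2_def] d(3-5) d(6)[unfolded u1_def] d(7) d(8)[unfolded u2_def] b Q])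
  then obtain G1 G2 where G: "G1 \<in> L2w \<alpha>" "G2 \<in> L2w \<alpha>"
   and L: "AE z in lborel. Lop a b c \<alpha> \<eta> u z = (c * d1 z + u2 z, G1 z + c * e1' z - G2 z)"
   and Lm: "bmeas (\<lambda>z. fst (Lop a b c \<alpha> \<eta> u z))" "bmeas (\<lambda>z. snd (Lop a b c \<alpha> \<eta> u z))"
   and G1: "!!\<phi>. \<phi> \<in> test_fun ==> ellip b \<eta> (tst G1) \<phi> = ellip a \<eta> (tst f) \<phi>"
   and G2: "!!\<phi>. \<phi> \<in> test_fun ==> ellip b \<eta> (tst G2) \<phi> = tst F \<phi>"
   by blast
  define A1 where "A1 = lc [(cx c, d1), (1, u2)]"
  define A2 where "A2 = lc [(1, G1), (cx c, e1'), (-1, G2)]"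
  have A: "A1 \<in> L2w \<alpha>" "A2 \<in> L2w \<alpha>" unfolding A1_def A2_def by (rule lc_L2w; use d G in auto)+
  have LA: "AE z in lborel. fst (Lop a b c \<alpha> \<eta> u z) * K 0 z = A1 z * K 0 z" "AE z in lborel. snd (Lop a b c \<alpha> \<eta> u z) * g2 0 z = A2 z * g2 0 z"
   using L by (eventually_elim, simp add: A1_def A2_def lc_def)+
  have "pairing (Lop a b c \<alpha> \<eta> u) (\<lambda>z. (cnj (K 0 z), cnj (g2 0 z))) = ip A1 (K 0) + ip A2 (g2 0)"
   unfolding pairing_def ip_def fst_conv snd_conv complex_cnj_cnj
   using Lm L2w_measurable[OF A(1)] L2w_measurable[OF A(2)] L2w_measurable[OF HL(2)] L2w_measurable[OF HL(3)] LA
   by (intro arg_cong2[of _ _ _ _ "(+)"] integral_cong_AE) auto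
  also have "ip A1 (K 0) = c * ip d1 (K 0) + ip u2 (K 0)"
   unfolding A1_def using ip_lc[of "[(cx c, d1), (1, u2)]" \<alpha>, OF _ HL(2)[of 0]] d by auto
  also have "ip A2 (g2 0) = ip G1 (g2 0) + c * ip e1' (g2 0) - ip G2 (g2 0)"
   unfolding A2_def using ip_lc[of "[(1, G1), (cx c, e1'), (-1, G2)]" \<alpha>, OF _ HL(3)[of 0]] d G by auto
  also have "ip d1 (K 0) = - ip u1 (K 1)" using weak_ibp[OF d(1,3,6) H(2,3), of 0] by (simp add: ip_def)
  also have "ip e1' (g2 0) = - ip u2 (g2 1)" using weak_ibp[OF d(2,5,8) g2w H(3), of 0] by (simp add: ip_def)
  also have "ip G1 (g2 0) = (1 + a * \<eta>\<^sup>2) * ip f (H 0) - a * ip f (H 2)"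
  proof -
   have z0: "(\<lambda>x. 0) \<in> L2w \<alpha>" by (simp add: L2w_def)
   have "ip G1 (g2 0) = (1 + b * \<eta>\<^sup>2) * ip G1 (H 0) - b * ip G1 (H 2)"
    using ip_lc_right[of "[(cx (1 + b * \<eta>\<^sup>2), H 0), (- cx b, H 2)]" \<alpha>, OF _ G(1)] HL
    by (simp add: lc_def[abs_def] g2[abs_def] numeral_2_eq_2)
   then show ?thesis using ellip_extend[OF G(1) fL z0 H(1,3), of b \<eta> a] G1 by (simp add: tst_def) (simp add: ip_def)
  qed
  also have "ip G2 (g2 0) = ip F (H 0)"
  proof -
   have z0: "(\<lambda>x. 0) \<in> L2w \<alpha>" by (simp add: L2w_def)
   have "ip G2 (g2 0) = (1 + b * \<eta>\<^sup>2) * ip G2 (H 0) - b * ip G2 (H 2)"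
    using ip_lc_right[of "[(cx (1 + b * \<eta>\<^sup>2), H 0), (- cx b, H 2)]" \<alpha>, OF _ G(2)] HL
    by (simp add: lc_def[abs_def] g2[abs_def] numeral_2_eq_2)
   then show ?thesis using ellip_extend[OF G(2) z0 FL H(1,3), of b \<eta> 0] G2
    by (simp add: ellip_tst) (simp add: tst_def ip_def)
  qed
  finally have main: "pairing (Lop a b c \<alpha> \<eta> u) (\<lambda>z. (cnj (K 0 z), cnj (g2 0 z))) =
    c * (- ip u1 (K 1)) + ip u2 (K 0) + ((1 + a * \<eta>\<^sup>2) * ip f (H 0) - a * ip f (H 2) + c * (- ip u2 (g2 1)) - ip F (H 0))" .
  have d2H: "ip d2 (H n) = ip u1 (H (n + 2))" for n
   using weak_ibp[OF d(3,4,7) H(1,3), of n] weak_ibp[OF d(1,3,6) H(1,3), of "Suc n"] by (simp add: ip_def)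
  have fH: "ip f (H n) = ip u1 (H (n + 2)) - \<eta>\<^sup>2 * ip u1 (H n)" for n
   using ip_lc[of "[(1, d2), (- cx (\<eta>\<^sup>2), u1)]" \<alpha>, OF _ HL(1)[of n]] d d2H[of n] by (auto simp: f_def)
  \<comment> \<open>Products with the profile are turned into derivative sequences because
    \<open>weak_ibp\<close> moves derivatives only along such a sequence.\<close>
  have QH: "\<exists>E. E 0 = (\<lambda>x. cx (Q i x) * H 0 x) \<and> wsmooth (- \<alpha>) \<delta> E \<and>
    E 1 = (\<lambda>x. cx (Q (Suc i) x) * H 0 x + cx (Q i x) * H 1 x) \<and>
    E 2 = (\<lambda>x. cx (Q (i + 2) x) * H 0 x + 2 * cx (Q (Suc i) x) * H 1 x + cx (Q i x) * H 2 x)" for i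
  proof -
   have "bsmooth (\<lambda>n. Q (i + n))" using Q by (auto simp: bsmooth_def)
   from wsmooth_mult[OF this H(1)] obtain E where E: "E 0 = (\<lambda>x. cx (Q i x) * H 0 x)" "wsmooth (- \<alpha>) \<delta> E" by auto
   have dQ: "((\<lambda>x. cx (Q i x) * H j x) has_vector_derivative (cx (Q (Suc i) x) * H j x + cx (Q i x) * H (Suc j) x)) (at x)" for i j x
    using has_vector_derivative_mult[OF has_vector_derivative_of_real'[OF Qd[of i x]] wsmooth_deriv[OF H(1), of j x]] by (simp add: add.commute)
   have E1: "E 1 x = cx (Q (Suc i) x) * H 0 x + cx (Q i x) * H 1 x" for x
    using wsmooth_deriv[OF E(2), of 0 x] dQ[of i 0 x] unfolding E(1) by (auto intro: vector_derivative_unique_at)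
   have E2: "E 2 x = cx (Q (i + 2) x) * H 0 x + 2 * cx (Q (Suc i) x) * H 1 x + cx (Q i x) * H 2 x" for x
   proof -
    have "(E 1 has_vector_derivative ((cx (Q (Suc (Suc i)) x) * H 0 x + cx (Q (Suc i) x) * H 1 x) + (cx (Q (Suc i) x) * H 1 x + cx (Q i x) * H 2 x))) (at x)"
     unfolding E1[abs_def] using has_vector_derivative_add[OF dQ[of "Suc i" 0 x] dQ[of i 1 x]] by (simp add: numeral_2_eq_2)
    then show ?thesis using vector_derivative_unique_at[OF wsmooth_deriv[OF E(2), of 1 x]] by (simp add: numeral_2_eq_2)
   qed
   show ?thesis using E E1 E2 by blast
  qed
  obtain E where E: "E 0 = (\<lambda>x. cx (Q 0 x) * H 0 x)" "wsmooth (- \<alpha>) \<delta> E"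
    "E 1 = (\<lambda>x. cx (Q 1 x) * H 0 x + cx (Q 0 x) * H 1 x)"
    "E 2 = (\<lambda>x. cx (Q 2 x) * H 0 x + 2 * cx (Q 1 x) * H 1 x + cx (Q 0 x) * H 2 x)"
   using QH[of 0] by (auto simp: numeral_2_eq_2)
  obtain E' where E': "E' 0 = (\<lambda>x. cx (Q 1 x) * H 0 x)" "wsmooth (- \<alpha>) \<delta> E'"
    "E' 1 = (\<lambda>x. cx (Q 2 x) * H 0 x + cx (Q 1 x) * H 1 x)"
   using QH[of 1] by (auto simp: numeral_2_eq_2)
  have mv: "ip (\<lambda>x. cx (Q i x) * v x) (H j) = ip v (\<lambda>x. cx (Q i x) * H j x)" for i v j
   by (simp add: ip_def ac_simps)
  define P where "P i j = ip u1 (\<lambda>x. cx (Q i x) * H j x)" for i j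
  define R where "R i j = ip u2 (\<lambda>x. cx (Q i x) * H j x)" for i j
  have QHL: "(\<lambda>x. cx (Q i x) * H j x) \<in> L2w (- \<alpha>)" for i j by (rule QL[OF HL(1)])
  have lcR: "ip v (lc [(s, \<lambda>x. cx (Q i x) * H j x), (s', \<lambda>x. cx (Q i' x) * H j' x), (s'', \<lambda>x. cx (Q i'' x) * H j'' x)])
    = s * ip v (\<lambda>x. cx (Q i x) * H j x) + s' * ip v (\<lambda>x. cx (Q i' x) * H j' x) + s'' * ip v (\<lambda>x. cx (Q i'' x) * H j'' x)"
   if "v \<in> L2w \<alpha>" for v s i j s' i' j' s'' i'' j''
   using ip_lc_right[of "[(s, \<lambda>x. cx (Q i x) * H j x), (s', \<lambda>x. cx (Q i' x) * H j' x), (s'', \<lambda>x. cx (Q i'' x) * H j'' x)]" \<alpha>, OF _ that] QHL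
   by auto
  have t1: "ip d1 (\<lambda>x. cx (Q 1 x) * H 0 x) = - (P 2 0 + P 1 1)"
  proof -
   have "ip d1 (E' 0) = - ip u1 (E' 1)" using weak_ibp[OF d(1,3,6) E'(2) H(3), of 0] by (simp add: ip_def)
   then show ?thesis using lcR[OF d(1), of 1 2 0 1 1 1 0 0 0] unfolding E' by (simp add: lc_def[abs_def] P_def)
  qed
  have t2: "ip d2 (\<lambda>x. cx (Q 0 x) * H 0 x) = P 2 0 + 2 * P 1 1 + P 0 2"
  proof -
   have "ip d2 (E 0) = ip u1 (E 2)"
    using weak_ibp[OF d(3,4,7) E(2) H(3), of 0] weak_ibp[OF d(1,3,6) E(2) H(3), of 1] by (simp add: ip_def numeral_2_eq_2)
   then show ?thesis using lcR[OF d(1), of 1 2 0 2 1 1 1 0 2] unfolding E by (simp add: lc_def[abs_def] P_def mult.assoc add.assoc)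
  qed
  have t3: "ip e1' (\<lambda>x. cx (Q 0 x) * H 0 x) = - (R 1 0 + R 0 1)"
  proof -
   have "ip e1' (E 0) = - ip u2 (E 1)" using weak_ibp[OF d(2,5,8) E(2) H(3), of 0] by (simp add: ip_def)
   then show ?thesis using lcR[OF d(2), of 1 1 0 1 0 1 0 0 0] unfolding E by (simp add: lc_def[abs_def] R_def)
  qed
  have FH: "ip F (H 0) = - 2 * cx c * (- (P 2 0 + P 1 1)) - c * (P 2 0 + 2 * P 1 1 + P 0 2) + c * \<eta>\<^sup>2 * P 0 0
    + 2 * (- (R 1 0 + R 0 1)) + R 1 0"
  proof -
   have "ip F (H 0) = - 2 * cx c * ip (\<lambda>x. cx (Q 1 x) * d1 x) (H 0) - c * ip (\<lambda>x. cx (Q 0 x) * d2 x) (H 0)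
    + c * \<eta>\<^sup>2 * ip (\<lambda>x. cx (Q 0 x) * u1 x) (H 0) + 2 * ip (\<lambda>x. cx (Q 0 x) * e1' x) (H 0) + ip (\<lambda>x. cx (Q 1 x) * u2 x) (H 0)"
    unfolding F_def by (subst ip_lc[OF _ HL(1)]) (use d QL in auto)
   then show ?thesis unfolding mv t1 t2 t3 by (simp add: P_def R_def)
  qed
  have K1: "c * ip u1 (K 1) = (1 + a * \<eta>\<^sup>2) * (ip u1 (H 2) - \<eta>\<^sup>2 * ip u1 (H 0)) - a * (ip u1 (H 4) - \<eta>\<^sup>2 * ip u1 (H 2))
    + c * (- P 2 0 + P 0 2 - \<eta>\<^sup>2 * P 0 0) - lam * ip u1 (K 0)"
  proof -
   define xs where "xs = [(cx (1 + a * \<eta>\<^sup>2), H 2), (- cx ((1 + a * \<eta>\<^sup>2) * \<eta>\<^sup>2), H 0), (- cx a, H 4), (cx (a * \<eta>\<^sup>2), H 2),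
    (- cx c, \<lambda>x. cx (Q 2 x) * H 0 x), (cx c, \<lambda>x. cx (Q 0 x) * H 2 x), 
    (- cx (c * \<eta>\<^sup>2), \<lambda>x. cx (Q 0 x) * H 0 x), (- lam, K 0)]"
   have xe: "lc xs = lc [(cx c, K 1)]"
   proof
    fix z
    have "c * K 1 z = (1 + a * \<eta>\<^sup>2) * (H 2 z - \<eta>\<^sup>2 * H 0 z) - a * (H 4 z - \<eta>\<^sup>2 * H 2 z)
    + c * (- Q 2 z * H 0 z + Q 0 z * H 2 z - \<eta>\<^sup>2 * Q 0 z * H 0 z) - lam * K 0 z"
     using e2[of z] by (simp add: algebra_simps)
    then show "lc xs z = lc [(cx c, K 1)] z" by (simp add: lc_def xs_def algebra_simps)
   qed
   have "ip u1 (lc xs) = (\<Sum>(s, f)\<leftarrow>xs. s * ip u1 f)"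
    by (rule ip_lc_right[OF _ d(1)]) (use HL QHL in \<open>auto simp: xs_def\<close>)
   moreover have "ip u1 (lc [(cx c, K 1)]) = c * ip u1 (K 1)"
    using ip_lc_right[of "[(cx c, K 1)]" \<alpha>, OF _ d(1)] HL by auto
   ultimately show ?thesis unfolding xe by (simp add: xs_def P_def algebra_simps)
  qed
  have K0: "ip u2 (K 0) = lam * ip u2 (g2 0) + c * ip u2 (g2 1) - 2 * R 0 1 - R 1 0"
  proof -
   define xs where "xs = [(lam, g2 0), (cx c, g2 1), (-2, \<lambda>x. cx (Q 0 x) * H 1 x), (-1, \<lambda>x. cx (Q 1 x) * H 0 x)]"
   have xe: "K 0 = lc xs" by (simp add: e1 fun_eq_iff lc_def xs_def)
   have "ip u2 (lc xs) = (\<Sum>(s, f)\<leftarrow>xs. s * ip u2 f)"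
    by (rule ip_lc_right[OF _ d(2)]) (use HL QHL in \<open>auto simp: xs_def\<close>)
   then show ?thesis unfolding xe by (simp add: xs_def R_def algebra_simps)
  qed
  have "pairing (Lop a b c \<alpha> \<eta> u) (\<lambda>z. (cnj (K 0 z), cnj (g2 0 z))) = lam * ip u1 (K 0) + lam * ip u2 (g2 0)"
   unfolding main mult_minus_right K1 K0 fH FH by (simp add: algebra_simps numeral_eq_Suc)
  also have "\<dots> = pairing u (\<lambda>z. cscale (cnj lam) (cnj (K 0 z), cnj (g2 0 z)))"
   unfolding pairing_def ip_def u1_def u2_def
   by (simp add: mult.left_commute[of _ lam])
  finally show ?thesis .
 qed
 then show ?thesis unfolding Lstar_eq_def using memb memb2 by blast
qed

section \<open>Holomorphic families of weighted functions\<close>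

text \<open>Holomorphy together with the symmetry of functions having real Taylor coefficients; on
  the imaginary axis it yields the conjugation relations between \<open>\<eta>\<close> and
  \<open>- \<eta>\<close>.\<close>

definition hsym :: "real => (complex => complex) => bool" where
 "hsym R g \<longleftrightarrow> g holomorphic_on ball 0 R \<and> (\<forall>e\<in>ball 0 R. g (cnj e) = cnj (g e))"

text \<open>Holomorphy is required at each fixed \<open>z\<close>, while the bound is uniform in the
  parameter relative to \<open>w\<close>. This combination survives integration against kernels,
  limits and Cauchy's estimates.\<close>

definition fam :: "real => (real => real) => real => (complex => real => complex) => bool" where
 "fam R w C f \<longleftrightarrow> (\<forall>e\<in>ball 0 R. continuous_on UNIV (f e)) \<and>
   (\<forall>e\<in>ball 0 R. \<forall>z. norm (f e z) <= C * w z) \<and> (\<forall>z. hsym R (\<lambda>e. f e z))"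

definition lint :: "(real => real) => (real => complex) => complex" where
 "lint k f = (LINT s|lborel. cx (k s) * f s)"

lemma fam_cont: "fam R w C f ==> e \<in> ball 0 R ==> continuous_on A (f e)"
 by (meson continuous_on_subset fam_def subset_UNIV)

lemma fam_bound: "fam R w C f ==> e \<in> ball 0 R ==> norm (f e z) <= C * w z"
 and fam_hsym: "fam R w C f ==> hsym R (\<lambda>e. f e z)"
 and fam_hol: "fam R w C f ==> (\<lambda>e. f e z) holomorphic_on ball 0 R"
 and fam_cnj: "fam R w C f ==> e \<in> ball 0 R ==> f (cnj e) z = cnj (f e z)"
 by (auto simp: fam_def hsym_def)

lemma fam_measurable: "fam R w C f ==> e \<in> ball 0 R ==> f e \<in> borel_measurable borel"
 by (intro borel_measurable_continuous_onI fam_cont)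

lemma hsym_const: "hsym R (\<lambda>e. cx r)"
 and hsym_ident: "hsym R (\<lambda>e. e)"
 by (auto simp: hsym_def)

lemma hsym_add: "hsym R f ==> hsym R g ==> hsym R (\<lambda>e. f e + g e)"
 and hsym_diff: "hsym R f ==> hsym R g ==> hsym R (\<lambda>e. f e - g e)"
 and hsym_mult: "hsym R f ==> hsym R g ==> hsym R (\<lambda>e. f e * g e)"
 by (auto simp: hsym_def intro!: holomorphic_intros)

lemma hsym_power: "hsym R f ==> hsym R (\<lambda>e. f e ^ n)"
 by (auto simp: hsym_def intro!: holomorphic_intros)

lemma fam_mono: "fam R w C f ==> C <= C' ==> (!!z. w z >= 0) ==> fam R w C' f"
 unfolding fam_def by (meson mult_right_mono order_trans)

lemma fam_diff:
 assumes "fam R w C f" "fam R w D g" shows "fam R w (C + D) (\<lambda>e z. f e z - g e z)"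
 unfolding fam_def
proof (intro conjI ballI allI)
 show "norm (f e z - g e z) <= (C + D) * w z" if "e \<in> ball 0 R" for e z
  using norm_triangle_ineq4[of "f e z" "g e z"] fam_bound[OF assms(1) that, of z] fam_bound[OF assms(2) that, of z]
  by (simp add: distrib_right)
qed (auto intro!: continuous_intros hsym_diff fam_cont[OF assms(1)] fam_cont[OF assms(2)] fam_hsym[OF assms(1)] fam_hsym[OF assms(2)])

lemma fam_add:
 assumes "fam R w C f" "fam R w D g" shows "fam R w (C + D) (\<lambda>e z. f e z + g e z)"
 unfolding fam_def
proof (intro conjI ballI allI)
 show "norm (f e z + g e z) <= (C + D) * w z" if "e \<in> ball 0 R" for e z
  using norm_triangle_ineq[of "f e z" "g e z"] fam_bound[OF assms(1) that, of z] fam_bound[OF assms(2) that, of z]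
  by (simp add: distrib_right)
qed (auto intro!: continuous_intros hsym_add fam_cont[OF assms(1)] fam_cont[OF assms(2)] fam_hsym[OF assms(1)] fam_hsym[OF assms(2)])

lemma fam_scale:
 assumes f: "fam R w C f" and g: "hsym R g" "!!e. e \<in> ball 0 R ==> norm (g e) <= D" "D >= 0"
 shows "fam R w (D * C) (\<lambda>e z. g e * f e z)"
 unfolding fam_def
proof (intro conjI ballI allI)
 show "norm (g e * f e z) <= (D * C) * w z" if "e \<in> ball 0 R" for e z
  using mult_mono[OF g(2)[OF that] fam_bound[OF f that, of z]] g(3) by (simp add: norm_mult mult.assoc)
qed (auto intro!: continuous_intros hsym_mult fam_cont[OF f] fam_hsym[OF f] g)

lemma fam_real:
 assumes "continuous_on UNIV s" "!!z. abs (s z) <= C * w z"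
 shows "fam R w C (\<lambda>e z. cx (s z))"
 unfolding fam_def using assms by (auto intro!: continuous_intros hsym_const)

lemma fam_mult_real:
 assumes f: "fam R w C f" and s: "continuous_on UNIV s" "!!z. abs (s z) * w z <= D * w' z" and C: "C >= 0"
 shows "fam R w' (C * D) (\<lambda>e z. cx (s z) * f e z)"
 unfolding fam_def
proof (intro conjI ballI allI)
 show "norm (cx (s z) * f e z) <= (C * D) * w' z" if "e \<in> ball 0 R" for e z
 proof -
  have "abs (s z) * norm (f e z) <= abs (s z) * (C * w z)" by (intro mult_left_mono fam_bound[OF f that]) simp
  also have "\<dots> = C * (abs (s z) * w z)" by simp
  also have "\<dots> <= C * (D * w' z)" by (intro mult_left_mono s C)
  finally show ?thesis by (simp add: norm_mult mult.assoc)
 qed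
qed (auto intro!: continuous_intros hsym_mult hsym_const fam_cont[OF f] fam_hsym[OF f] s)

lemma lint_bound:
 assumes "bmeas f" "!!s. norm (f s) <= C * w s" "bmeas k" "intg (\<lambda>s. abs (k s) * w s)"
 shows "intg (\<lambda>s. cx (k s) * f s)"
  and "norm (lint k f) <= C * (LINT s|lborel. abs (k s) * w s)"
proof -
 note [measurable] = assms(1,3)
 have b: "norm (cx (k s) * f s) <= C * (abs (k s) * w s)" for s
  using mult_left_mono[OF assms(2)[of s], of "abs (k s)"] by (simp add: norm_mult mult.left_commute)
 have i: "intg (\<lambda>s. C * (abs (k s) * w s))" using assms(4) by simp
 show I: "intg (\<lambda>s. cx (k s) * f s)"
  by (rule Bochner_Integration.integrable_bound[OF i])
   (use b in \<open>auto intro!: AE_I2 order_trans[OF b] abs_ge_self simp del: abs_mult norm_mult\<close>)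
 have "norm (lint k f) <= (LINT s|lborel. norm (cx (k s) * f s))"
  unfolding lint_def by (rule integral_norm_bound)
 also have "\<dots> <= (LINT s|lborel. C * (abs (k s) * w s))"
  by (intro integral_mono integrable_norm I i b)
 finally show "norm (lint k f) <= C * (LINT s|lborel. abs (k s) * w s)" by simp
qed

lemma fam_lint_int:
 assumes "fam R w C f" "e \<in> ball 0 R" "bmeas k" "intg (\<lambda>s. abs (k s) * w s)"
 shows "intg (\<lambda>s. cx (k s) * f e s)"
 by (rule lint_bound(1)[OF fam_measurable[OF assms(1,2)] _ assms(3,4)]) (rule fam_bound[OF assms(1,2)])

text \<open>Cauchy's inequality on a circle of radius \<open>R / 4\<close>, which stays in the ball
  because \<open>e\<close> has modulus below \<open>R / 2\<close>. Applied at fixed \<open>z\<close>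
  to a \<open>fam\<close>, the bound is again proportional to \<open>w z\<close>.\<close>

lemma higher_deriv_bound:
 fixes f :: "complex => complex"
 assumes f: "f holomorphic_on ball 0 R" "!!e. e \<in> ball 0 R ==> norm (f e) <= B" and e: "e \<in> ball 0 (R / 2)"
 shows "norm ((deriv ^^ n) f e) <= fact n * B / (R / 4) ^ n"
proof -
 have R: "R > 0" using e norm_ge_zero[of e] by (simp del: norm_ge_zero)
 have sub: "cball e (R / 4) \<subseteq> ball 0 R"
 proof
  fix x assume "x \<in> cball e (R / 4)"
  then have "norm (x - e) <= R / 4" by (simp add: dist_norm norm_minus_commute)
  then have "norm x <= norm e + R / 4" using norm_triangle_ineq[of "x - e" e] by simp
  then show "x \<in> ball 0 R" using e R by simp
 qed
 show ?thesis
 proof (rule Cauchy_inequality)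
  show "f holomorphic_on ball e (R / 4)" by (rule holomorphic_on_subset[OF f(1)]) (use sub ball_subset_cball in blast)
  show "continuous_on (cball e (R / 4)) f" by (rule continuous_on_subset[OF holomorphic_on_imp_continuous_on[OF f(1)] sub])
  show "norm (f x) <= B" if "norm (e - x) = R / 4" for x using sub that by (intro f(2)) (auto simp: dist_norm)
 qed (use R in simp)
qed

text \<open>The quadratic remainder serves twice: divided by the increment it gives
  differentiability in norm, and at the origin it is the error of the expansions.\<close>

lemma higher_deriv_taylor:
 fixes f :: "complex => complex"
 assumes f: "f holomorphic_on ball 0 R" "!!e. e \<in> ball 0 R ==> norm (f e) <= B" and e: "e \<in> ball 0 (R / 2)" "e0 \<in> ball 0 (R / 2)"
 shows "norm ((deriv ^^ n) f e - (deriv ^^ n) f e0 - (e - e0) * (deriv ^^ Suc n) f e0) <= (fact (n + 2) * B / (R / 4) ^ (n + 2)) * (norm (e - e0))\<^sup>2"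
proof -
 define K where "K = fact (n + 2) * B / (R / 4) ^ (n + 2)"
 have b: "norm ((deriv ^^ (n + 2)) f x) <= K" if "x \<in> ball 0 (R / 2)" for x
  unfolding K_def by (rule higher_deriv_bound[OF f that])
 have "norm ((deriv ^^ (n + 0)) f e - (\<Sum>i\<le>1. (deriv ^^ (n + i)) f e0 * (e - e0) ^ i / fact i)) <= K * norm (e - e0) ^ Suc 1 / fact 1"
 proof (rule complex_Taylor[of "ball 0 (R / 2)"])
  fix i x assume "x \<in> ball (0::complex) (R / 2)"
  then have "x \<in> ball 0 R" using norm_ge_zero[of x] by (simp del: norm_ge_zero)
  moreover have "(deriv ^^ (n + i)) f holomorphic_on ball 0 R" by (rule holomorphic_higher_deriv[OF f(1)]) simp
  ultimately have "((deriv ^^ (n + i)) f has_field_derivative deriv ((deriv ^^ (n + i)) f) x) (at x)"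
   by (intro holomorphic_derivI) auto
  then show "((deriv ^^ (n + i)) f has_field_derivative (deriv ^^ (n + Suc i)) f x) (at x within ball 0 (R / 2))"
   by (simp add: has_field_derivative_at_within)
 qed (use e b in auto)
 then show ?thesis by (simp add: K_def power2_eq_square algebra_simps)
qed

text \<open>Differentiation under the integral sign: the Taylor remainder at each \<open>s\<close>
  is at most a constant times \<open>norm h ^ 2 * w s\<close>, and integrating it against the kernel
  shows complex differentiability of the integral.\<close>

lemma lint_hsym:
 assumes f: "fam R w C f" and k: "bmeas k" "intg (\<lambda>s. abs (k s) * w s)"
 shows "hsym R (\<lambda>e. lint k (f e))"
 unfolding hsym_def
proof (intro conjI ballI)
 fix e :: complex assume e: "e \<in> ball 0 R"
 have "lint k (f (cnj e)) = (LINT s|lborel. cnj (cx (k s) * f e s))"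
  unfolding lint_def by (intro Bochner_Integration.integral_cong refl) (simp add: fam_cnj[OF f e])
 then show "lint k (f (cnj e)) = cnj (lint k (f e))" by (simp only: lint_def Bochner_Integration.integral_cnj)
next
 have "\<exists>D. ((\<lambda>e. lint k (f e)) has_field_derivative D) (at e0)" if e0: "e0 \<in> ball 0 R" for e0
 proof
  define r where "r = R - norm e0"
  have r: "r > 0" using e0 by (simp add: r_def)
  have inb: "e0 + h \<in> ball 0 R" if "h \<in> ball 0 r" for h
   using that norm_triangle_ineq[of e0 h] by (simp add: r_def)
  have hol: "(\<lambda>h. f (e0 + h) s) holomorphic_on ball 0 r" for s
  proof -
   have "((\<lambda>e. f e s) \<circ> (\<lambda>h. e0 + h)) holomorphic_on ball 0 r"
    by (rule holomorphic_on_compose_gen[OF _ fam_hol[OF f] image_subsetI[OF inb]]) (intro holomorphic_intros)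
   then show ?thesis by (simp only: o_def)
  qed
  have bd: "norm (f (e0 + h) s) <= C * w s" if "h \<in> ball 0 r" for h s by (rule fam_bound[OF f inb[OF that]])
  define D where "D s = deriv (\<lambda>h. f (e0 + h) s) 0" for s
  have Db: "norm (D s) <= C / (r / 4) * w s" for s
   using higher_deriv_bound[OF hol bd, of 0 1 s] r by (simp add: D_def ac_simps)
  define K where "K = 2 * C / (r / 4)\<^sup>2"
  have t: "norm (f (e0 + h) s - f e0 s - h * D s) <= K * (norm h)\<^sup>2 * w s" if "norm h < r / 2" for h s
   using higher_deriv_taylor[OF hol bd, of h 0 0 s] that r by (simp add: D_def K_def numeral_2_eq_2 ac_simps)
  have half: "h \<in> ball 0 r" if "norm h < r / 2" for h :: complex using that r by simp
  \<comment> \<open>The pointwise derivative is measurable as a limit of difference quotients, taken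
    along nonzero steps below \<open>r / 2\<close>.\<close>
  have [measurable]: "bmeas D"
  proof (rule borel_measurable_LIMSEQ_metric)
   define X where "X n = cx (r / (2 * real n + 3))" for n
   have Xn: "norm (X n) < r / 2" "X n \<noteq> 0" for n
    using r by (simp_all only: X_def norm_of_real of_real_eq_0_iff) (auto simp: field_simps abs_of_pos intro!: add_pos_nonneg)
   have X0: "X \<longlonglongrightarrow> 0"
   proof -
    have "(\<lambda>n. r / (2 * real n + 3)) \<longlonglongrightarrow> 0" by real_asymp
    then have "X \<longlonglongrightarrow> cx 0" unfolding X_def[abs_def] by (rule tendsto_of_real)
    then show ?thesis by simp
   qed
   show "(\<lambda>n. (f (e0 + X n) s - f e0 s) / X n) \<longlonglongrightarrow> D s" for s
   proof (rule LIM_zero_cancel, rule Lim_null_comparison[OF always_eventually], rule allI)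
    show "norm ((f (e0 + X n) s - f e0 s) / X n - D s) <= K * norm (X n) * w s" for n
    proof -
     have "(f (e0 + X n) s - f e0 s) / X n - D s = (f (e0 + X n) s - f e0 s - X n * D s) / X n"
      using Xn(2)[of n] by (simp add: field_simps)
     then show ?thesis using t[OF Xn(1)[of n], of s] Xn(2)[of n] by (simp add: norm_divide divide_le_eq power2_eq_square ac_simps)
    qed
    show "(\<lambda>n. K * norm (X n) * w s) \<longlonglongrightarrow> 0" using tendsto_norm[OF X0] by (intro tendsto_mult_left_zero tendsto_mult_right_zero) simp
   qed
   show "bmeas (\<lambda>s. (f (e0 + X n) s - f e0 s) / X n)" for n
    using fam_measurable[OF f inb[OF half[OF Xn(1)[of n]]]] fam_measurable[OF f e0] by measurable
  qed
  have i: "intg (\<lambda>s. cx (k s) * D s)" by (rule lint_bound(1)[OF _ Db k]) measurable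
  have l: "norm (lint k (f (e0 + h)) - lint k (f e0) - h * lint k D) <= K * (norm h)\<^sup>2 * (LINT s|lborel. abs (k s) * w s)"
   if h: "norm h < r / 2" for h
  proof -
   have "lint k (f (e0 + h)) - lint k (f e0) - h * lint k D = lint k (\<lambda>s. f (e0 + h) s - f e0 s - h * D s)"
    using i fam_lint_int[OF f inb[OF half[OF h]] k] fam_lint_int[OF f e0 k]
    by (simp add: lint_def right_diff_distrib mult.left_commute[of _ h])
   moreover have "bmeas (\<lambda>s. f (e0 + h) s - f e0 s - h * D s)"
    using fam_measurable[OF f inb[OF half[OF h]]] fam_measurable[OF f e0] by measurable
   ultimately show ?thesis using lint_bound(2)[OF _ t[OF h] k] by simp
  qed
  show "((\<lambda>e. lint k (f e)) has_field_derivative lint k D) (at e0)"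
   unfolding DERIV_def
  proof (rule LIM_zero_cancel, rule Lim_null_comparison)
   have "eventually (\<lambda>h::complex. h \<in> ball 0 (r / 2)) (at 0)" by (rule eventually_at_in_open') (use r in auto)
   moreover have "eventually (\<lambda>h::complex. h \<noteq> 0) (at 0)" by (simp add: eventually_at_filter)
   ultimately show "\<forall>\<^sub>F h in at 0. norm ((lint k (f (e0 + h)) - lint k (f e0)) / h - lint k D) <= K * (LINT s|lborel. abs (k s) * w s) * norm h"
   proof eventually_elim
    case (elim h)
    have "(lint k (f (e0 + h)) - lint k (f e0)) / h - lint k D = (lint k (f (e0 + h)) - lint k (f e0) - h * lint k D) / h"
     using elim(2) by (simp add: field_simps)
    then show ?case using l[of h] elim by (simp add: norm_divide divide_le_eq power2_eq_square ac_simps)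
   qed
   show "((\<lambda>h. K * (LINT s|lborel. abs (k s) * w s) * norm h) \<longlongrightarrow> 0) (at 0)" by (intro tendsto_mult_right_zero tendsto_norm_zero tendsto_ident_at)
  qed
 qed
 then show "(\<lambda>e. lint k (f e)) holomorphic_on ball 0 R"
  by (intro holomorphic_onI) (meson field_differentiable_def field_differentiable_at_within)
qed

text \<open>The bounds \<open>B n\<close> do not depend on the parameter, so the convergence is
  uniform and Weierstrass' theorem applies.\<close>

lemma hsym_limit:
 assumes g: "!!n. hsym R (g n)" and b: "!!n e. e \<in> ball 0 R ==> norm (g n e - h e) <= B n" and B: "B \<longlonglongrightarrow> 0"
 shows "hsym R h"
 unfolding hsym_def
proof (intro conjI ballI)
 show "h holomorphic_on ball 0 R"
 proof (rule holomorphic_uniform_sequence[OF open_ball])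
  show "g n holomorphic_on ball 0 R" for n using g by (simp add: hsym_def)
  fix x :: complex assume x: "x \<in> ball 0 R"
  then obtain d where d: "d > 0" "cball x d \<subseteq> ball 0 R" using open_contains_cball open_ball by blast
  have "uniform_limit (cball x d) g h sequentially"
  proof (rule uniform_limitI)
   fix t :: real assume "t > 0"
   then have "eventually (\<lambda>n. B n < t) sequentially" using B by (auto dest: order_tendstoD)
   then show "\<forall>\<^sub>F n in sequentially. \<forall>x\<in>cball x d. dist (g n x) (h x) < t"
   proof eventually_elim
    case (elim n)
    show ?case
    proof
     fix y assume "y \<in> cball x d"
     then have "y \<in> ball 0 R" using d by blast
     from b[OF this, of n] show "dist (g n y) (h y) < t" using elim by (simp add: dist_norm)
    qed
   qed
  qed
  then show "\<exists>d>0. cball x d \<subseteq> ball 0 R \<and> uniform_limit (cball x d) g h sequentially" using d by blast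
 qed
 fix e :: complex assume e: "e \<in> ball 0 R"
 have lim: "(\<lambda>n. g n e) \<longlonglongrightarrow> h e" if "e \<in> ball 0 R" for e :: complex
 proof -
  have "(\<lambda>n. g n e - h e) \<longlonglongrightarrow> 0"
   by (rule Lim_null_comparison[OF always_eventually B]) (use b[OF that] in blast)
  then show ?thesis by (simp add: LIM_zero_iff)
 qed
 have "(\<lambda>n. cnj (g n e)) \<longlonglongrightarrow> cnj (h e)" by (intro tendsto_cnj lim e)
 moreover have "(\<lambda>n. g n (cnj e)) \<longlonglongrightarrow> h (cnj e)" using e by (intro lim) simp
 moreover have "g n (cnj e) = cnj (g n e)" for n using g[of n] e by (simp add: hsym_def)
 ultimately show "h (cnj e) = cnj (h e)" by (simp add: LIMSEQ_unique)
qed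

section \<open>A contraction producing holomorphic branches\<close>

text \<open>Bounded linear maps on weighted families. Additivity is stated for differences of
  members of families, since the integral operators below are additive where their integrals
  converge.\<close>

definition opr :: "(real => real) => real => ((real => complex) => real => complex) => bool" where
 "opr w k L \<longleftrightarrow> k >= 0 \<and> (\<forall>R C f. C >= 0 \<longrightarrow> fam R w C f \<longrightarrow> fam R w (k * C) (\<lambda>e. L (f e))) \<and>
   (\<forall>R C D f g e. C >= 0 \<longrightarrow> D >= 0 \<longrightarrow> fam R w C f \<longrightarrow> fam R w D g \<longrightarrow> e \<in> ball 0 R \<longrightarrow>
    L (\<lambda>z. f e z - g e z) = (\<lambda>z. L (f e) z - L (g e) z))"

lemma opr_nonneg: "opr w k L ==> k >= 0"
 and opr_fam: "opr w k L ==> C >= 0 ==> fam R w C f ==> fam R w (k * C) (\<lambda>e. L (f e))"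
 and opr_diff: "opr w k L ==> C >= 0 ==> D >= 0 ==> fam R w C f ==> fam R w D g ==> e \<in> ball 0 R ==>
    L (\<lambda>z. f e z - g e z) = (\<lambda>z. L (f e) z - L (g e) z)"
 unfolding opr_def by blast+

lemma opr_comp: "opr w k L ==> opr w k' L' ==> opr w (k * k') (\<lambda>f. L (L' f))"
proof -
 assume L: "opr w k L" "opr w k' L'"
 show "opr w (k * k') (\<lambda>f. L (L' f))" unfolding opr_def
 proof (intro conjI allI impI)
  show "fam R w (k * k' * C) (\<lambda>e. L (L' (f e)))" if "C >= 0" "fam R w C f" for R C f
   using opr_fam[OF L(1) _ opr_fam[OF L(2) that]] opr_nonneg[OF L(2)] that(1) by (simp add: mult.assoc)
  fix R C D f g and e :: complex assume *: "0 <= C" "0 <= D" "fam R w C f" "fam R w D g" "e \<in> ball 0 R"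
  show "L (L' (\<lambda>z. f e z - g e z)) = (\<lambda>z. L (L' (f e)) z - L (L' (g e)) z)"
   using opr_diff[OF L(1) _ _ opr_fam[OF L(2) *(1,3)] opr_fam[OF L(2) *(2,4)] *(5)] opr_diff[OF L(2) *] opr_nonneg[OF L(2)] *(1,2)
   by simp
 qed (use opr_nonneg[OF L(1)] opr_nonneg[OF L(2)] in simp)
qed

lemma opr_add:
 assumes "opr w k L" "opr w k' L'" shows "opr w (k + k') (\<lambda>f z. L f z + L' f z)"
 unfolding opr_def
proof (intro conjI allI impI)
 show "fam R w ((k + k') * C) (\<lambda>e z. L (f e) z + L' (f e) z)" if "C >= 0" "fam R w C f" for R C f
  using fam_add[OF opr_fam[OF assms(1) that] opr_fam[OF assms(2) that]] by (simp add: distrib_right)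
qed (use opr_nonneg[OF assms(1)] opr_nonneg[OF assms(2)] opr_diff[OF assms(1)] opr_diff[OF assms(2)] in \<open>auto simp: fun_eq_iff\<close>)

lemma opr_mult:
 assumes L: "opr w k L" and s: "continuous_on UNIV s" "!!z. abs (s z) <= B" and w: "!!z. w z >= 0"
 shows "opr w (k * B) (\<lambda>f z. cx (s z) * L f z)"
 unfolding opr_def
proof (intro conjI allI impI)
 have B: "B >= 0" using order_trans[OF abs_ge_zero s(2)] .
 show "k * B >= 0" using opr_nonneg[OF L] B by simp
 show "fam R w (k * B * C) (\<lambda>e z. cx (s z) * L (f e) z)" if "C >= 0" "fam R w C f" for R C f
  using fam_mult_real[OF opr_fam[OF L that] s(1), of B w] mult_right_mono[OF s(2) w] that opr_nonneg[OF L]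
  by (simp add: ac_simps)
qed (use opr_diff[OF L] in \<open>auto simp: fun_eq_iff right_diff_distrib\<close>)

lemma power_diff_bound:
 fixes x y :: "'a::{real_normed_field}"
 assumes "norm x <= m" "norm y <= m"
 shows "norm (x ^ n - y ^ n) <= real n * m ^ (n - 1) * norm (x - y)"
proof (cases n)
 case (Suc j)
 have m: "m >= 0" using assms(1) norm_ge_zero order_trans by blast
 have "norm (\<Sum>p<Suc j. x ^ p * y ^ (j - p)) <= (\<Sum>p<Suc j. m ^ j)"
 proof (rule sum_norm_le)
  fix p assume "p \<in> {..<Suc j}"
  then have "m ^ p * m ^ (j - p) = m ^ j" by (simp flip: power_add)
  then show "norm (x ^ p * y ^ (j - p)) <= m ^ j"
   using mult_mono[of "norm x ^ p" "m ^ p" "norm y ^ (j - p)" "m ^ (j - p)"] assms m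
   by (simp add: norm_mult norm_power power_mono)
 qed
 then have "norm (x - y) * norm (\<Sum>p<Suc j. x ^ p * y ^ (j - p)) <= norm (x - y) * (real (Suc j) * m ^ j)"
  by (intro mult_left_mono) simp_all
 then show ?thesis using power_diff_sumr2[of x "Suc j" y] Suc by (simp add: norm_mult ac_simps del: of_nat_Suc sum.lessThan_Suc)
qed simp

text \<open>The reduced problem in abstract form: find \<open>\<mu>\<close> and \<open>f\<close>
  with \<open>f = \<mu>^2 A0 + B0 + e Xi\<close> and \<open>lint q f = 0\<close>. By the assumptions
  \<open>A\<close> the orthogonality reads \<open>A (\<mu>^2 - m0^2) = O(e)\<close>, so
  \<open>m0\<close> is the wanted value of \<open>\<mu>\<close> at \<open>e = 0\<close>.\<close>

locale branch =
 fixes w :: "real => real" and N :: nat and a b :: "nat => nat" and s :: "nat => real => real"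
  and L :: "nat => (real => complex) => real => complex" and k :: "nat => real"
  and A0 B0 q :: "real => real" and S A m0 :: real
 assumes w: "continuous_on UNIV w" "!!z. w z > 0"
  and L: "!!i. i < N ==> opr w (k i) (L i)"
  and sc: "!!i. i < N ==> continuous_on UNIV (s i)" and sb: "!!i z. i < N ==> abs (s i z) <= S * w z"
  and A0: "continuous_on UNIV A0" "!!z. abs (A0 z) <= S * w z"
  and B0: "continuous_on UNIV B0" "!!z. abs (B0 z) <= S * w z"
  and q: "bmeas q" "intg (\<lambda>s. abs (q s) * w s)"
  and A: "lint q (\<lambda>z. cx (A0 z)) = cx A" "lint q (\<lambda>z. cx (B0 z)) = cx (- A * m0\<^sup>2)" "A \<noteq> 0"
  and m0: "m0 > 0" and S: "S >= 0"
begin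

definition Xi :: "complex => complex => (real => complex) => real => complex" where
 "Xi e \<mu> f z = (\<Sum>i<N. e ^ a i * \<mu> ^ b i * (cx (s i z) + L i f z))"

definition Fx :: "complex => complex => (real => complex) => real => complex" where
 "Fx e \<mu> f z = \<mu>\<^sup>2 * cx (A0 z) + cx (B0 z) + e * Xi e \<mu> f z"

text \<open>A Newton step for the orthogonality condition, its derivative frozen at the value
  \<open>2 * A * m0\<close> taken for \<open>e = 0\<close> and \<open>\<mu> = m0\<close>.\<close>

definition Mx :: "complex => complex => (real => complex) => complex" where
 "Mx e \<mu> f = \<mu> - lint q (Fx e \<mu> f) / cx (2 * A * m0)"

definition "qb = (LINT s|lborel. abs (q s) * w s)"
definition "mm = 2 * m0"
definition "X1 Cf = (\<Sum>i<N. mm ^ b i * (S + k i * Cf))"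
definition "Y1 Cf = (\<Sum>i<N. real (b i) * mm ^ (b i - 1) * (S + k i * Cf))"
definition "Y2 = (\<Sum>i<N. mm ^ b i * k i)"

lemma w0: "w z >= 0" using w(2)[of z] by simp

lemma kn: "i < N ==> k i >= 0" using L opr_nonneg by blast

lemma mm0: "mm > 0" using m0 by (simp add: mm_def)

lemma qb0: "qb >= 0" unfolding qb_def by (intro Bochner_Integration.integral_nonneg) (simp add: w0)

lemma term_fam:
 assumes f: "fam R w Cf f" "Cf >= 0" and i: "i < N"
 shows "fam R w (S + k i * Cf) (\<lambda>e z. cx (s i z) + L i (f e) z)"
 by (intro fam_add fam_real sc sb opr_fam[OF L] f i)

lemma Xi_fam:
 assumes f: "fam R w Cf f" "Cf >= 0" and mu: "hsym R mu" "!!e. e \<in> ball 0 R ==> norm (mu e) <= mm" and R: "R <= 1"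
 shows "fam R w (X1 Cf) (\<lambda>e. Xi e (mu e) (f e))"
proof -
 have t: "fam R w (mm ^ b i * (S + k i * Cf)) (\<lambda>e z. (e ^ a i * mu e ^ b i) * (cx (s i z) + L i (f e) z))" if i: "i < N" for i
 proof (rule fam_scale[OF term_fam[OF f i]])
  show "hsym R (\<lambda>e. e ^ a i * mu e ^ b i)" by (intro hsym_mult hsym_power hsym_ident mu)
  show "norm (e ^ a i * mu e ^ b i) <= mm ^ b i" if e: "e \<in> ball 0 R" for e
  proof -
   have "norm e ^ a i <= 1" using e R by (intro power_le_one) auto
   moreover have "norm (mu e) ^ b i <= mm ^ b i" by (intro power_mono mu e) simp
   ultimately show ?thesis using mult_mono[of "norm e ^ a i" 1 "norm (mu e) ^ b i" "mm ^ b i"]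
    by (simp add: norm_mult norm_power)
  qed
 qed (use mm0 in simp)
 have "fam R w (\<Sum>i<n. mm ^ b i * (S + k i * Cf)) (\<lambda>e z. \<Sum>i<n. (e ^ a i * mu e ^ b i) * (cx (s i z) + L i (f e) z))" if "n <= N" for n
  using that
 proof (induction n)
  case 0
  show ?case by (simp add: fam_def hsym_def)
 next
  case (Suc n)
  then show ?case using fam_add[OF Suc.IH t[of n]] by simp
 qed
 from this[of N] show ?thesis by (simp add: X1_def Xi_def[abs_def])
qed

lemma Xi_lip:
 assumes f: "fam R w Cf f" "fam R w Cf f'" "Cf >= 0" and d: "fam R w d (\<lambda>e z. f e z - f' e z)" "d >= 0"
  and e: "e \<in> ball 0 R" "R <= 1" and mu: "norm \<mu> <= mm" "norm \<mu>' <= mm"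
 shows "norm (Xi e \<mu> (f e) z - Xi e \<mu>' (f' e) z) <= (Y1 Cf * norm (\<mu> - \<mu>') + Y2 * d) * w z"
proof -
 have "norm (Xi e \<mu> (f e) z - Xi e \<mu>' (f' e) z) = norm (\<Sum>i<N. e ^ a i * ((\<mu> ^ b i - \<mu>' ^ b i) * (cx (s i z) + L i (f e) z) + \<mu>' ^ b i * (L i (f e) z - L i (f' e) z)))"
  unfolding Xi_def sum_subtractf[symmetric] by (intro arg_cong[where f = norm] sum.cong refl) (simp add: algebra_simps)
 also have "\<dots> <= (\<Sum>i<N. (real (b i) * mm ^ (b i - 1) * (S + k i * Cf) * norm (\<mu> - \<mu>') + mm ^ b i * k i * d) * w z)"
 proof (rule sum_norm_le)
  fix i assume "i \<in> {..<N}"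
  then have i: "i < N" by simp
  have 1: "norm (cx (s i z) + L i (f e) z) <= (S + k i * Cf) * w z" by (rule fam_bound[OF term_fam[OF f(1,3) i] e(1)])
  have 2: "norm (L i (f e) z - L i (f' e) z) <= (k i * d) * w z"
   using fam_bound[OF opr_fam[OF L[OF i] d(2,1)] e(1), of z] opr_diff[OF L[OF i] f(3,3) f(1,2) e(1)] by simp
  have 3: "norm e ^ a i <= 1" using e by (intro power_le_one) auto
  have Sk: "0 <= S + k i * Cf" using S kn[OF i] f(3) by simp
  have "norm ((\<mu> ^ b i - \<mu>' ^ b i) * (cx (s i z) + L i (f e) z)) <= (real (b i) * mm ^ (b i - 1) * norm (\<mu> - \<mu>')) * ((S + k i * Cf) * w z)"
   unfolding norm_mult by (intro mult_mono power_diff_bound mu 1) (use mm0 in auto)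
  moreover have "norm (\<mu>' ^ b i * (L i (f e) z - L i (f' e) z)) <= mm ^ b i * ((k i * d) * w z)"
   unfolding norm_mult norm_power by (intro mult_mono power_mono mu 2) (use mm0 in auto)
  ultimately have "norm ((\<mu> ^ b i - \<mu>' ^ b i) * (cx (s i z) + L i (f e) z) + \<mu>' ^ b i * (L i (f e) z - L i (f' e) z))
   <= (real (b i) * mm ^ (b i - 1) * (S + k i * Cf) * norm (\<mu> - \<mu>') + mm ^ b i * k i * d) * w z" (is "?l <= ?r")
   by (intro order_trans[OF norm_triangle_ineq]) (simp add: algebra_simps)
  then have "norm e ^ a i * ?l <= 1 * ?r" using 3 by (intro mult_mono) auto
  then show "norm (e ^ a i * ((\<mu> ^ b i - \<mu>' ^ b i) * (cx (s i z) + L i (f e) z) + \<mu>' ^ b i * (L i (f e) z - L i (f' e) z)))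
   <= (real (b i) * mm ^ (b i - 1) * (S + k i * Cf) * norm (\<mu> - \<mu>') + mm ^ b i * k i * d) * w z"
   by (simp only: norm_mult[of "e ^ a i"] norm_power mult_1)
 qed
 also have "\<dots> = (Y1 Cf * norm (\<mu> - \<mu>') + Y2 * d) * w z"
  by (simp add: Y1_def Y2_def sum_distrib_right sum.distrib flip: sum_distrib_right)
 finally show ?thesis .
qed

lemma Fx_fam:
 assumes f: "fam R w Cf f" "Cf >= 0" and mu: "hsym R mu" "!!e. e \<in> ball 0 R ==> norm (mu e) <= mm" and R: "R <= 1" "R >= 0"
 shows "fam R w (mm\<^sup>2 * S + S + R * X1 Cf) (\<lambda>e. Fx e (mu e) (f e))"
 unfolding Fx_def
proof (intro fam_add)
 show "fam R w (mm\<^sup>2 * S) (\<lambda>e z. (mu e)\<^sup>2 * cx (A0 z))"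
  by (rule fam_scale[OF fam_real]) (use A0 mu in \<open>auto intro!: hsym_power power_mono simp: norm_power\<close>)
 show "fam R w S (\<lambda>e z. cx (B0 z))" by (rule fam_real[OF B0])
 show "fam R w (R * X1 Cf) (\<lambda>e z. e * Xi e (mu e) (f e) z)"
  by (rule fam_scale[OF Xi_fam[OF f mu R(1)] hsym_ident]) (use R in auto)
qed

lemma lint_Fx:
 assumes f: "fam R w Cf f" "Cf >= 0" and mu: "hsym R mu" "!!e. e \<in> ball 0 R ==> norm (mu e) <= mm" and R: "R <= 1" and e: "e \<in> ball 0 R"
 shows "lint q (Fx e (mu e) (f e)) = cx A * ((mu e)\<^sup>2 - cx (m0\<^sup>2)) + e * lint q (Xi e (mu e) (f e))"
proof -
 have i1: "intg (\<lambda>z. cx (q z) * cx (A0 z))" "intg (\<lambda>z. cx (q z) * cx (B0 z))"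
  using fam_lint_int[OF fam_real[OF A0] e q]
   fam_lint_int[OF fam_real[OF B0] e q] by auto
 have i2: "intg (\<lambda>z. cx (q z) * Xi e (mu e) (f e) z)"
  by (rule fam_lint_int[OF Xi_fam[OF f mu R] e q])
 have "lint q (Fx e (mu e) (f e)) = (LINT z|lborel. (mu e)\<^sup>2 * (cx (q z) * cx (A0 z)) + cx (q z) * cx (B0 z) + e * (cx (q z) * Xi e (mu e) (f e) z))"
  unfolding lint_def Fx_def by (intro Bochner_Integration.integral_cong refl) (simp add: algebra_simps)
 also have "\<dots> = (mu e)\<^sup>2 * lint q (\<lambda>z. cx (A0 z)) + lint q (\<lambda>z. cx (B0 z)) + e * lint q (Xi e (mu e) (f e))"
  using i1 i2 by (simp add: lint_def)
 finally show ?thesis by (simp add: A algebra_simps)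
qed

definition "Cf0 = mm\<^sup>2 * S + S + 1"
definition "NN = 4 * (2 * mm * S) + 2"
definition "rr = m0 / 4"
definition "KK = qb / (2 * abs A * m0)"
text \<open>The entries match the inequalities of lemma \<open>R0\<close>: a parameter of modulus
  below 1, invariance of the bound on \<open>f\<close>, invariance of the disc for
  \<open>\<mu>\<close>, and two contraction estimates. The added ones in the denominators avoid
  division by zero.\<close>

definition "R0 = Min {1, 1 / (X1 Cf0 + 1), rr / (2 * (KK * X1 Cf0 + 1)), 1 / (Y1 Cf0 + Y2 * NN + 1), 1 / (4 * (KK * (Y1 Cf0 + Y2 * NN) + 1))}"

lemma cfacts: "X1 Cf0 >= 0" "Y1 Cf0 >= 0" "Y2 >= 0" "NN >= 2" "rr > 0" "KK >= 0" "Cf0 >= 1"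
proof -
 show C: "Cf0 >= 1" using S by (simp add: Cf0_def)
 show "X1 Cf0 >= 0" "Y1 Cf0 >= 0" "Y2 >= 0" unfolding X1_def Y1_def Y2_def
  using C S kn mm0 by (auto intro!: sum_nonneg mult_nonneg_nonneg add_nonneg_nonneg)
 show "NN >= 2" using mm0 S by (simp add: NN_def)
 show "rr > 0" using m0 by (simp add: rr_def)
 show "KK >= 0" using qb0 m0 by (simp add: KK_def)
qed

lemma R0: "R0 > 0" "R0 <= 1" "R0 * X1 Cf0 <= 1" "R0 * (KK * X1 Cf0) <= rr / 2" "R0 * (Y1 Cf0 + Y2 * NN) <= 1"
 "R0 * (KK * (Y1 Cf0 + Y2 * NN)) <= 1 / 4"
proof -
 note c = cfacts
 have YN: "0 <= Y1 Cf0 + Y2 * NN" using c by (intro add_nonneg_nonneg mult_nonneg_nonneg) auto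
 have K1: "0 <= KK * X1 Cf0" "0 <= KK * (Y1 Cf0 + Y2 * NN)" using c YN by auto
 show R: "R0 > 0" using c YN K1 by (auto simp: R0_def intro!: divide_pos_pos add_nonneg_pos mult_nonneg_nonneg)
 have le: "R0 <= 1" "R0 <= 1 / (X1 Cf0 + 1)" "R0 <= rr / (2 * (KK * X1 Cf0 + 1))" "R0 <= 1 / (Y1 Cf0 + Y2 * NN + 1)" 
  "R0 <= 1 / (4 * (KK * (Y1 Cf0 + Y2 * NN) + 1))" unfolding R0_def by (intro Min_le; simp)+
 show "R0 <= 1" by (rule le)
 have g: "R0 * x <= t" if "R0 <= t / (x + 1)" "x >= 0" for x t :: real
 proof -
  have "R0 * (x + 1) <= t" using that by (simp add: pos_le_divide_eq)
  then show ?thesis using R by (simp add: distrib_left)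
 qed
 show "R0 * X1 Cf0 <= 1" by (rule g[OF le(2) c(1)])
 show "R0 * (KK * X1 Cf0) <= rr / 2" by (rule g[OF _ K1(1)]) (use le(3) in \<open>simp add: divide_divide_eq_left\<close>)
 show "R0 * (Y1 Cf0 + Y2 * NN) <= 1" by (rule g[OF le(4) YN])
 show "R0 * (KK * (Y1 Cf0 + Y2 * NN)) <= 1 / 4" by (rule g[OF _ K1(2)]) (use le(5) in \<open>simp add: divide_divide_eq_left\<close>)
qed

definition invar where
 "invar mu f \<longleftrightarrow> fam R0 w Cf0 f \<and> hsym R0 mu \<and> (\<forall>e\<in>ball 0 R0. norm (mu e - cx m0) <= rr)"

lemma invar_mm: "invar mu f ==> e \<in> ball 0 R0 ==> norm (mu e) <= mm"
 using norm_triangle_ineq[of "mu e - cx m0" "cx m0"] m0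
 by (force simp: invar_def rr_def mm_def)

lemma newton_id:
 fixes mu mu' :: complex
 assumes "f1 = cx A * (mu\<^sup>2 - cx (m0\<^sup>2)) + y1" "f2 = cx A * (mu'\<^sup>2 - cx (m0\<^sup>2)) + y2"
 shows "(mu - f1 / cx (2 * A * m0)) - (mu' - f2 / cx (2 * A * m0)) =
  (mu - mu') * ((cx m0 - mu + (cx m0 - mu')) / cx (2 * m0)) - (y1 - y2) / cx (2 * A * m0)"
 using A(3) m0 unfolding assms by (simp add: field_simps power2_eq_square)

lemma newton_bound:
 fixes mu mu' :: complex
 assumes "norm (mu - cx m0) <= rr" "norm (mu' - cx m0) <= rr"
 shows "norm ((mu - mu') * ((cx m0 - mu + (cx m0 - mu')) / cx (2 * m0))) <= norm (mu - mu') / 4"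
proof -
 have "norm (cx m0 - mu + (cx m0 - mu')) <= rr + rr"
  using assms by (intro order_trans[OF norm_triangle_ineq] add_mono) (simp_all add: norm_minus_commute)
 then have "norm ((cx m0 - mu + (cx m0 - mu')) / cx (2 * m0)) <= 1 / 4"
  using m0 by (simp add: norm_divide rr_def field_simps)
 from mult_left_mono[OF this norm_ge_zero[of "mu - mu'"]]
 have "norm (mu - mu') * norm ((cx m0 - mu + (cx m0 - mu')) / cx (2 * m0)) <= norm (mu - mu') / 4" by simp
 then show ?thesis by (simp only: norm_mult[of "mu - mu'"])
qed

lemma lint_le:
 assumes "fam R w C f" "e \<in> ball 0 R" shows "norm (lint q (f e)) <= C * qb"
 unfolding qb_def by (rule lint_bound(2)[OF fam_measurable[OF assms] fam_bound[OF assms] q])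

lemma invar_step:
 assumes i: "invar mu f"
 shows "invar (\<lambda>e. Mx e (mu e) (f e)) (\<lambda>e. Fx e (mu e) (f e))"
proof -
 have f: "fam R0 w Cf0 f" and mu: "hsym R0 mu" "!!e. e \<in> ball 0 R0 ==> norm (mu e) <= mm"
  and mr: "!!e. e \<in> ball 0 R0 ==> norm (mu e - cx m0) <= rr"
  using i invar_mm[OF i] by (auto simp: invar_def)
 have C0: "Cf0 >= 0" using cfacts(7) by simp
 note Ff = Fx_fam[OF f C0 mu R0(2) less_imp_le[OF R0(1)]]
 have F: "fam R0 w Cf0 (\<lambda>e. Fx e (mu e) (f e))"
  by (rule fam_mono[OF Ff]) (use R0(3) w0 in \<open>auto simp: Cf0_def\<close>)
 have h: "hsym R0 (\<lambda>e. Mx e (mu e) (f e))"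
  unfolding Mx_def divide_inverse of_real_inverse[symmetric]
  by (intro hsym_diff hsym_mult hsym_const mu lint_hsym[OF Ff q])
 have "norm (Mx e (mu e) (f e) - cx m0) <= rr" if e: "e \<in> ball 0 R0" for e
 proof -
  have l: "norm (lint q (Xi e (mu e) (f e))) <= X1 Cf0 * qb" by (rule lint_le[OF Xi_fam[OF f C0 mu R0(2)] e])
  have "norm (e * lint q (Xi e (mu e) (f e)) / cx (2 * A * m0)) <= R0 * (KK * X1 Cf0)"
  proof -
   have "norm (e * lint q (Xi e (mu e) (f e))) <= R0 * (X1 Cf0 * qb)"
    unfolding norm_mult using e l R0(1) by (intro mult_mono) auto
   then have "norm (e * lint q (Xi e (mu e) (f e))) / (2 * abs A * m0) <= (R0 * (X1 Cf0 * qb)) / (2 * abs A * m0)"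
    using m0 by (intro divide_right_mono) auto
   then show ?thesis using m0 by (simp add: norm_divide KK_def norm_mult abs_mult field_simps)
  qed
  also have "\<dots> <= rr / 2" by (rule R0(4))
  finally have 1: "norm (e * lint q (Xi e (mu e) (f e)) / cx (2 * A * m0)) <= rr / 2" .
  have "Mx e (mu e) (f e) - cx m0 = (mu e - cx m0) * ((cx m0 - mu e + (cx m0 - cx m0)) / cx (2 * m0)) - (e * lint q (Xi e (mu e) (f e)) - 0) / cx (2 * A * m0)"
   using newton_id[OF lint_Fx[OF f C0 mu R0(2) e], of 0 "cx m0" 0] unfolding Mx_def by simp
  then have "norm (Mx e (mu e) (f e) - cx m0) <= norm ((mu e - cx m0) * ((cx m0 - mu e + (cx m0 - cx m0)) / cx (2 * m0))) + norm (e * lint q (Xi e (mu e) (f e)) / cx (2 * A * m0))"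
   using norm_triangle_ineq4 by (metis diff_zero)
  also have "\<dots> <= norm (mu e - cx m0) / 4 + rr / 2"
   using newton_bound[OF mr[OF e], of "cx m0"] cfacts(5) 1 by (intro add_mono) auto
  also have "\<dots> <= rr" using mr[OF e] cfacts(5) by simp
  finally show ?thesis .
 qed
 with F h show ?thesis by (simp add: invar_def)
qed

definition cl where
 "cl E mu f mu' f' \<longleftrightarrow> (\<forall>e\<in>ball 0 R0. norm (mu e - mu' e) <= E \<and> (\<forall>z. norm (f e z - f' e z) <= (NN * E) * w z))"

text \<open>The error in \<open>\<mu>\<close> is halved as two quarters, one from the Newton slope
  and one from the choice of \<open>R0\<close>. The error in \<open>f\<close> is halved because the
  new \<open>f\<close> depends on the old one only through a term with the factor
  \<open>e\<close>.\<close>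

lemma cl_step:
 assumes i: "invar mu f" "invar mu' f'" and c: "cl E mu f mu' f'" and E: "E >= 0"
 shows "cl (E / 2) (\<lambda>e. Mx e (mu e) (f e)) (\<lambda>e. Fx e (mu e) (f e)) (\<lambda>e. Mx e (mu' e) (f' e)) (\<lambda>e. Fx e (mu' e) (f' e))"
 unfolding cl_def
proof (intro ballI conjI allI)
 fix e :: complex assume e: "e \<in> ball 0 R0"
 have f: "fam R0 w Cf0 f" "fam R0 w Cf0 f'" and mu: "hsym R0 mu" "hsym R0 mu'" "!!e. e \<in> ball 0 R0 ==> norm (mu e) <= mm" "!!e. e \<in> ball 0 R0 ==> norm (mu' e) <= mm"
  and mr: "norm (mu e - cx m0) <= rr" "norm (mu' e - cx m0) <= rr"
  using i invar_mm[OF i(1)] invar_mm[OF i(2)] e by (auto simp: invar_def)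
 have C0: "Cf0 >= 0" using cfacts(7) by simp
 have NE: "NN * E >= 0" using cfacts(4) E by simp
 have d: "fam R0 w (NN * E) (\<lambda>e z. f e z - f' e z)"
  using fam_diff[OF f] c unfolding fam_def cl_def by blast
 have dm: "norm (mu e - mu' e) <= E" using c e by (simp add: cl_def)
 have X: "norm (Xi e (mu e) (f e) z - Xi e (mu' e) (f' e) z) <= ((Y1 Cf0 + Y2 * NN) * E) * w z" for z
 proof -
  have "Y1 Cf0 * norm (mu e - mu' e) + Y2 * (NN * E) <= Y1 Cf0 * E + Y2 * (NN * E)"
   using dm cfacts(2) by (simp add: mult_left_mono)
  then have "(Y1 Cf0 * norm (mu e - mu' e) + Y2 * (NN * E)) * w z <= ((Y1 Cf0 + Y2 * NN) * E) * w z"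
   using w0 by (intro mult_right_mono) (auto simp: algebra_simps)
  then show ?thesis using Xi_lip[OF f C0 d NE e R0(2) mu(3)[OF e] mu(4)[OF e], of z] by linarith
 qed
 note xf = Xi_fam[OF f(1) C0 mu(1,3) R0(2)] Xi_fam[OF f(2) C0 mu(2,4) R0(2)]
 show "norm (Mx e (mu e) (f e) - Mx e (mu' e) (f' e)) <= E / 2"
 proof -
  have "lint q (Xi e (mu e) (f e)) - lint q (Xi e (mu' e) (f' e)) = lint q (\<lambda>z. Xi e (mu e) (f e) z - Xi e (mu' e) (f' e) z)"
   using fam_lint_int[OF xf(1) e q] fam_lint_int[OF xf(2) e q]
   by (simp add: lint_def right_diff_distrib)
  moreover have "norm (lint q (\<lambda>z. Xi e (mu e) (f e) z - Xi e (mu' e) (f' e) z)) <= ((Y1 Cf0 + Y2 * NN) * E) * qb"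
   unfolding qb_def using fam_measurable[OF fam_diff[OF xf] e] by (intro lint_bound(2) X q)
  ultimately have l: "norm (lint q (Xi e (mu e) (f e)) - lint q (Xi e (mu' e) (f' e))) <= ((Y1 Cf0 + Y2 * NN) * E) * qb" by simp
  have "norm ((e * lint q (Xi e (mu e) (f e)) - e * lint q (Xi e (mu' e) (f' e))) / cx (2 * A * m0)) <= (R0 * (((Y1 Cf0 + Y2 * NN) * E) * qb)) / (2 * abs A * m0)"
  proof -
   have "norm (e * (lint q (Xi e (mu e) (f e)) - lint q (Xi e (mu' e) (f' e)))) <= R0 * (((Y1 Cf0 + Y2 * NN) * E) * qb)"
    unfolding norm_mult using e l R0(1) by (intro mult_mono) auto
   then have "norm (e * (lint q (Xi e (mu e) (f e)) - lint q (Xi e (mu' e) (f' e)))) / (2 * abs A * m0) <= R0 * (((Y1 Cf0 + Y2 * NN) * E) * qb) / (2 * abs A * m0)"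
    using m0 by (intro divide_right_mono) auto
   then show ?thesis using m0 by (simp add: norm_divide norm_mult abs_mult right_diff_distrib[symmetric])
  qed
  also have "\<dots> = (R0 * (KK * (Y1 Cf0 + Y2 * NN))) * E" by (simp add: KK_def field_simps)
  also have "\<dots> <= 1 / 4 * E" by (intro mult_right_mono R0(6) E)
  finally have 2: "norm ((e * lint q (Xi e (mu e) (f e)) - e * lint q (Xi e (mu' e) (f' e))) / cx (2 * A * m0)) <= 1 / 4 * E" .
  have 1: "norm ((mu e - mu' e) * ((cx m0 - mu e + (cx m0 - mu' e)) / cx (2 * m0))) <= 1 / 4 * E"
   using newton_bound[OF mr] dm by linarith
  show ?thesis unfolding Mx_def
   using newton_id[OF lint_Fx[OF f(1) C0 mu(1,3) R0(2) e] lint_Fx[OF f(2) C0 mu(2,4) R0(2) e]]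
    order_trans[OF norm_triangle_ineq4 add_mono[OF 1 2]] by simp
 qed
 show "norm (Fx e (mu e) (f e) z - Fx e (mu' e) (f' e) z) <= NN * (E / 2) * w z" for z
 proof -
  have "norm (((mu e)\<^sup>2 - (mu' e)\<^sup>2) * cx (A0 z)) <= (2 * mm * E) * (S * w z)"
  proof -
   have "norm ((mu e)\<^sup>2 - (mu' e)\<^sup>2) <= 2 * mm * norm (mu e - mu' e)"
    using power_diff_bound[OF mu(3)[OF e] mu(4)[OF e], of 2] by simp
   also have "\<dots> <= 2 * mm * E" using dm mm0 by (intro mult_left_mono) auto
   finally show ?thesis unfolding norm_mult using A0(2)[of z] mm0 E by (intro mult_mono) auto
  qed
  moreover have "norm (e * (Xi e (mu e) (f e) z - Xi e (mu' e) (f' e) z)) <= E * w z"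
  proof -
   have "norm (e * (Xi e (mu e) (f e) z - Xi e (mu' e) (f' e) z)) <= R0 * (((Y1 Cf0 + Y2 * NN) * E) * w z)"
    unfolding norm_mult using e X[of z] R0(1) by (intro mult_mono) auto
   also have "\<dots> = (R0 * (Y1 Cf0 + Y2 * NN)) * (E * w z)" by simp
   also have "\<dots> <= 1 * (E * w z)" using E w0 by (intro mult_right_mono R0(5)) auto
   finally show ?thesis by simp
  qed
  moreover have "Fx e (mu e) (f e) z - Fx e (mu' e) (f' e) z = ((mu e)\<^sup>2 - (mu' e)\<^sup>2) * cx (A0 z) + e * (Xi e (mu e) (f e) z - Xi e (mu' e) (f' e) z)"
   by (simp add: Fx_def algebra_simps)
  ultimately have "norm (Fx e (mu e) (f e) z - Fx e (mu' e) (f' e) z) <= (2 * mm * E) * (S * w z) + E * w z"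
   using norm_triangle_le add_mono by metis
  also have "\<dots> <= NN * (E / 2) * w z"
  proof -
   have "0 <= mm * E * S * w z" using mm0 E S w0 by (intro mult_nonneg_nonneg) auto
   then show ?thesis by (simp add: NN_def algebra_simps)
  qed
  finally show ?thesis .
 qed
qed

definition it :: "nat => (complex => complex) \<times> (complex => real => complex)" where
 "it n = ((\<lambda>(mu, f). (\<lambda>e. Mx e (mu e) (f e), \<lambda>e. Fx e (mu e) (f e))) ^^ n) (\<lambda>e. cx m0, \<lambda>e z. 0)"

lemma it_Suc: "fst (it (Suc n)) = (\<lambda>e. Mx e (fst (it n) e) (snd (it n) e))" "snd (it (Suc n)) = (\<lambda>e. Fx e (fst (it n) e) (snd (it n) e))"
 by (simp_all add: it_def case_prod_beta')

lemma it_invar: "invar (fst (it n)) (snd (it n))"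
proof (induction n)
 case 0
 have "fam R0 w Cf0 (\<lambda>e z. 0)" using cfacts(7) w0 by (auto simp: fam_def hsym_def intro!: mult_nonneg_nonneg)
 then show ?case using cfacts(5) by (auto simp: it_def invar_def intro: hsym_const)
next
 case (Suc n)
 then show ?case unfolding it_Suc by (rule invar_step)
qed

definition "EE = 2 * rr + 2 * Cf0"

lemma it_cl: "cl (EE * (1/2) ^ n) (fst (it (Suc n))) (snd (it (Suc n))) (fst (it n)) (snd (it n))"
proof (induction n)
 case 0
 show ?case unfolding cl_def
 proof (intro ballI conjI allI)
  fix e :: complex assume e: "e \<in> ball 0 R0"
  show "norm (fst (it (Suc 0)) e - fst (it 0) e) <= EE * (1/2) ^ 0"
  proof -
   have "norm (fst (it (Suc 0)) e - cx m0) <= rr" using it_invar[of "Suc 0"] e unfolding invar_def by blast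
   moreover have "fst (it 0) e = cx m0" by (simp add: it_def)
   moreover have "rr <= EE" using cfacts(5,7) by (simp add: EE_def)
   ultimately show ?thesis by simp
  qed
  fix z
  have "norm (snd (it (Suc 0)) e z) <= Cf0 * w z" using it_invar[of "Suc 0"] e fam_bound by (auto simp: invar_def)
  also have "\<dots> <= (NN * EE) * w z"
  proof (rule mult_right_mono[OF _ w0])
   have "2 * Cf0 <= NN * EE" using cfacts by (intro mult_mono) (auto simp: EE_def)
   then show "Cf0 <= NN * EE" using cfacts(7) by linarith
  qed
  finally show "norm (snd (it (Suc 0)) e z - snd (it 0) e z) <= (NN * (EE * (1/2) ^ 0)) * w z"
   by (simp add: it_def)
 qed
next
 case (Suc n)
 have "0 <= EE * (1/2) ^ n" using cfacts by (simp add: EE_def)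
 from cl_step[OF it_invar it_invar Suc.IH this, folded it_Suc] show ?case by (simp add: field_simps)
qed

text \<open>The explicit rate, rather than bare convergence, later makes the pointwise limits
  uniform in the parameter and relative to \<open>w\<close>.\<close>

lemma geometric_limit:
 fixes x :: "nat => complex"
 assumes "!!n. norm (x (Suc n) - x n) <= E * (1/2) ^ n"
 shows "\<exists>l. \<forall>n. norm (x n - l) <= 2 * E * (1/2) ^ n"
proof -
 have E: "E >= 0" using order_trans[OF norm_ge_zero assms[of 0]] by simp
 have b: "norm (x (n + j) - x n) <= 2 * E * (1/2) ^ n - 2 * E * (1/2) ^ (n + j)" for n j
 proof (induction j)
  case (Suc j)
  have "norm (x (n + Suc j) - x n) <= norm (x (n + j) - x n) + norm (x (Suc (n + j)) - x (n + j))"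
   using norm_triangle_ineq[of "x (n + j) - x n" "x (Suc (n + j)) - x (n + j)"] by simp
  then show ?case using Suc assms[of "n + j"] by (simp add: power_add)
 qed simp
 have b': "norm (x (n + j) - x n) <= 2 * E * (1/2) ^ n" for n j
 proof -
  have "0 <= 2 * E * (1/2) ^ (n + j)" using E by simp
  then show ?thesis using b[of n j] by linarith
 qed
 have lim0: "(\<lambda>n. 2 * E * (1/2) ^ n) \<longlonglongrightarrow> 0"
  by (intro tendsto_mult_right_zero LIMSEQ_power_zero) simp
 have "Cauchy x"
 proof (rule metric_CauchyI)
  fix t :: real assume "t > 0"
  then obtain M where M: "!!n. n >= M ==> 2 * E * (1/2) ^ n < t / 2"
   using order_tendstoD(2)[OF lim0, of "t / 2"] by (auto simp: eventually_sequentially)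
  have "dist (x i) (x j) < t" if "i >= M" "j >= M" for i j
  proof -
   have "norm (x i - x M) < t / 2" "norm (x j - x M) < t / 2"
    using b'[of M "i - M"] b'[of M "j - M"] M[of M] that by auto
   then show ?thesis using norm_triangle_ineq4[of "x i - x M" "x j - x M"] by (simp add: dist_norm)
  qed
  then show "\<exists>M. \<forall>m\<ge>M. \<forall>n\<ge>M. dist (x m) (x n) < t" by blast
 qed
 then obtain l where l: "x \<longlonglongrightarrow> l" using Cauchy_convergent_iff convergent_def by blast
 have "norm (x n - l) <= 2 * E * (1/2) ^ n" for n
 proof (rule tendsto_upperbound)
  show "(\<lambda>j. norm (x n - x (j + n))) \<longlonglongrightarrow> norm (x n - l)"
   by (intro tendsto_norm tendsto_diff tendsto_const LIMSEQ_ignore_initial_segment l)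
  show "eventually (\<lambda>j. norm (x n - x (j + n)) <= 2 * E * (1/2) ^ n) sequentially"
   using b'[of n] by (intro always_eventually) (simp add: norm_minus_commute add.commute)
 qed simp
 then show ?thesis by blast
qed

theorem branch_exists:
 "\<exists>R>0. \<exists>mu f. hsym R mu \<and> fam R w Cf0 f \<and> R <= 1 \<and> (\<forall>e\<in>ball 0 R. norm (mu e) <= mm) \<and> mu 0 = cx m0 \<and>
   (\<forall>e\<in>ball 0 R. f e = Fx e (mu e) (f e) \<and> lint q (f e) = 0)"
proof -
 have E0: "EE >= 0" using cfacts by (simp add: EE_def)
 define mu where "mu e = (SOME l. \<forall>n. norm (fst (it n) e - l) <= 2 * EE * (1/2) ^ n)" for e
 define f where "f e z = (SOME l. \<forall>n. norm (snd (it n) e z - l) <= 2 * (NN * EE * w z) * (1/2) ^ n)" for e z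
 have mu: "norm (fst (it n) e - mu e) <= 2 * EE * (1/2) ^ n" if e: "e \<in> ball 0 R0" for e n
 proof -
  have "\<exists>l. \<forall>n. norm (fst (it n) e - l) <= 2 * EE * (1/2) ^ n"
   by (rule geometric_limit) (use it_cl e in \<open>auto simp: cl_def\<close>)
  from someI_ex[OF this] show ?thesis by (simp add: mu_def)
 qed
 have f: "norm (snd (it n) e z - f e z) <= 2 * (NN * EE * w z) * (1/2) ^ n" if e: "e \<in> ball 0 R0" for e n z
 proof -
  have "norm (snd (it (Suc n)) e z - snd (it n) e z) <= (NN * EE * w z) * (1/2) ^ n" for n
   using it_cl[of n] e unfolding cl_def by (simp add: ac_simps)
  from someI_ex[OF geometric_limit[OF this]] show ?thesis by (simp add: f_def)
 qed
 have lim0: "(\<lambda>n. K * (1/2) ^ n) \<longlonglongrightarrow> 0" for K :: real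
  by (intro tendsto_mult_right_zero LIMSEQ_power_zero) simp
 have ff: "fam R0 w Cf0 (snd (it n))" and hm: "hsym R0 (fst (it n))" for n using it_invar[of n] by (auto simp: invar_def)
 have lf: "(\<lambda>n. snd (it n) e z) \<longlonglongrightarrow> f e z" if "e \<in> ball 0 R0" for e z
 proof -
  have "(\<lambda>n. snd (it n) e z - f e z) \<longlonglongrightarrow> 0"
   by (rule Lim_null_comparison[OF always_eventually lim0]) (use f[OF that] in blast)
  then show ?thesis by (simp add: LIM_zero_iff)
 qed
 have lm: "(\<lambda>n. fst (it n) e) \<longlonglongrightarrow> mu e" if "e \<in> ball 0 R0" for e
 proof -
  have "(\<lambda>n. fst (it n) e - mu e) \<longlonglongrightarrow> 0"
   by (rule Lim_null_comparison[OF always_eventually lim0]) (use mu[OF that] in blast)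
  then show ?thesis by (simp add: LIM_zero_iff)
 qed
 have hmu: "hsym R0 mu" by (rule hsym_limit[OF hm mu lim0])
 have nf: "norm (f e z) <= Cf0 * w z" if e: "e \<in> ball 0 R0" for e z
  by (rule tendsto_upperbound[OF tendsto_norm[OF lf[OF e]]]) (use fam_bound[OF ff e] in auto)
 \<comment> \<open>After division by the positive continuous weight the convergence is uniform on
   the whole line, so continuity survives the limit.\<close>
 have cf: "continuous_on UNIV (f e)" if e: "e \<in> ball 0 R0" for e
 proof -
  have "continuous_on UNIV (\<lambda>z. f e z / cx (w z))"
  proof (rule uniform_limit_theorem[where F = sequentially and f = "\<lambda>n z. snd (it n) e z / cx (w z)"])
   show "\<forall>\<^sub>F n in sequentially. continuous_on UNIV (\<lambda>z. snd (it n) e z / cx (w z))"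
    using w by (intro always_eventually allI continuous_intros fam_cont[OF ff e]) (auto simp: less_imp_neq[OF w(2)] dest: sym)
   show "uniform_limit UNIV (\<lambda>n z. snd (it n) e z / cx (w z)) (\<lambda>z. f e z / cx (w z)) sequentially"
   proof (rule uniform_limitI)
    fix t :: real assume "t > 0"
    then have "eventually (\<lambda>n. (2 * (NN * EE)) * (1/2) ^ n < t) sequentially" using order_tendstoD(2)[OF lim0] by blast
    then show "\<forall>\<^sub>F n in sequentially. \<forall>z\<in>UNIV. dist (snd (it n) e z / cx (w z)) (f e z / cx (w z)) < t"
    proof eventually_elim
     case (elim n)
     show ?case
     proof
      fix z
      have "norm (snd (it n) e z - f e z) / w z <= (2 * (NN * EE)) * (1/2) ^ n"
       using f[OF e, of n z] w(2)[of z] by (simp add: field_simps)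
      then show "dist (snd (it n) e z / cx (w z)) (f e z / cx (w z)) < t"
       using elim w(2)[of z] by (simp add: dist_norm norm_divide flip: diff_divide_distrib)
     qed
    qed
   qed
  qed simp
  then have "continuous_on UNIV (\<lambda>z. f e z / cx (w z) * cx (w z))"
   by (rule continuous_on_mult[OF _ continuous_on_of_real[OF w(1)]])
  moreover have "f e z / cx (w z) * cx (w z) = f e z" for z using w(2)[of z] by simp
  ultimately show ?thesis by simp
 qed
 have fam: "fam R0 w Cf0 f"
  unfolding fam_def using cf nf hsym_limit[OF fam_hsym[OF ff] f lim0] by blast
 have mr: "norm (mu e - cx m0) <= rr" if e: "e \<in> ball 0 R0" for e
  by (rule tendsto_upperbound[OF tendsto_norm[OF tendsto_diff[OF lm[OF e] tendsto_const]]])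
   (use it_invar e in \<open>auto simp: invar_def\<close>)
 have i: "invar mu f" using fam hmu mr by (simp add: invar_def)
 have c: "cl (2 * EE * (1/2) ^ n) (fst (it n)) (snd (it n)) mu f" for n
  unfolding cl_def using mu f by (auto simp: ac_simps)
 have c2: "cl (2 * EE * (1/2) ^ n / 2) (fst (it (Suc n))) (snd (it (Suc n))) (\<lambda>e. Mx e (mu e) (f e)) (\<lambda>e. Fx e (mu e) (f e))" for n
  using cl_step[OF it_invar i c, folded it_Suc] E0 by simp
 have eqm: "mu e = Mx e (mu e) (f e)" and eqf: "f e z = Fx e (mu e) (f e) z" if e: "e \<in> ball 0 R0" for e z
 proof -
  have "(\<lambda>n. fst (it (Suc n)) e - Mx e (mu e) (f e)) \<longlonglongrightarrow> 0"
   by (rule Lim_null_comparison[OF always_eventually lim0[of EE]]) (use c2 e in \<open>auto simp: cl_def\<close>)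
  then have "(\<lambda>n. fst (it (Suc n)) e) \<longlonglongrightarrow> Mx e (mu e) (f e)" by (simp add: LIM_zero_iff)
  then show "mu e = Mx e (mu e) (f e)" using LIMSEQ_Suc[OF lm[OF e]] LIMSEQ_unique by blast
  have "(\<lambda>n. snd (it (Suc n)) e z - Fx e (mu e) (f e) z) \<longlonglongrightarrow> 0"
   by (rule Lim_null_comparison[OF always_eventually lim0[of "NN * EE * w z"]]) (use c2 e in \<open>auto simp: cl_def ac_simps\<close>)
  then have "(\<lambda>n. snd (it (Suc n)) e z) \<longlonglongrightarrow> Fx e (mu e) (f e) z" by (simp add: LIM_zero_iff)
  then show "f e z = Fx e (mu e) (f e) z" using LIMSEQ_Suc[OF lf[OF e]] LIMSEQ_unique by blast
 qed
 have l0: "lint q (f e) = 0" if e: "e \<in> ball 0 R0" for e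
 proof -
  have "f e = Fx e (mu e) (f e)" using eqf[OF e] by blast
  then have "lint q (f e) = lint q (Fx e (mu e) (f e))" by simp
  moreover have "lint q (Fx e (mu e) (f e)) = 0"
   using eqm[OF e] A(3) m0 by (simp add: Mx_def)
  ultimately show ?thesis by simp
 qed
 \<comment> \<open>At \<open>e = 0\<close> the orthogonality leaves \<open>\<mu>^2 = m0^2\<close>,
   and the disc of radius \<open>m0 / 4\<close> around \<open>m0\<close> excludes the negative
   root.\<close>
 have m00: "mu 0 = cx m0"
 proof -
  have z: "(0::complex) \<in> ball 0 R0" using R0(1) by simp
  have "(mu 0)\<^sup>2 = (cx m0)\<^sup>2"
   using lint_Fx[OF fam _ hmu invar_mm[OF i] R0(2) z] l0[OF z] eqf[OF z] cfacts(7) A(3)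
   by (metis (no_types, opaque_lifting) add.right_neutral cancel_comm_monoid_add_class.diff_cancel eq_iff_diff_eq_0 ext mult_eq_0_iff mult_zero_left of_real_eq_0_iff of_real_power order_trans zero_le_one)
  moreover have "mu 0 \<noteq> - cx m0"
  proof
   assume "mu 0 = - cx m0"
   then have "norm (mu 0 - cx m0) = 2 * m0" using m0 by (simp flip: of_real_minus of_real_diff)
   then show False using mr[OF z] m0 by (simp add: rr_def)
  qed
  ultimately show ?thesis by (simp add: power2_eq_iff)
 qed
 show ?thesis
  by (rule exI[of _ R0], intro conjI exI[of _ mu] exI[of _ f]) (use R0 fam hmu invar_mm[OF i] m00 eqf l0 in auto)
qed

end

section \<open>Integration of exponentially weighted functions\<close>

text \<open>The oriented integral from 0 to \<open>z\<close> as integration against one kernel,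
  whichever sign \<open>z\<close> has.\<close>

definition sgi :: "real => real => real" where
 "sgi z s = indicator {0..z} s - indicator {z..0} s"

lemma sgi_measurable [measurable]: "sgi z \<in> borel_measurable borel"
 unfolding sgi_def by measurable

lemma sgi_primitive:
 fixes F :: "real => complex"
 assumes F: "continuous_on UNIV F"
 shows "((\<lambda>z. LINT s|lborel. cx (sgi z s) * F s) has_vector_derivative F x) (at x)"
proof -
 have Fc: "continuous_on A F" for A using F continuous_on_subset by blast
 have si: "set_integrable lborel {u..v} F" for u v by (rule borel_integrable_atLeastAtMost'[OF Fc])
 have eq: "(LINT s|lborel. cx (sgi z s) * F s) = integral {0..z} F - integral {z..0} F" for z
 proof -
  have "(LINT s|lborel. cx (sgi z s) * F s) = (LINT s|lborel. indicator {0..z} s *\<^sub>R F s - indicator {z..0} s *\<^sub>R F s)"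
   by (intro Bochner_Integration.integral_cong refl) (simp add: sgi_def scaleR_conv_of_real algebra_simps)
  also have "\<dots> = (LINT s:{0..z}|lborel. F s) - (LINT s:{z..0}|lborel. F s)"
   using si[of 0 z] si[of z 0] unfolding set_integrable_def set_lebesgue_integral_def by simp
  finally show ?thesis by (simp only: set_borel_integral_eq_integral[OF si])
 qed
 \<comment> \<open>A base point to the left of both 0 and \<open>x\<close>, so that one primitive
   covers a neighbourhood of \<open>x\<close>.\<close>
 define a where "a = min 0 x - 1"
 have io: "F integrable_on {u..v}" for u v by (rule integrable_continuous_real[OF Fc])
 have eq2: "(LINT s|lborel. cx (sgi z s) * F s) = integral {a..z} F - integral {a..0} F" if "z >= a" for z
 proof (cases "z >= 0")
  case True
  have "integral {z..0} F = 0"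
  proof (cases "z = 0")
   case False
   then have "{z..0} = {}" using True by auto
   then show ?thesis by simp
  qed simp
  moreover have "integral {a..0} F + integral {0..z} F = integral {a..z} F"
   by (rule Henstock_Kurzweil_Integration.integral_combine[OF _ True io]) (simp add: a_def)
  ultimately show ?thesis unfolding eq by (simp add: algebra_simps)
 next
  case False
  then have "integral {0..z} F = 0" by simp
  moreover have "integral {a..z} F + integral {z..0} F = integral {a..0} F"
   by (rule Henstock_Kurzweil_Integration.integral_combine[OF that _ io]) (use False in simp)
  ultimately show ?thesis unfolding eq by (simp add: algebra_simps)
 qed
 have "((\<lambda>z. integral {a..z} F) has_vector_derivative F x) (at x within {a..x + 1})"
  by (rule integral_has_vector_derivative[OF Fc]) (auto simp: a_def)
 then have "((\<lambda>z. integral {a..z} F) has_vector_derivative F x) (at x)"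
  by (subst (asm) at_within_interior) (auto simp: a_def)
 then have "((\<lambda>z. integral {a..z} F - integral {a..0} F) has_vector_derivative F x) (at x)"
  by (auto intro!: derivative_eq_intros)
 then show ?thesis
 proof (rule has_vector_derivative_transform_within_open[where S = "{a<..}"])
  show "integral {a..z} F - integral {a..0} F = (LINT s|lborel. cx (sgi z s) * F s)" if "z \<in> {a<..}" for z
   using eq2[of z] that by simp
 qed (auto simp: a_def)
qed

lemma tail_derivative:
 fixes F :: "real => complex"
 assumes F: "continuous_on UNIV F" and i: "!!z. intg (\<lambda>s. cx (indicator {z..} s) * F s)"
 shows "((\<lambda>z. LINT s|lborel. cx (indicator {z..} s) * F s) has_vector_derivative - F x) (at x)"
proof -
 have [measurable]: "bmeas F" by (rule borel_measurable_continuous_onI[OF F])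
 have eq: "(LINT s|lborel. cx (indicator {z..} s) * F s) = (LINT s|lborel. cx (indicator {0..} s) * F s) - (LINT s|lborel. cx (sgi z s) * F s)" for z
 proof -
  have "AE s in lborel. cx (sgi z s) * F s = cx (indicator {0..} s) * F s - cx (indicator {z..} s) * F s"
   using AE_lborel_singleton[of 0] AE_lborel_singleton[of z]
   by eventually_elim (auto simp: sgi_def indicator_def)
  then have "(LINT s|lborel. cx (sgi z s) * F s) = (LINT s|lborel. cx (indicator {0..} s) * F s - cx (indicator {z..} s) * F s)"
   by (intro integral_cong_AE) auto
  then show ?thesis using i[of 0] i[of z] by simp
 qed
 have fe: "(\<lambda>z. LINT s|lborel. cx (indicator {z..} s) * F s) = (\<lambda>z. (LINT s|lborel. cx (indicator {0..} s) * F s) - (LINT s|lborel. cx (sgi z s) * F s))"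
  by (rule ext, rule eq)
 have "((\<lambda>z. (LINT s|lborel. cx (indicator {0..} s) * F s) - (LINT s|lborel. cx (sgi z s) * F s)) has_vector_derivative 0 - F x) (at x)"
  by (intro has_vector_derivative_diff has_vector_derivative_const sgi_primitive F)
 then show ?thesis by (simp only: fe diff_0)
qed

lemma integral_derivative_line:
 fixes F :: "real => complex"
 assumes d: "!!x. (F has_vector_derivative f x) (at x)" and f: "continuous_on UNIV f" "intg f"
  and l: "(F \<longlongrightarrow> l) at_top" "(F \<longlongrightarrow> l') at_bot"
 shows "(LINT x|lborel. f x) = l - l'"
proof -
 have [measurable]: "bmeas f" by (rule borel_measurable_continuous_onI[OF f(1)])
 have "(\<lambda>n. LINT x|lborel. indicator {- real n..real n} x *\<^sub>R f x) \<longlonglongrightarrow> (LINT x|lborel. f x)"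
 proof (rule integral_dominated_convergence[where w = "\<lambda>x. norm (f x)"])
  show "AE x in lborel. (\<lambda>n. indicator {- real n..real n} x *\<^sub>R f x) \<longlonglongrightarrow> f x"
  proof (rule AE_I2)
   fix x
   obtain N where N: "real N >= abs x" using real_arch_simple by blast
   have "eventually (\<lambda>n. indicator {- real n..real n} x *\<^sub>R f x = f x) sequentially"
    unfolding eventually_sequentially
   proof (intro exI allI impI)
    fix n assume "N <= n"
    then have "real N <= real n" by simp
    then have "abs x <= real n" using N by linarith
    then have "x \<in> {- real n..real n}" by (simp add: abs_le_iff)
    then show "indicator {- real n..real n} x *\<^sub>R f x = f x" by simp
   qed
   then show "(\<lambda>n. indicator {- real n..real n} x *\<^sub>R f x) \<longlonglongrightarrow> f x" by (rule tendsto_eventually)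
  qed
  show "AE x in lborel. norm (indicator {- real n..real n} x *\<^sub>R f x) <= norm (f x)" for n
   by (intro AE_I2) (simp add: indicator_def)
 qed (use f in auto)
 moreover have "(LINT x|lborel. indicator {- real n..real n} x *\<^sub>R f x) = F (real n) - F (- real n)" for n
  by (rule integral_FTC_Icc) (auto intro: has_vector_derivative_at_within d continuous_on_subset[OF f(1)])
 moreover have "(\<lambda>n. F (real n) - F (- real n)) \<longlonglongrightarrow> l - l'"
  by (intro tendsto_diff filterlim_compose[OF l(1) filterlim_real_sequentially]
    filterlim_compose[OF l(2)] filterlim_compose[OF filterlim_uminus_at_bot_at_top filterlim_real_sequentially])
 ultimately show ?thesis by (simp add: LIMSEQ_unique)
qed

lemma exp_kernel_integrable:
 fixes k w :: "real => real" and \<sigma> B z :: real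
 assumes k: "bmeas k" "bmeas w" "!!s. w s >= 0" and s: "\<sigma> > 0"
  and b: "!!s. abs (k s) * w s <= B * exp (- \<sigma> * \<bar>z - s\<bar>)"
 shows "intg (\<lambda>s. abs (k s) * w s)" "(LINT s|lborel. abs (k s) * w s) <= B * (2 / \<sigma>)"
proof -
 note [measurable] = k(1,2)
 have i: "intg (\<lambda>s. B * exp (- \<sigma> * \<bar>z - s\<bar>))"
  using exp_abs_shift[OF s, of z] by (auto simp: has_bochner_integral_iff)
 show I: "intg (\<lambda>s. abs (k s) * w s)"
 proof (rule Bochner_Integration.integrable_bound[OF i])
  show "AE s in lborel. norm (abs (k s) * w s) <= norm (B * exp (- \<sigma> * \<bar>z - s\<bar>))"
  proof (rule AE_I2)
   fix s
   have "norm (abs (k s) * w s) = abs (k s) * w s" using k(3)[of s] by (simp add: abs_mult)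
   also note b[of s]
   also have "B * exp (- \<sigma> * \<bar>z - s\<bar>) <= norm (B * exp (- \<sigma> * \<bar>z - s\<bar>))" by (simp only: real_norm_def abs_ge_self)
   finally show "norm (abs (k s) * w s) <= norm (B * exp (- \<sigma> * \<bar>z - s\<bar>))" .
  qed
 qed simp
 have "(LINT s|lborel. abs (k s) * w s) <= (LINT s|lborel. B * exp (- \<sigma> * \<bar>z - s\<bar>))"
  by (intro integral_mono I i b)
 then show "(LINT s|lborel. abs (k s) * w s) <= B * (2 / \<sigma>)"
  using exp_abs_shift[OF s, of z] by (simp add: has_bochner_integral_iff)
qed

lemma fam_lint_diff:
 assumes "fam R w C f" "fam R w D g" "e \<in> ball 0 R" "bmeas k" "intg (\<lambda>s. abs (k s) * w s)"
 shows "lint k (\<lambda>z. f e z - g e z) = lint k (f e) - lint k (g e)"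
 using fam_lint_int[OF assms(1,3,4,5)] fam_lint_int[OF assms(2,3,4,5)] by (simp add: lint_def right_diff_distrib)

section \<open>The solitary wave and its linearization\<close>

locale benney_luke =
 fixes a b c \<alpha> :: real
 assumes a0: "0 < a" and ab: "a < b" and c1: "1 < c" and al0: "0 < \<alpha>" and al1: "\<alpha> < alpha_c a b c"
begin

definition "kp = alpha_c a b c"
definition "m = b * c\<^sup>2 - a"
text \<open>Half the distance of \<open>\<alpha>\<close> to the ends of \<open>(0, kp)\<close>.
  Hence \<open>\<alpha> - de > 0\<close>, which makes integrals over right half lines converge, and
  \<open>\<alpha> + de < kp\<close>, so that the soliton decays faster than the weight.\<close>

definition "de = min \<alpha> (kp - \<alpha>) / 2"
definition T :: "real => real" where "T z = tanh (kp * z / 2)"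
text \<open>The profile \<open>sech^2\<close> is expressed through \<open>tanh\<close> so that, up
  to factors \<open>z\<close>, the explicit functions become polynomials in \<open>T\<close>, whose
  derivative is again a polynomial in \<open>T\<close>.\<close>

definition S :: "real => real" where "S z = 1 - (T z)\<^sup>2"

abbreviation "w \<equiv> wt \<alpha> de"

lemma csq: "c\<^sup>2 > 1" using c1 by (simp add: one_less_power)

lemma m0: "m > 0"
proof -
 have "b * 1 < b * c\<^sup>2" using csq a0 ab by (intro mult_strict_left_mono) auto
 then show ?thesis using ab by (simp add: m_def)
qed

lemma kp0: "kp > 0" using al0 al1 by (simp add: kp_def)

lemma kpm: "kp\<^sup>2 * m = c\<^sup>2 - 1"
 using csq m0 by (simp add: kp_def alpha_c_def m_def[symmetric])

lemma de: "de > 0" "de < \<alpha>" "\<alpha> + de < kp"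
 using al0 al1 by (auto simp: de_def kp_def min_def field_simps)

lemma T_deriv [derivative_intros]:
 "(T has_real_derivative kp / 2 * S z) (at z)"
 unfolding T_def[abs_def] S_def using cosh_real_pos[of "kp * z / 2"]
 by (auto intro!: derivative_eq_intros)

lemma S_deriv [derivative_intros]: "(S has_real_derivative - kp * T z * S z) (at z)"
proof -
 have "((\<lambda>z. 1 - (T z)\<^sup>2) has_real_derivative - kp * T z * S z) (at z)"
  by (auto intro!: derivative_eq_intros)
 then show ?thesis by (simp add: S_def[abs_def])
qed

lemma T_abs: "abs (T z) < 1" by (simp add: T_def abs_less_iff tanh_real_lt_1 tanh_real_gt_neg1 minus_less_iff)

lemma S_cosh: "S z = 1 / (cosh (kp * z / 2))\<^sup>2"
proof -
 have "S z = ((cosh (kp * z / 2))\<^sup>2 - (sinh (kp * z / 2))\<^sup>2) / (cosh (kp * z / 2))\<^sup>2"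
  using cosh_real_pos[of "kp * z / 2"] by (simp add: S_def T_def tanh_def power_divide diff_divide_distrib)
 also have "(cosh (kp * z / 2))\<^sup>2 - (sinh (kp * z / 2))\<^sup>2 = 1" by (simp add: cosh_square_eq)
 finally show ?thesis .
qed

lemma S_pos: "S z > 0" and S_le1: "S z <= 1"
proof -
 show "S z > 0" using cosh_real_pos[of "kp * z / 2"] by (simp add: S_cosh)
 show "S z <= 1" by (simp add: S_def)
qed

lemma T_minus: "T (- z) = - T z" by (simp add: T_def)
lemma S_minus: "S (- z) = S z" by (simp add: S_def T_minus)

lemma S_exp: "S z <= 4 * exp (- kp * abs z)" and S_inv: "1 / S z <= exp (kp * abs z)"
proof -
 define y where "y = kp * z / 2"
 have e: "exp (kp * abs z) = (exp (abs y))\<^sup>2" using kp0 by (simp add: y_def abs_mult power2_eq_square flip: exp_add)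
 have c: "exp (abs y) / 2 <= cosh y" "cosh y <= exp (abs y)"
  by (auto simp: cosh_field_def abs_if)
 have "(exp (abs y) / 2)\<^sup>2 <= (cosh y)\<^sup>2" "(cosh y)\<^sup>2 <= (exp (abs y))\<^sup>2" using c by (intro power_mono; simp)+
 then have b: "exp (kp * abs z) / 4 <= (cosh y)\<^sup>2" "(cosh y)\<^sup>2 <= exp (kp * abs z)" by (simp_all add: e power_divide)
 have p: "(cosh y)\<^sup>2 > 0" by simp
 show "1 / S z <= exp (kp * abs z)" using b by (simp add: S_cosh y_def)
 have "1 / (cosh y)\<^sup>2 <= 1 / (exp (kp * abs z) / 4)" using b by (intro divide_left_mono) auto
 then show "S z <= 4 * exp (- kp * abs z)" by (simp add: S_cosh y_def exp_minus field_simps)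
qed

lemma zS_bound: "kp * abs z * S z <= 4"
proof -
 have "kp * abs z <= exp (kp * abs z)" using exp_ge_add_one_self[of "kp * abs z"] by linarith
 then have "kp * abs z * S z <= exp (kp * abs z) * (4 * exp (- kp * abs z))"
  using S_exp[of z] S_pos[of z] by (intro mult_mono) auto
 also have "\<dots> = 4 * (exp (kp * abs z) * exp (- (kp * abs z)))" by simp
 finally show ?thesis by (simp only: exp_minus_inverse mult_1_right)
qed

lemma T_continuous: "continuous_on A T" and S_continuous: "continuous_on A S"
 by (meson DERIV_isCont T_deriv S_deriv continuous_at_imp_continuous_on)+

lemma w_pos: "w z > 0" by (rule wt_pos)

lemma w_continuous: "continuous_on A w"
 unfolding wt_def by (intro continuous_intros)

definition "sg = kp - \<alpha> - de"

lemma sg0: "sg > 0" using de by (simp add: sg_def)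

text \<open>Moving the weight from \<open>s\<close> to \<open>z\<close> costs at most the rate
  \<open>\<alpha> + de\<close>, which leaves the positive rate \<open>sg\<close> of a kernel
  decaying at rate \<open>kp\<close>.\<close>

lemma w_shift: "exp (- kp * \<bar>z - s\<bar>) * w s <= w z * exp (- sg * \<bar>z - s\<bar>)"
proof -
 have "\<alpha> * (z - s) <= \<alpha> * \<bar>z - s\<bar>" using al0 by (intro mult_left_mono) auto
 moreover have "de * (abs z - abs s) <= de * \<bar>z - s\<bar>" using de by (intro mult_left_mono) auto
 ultimately show ?thesis by (simp add: wt_def sg_def algebra_simps flip: exp_add)
qed

text \<open>To the right of \<open>z\<close> the weight decays at least at rate
  \<open>\<alpha> - de\<close>, which bounds integrals over right half lines by the weight
  itself.\<close>

lemma w_tail: "s >= z ==> w s <= w z * exp (- (\<alpha> - de) * \<bar>z - s\<bar>)"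
proof -
 assume "s >= z"
 then have e: "\<bar>z - s\<bar> = s - z" by simp
 have "de * (abs z - abs s) <= de * (s - z)" using de \<open>s >= z\<close> by (intro mult_left_mono) auto
 then show ?thesis by (simp add: wt_def e algebra_simps flip: exp_add)
qed

lemma dual_integrable:
 assumes "bmeas k" "!!z. abs (k z) <= C * w (- z)"
 shows "intg (\<lambda>s. abs (k s) * w s)"
proof (rule exp_kernel_integrable(1)[where \<sigma> = "2 * de" and z = 0 and B = C])
 show "abs (k s) * w s <= C * exp (- (2 * de) * \<bar>0 - s\<bar>)" for s
  using mult_right_mono[OF assms(2)[of s], of "w s"] wt_pos[of \<alpha> de s]
  by (simp add: wt_def ac_simps flip: exp_add)
qed (use assms de wt_pos in \<open>auto simp: less_imp_le\<close>)

lemma exp_le_w: "exp (- kp * abs z) <= w z" "exp (- kp * abs z) <= w (- z)"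
proof -
 have "\<alpha> * abs z + de * abs z <= kp * abs z" using de by (simp flip: distrib_right add: mult_right_mono)
 moreover have "\<alpha> * z <= \<alpha> * abs z" "\<alpha> * (- z) <= \<alpha> * abs z" using al0 by (intro mult_left_mono; simp)+
 ultimately show "exp (- kp * abs z) <= w z" "exp (- kp * abs z) <= w (- z)" by (simp_all add: wt_def)
qed

lemma S_w: "S z <= 4 * w z" "S z <= 4 * w (- z)"
 using S_exp[of z] exp_le_w[of z] by linarith+

text \<open>A multiple of the derivative of the profile. It is the decaying solution of
  \<open>y'' = kp^2 (1 - 3 S) y\<close>, the homogeneous equation of the middle factor of
  \<open>P0\<close>.\<close>

definition ph :: "real => real" where "ph z = T z * S z"
definition ph1 :: "real => real" where "ph1 z = kp * (1 / 2 * (S z * S z) - T z * T z * S z)"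
definition Si :: "real => real" where "Si z = 1 / S z"
text \<open>The second solution of the same equation, growing like \<open>exp (kp * abs z)\<close>.
  Reduction of order from \<open>ph\<close> produces the term \<open>z * ph z\<close> and the
  growing \<open>1 / S\<close>; the normalization gives the Wronskian \<open>kp / 2\<close>.\<close>

definition ps :: "real => real" where
 "ps z = 15 / 16 * kp * z * ph z - S z + 7 / 8 * (T z * T z) + 1 / 4 * (Si z - 1)"
definition ps1 :: "real => real" where
 "ps1 z = 15 / 16 * kp * ph z + 15 / 16 * kp * z * ph1 z + 15 / 8 * kp * ph z + kp / 4 * (T z * Si z)"

lemma TT: "T z * T z = 1 - S z" by (simp add: S_def power2_eq_square)

lemma SSi: "S z * Si z = 1" "Si z * S z = 1" using S_pos[of z] by (simp_all add: Si_def)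

lemma SSi_left: "S z * (Si z * x) = x" "Si z * (S z * x) = x" "T z * (T z * x) = x - S z * x"
 using SSi[of z] TT[of z] by (simp_all flip: mult.assoc add: left_diff_distrib)

lemma Si_deriv: "(Si has_real_derivative kp * (T z * Si z)) (at z)"
proof -
 have "((\<lambda>z. 1 / S z) has_real_derivative kp * (T z * Si z)) (at z)"
  using S_pos[of z] by (auto intro!: derivative_eq_intros simp: Si_def field_simps)
 then show ?thesis by (simp add: Si_def[abs_def])
qed

lemma ph_deriv: "(ph has_real_derivative ph1 z) (at z)"
 unfolding ph_def[abs_def] ph1_def
 by (rule derivative_eq_intros refl)+ (simp add: algebra_simps)

lemma ph1_deriv: "(ph1 has_real_derivative (kp\<^sup>2 - 3 * kp\<^sup>2 * S z) * ph z) (at z)"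
 unfolding ph_def ph1_def[abs_def]
 by (rule derivative_eq_intros refl)+ (simp add: SSi_left TT power2_eq_square algebra_simps)

lemma ps_deriv: "(ps has_real_derivative ps1 z) (at z)"
 unfolding ps_def[abs_def] ps1_def
 by (rule derivative_eq_intros ph_deriv Si_deriv refl)+ (simp add: ph_def algebra_simps)

lemma ps1_deriv: "(ps1 has_real_derivative (kp\<^sup>2 - 3 * kp\<^sup>2 * S z) * ps z) (at z)"
 unfolding ps_def ps1_def[abs_def]
 by (rule derivative_eq_intros ph_deriv ph1_deriv Si_deriv refl)+
  (simp add: ph_def ph1_def SSi_left SSi TT power2_eq_square algebra_simps add_divide_distrib diff_divide_distrib)

lemma wronskian: "ph z * ps1 z - ph1 z * ps z = kp / 2"
 unfolding ps_def ps1_def ph_def ph1_def 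
 by (simp add: SSi_left SSi TT power2_eq_square algebra_simps add_divide_distrib diff_divide_distrib)

lemma ph_bound: "abs (ph z) <= 4 * exp (- kp * abs z)" "abs (ph1 z) <= (8 * kp) * exp (- kp * abs z)"
proof -
 have "abs (ph z) <= 1 * S z" unfolding ph_def abs_mult using T_abs[of z] S_pos[of z] by (intro mult_mono) auto
 then show "abs (ph z) <= 4 * exp (- kp * abs z)" using S_exp[of z] by simp
 have "ph1 z = kp * (3 / 2 * S z - 1) * S z" by (simp add: ph1_def TT algebra_simps)
 moreover have "\<bar>3 / 2 * S z - 1\<bar> <= 1" using S_pos[of z] S_le1[of z] by (simp add: abs_le_iff)
 ultimately have "abs (ph1 z) <= (kp * 1) * S z"
  unfolding abs_mult using kp0 S_pos[of z] by (simp add: abs_mult mult_mono)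
 also have "\<dots> <= (kp * 1) * (4 * exp (- kp * abs z))" using kp0 by (intro mult_left_mono S_exp) simp
 also have "\<dots> <= (8 * kp) * exp (- kp * abs z)" using kp0 by simp
 finally show "abs (ph1 z) <= (8 * kp) * exp (- kp * abs z)" .
qed

lemma ps_bound: "abs (ps z) <= 8 * exp (kp * abs z)" "abs (ps1 z) <= (12 * kp) * exp (kp * abs z)"
proof -
 define E where "E = exp (kp * abs z)"
 have E1: "E >= 1" using kp0 by (simp add: E_def)
 have Si: "0 < Si z" "Si z <= E" using S_pos[of z] S_inv[of z] by (simp_all add: Si_def E_def)
 have p: "abs (ph z) <= S z" unfolding ph_def abs_mult using T_abs[of z] S_pos[of z] mult_mono[of "abs (T z)" 1 "abs (S z)" "S z"] by simp
 have p1: "abs (ph1 z) <= kp * S z"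
 proof -
  have "ph1 z = kp * (3 / 2 * S z - 1) * S z" by (simp add: ph1_def TT algebra_simps)
  moreover have "\<bar>3 / 2 * S z - 1\<bar> <= 1" using S_pos[of z] S_le1[of z] by (simp add: abs_le_iff)
  ultimately show ?thesis using kp0 S_pos[of z] by (simp add: abs_mult mult_left_mono)
 qed
 have "\<bar>kp * z * ph z\<bar> <= kp * abs z * S z" unfolding abs_mult using p kp0 by (intro mult_mono) auto
 then have a1: "\<bar>kp * z * ph z\<bar> <= 4" using zS_bound[of z] by linarith
 have "\<bar>kp * z * ph1 z\<bar> <= kp * abs z * (kp * S z)" unfolding abs_mult using p1 kp0 by (intro mult_mono) auto
 also have "\<dots> = kp * (kp * abs z * S z)" by simp
 also have "\<dots> <= kp * 4" using zS_bound[of z] kp0 by (intro mult_left_mono) auto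
 finally have a2: "\<bar>kp * z * ph1 z\<bar> <= kp * 4" .
 define y where "y = kp * z * ph z"
 have ps_e: "ps z = 15 / 16 * y - S z + 7 / 8 * (1 - S z) + 1 / 4 * (Si z - 1)" by (simp add: ps_def TT y_def)
 note ps_facts = ps_e abs_le_D1[OF a1[folded y_def]] abs_le_D2[OF a1[folded y_def]] E1 Si S_pos[of z] S_le1[of z]
 have "u <= 8 * E \<and> - u <= 8 * E" if "u = 15 / 16 * y - s + 7 / 8 * (1 - s) + 1 / 4 * (r - 1)" "y <= 4" "- y <= 4" "1 <= E" "0 < r" "r <= E" "0 < s" "s <= 1" for u s r :: real
  using that by (simp add: field_simps)
 then have "ps z <= 8 * E \<and> - ps z <= 8 * E" using ps_facts by blast
 then have "ps z <= 8 * E" "- ps z <= 8 * E" by auto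
 then show "abs (ps z) <= 8 * exp (kp * abs z)" unfolding E_def[symmetric] by (rule abs_leI)
 have b1: "\<bar>kp * ph z\<bar> <= kp" unfolding abs_mult using p S_le1[of z] kp0 by simp
 have b2: "\<bar>kp * (T z * Si z)\<bar> <= kp * E"
 proof -
  have "\<bar>T z * Si z\<bar> <= 1 * E" unfolding abs_mult using T_abs[of z] Si by (intro mult_mono) auto
  then show ?thesis using kp0 by (simp add: abs_mult)
 qed
 have kE: "kp <= kp * E" using E1 kp0 by simp
 have ps_e: "ps1 z = 15 / 16 * (kp * ph z) + 15 / 16 * (kp * z * ph1 z) + 15 / 8 * (kp * ph z) + 1 / 4 * (kp * (T z * Si z))"
  by (simp add: ps1_def)
 note ps1_facts = ps_e a2[THEN abs_le_D1] a2[THEN abs_le_D2] b1[THEN abs_le_D1] b1[THEN abs_le_D2] b2[THEN abs_le_D1] b2[THEN abs_le_D2] kE kp0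
 have "ps1 z <= 12 * (kp * E)" using ps1_facts by linarith
 moreover have "- ps1 z <= 12 * (kp * E)" using ps1_facts by linarith
 ultimately show "abs (ps1 z) <= (12 * kp) * exp (kp * abs z)" unfolding E_def[symmetric] mult.assoc by (rule abs_leI)
qed

lemma ph_continuous: "continuous_on A ph" and ps_continuous: "continuous_on A ps"
 by (meson DERIV_isCont ph_deriv ps_deriv continuous_at_imp_continuous_on)+

section \<open>A bounded right inverse of the linearized operator\<close>

definition qz :: "real => real" where "qz z = (c\<^sup>2 - 1) / c * S z"

lemma qz_eq: "q_c a b c = qz"
 by (simp add: q_c_def qz_def S_cosh kp_def fun_eq_iff power_divide)

text \<open>The decaying \<open>ph\<close> is integrated outward from \<open>z\<close>, where
  \<open>abs s = abs z + abs (z - s)\<close>; the formulas for both signs of \<open>z\<close> fit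
  together when \<open>lint ph g = 0\<close>. The growing \<open>ps\<close> in \<open>kc2\<close> is
  integrated between 0 and \<open>z\<close>, where \<open>abs s = abs z - abs (z - s)\<close>.
  Either way the exponential in \<open>abs z\<close> cancels against the other solution.\<close>

definition kc1 :: "real => real => real" where
 "kc1 z s = (if z >= 0 then indicator {z..} s else - indicator {..z} s) * ph s"
definition kc2 :: "real => real => real" where "kc2 z s = sgi z s * ps s"

lemma kc_measurable [measurable]: "kc1 z \<in> borel_measurable borel" "kc2 z \<in> borel_measurable borel"
proof -
 have [measurable]: "bmeas ph" "bmeas ps"
  by (intro borel_measurable_continuous_onI ph_continuous ps_continuous)+
 show "kc1 z \<in> borel_measurable borel" "kc2 z \<in> borel_measurable borel"
  unfolding kc1_def kc2_def by measurable
qed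

lemma w_measurable: "bmeas w" by (rule wt_measurable)

lemma kc1_bound: "abs (kc1 z s) * w s <= (4 * exp (- kp * abs z) * w z) * exp (- sg * \<bar>z - s\<bar>)"
proof (cases "(z >= 0 \<and> s >= z) \<or> (z < 0 \<and> s <= z)")
 case True
 then have e: "abs s = abs z + \<bar>z - s\<bar>" by auto
 have "abs (kc1 z s) <= 4 * exp (- kp * abs s)" using ph_bound(1)[of s] True by (auto simp: kc1_def indicator_def)
 then have "abs (kc1 z s) * w s <= (4 * exp (- kp * abs s)) * w s" using w_pos[of s] by (intro mult_right_mono) auto
 also have "\<dots> = 4 * exp (- kp * abs z) * (exp (- kp * \<bar>z - s\<bar>) * w s)"
  unfolding e by (simp add: algebra_simps flip: exp_add mult.assoc)
 also have "\<dots> <= 4 * exp (- kp * abs z) * (w z * exp (- sg * \<bar>z - s\<bar>))" by (intro mult_left_mono w_shift) simp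
 finally show ?thesis by (simp add: mult.assoc)
next
 case False
 then have "kc1 z s = 0" by (auto simp: kc1_def indicator_def)
 then show ?thesis using w_pos[of z] by simp
qed

lemma kc2_bound: "abs (kc2 z s) * w s <= (8 * exp (kp * abs z) * w z) * exp (- sg * \<bar>z - s\<bar>)"
proof (cases "(0 <= s \<and> s <= z) \<or> (z <= s \<and> s <= 0)")
 case True
 then have e: "abs s = abs z - \<bar>z - s\<bar>" by auto
 have "abs (kc2 z s) <= 8 * exp (kp * abs s)" using ps_bound(1)[of s] by (auto simp: kc2_def sgi_def indicator_def)
 then have "abs (kc2 z s) * w s <= (8 * exp (kp * abs s)) * w s" using w_pos[of s] by (intro mult_right_mono) auto
 also have "\<dots> = 8 * exp (kp * abs z) * (exp (- kp * \<bar>z - s\<bar>) * w s)"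
  unfolding e by (simp add: algebra_simps flip: exp_add mult.assoc)
 also have "\<dots> <= 8 * exp (kp * abs z) * (w z * exp (- sg * \<bar>z - s\<bar>))" by (intro mult_left_mono w_shift) simp
 finally show ?thesis by (simp add: mult.assoc)
next
 case False
 then have "kc2 z s = 0" by (auto simp: kc2_def sgi_def indicator_def)
 then show ?thesis using w_pos[of z] by simp
qed

lemma tail_bound: "\<bar>indicator {z..} s\<bar> * w s <= w z * exp (- (\<alpha> - de) * \<bar>z - s\<bar>)"
 using w_tail[of z s] w_pos[of z] by (auto simp: indicator_def)

lemmas kc1_int = exp_kernel_integrable[OF kc_measurable(1) w_measurable less_imp_le[OF w_pos] sg0 kc1_bound]
lemmas kc2_int = exp_kernel_integrable[OF kc_measurable(2) w_measurable less_imp_le[OF w_pos] sg0 kc2_bound]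

lemma ind_measurable: "indicat_real {z::real..} \<in> borel_measurable borel" by (rule borel_measurable_indicator) simp

lemmas tail_int = exp_kernel_integrable[OF ind_measurable w_measurable less_imp_le[OF w_pos] _ tail_bound]

definition tail :: "(real => complex) => real => complex" where
 "tail f z = lint (indicator {z..}) f"

lemma ade: "\<alpha> - de > 0" using de by simp

lemma tail_deriv:
 assumes f: "continuous_on UNIV f" "!!z. norm (f z) <= C * w z"
 shows "(tail f has_vector_derivative - f z) (at z)"
 unfolding tail_def[abs_def] lint_def
 by (rule tail_derivative[OF f(1)])
  (rule lint_bound(1)[OF borel_measurable_continuous_onI[OF f(1)] f(2) ind_measurable tail_int(1)[OF ade]])

lemma opr_tail: "opr w (2 / (\<alpha> - de)) tail"
 unfolding opr_def
proof (intro conjI allI impI)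
 show "2 / (\<alpha> - de) >= 0" using ade by simp
 fix R C D f g and e :: complex assume "C >= 0" "fam R w C f" "fam R w D g" "e \<in> ball 0 R"
 then show "tail (\<lambda>z. f e z - g e z) = (\<lambda>z. tail (f e) z - tail (g e) z)"
  unfolding tail_def by (intro ext fam_lint_diff[OF _ _ _ ind_measurable tail_int(1)[OF ade]])
next
 fix R C f assume C: "C >= 0" and f: "fam R w C f"
 show "fam R w (2 / (\<alpha> - de) * C) (\<lambda>e. tail (f e))"
  unfolding fam_def
 proof (intro conjI ballI allI)
  fix e :: complex assume e: "e \<in> ball 0 R"
  show "continuous_on UNIV (tail (f e))"
   using tail_deriv[OF fam_cont[OF f e] fam_bound[OF f e]]
   by (blast intro: continuous_at_imp_continuous_on has_vector_derivative_continuous)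
  fix z
  have "norm (tail (f e) z) <= C * (LINT s|lborel. \<bar>indicat_real {z..} s\<bar> * w s)"
   unfolding tail_def by (rule lint_bound(2)[OF fam_measurable[OF f e] fam_bound[OF f e] ind_measurable tail_int(1)[OF ade]])
  also have "\<dots> <= C * (w z * (2 / (\<alpha> - de)))" by (intro mult_left_mono tail_int(2)[OF ade] C)
  finally show "norm (tail (f e) z) <= 2 / (\<alpha> - de) * C * w z" by (simp add: ac_simps)
 next
  show "hsym R (\<lambda>e. tail (f e) z)" for z
   unfolding tail_def by (rule lint_hsym[OF f ind_measurable tail_int(1)[OF ade]])
 qed
qed

definition "qq = (LINT z|lborel. (qz z)\<^sup>2)"

text \<open>Projecting orthogonally to \<open>qz\<close> first makes the right inverse total, hence
  an \<open>opr\<close>. On the constructed solutions, which satisfy \<open>lint qz f = 0\<close>,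
  the projection is the identity.\<close>

definition pj :: "(real => complex) => real => complex" where
 "pj f z = f z - lint qz f / cx qq * cx (qz z)"

text \<open>Undoes the outer derivative of \<open>P0\<close> and divides by \<open>m\<close>,
  leaving a second-order equation for the derivative of the unknown.\<close>

definition gg :: "(real => complex) => real => complex" where
 "gg f z = cx (- 1 / m) * tail (pj f) z"

lemma qz_continuous: "continuous_on A qz" unfolding qz_def[abs_def] by (intro continuous_intros S_continuous)

lemma qz_measurable: "bmeas qz" by (intro borel_measurable_continuous_onI qz_continuous)

definition "qB = (c\<^sup>2 - 1) / c * 4"

lemma qB0: "qB >= 0" using csq c1 by (simp add: qB_def)

lemma qz_pos: "qz z > 0" using csq c1 S_pos[of z] by (simp add: qz_def)

lemma qz_w: "abs (qz z) <= qB * w z" "abs (qz z) <= qB * w (- z)"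
proof -
 have p: "(c\<^sup>2 - 1) / c >= 0" using csq c1 by simp
 have "abs (qz z) = (c\<^sup>2 - 1) / c * S z" using abs_of_pos[OF qz_pos[of z]] by (simp only: qz_def)
 then show "abs (qz z) <= qB * w z" "abs (qz z) <= qB * w (- z)"
  using mult_left_mono[OF S_w(1)[of z] p] mult_left_mono[OF S_w(2)[of z] p] by (simp_all only: qB_def mult.assoc)
qed

lemma qz_int: "intg (\<lambda>s. abs (qz s) * w s)"
 by (rule dual_integrable[OF qz_measurable qz_w(2)])

lemma qz2_int: "intg (\<lambda>z. (qz z)\<^sup>2)"
proof (rule Bochner_Integration.integrable_bound)
 show "intg (\<lambda>s. qB * (abs (qz s) * w s))" using qz_int by simp
 show "AE z in lborel. norm ((qz z)\<^sup>2) <= norm (qB * (abs (qz z) * w z))"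
 proof (rule AE_I2)
  fix z
  have "abs (qz z) * abs (qz z) <= abs (qz z) * (qB * w z)" by (intro mult_left_mono qz_w) simp
  also have "\<dots> = norm (qB * (abs (qz z) * w z))" using qB0 w_pos[of z] by (simp add: abs_mult)
  finally show "norm ((qz z)\<^sup>2) <= norm (qB * (abs (qz z) * w z))" by (simp add: power2_eq_square abs_mult)
 qed
 show "(\<lambda>z. (qz z)\<^sup>2) \<in> borel_measurable lborel" using qz_measurable by simp
qed

definition "pjk = 1 + (LINT s|lborel. abs (qz s) * w s) / abs qq * qB"

lemma opr_pj: "opr w pjk pj"
 unfolding opr_def
proof (intro conjI allI impI)
 have I0: "0 <= (LINT s|lborel. abs (qz s) * w s)" using w_pos by (intro Bochner_Integration.integral_nonneg) (simp add: less_imp_le)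
 then show "pjk >= 0" using qB0 by (simp add: pjk_def)
 fix R C D f g and e :: complex assume *: "C >= 0" "fam R w C f" "fam R w D g" "e \<in> ball 0 R"
 have eq: "lint qz (\<lambda>z. f e z - g e z) = lint qz (f e) - lint qz (g e)" by (rule fam_lint_diff[OF *(2,3,4) qz_measurable qz_int])
 show "pj (\<lambda>z. f e z - g e z) = (\<lambda>z. pj (f e) z - pj (g e) z)"
  unfolding pj_def eq by (simp add: fun_eq_iff algebra_simps diff_divide_distrib)
next
 fix R C f assume C: "C >= 0" and f: "fam R w C f"
 define I where "I = (LINT s|lborel. abs (qz s) * w s)"
 have I0: "0 <= I" unfolding I_def using w_pos by (intro Bochner_Integration.integral_nonneg) (simp add: less_imp_le)
 have "fam R w (C + (C * I / abs qq) * qB) (\<lambda>e z. f e z - lint qz (f e) / cx qq * cx (qz z))"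
 proof (rule fam_diff[OF f fam_scale[OF fam_real[OF qz_continuous qz_w(1)]]])
  show "hsym R (\<lambda>e. lint qz (f e) / cx qq)"
   unfolding divide_inverse of_real_inverse[symmetric] by (intro hsym_mult hsym_const lint_hsym[OF f qz_measurable qz_int])
  fix e :: complex assume e: "e \<in> ball 0 R"
  have "norm (lint qz (f e)) <= C * I"
   unfolding I_def by (rule lint_bound(2)[OF fam_measurable[OF f e] fam_bound[OF f e] qz_measurable qz_int])
  then show "norm (lint qz (f e) / cx qq) <= C * I / abs qq" by (simp add: norm_divide divide_right_mono)
 qed (use C I0 in simp)
 then show "fam R w (pjk * C) (\<lambda>e. pj (f e))" by (simp add: pj_def[abs_def] pjk_def I_def[symmetric] algebra_simps)
qed

lemma w_bounds: "!!z. w z >= 0" using w_pos less_imp_le by blast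

lemma opr_gg: "opr w (2 / (\<alpha> - de) * pjk * (1 / m)) gg"
 unfolding gg_def[abs_def]
 by (rule opr_mult[OF opr_comp[OF opr_tail opr_pj]]) (use m0 w_bounds in auto)

lemma w_le_exp: "w z <= exp ((\<alpha> - de) * abs z)"
proof -
 have "\<alpha> * (- z) <= \<alpha> * abs z" using al0 by (intro mult_left_mono) auto
 then show ?thesis by (simp add: wt_def algebra_simps)
qed

lemma Sw_tendsto: "((\<lambda>z. S z * w z) \<longlongrightarrow> 0) at_top" "((\<lambda>z. S z * w z) \<longlongrightarrow> 0) at_bot"
proof -
 have b: "norm (S z * w z) <= 4 * exp (- sg * abs z)" for z
 proof -
  have "S z * w z <= (4 * exp (- kp * abs z)) * exp ((\<alpha> - de) * abs z)"
   using S_pos[of z] w_pos[of z] by (intro mult_mono S_exp w_le_exp) auto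
  also have "\<dots> = 4 * exp (- (kp - \<alpha> + de) * abs z)" by (simp add: algebra_simps flip: exp_add)
  also have "\<dots> <= 4 * exp (- sg * abs z)" using de by (simp add: sg_def mult_right_mono)
  finally show ?thesis using S_pos[of z] w_pos[of z] by simp
 qed
 have "filterlim (\<lambda>z. - sg * abs z) at_bot F" if "filterlim (\<lambda>z::real. abs z) at_top F" for F
  using sg0 by (intro filterlim_tendsto_neg_mult_at_bot[OF tendsto_const _ that]) auto
 then have l: "((\<lambda>z. 4 * exp (- sg * abs z)) \<longlongrightarrow> 4 * 0) F" if "filterlim (\<lambda>z::real. abs z) at_top F" for F
  using that by (intro tendsto_mult tendsto_const filterlim_compose[OF exp_at_bot])
 show "((\<lambda>z. S z * w z) \<longlongrightarrow> 0) at_top" "((\<lambda>z. S z * w z) \<longlongrightarrow> 0) at_bot"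
  by (rule Lim_null_comparison[OF always_eventually]; use b l[OF filterlim_abs_real] l[OF filterlim_at_bot_mirror[THEN iffD2, of abs]] filterlim_abs_real in auto)+
qed

lemma qz_lint_self: "lint qz (\<lambda>z. cx (qz z)) = cx qq"
 by (simp add: lint_def qq_def power2_eq_square flip: of_real_mult)

lemma T_lim: "(T \<longlongrightarrow> 1) at_top" "(T \<longlongrightarrow> - 1) at_bot"
proof -
 have k: "kp / 2 > 0" using kp0 by simp
 have "filterlim (\<lambda>z. kp / 2 * z) at_top at_top" "filterlim (\<lambda>z. kp / 2 * z) at_bot at_bot"
  by (rule filterlim_tendsto_pos_mult_at_top[OF tendsto_const k filterlim_ident],
   rule filterlim_tendsto_pos_mult_at_bot[OF tendsto_const k filterlim_ident])
 from filterlim_compose[OF tanh_real_at_top this(1)] filterlim_compose[OF tanh_real_at_bot this(2)]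
 show "(T \<longlongrightarrow> 1) at_top" "(T \<longlongrightarrow> - 1) at_bot" by (simp_all add: T_def[abs_def])
qed

lemma real_integral_line:
 fixes F f :: "real => real"
 assumes d: "!!x. (F has_real_derivative f x) (at x)" and f: "continuous_on UNIV f" "intg f"
  and l: "(F \<longlongrightarrow> l) at_top" "(F \<longlongrightarrow> l') at_bot"
 shows "(LINT x|lborel. f x) = l - l'"
proof -
 have "(LINT x|lborel. cx (f x)) = cx l - cx l'"
  by (rule integral_derivative_line[OF has_vector_derivative_of_real'[OF d]])
   (use f l in \<open>auto intro: continuous_intros tendsto_of_real integrable_of_real\<close>)
 then show ?thesis by (simp flip: of_real_diff)
qed

lemma S2_int: "(LINT z|lborel. S z * S z) = 8 / (3 * kp)" "intg (\<lambda>z. S z * S z)"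
proof -
 have p: "(c\<^sup>2 - 1) / c \<noteq> 0" using csq c1 by (simp add: less_imp_neq[symmetric])
 have "intg (\<lambda>z. 1 / ((c\<^sup>2 - 1) / c)\<^sup>2 * (qz z)\<^sup>2)" using qz2_int by simp
 moreover have "(\<lambda>z. 1 / ((c\<^sup>2 - 1) / c)\<^sup>2 * (qz z)\<^sup>2) = (\<lambda>z. S z * S z)" using p by (simp add: qz_def power2_eq_square fun_eq_iff)
 ultimately show i: "intg (\<lambda>z. S z * S z)" by (simp only:)
 have d: "((\<lambda>z. 2 / kp * (T z - 1 / 3 * (T z * (T z * T z)))) has_real_derivative S z * S z) (at z)" for z
  using kp0 by (rule_tac derivative_eq_intros refl)+ (simp add: TT SSi_left algebra_simps add_divide_distrib diff_divide_distrib)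
 have "(LINT z|lborel. S z * S z) = 2 / kp * (1 - 1 / 3 * (1 * (1 * 1))) - 2 / kp * (- 1 - 1 / 3 * (- 1 * (- 1 * - 1)))"
  by (rule real_integral_line[OF d _ i]) (intro continuous_intros S_continuous tendsto_intros T_lim)+
 then show "(LINT z|lborel. S z * S z) = 8 / (3 * kp)" by simp
qed

lemma qq_eq: "qq = ((c\<^sup>2 - 1) / c)\<^sup>2 * (8 / (3 * kp))"
proof -
 have "(qz z)\<^sup>2 = ((c\<^sup>2 - 1) / c)\<^sup>2 * (S z * S z)" for z by (simp add: qz_def power2_eq_square)
 then show ?thesis unfolding qq_def by (simp only: integral_mult_right_zero S2_int)
qed

lemma qq_pos: "qq > 0"
proof -
 have "(c\<^sup>2 - 1) / c > 0" using csq c1 by (intro divide_pos_pos) auto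
 then show ?thesis unfolding qq_eq using kp0 by (intro mult_pos_pos zero_less_power) auto
qed

lemma lint_pj:
 assumes "fam R w C f" "e \<in> ball 0 R" shows "lint qz (pj (f e)) = 0"
proof -
 have i: "intg (\<lambda>z. cx (qz z) * cx (qz z))"
  using qz2_int by (simp add: power2_eq_square flip: of_real_mult)
 have "lint qz (pj (f e)) = (LINT z|lborel. cx (qz z) * f e z - lint qz (f e) / cx qq * (cx (qz z) * cx (qz z)))"
  unfolding lint_def pj_def by (intro Bochner_Integration.integral_cong refl) (simp add: algebra_simps lint_def)
 also have "\<dots> = lint qz (f e) - lint qz (f e) / cx qq * lint qz (\<lambda>z. cx (qz z))"
  using fam_lint_int[OF assms qz_measurable qz_int] i by (simp add: lint_def)
 finally show ?thesis using qq_pos by (simp add: qz_lint_self)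
qed

lemma gg_fam: "C >= 0 ==> fam R w C f ==> fam R w (2 / (\<alpha> - de) * pjk * (1 / m) * C) (\<lambda>e. gg (f e))"
 by (rule opr_fam[OF opr_gg])

lemma gg_deriv:
 assumes "fam R w C f" "C >= 0" "e \<in> ball 0 R"
 shows "(gg (f e) has_vector_derivative pj (f e) z / cx m) (at z)"
proof -
 note p = opr_fam[OF opr_pj assms(2,1)]
 have "(tail (pj (f e)) has_vector_derivative - pj (f e) z) (at z)"
  by (rule tail_deriv[OF fam_cont[OF p assms(3)] fam_bound[OF p assms(3)]])
 then have "((\<lambda>z. cx (- 1 / m) * tail (pj (f e)) z) has_vector_derivative cx (- 1 / m) * (- pj (f e) z)) (at z)"
  by (rule has_vector_derivative_mult_right)
 then show ?thesis by (simp add: gg_def[abs_def])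
qed

lemma ph_int: "intg (\<lambda>s. abs (ph s) * w s)"
proof (rule dual_integrable)
 show "bmeas ph" by (intro borel_measurable_continuous_onI ph_continuous)
 show "abs (ph z) <= 4 * w (- z)" for z using ph_bound(1)[of z] exp_le_w(2)[of z] by linarith
qed

lemma ph_measurable: "bmeas ph" by (intro borel_measurable_continuous_onI ph_continuous)

text \<open>Solvability of the second-order equation: the derivative of \<open>S\<close> is
  \<open>- kp * ph\<close>, so integration by parts turns the pairing of \<open>ph\<close> with
  \<open>gg (f e)\<close> into a multiple of \<open>lint qz (pj (f e))\<close>, which
  vanishes.\<close>

lemma gg_solvable:
 assumes f: "fam R w C f" "C >= 0" and e: "e \<in> ball 0 R"
 shows "lint ph (gg (f e)) = 0"
proof -
 define G where "G = gg (f e)"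
 note gf = gg_fam[OF f(2,1)] and pf = opr_fam[OF opr_pj f(2,1)]
 have Sm: "bmeas S" by (intro borel_measurable_continuous_onI S_continuous)
 have Si: "intg (\<lambda>s. abs (S s) * w s)"
  using dual_integrable[OF Sm, of 4] S_w(2) S_pos by (simp add: less_imp_le)
 have d: "((\<lambda>z. cx (S z) * G z) has_vector_derivative cx (S z) * (pj (f e) z / cx m) + cx (- kp * T z * S z) * G z) (at z)" for z
  unfolding G_def by (rule has_vector_derivative_mult[OF has_vector_derivative_of_real'[OF S_deriv] gg_deriv[OF f e]])
 have i1: "intg (\<lambda>z. cx (S z) * pj (f e) z)" by (rule fam_lint_int[OF pf e Sm Si])
 have i2: "intg (\<lambda>z. cx (ph z) * G z)" unfolding G_def by (rule fam_lint_int[OF gf e ph_measurable ph_int])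
 have eq: "cx (S z) * (pj (f e) z / cx m) + cx (- kp * T z * S z) * G z = cx (1 / m) * (cx (S z) * pj (f e) z) - cx kp * (cx (ph z) * G z)" for z
  by (simp add: ph_def)
 have bnd: "norm (cx (S z) * G z) <= (2 / (\<alpha> - de) * pjk * (1 / m) * C) * (S z * w z)" for z
  using mult_left_mono[OF fam_bound[OF gf e, of z], of "S z"] S_pos[of z] by (simp add: norm_mult G_def ac_simps)
 have lim: "((\<lambda>z. cx (S z) * G z) \<longlongrightarrow> 0) F" if "((\<lambda>z. S z * w z) \<longlongrightarrow> 0) F" for F
  by (rule Lim_null_comparison[OF always_eventually tendsto_mult_right_zero[OF that]]) (use bnd in blast)
 have "(LINT z|lborel. cx (1 / m) * (cx (S z) * pj (f e) z) - cx kp * (cx (ph z) * G z)) = 0 - 0"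
 proof (rule integral_derivative_line[OF d[unfolded eq]])
  show "continuous_on UNIV (\<lambda>z. cx (1 / m) * (cx (S z) * pj (f e) z) - cx kp * (cx (ph z) * G z))"
   unfolding G_def by (intro continuous_intros S_continuous ph_continuous fam_cont[OF pf e] fam_cont[OF gf e])
  show "intg (\<lambda>z. cx (1 / m) * (cx (S z) * pj (f e) z) - cx kp * (cx (ph z) * G z))"
   using i1 i2 by simp
 qed (rule lim Sw_tendsto)+
 then have "cx (1 / m) * lint S (pj (f e)) = cx kp * lint ph G"
  using i1 i2 by (simp add: lint_def del: of_real_divide)
 moreover have "lint qz (pj (f e)) = cx ((c\<^sup>2 - 1) / c) * lint S (pj (f e))"
  unfolding lint_def qz_def by (subst integral_mult_right_zero[symmetric]) (simp add: mult.assoc)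
 then have "lint S (pj (f e)) = 0" using lint_pj[OF f(1) e] csq c1 by (auto simp del: of_real_divide)
 ultimately show ?thesis using kp0 by (simp add: G_def)
qed

text \<open>Variation of constants; \<open>2 / kp\<close> is the reciprocal of the Wronskian of
  \<open>ph\<close> and \<open>ps\<close>.\<close>

definition Wg :: "(real => complex) => real => complex" where
 "Wg g z = cx (- 2 / kp * ps z) * lint (kc1 z) g + cx (- 2 / kp * ph z) * lint (kc2 z) g"
definition Wg1 :: "(real => complex) => real => complex" where
 "Wg1 g z = cx (- 2 / kp * ps1 z) * lint (kc1 z) g + cx (- 2 / kp * ph1 z) * lint (kc2 z) g"

lemma Wg_deriv:
 assumes g: "continuous_on UNIV g" "!!z. norm (g z) <= C * w z" and s: "lint ph g = 0"
 shows "(Wg g has_vector_derivative Wg1 g z) (at z)"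
  and "(Wg1 g has_vector_derivative g z + cx (kp\<^sup>2 - 3 * kp\<^sup>2 * S z) * Wg g z) (at z)"
proof -
 note gm = borel_measurable_continuous_onI[OF g(1)]
 note [measurable] = gm ph_measurable
 have Fi: "intg (\<lambda>s. cx (ph s) * g s)" by (rule lint_bound(1)[OF gm g(2) ph_measurable ph_int])
 have ii: "intg (\<lambda>s. cx (indicat_real A s) * (cx (ph s) * g s))" if [measurable]: "A \<in> sets borel" for A
  by (rule Bochner_Integration.integrable_bound[OF Fi]) (auto simp: indicator_def)
 \<comment> \<open>The condition \<open>lint ph g = 0\<close> identifies the outward integral for
   negative \<open>z\<close> with the integral over the right half line, so one differentiable
   formula holds for all \<open>z\<close>.\<close>
 have k1: "lint (kc1 z) g = (LINT s|lborel. cx (indicator {z..} s) * (cx (ph s) * g s))" for z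
 proof (cases "z >= 0")
  case True
  then show ?thesis by (simp add: lint_def kc1_def mult.assoc)
 next
  case False
  have "AE s in lborel. cx (ph s) * g s = cx (indicator {z..} s) * (cx (ph s) * g s) + cx (indicator {..z} s) * (cx (ph s) * g s)"
   using AE_lborel_singleton[of z] by eventually_elim (auto simp: indicator_def)
  then have "lint ph g = (LINT s|lborel. cx (indicator {z..} s) * (cx (ph s) * g s) + cx (indicator {..z} s) * (cx (ph s) * g s))"
   unfolding lint_def by (intro integral_cong_AE) auto
  also have "\<dots> = (LINT s|lborel. cx (indicator {z..} s) * (cx (ph s) * g s)) + (LINT s|lborel. cx (indicator {..z} s) * (cx (ph s) * g s))"
   using ii[of "{z..}"] ii[of "{..z}"] by simp
  finally have "(LINT s|lborel. cx (indicator {z..} s) * (cx (ph s) * g s)) = - (LINT s|lborel. cx (indicator {..z} s) * (cx (ph s) * g s))"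
   unfolding s by (simp add: eq_neg_iff_add_eq_0)
  then show ?thesis using False by (simp add: lint_def kc1_def mult.assoc)
 qed
 have k2: "lint (kc2 z) g = (LINT s|lborel. cx (sgi z s) * (cx (ps s) * g s))" for z
  by (simp add: lint_def kc2_def mult.assoc)
 have cF: "continuous_on UNIV (\<lambda>s. cx (ph s) * g s)" "continuous_on UNIV (\<lambda>s. cx (ps s) * g s)"
  by (intro continuous_intros ph_continuous ps_continuous g)+
 have fe: "(\<lambda>z. lint (kc1 z) g) = (\<lambda>z. LINT s|lborel. cx (indicator {z..} s) * (cx (ph s) * g s))"
  "(\<lambda>z. lint (kc2 z) g) = (\<lambda>z. LINT s|lborel. cx (sgi z s) * (cx (ps s) * g s))"
  by (rule ext, rule k1, rule ext, rule k2)
 have d1: "((\<lambda>z. lint (kc1 z) g) has_vector_derivative - (cx (ph z) * g z)) (at z)" for z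
  unfolding fe by (rule tail_derivative[OF cF(1) ii]) simp
 have d2: "((\<lambda>z. lint (kc2 z) g) has_vector_derivative cx (ps z) * g z) (at z)" for z
  unfolding fe by (rule sgi_primitive[OF cF(2)])
 note sc = has_vector_derivative_of_real'[OF DERIV_cmult]
 have "(Wg g has_vector_derivative (cx (- 2 / kp * ps z) * - (cx (ph z) * g z) + cx (- 2 / kp * ps1 z) * lint (kc1 z) g)
   + (cx (- 2 / kp * ph z) * (cx (ps z) * g z) + cx (- 2 / kp * ph1 z) * lint (kc2 z) g)) (at z)"
  unfolding Wg_def[abs_def]
  by (intro has_vector_derivative_add has_vector_derivative_mult[OF sc[OF ps_deriv] d1] has_vector_derivative_mult[OF sc[OF ph_deriv] d2])
 then show "(Wg g has_vector_derivative Wg1 g z) (at z)"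
  by (rule back_subst[of "\<lambda>x. (Wg g has_vector_derivative x) (at z)"]) (simp add: Wg1_def algebra_simps)
 have "(Wg1 g has_vector_derivative (cx (- 2 / kp * ps1 z) * - (cx (ph z) * g z) + cx (- 2 / kp * ((kp\<^sup>2 - 3 * kp\<^sup>2 * S z) * ps z)) * lint (kc1 z) g)
   + (cx (- 2 / kp * ph1 z) * (cx (ps z) * g z) + cx (- 2 / kp * ((kp\<^sup>2 - 3 * kp\<^sup>2 * S z) * ph z)) * lint (kc2 z) g)) (at z)"
  unfolding Wg1_def[abs_def]
  by (intro has_vector_derivative_add has_vector_derivative_mult[OF sc[OF ps1_deriv] d1] has_vector_derivative_mult[OF sc[OF ph1_deriv] d2])
 moreover have "(cx (- 2 / kp * ps1 z) * - (cx (ph z) * g z) + cx (- 2 / kp * ((kp\<^sup>2 - 3 * kp\<^sup>2 * S z) * ps z)) * lint (kc1 z) g)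
   + (cx (- 2 / kp * ph1 z) * (cx (ps z) * g z) + cx (- 2 / kp * ((kp\<^sup>2 - 3 * kp\<^sup>2 * S z) * ph z)) * lint (kc2 z) g)
   = cx (2 / kp * (ph z * ps1 z - ph1 z * ps z)) * g z + cx (kp\<^sup>2 - 3 * kp\<^sup>2 * S z) * Wg g z"
  unfolding Wg_def by (simp add: algebra_simps)
 ultimately show "(Wg1 g has_vector_derivative g z + cx (kp\<^sup>2 - 3 * kp\<^sup>2 * S z) * Wg g z) (at z)"
  unfolding wronskian using kp0 by simp
qed

end

section \<open>Boundedness and derivatives of the right inverse\<close>

context benney_luke
begin

definition "ggk = 2 / (\<alpha> - de) * pjk * (1 / m)"

lemma ggk0: "ggk >= 0" using opr_nonneg[OF opr_gg] by (simp add: ggk_def)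

lemma gg_fam': "C >= 0 ==> fam R w C f ==> fam R w (ggk * C) (\<lambda>e. gg (f e))"
 unfolding ggk_def by (rule gg_fam)

text \<open>The common shape of \<open>Wg\<close> and its derivative, so that boundedness is proved
  once: growth of \<open>p1\<close> and decay of \<open>p2\<close> at rate \<open>kp\<close> balance
  the bounds of the two kernel integrals.\<close>

definition Vk :: "(real => real) => (real => real) => (real => complex) => real => complex" where
 "Vk p1 p2 f z = cx (p1 z) * lint (kc1 z) (gg f) + cx (p2 z) * lint (kc2 z) (gg f)"

lemma opr_Vk:
 assumes p: "!!z. abs (p1 z) <= D1 * exp (kp * abs z)" "!!z. abs (p2 z) <= D2 * exp (- kp * abs z)" "D1 >= 0" "D2 >= 0"
  and cont: "!!R C f e. C >= 0 ==> fam R w C f ==> e \<in> ball 0 R ==> continuous_on UNIV (Vk p1 p2 (f e))"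
 shows "opr w ((D1 * 4 + D2 * 8) * (2 / sg) * ggk) (Vk p1 p2)"
 unfolding opr_def
proof (intro conjI allI impI)
 show "(D1 * 4 + D2 * 8) * (2 / sg) * ggk >= 0" using p(3,4) sg0 ggk0 by simp
 fix R C D f g and e :: complex assume *: "C >= 0" "D >= 0" "fam R w C f" "fam R w D g" "e \<in> ball 0 R"
 have g: "gg (\<lambda>z. f e z - g e z) = (\<lambda>z. gg (f e) z - gg (g e) z)" by (rule opr_diff[OF opr_gg *])
 note gf = gg_fam'[OF *(1,3)] gg_fam'[OF *(2,4)]
 have l: "lint (kc1 z) (\<lambda>z. gg (f e) z - gg (g e) z) = lint (kc1 z) (gg (f e)) - lint (kc1 z) (gg (g e))"
   "lint (kc2 z) (\<lambda>z. gg (f e) z - gg (g e) z) = lint (kc2 z) (gg (f e)) - lint (kc2 z) (gg (g e))" for z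
  by (rule fam_lint_diff[OF gf *(5) kc_measurable(1) kc1_int(1)], rule fam_lint_diff[OF gf *(5) kc_measurable(2) kc2_int(1)])
 show "Vk p1 p2 (\<lambda>z. f e z - g e z) = (\<lambda>z. Vk p1 p2 (f e) z - Vk p1 p2 (g e) z)"
  by (rule ext) (simp only: Vk_def g l right_diff_distrib, simp)
next
 fix R C f assume C: "C >= 0" and f: "fam R w C f"
 note gf = gg_fam'[OF C f]
 show "fam R w ((D1 * 4 + D2 * 8) * (2 / sg) * ggk * C) (\<lambda>e. Vk p1 p2 (f e))"
  unfolding fam_def
 proof (intro conjI ballI allI)
  fix e :: complex assume e: "e \<in> ball 0 R"
  show "continuous_on UNIV (Vk p1 p2 (f e))" by (rule cont[OF C f e])
  fix z
  have G: "ggk * C >= 0" using ggk0 C by simp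
  have ex: "exp (kp * abs z) * exp (- kp * abs z) = 1" by (simp add: exp_minus)
  have n1: "norm (lint (kc1 z) (gg (f e))) <= ggk * C * (4 * exp (- kp * abs z) * w z * (2 / sg))"
   by (rule order_trans[OF lint_bound(2)[OF fam_measurable[OF gf e] fam_bound[OF gf e] kc_measurable(1) kc1_int(1)]])
    (rule mult_left_mono[OF kc1_int(2) G])
  have n2: "norm (lint (kc2 z) (gg (f e))) <= ggk * C * (8 * exp (kp * abs z) * w z * (2 / sg))"
   by (rule order_trans[OF lint_bound(2)[OF fam_measurable[OF gf e] fam_bound[OF gf e] kc_measurable(2) kc2_int(1)]])
    (rule mult_left_mono[OF kc2_int(2) G])
  have "norm (Vk p1 p2 (f e) z) <= abs (p1 z) * norm (lint (kc1 z) (gg (f e))) + abs (p2 z) * norm (lint (kc2 z) (gg (f e)))"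
   unfolding Vk_def by (rule norm_triangle_le) (simp add: norm_mult)
  also have "\<dots> <= (D1 * exp (kp * abs z)) * (ggk * C * (4 * exp (- kp * abs z) * w z * (2 / sg)))
    + (D2 * exp (- kp * abs z)) * (ggk * C * (8 * exp (kp * abs z) * w z * (2 / sg)))"
   using p by (intro add_mono mult_mono n1 n2) auto
  also have "\<dots> = (D1 * 4 + D2 * 8) * (2 / sg) * ggk * C * (exp (kp * abs z) * exp (- kp * abs z) * w z)"
   by (simp only: ring_distribs ac_simps)
  finally show "norm (Vk p1 p2 (f e) z) <= (D1 * 4 + D2 * 8) * (2 / sg) * ggk * C * w z" unfolding ex by simp
 next
  show "hsym R (\<lambda>e. Vk p1 p2 (f e) z)" for z
   unfolding Vk_def
   by (intro hsym_add hsym_mult hsym_const lint_hsym[OF gf kc_measurable(1) kc1_int(1)] lint_hsym[OF gf kc_measurable(2) kc2_int(1)])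
 qed
qed

text \<open>\<open>KK 0\<close> is a bounded right inverse, on functions orthogonal to the profile, of the linearized
 operator \<open>D (m D\<^sup>2 - (c\<^sup>2 - 1) + 3 c q) D\<close>; \<open>KK 1, KK 2, KK 3\<close> are its derivatives.\<close>

definition KK :: "nat => (real => complex) => real => complex" where
 "KK j f = (if j = 0 then (\<lambda>z. cx (- 1) * tail (Wg (gg f)) z) else if j = 1 then Wg (gg f) else if j = 2 then Wg1 (gg f)
   else (\<lambda>z. gg f z + cx (kp\<^sup>2 - 3 * kp\<^sup>2 * S z) * Wg (gg f) z))"

lemma WW_deriv:
 assumes f: "C >= 0" "fam R w C f" "e \<in> ball 0 R"
 shows "(Wg (gg (f e)) has_vector_derivative Wg1 (gg (f e)) z) (at z)"
  and "(Wg1 (gg (f e)) has_vector_derivative gg (f e) z + cx (kp\<^sup>2 - 3 * kp\<^sup>2 * S z) * Wg (gg (f e)) z) (at z)"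
proof -
 note gf = gg_fam'[OF f(1,2)]
 note d = Wg_deriv[OF fam_cont[OF gf f(3)] fam_bound[OF gf f(3)] gg_solvable[OF f(2,1,3)], of z]
 show "(Wg (gg (f e)) has_vector_derivative Wg1 (gg (f e)) z) (at z)"
  "(Wg1 (gg (f e)) has_vector_derivative gg (f e) z + cx (kp\<^sup>2 - 3 * kp\<^sup>2 * S z) * Wg (gg (f e)) z) (at z)"
  by (rule d(1), rule d(2))
qed

lemma opr_WW: "\<exists>k. opr w k (\<lambda>f. Wg (gg f))" "\<exists>k. opr w k (\<lambda>f. Wg1 (gg f))"
proof -
 have e: "(\<lambda>f. Wg (gg f)) = Vk (\<lambda>z. - 2 / kp * ps z) (\<lambda>z. - 2 / kp * ph z)"
  "(\<lambda>f. Wg1 (gg f)) = Vk (\<lambda>z. - 2 / kp * ps1 z) (\<lambda>z. - 2 / kp * ph1 z)"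
  by (simp_all only: fun_eq_iff Vk_def Wg_def Wg1_def simp_thms)
 have c: "continuous_on UNIV (Wg (gg (f e)))" "continuous_on UNIV (Wg1 (gg (f e)))" if "C >= 0" "fam R w C f" "e \<in> ball 0 R" for R C f e
  using WW_deriv[OF that] by (blast intro: continuous_at_imp_continuous_on has_vector_derivative_continuous)+
 have b: "\<bar>- 2 / kp * x\<bar> <= (2 / kp * B) * y" if "abs x <= B * y" for x y B
 proof -
  have "\<bar>- 2 / kp * x\<bar> = 2 / kp * abs x" using kp0 by (simp add: abs_mult)
  also have "\<dots> <= 2 / kp * (B * y)" using kp0 that by (intro mult_left_mono) auto
  finally show ?thesis by (simp only: mult.assoc)
 qed
 show "\<exists>k. opr w k (\<lambda>f. Wg (gg f))"
 proof (rule exI)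
  show "opr w ((2 / kp * 8 * 4 + 2 / kp * 4 * 8) * (2 / sg) * ggk) (\<lambda>f. Wg (gg f))"
   unfolding e(1)
  proof (rule opr_Vk)
   show "\<bar>- 2 / kp * ps z\<bar> <= 2 / kp * 8 * exp (kp * abs z)" for z by (rule b[OF ps_bound(1)])
   show "\<bar>- 2 / kp * ph z\<bar> <= 2 / kp * 4 * exp (- kp * abs z)" for z by (rule b[OF ph_bound(1)])
  qed (use kp0 c(1)[unfolded fun_cong[OF e(1)]] in auto)
 qed
 show "\<exists>k. opr w k (\<lambda>f. Wg1 (gg f))"
 proof (rule exI)
  show "opr w ((2 / kp * (12 * kp) * 4 + 2 / kp * (8 * kp) * 8) * (2 / sg) * ggk) (\<lambda>f. Wg1 (gg f))"
   unfolding e(2)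
  proof (rule opr_Vk)
   show "\<bar>- 2 / kp * ps1 z\<bar> <= 2 / kp * (12 * kp) * exp (kp * abs z)" for z by (rule b[OF ps_bound(2)])
   show "\<bar>- 2 / kp * ph1 z\<bar> <= 2 / kp * (8 * kp) * exp (- kp * abs z)" for z by (rule b[OF ph_bound(2)])
  qed (use kp0 c(2)[unfolded fun_cong[OF e(2)]] in auto)
 qed
qed

lemma opr_KK_ex: "\<exists>k. opr w k (KK j)"
proof -
 obtain k0 k1 where k: "opr w k0 (\<lambda>f. Wg (gg f))" "opr w k1 (\<lambda>f. Wg1 (gg f))" using opr_WW by blast
 have b: "\<bar>kp\<^sup>2 - 3 * kp\<^sup>2 * S z\<bar> <= 2 * kp\<^sup>2" for z
 proof -
  have "kp\<^sup>2 - 3 * kp\<^sup>2 * S z = kp\<^sup>2 * (1 - 3 * S z)" by (simp add: algebra_simps)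
  moreover have "\<bar>1 - 3 * S z\<bar> <= 2" using S_pos[of z] S_le1[of z] by (simp add: abs_le_iff)
  ultimately show ?thesis using mult_left_mono[of "\<bar>1 - 3 * S z\<bar>" 2 "kp\<^sup>2"] by (simp add: abs_mult)
 qed
 have cS: "continuous_on UNIV (\<lambda>z. kp\<^sup>2 - 3 * kp\<^sup>2 * S z)" by (intro continuous_intros S_continuous)
 consider "j = 0" | "j = 1" | "j = 2" | "j \<noteq> 0" "j \<noteq> 1" "j \<noteq> 2" by blast
 then show ?thesis
 proof cases
  case 1
  show ?thesis unfolding KK_def 1
   using opr_mult[OF opr_comp[OF opr_tail k(1)], of "\<lambda>_. - 1" 1] w_bounds by auto
 next
  case 4
  show ?thesis using opr_add[OF opr_gg opr_mult[OF k(1) cS b w_bounds]] 4 unfolding KK_def by auto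
 next
  case 2
  have "KK j = (\<lambda>f. Wg (gg f))" by (rule ext) (simp add: KK_def 2)
  then show ?thesis using k(1) by auto
 next
  case 3
  have "KK j = (\<lambda>f. Wg1 (gg f))" by (rule ext) (simp add: KK_def 3)
  then show ?thesis using k(2) by auto
 qed
qed

definition "kk j = (SOME k. opr w k (KK j))"

lemma opr_KK: "opr w (kk j) (KK j)"
 unfolding kk_def by (rule someI_ex[OF opr_KK_ex])

lemma KK_deriv:
 assumes f: "C >= 0" "fam R w C f" "e \<in> ball 0 R"
 shows "(KK 0 (f e) has_vector_derivative KK 1 (f e) z) (at z)"
  and "(KK 1 (f e) has_vector_derivative KK 2 (f e) z) (at z)"
  and "(KK 2 (f e) has_vector_derivative KK 3 (f e) z) (at z)"
  and "(KK 3 (f e) has_vector_derivative (pj (f e) z / cx m + cx (3 * kp ^ 3 * (T z * S z)) * KK 1 (f e) z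
    + cx (kp\<^sup>2 - 3 * kp\<^sup>2 * S z) * KK 2 (f e) z)) (at z)"
proof -
 note kf = opr_fam[OF opr_KK[of 1] f(1,2)]
 note d = WW_deriv[OF f]
 have 1: "KK 1 (f e) = Wg (gg (f e))" "KK 2 (f e) = Wg1 (gg (f e))" by (simp_all add: KK_def)
 show "(KK 1 (f e) has_vector_derivative KK 2 (f e) z) (at z)" unfolding 1 by (rule d(1))
 show "(KK 2 (f e) has_vector_derivative KK 3 (f e) z) (at z)" unfolding 1 using d(2)[of z] by (simp add: KK_def)
 have "(tail (KK 1 (f e)) has_vector_derivative - KK 1 (f e) z) (at z)"
  by (rule tail_deriv[OF fam_cont[OF kf f(3)] fam_bound[OF kf f(3)]])
 then have "((\<lambda>z. cx (- 1) * tail (KK 1 (f e)) z) has_vector_derivative cx (- 1) * (- KK 1 (f e) z)) (at z)"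
  by (rule has_vector_derivative_mult_right)
 then show "(KK 0 (f e) has_vector_derivative KK 1 (f e) z) (at z)" unfolding 1 by (simp add: KK_def)
 have sd: "((\<lambda>z. kp\<^sup>2 - 3 * kp\<^sup>2 * S z) has_real_derivative 3 * kp ^ 3 * (T z * S z)) (at z)"
  by (rule derivative_eq_intros refl)+ (simp add: power3_eq_cube power2_eq_square)
 have "((\<lambda>z. gg (f e) z + cx (kp\<^sup>2 - 3 * kp\<^sup>2 * S z) * Wg (gg (f e)) z) has_vector_derivative
   (pj (f e) z / cx m + (cx (kp\<^sup>2 - 3 * kp\<^sup>2 * S z) * Wg1 (gg (f e)) z + cx (3 * kp ^ 3 * (T z * S z)) * Wg (gg (f e)) z))) (at z)"
  by (intro has_vector_derivative_add has_vector_derivative_mult gg_deriv[OF f(2,1,3)] has_vector_derivative_of_real'[OF sd] d(1))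
 moreover have "KK 3 (f e) = (\<lambda>z. gg (f e) z + cx (kp\<^sup>2 - 3 * kp\<^sup>2 * S z) * Wg (gg (f e)) z)" by (simp add: KK_def)
 ultimately show "(KK 3 (f e) has_vector_derivative (pj (f e) z / cx m + cx (3 * kp ^ 3 * (T z * S z)) * KK 1 (f e) z
    + cx (kp\<^sup>2 - 3 * kp\<^sup>2 * S z) * KK 2 (f e) z)) (at z)" unfolding 1 by (simp only: ac_simps)
qed

end

section \<open>Smooth holomorphic families\<close>

definition smfam :: "real => (real => real) => (nat => complex => real => complex) => bool" where
 "smfam R w D \<longleftrightarrow> (\<forall>n. \<exists>C\<ge>0. fam R w C (D n)) \<and>
   (\<forall>n. \<forall>e\<in>ball 0 R. \<forall>z. (D n e has_vector_derivative D (Suc n) e z) (at z))"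

text \<open>As \<open>T\<close> has a derivative polynomial in itself, this class is closed under
  \<open>d/dz\<close> once it contains the derivatives of its base. Weighted bounds and derivatives
  of every order then come without explicit formulas.\<close>

inductive gen :: "real => (real => real) => (complex => real => complex) set => (complex => real => complex) => bool"
 for R :: real and T :: "real => real" and B where
 gen_base: "X \<in> B ==> gen R T B X"
| gen_add: "gen R T B X ==> gen R T B Y ==> gen R T B (\<lambda>e z. X e z + Y e z)"
| gen_scale: "gen R T B X ==> hsym R h ==> (!!e. e \<in> ball 0 R ==> norm (h e) <= D) ==> D >= 0 ==> gen R T B (\<lambda>e z. h e * X e z)"
| gen_poly: "gen R T B X ==> gen R T B (\<lambda>e z. cx (poly p (T z)) * X e z)"

lemma gen_fam:
 assumes w: "!!z. w z >= 0" and T: "continuous_on UNIV T" "!!z. abs (T z) <= 1"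
  and B: "!!X. X \<in> B ==> \<exists>C\<ge>0. fam R w C X" and X: "gen R T B X"
 shows "\<exists>C\<ge>0. fam R w C X"
 using X
proof (induction rule: gen.induct)
 case (gen_add X Y)
 then obtain C C' where "C >= 0" "C' >= 0" "fam R w C X" "fam R w C' Y" by blast
 then show ?case using fam_add[of R w C X C' Y] by (intro exI[of _ "C + C'"]) simp
next
 case (gen_scale X h D)
 then obtain C where "C >= 0" "fam R w C X" by blast
 then show ?case using fam_scale[of R w C X h D] gen_scale by (intro exI[of _ "D * C"]) simp
next
 case (gen_poly X p)
 then obtain C where C: "C >= 0" "fam R w C X" by blast
 have "compact ((\<lambda>x. poly p x) ` {- 1..1::real})" by (intro compact_continuous_image continuous_intros compact_Icc)
 then obtain D where D: "!!x. x \<in> {- 1..1} ==> abs (poly p x) <= D"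
  by (force dest!: compact_imp_bounded simp: bounded_iff)
 have D0: "D >= 0" using D[of 0] by simp
 have "\<bar>poly p (T z)\<bar> * w z <= D * w z" for z
  using T(2)[of z] w[of z] by (intro mult_right_mono D) (auto simp: abs_le_iff)
 then have "fam R w (C * D) (\<lambda>e z. cx (poly p (T z)) * X e z)"
  by (intro fam_mult_real[OF C(2) _ _ C(1)] continuous_intros T)
 then show ?case using C D0 by (intro exI[of _ "C * D"]) simp
qed (use B in blast)

lemma gen_deriv:
 fixes t :: "real poly"
 assumes T: "!!z. (T has_real_derivative poly t (T z)) (at z)"
  and B: "!!X. X \<in> B ==> \<exists>Y. gen R T B Y \<and> (\<forall>e\<in>ball 0 R. \<forall>z. (X e has_vector_derivative Y e z) (at z))" and X: "gen R T B X"
 shows "\<exists>Y. gen R T B Y \<and> (\<forall>e\<in>ball 0 R. \<forall>z. (X e has_vector_derivative Y e z) (at z))"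
 using X
proof (induction rule: gen.induct)
 case (gen_add X Y)
 then obtain X' Y' where *: "gen R T B X'" "\<forall>e\<in>ball 0 R. \<forall>z. (X e has_vector_derivative X' e z) (at z)"
  "gen R T B Y'" "\<forall>e\<in>ball 0 R. \<forall>z. (Y e has_vector_derivative Y' e z) (at z)" by blast
 show ?case using * by (intro exI[of _ "\<lambda>e z. X' e z + Y' e z"] conjI gen.gen_add) (auto intro: has_vector_derivative_add)
next
 case (gen_scale X h D)
 then obtain X' where *: "gen R T B X'" "\<forall>e\<in>ball 0 R. \<forall>z. (X e has_vector_derivative X' e z) (at z)" by blast
 show ?case using * gen_scale
  by (intro exI[of _ "\<lambda>e z. h e * X' e z"] conjI gen.gen_scale[of R T B X' h D]) (auto intro: has_vector_derivative_mult_right)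
next
 case (gen_poly X p)
 then obtain X' where *: "gen R T B X'" "\<forall>e\<in>ball 0 R. \<forall>z. (X e has_vector_derivative X' e z) (at z)" by blast
 have d: "((\<lambda>z. poly p (T z)) has_real_derivative poly (pderiv p * t) (T z)) (at z)" for z
  using DERIV_chain2[OF poly_DERIV T] by simp
 show ?case using * gen_poly
  by (intro exI[of _ "\<lambda>e z. cx (poly p (T z)) * X' e z + cx (poly (pderiv p * t) (T z)) * X e z"] conjI gen.gen_add gen.gen_poly)
   (auto intro: has_vector_derivative_mult has_vector_derivative_of_real'[OF d] simp del: poly_mult of_real_mult)
qed (use B in blast)

lemma gen_smfam:
 fixes t :: "real poly"
 assumes w: "!!z. w z >= 0" and T: "!!z. (T has_real_derivative poly t (T z)) (at z)" "!!z. abs (T z) <= 1"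
  and B: "!!X. X \<in> B ==> \<exists>C\<ge>0. fam R w C X"
   "!!X. X \<in> B ==> \<exists>Y. gen R T B Y \<and> (\<forall>e\<in>ball 0 R. \<forall>z. (X e has_vector_derivative Y e z) (at z))"
  and X: "gen R T B X"
 shows "\<exists>D. D 0 = X \<and> smfam R w D"
proof -
 define d where "d X = (SOME Y. gen R T B Y \<and> (\<forall>e\<in>ball 0 R. \<forall>z. (X e has_vector_derivative Y e z) (at z)))" for X
 have d: "gen R T B (d X)" "\<forall>e\<in>ball 0 R. \<forall>z. (X e has_vector_derivative d X e z) (at z)" if "gen R T B X" for X
  using someI_ex[OF gen_deriv[OF T(1) B(2) that]] unfolding d_def by blast+
 have Tc: "continuous_on UNIV T" using T(1) by (meson DERIV_isCont continuous_at_imp_continuous_on)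
 have g: "gen R T B ((d ^^ n) X)" for n by (induction n) (auto intro: d X)
 show ?thesis
 proof (intro exI[of _ "\<lambda>n. (d ^^ n) X"] conjI)
  show "smfam R w (\<lambda>n. (d ^^ n) X)" unfolding smfam_def
  proof (intro conjI allI)
   show "\<exists>C\<ge>0. fam R w C ((d ^^ n) X)" for n by (rule gen_fam[OF w Tc T(2) B(1) g])
   show "\<forall>e\<in>ball 0 R. \<forall>z. ((d ^^ n) X e has_vector_derivative (d ^^ Suc n) X e z) (at z)" for n
    using d(2)[OF g[of n]] by simp
  qed
 qed simp
qed

section \<open>Parameter derivatives\<close>

definition ed :: "nat => (complex => real => complex) => complex => real => complex" where
 "ed n X e z = (deriv ^^ n) (\<lambda>e. X e z) e"

lemma smfam_fam: "smfam R w D ==> \<exists>C\<ge>0. fam R w C (D n)"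
 and smfam_deriv: "smfam R w D ==> e \<in> ball 0 R ==> (D n e has_vector_derivative D (Suc n) e z) (at z)"
 by (auto simp: smfam_def)

lemma smfam_ed_bound:
 assumes D: "smfam R w D" and R: "R > 0"
 shows "\<exists>C\<ge>0. \<forall>e\<in>ball 0 (R / 2). \<forall>z. norm (ed n (D j) e z) <= C * w z"
proof -
 obtain C where C: "C >= 0" "fam R w C (D j)" using smfam_fam[OF D] by blast
 have "norm (ed n (D j) e z) <= (fact n * C / (R / 4) ^ n) * w z" if "e \<in> ball 0 (R / 2)" for e z
  using higher_deriv_bound[OF fam_hol[OF C(2), of z] fam_bound[OF C(2)] that, of n] by (simp add: ed_def ac_simps)
 moreover have "fact n * C / (R / 4) ^ n >= 0" using C(1) R by simp
 ultimately show ?thesis by blast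
qed

lemma smfam_ed_taylor:
 assumes D: "smfam R w D" "R > 0"
 shows "\<exists>C\<ge>0. \<forall>e\<in>ball 0 (R / 2). \<forall>e0\<in>ball 0 (R / 2). \<forall>z.
  norm (ed n (D j) e z - ed n (D j) e0 z - (e - e0) * ed (Suc n) (D j) e0 z) <= C * (norm (e - e0))\<^sup>2 * w z"
proof -
 obtain C where C: "C >= 0" "fam R w C (D j)" using smfam_fam[OF D(1)] by blast
 have "norm (ed n (D j) e z - ed n (D j) e0 z - (e - e0) * ed (Suc n) (D j) e0 z) <= (fact (n + 2) * C / (R / 4) ^ (n + 2)) * (norm (e - e0))\<^sup>2 * w z"
  if "e \<in> ball 0 (R / 2)" "e0 \<in> ball 0 (R / 2)" for e e0 z
  using higher_deriv_taylor[OF fam_hol[OF C(2), of z] fam_bound[OF C(2)] that, of n] unfolding ed_def by (simp add: ac_simps del: funpow.simps)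
 moreover have "fact (n + 2) * C / (R / 4) ^ (n + 2) >= 0" using C(1) D(2) by simp
 ultimately show ?thesis by blast
qed

text \<open>The derivatives in the parameter and in the variable commute: the second-order Taylor
 remainder in the variable is a holomorphic function of the parameter, so Cauchy's estimate
 bounds its parameter derivatives.\<close>

lemma smfam_ed_deriv:
 assumes D: "smfam R w D" and w: "!!z s. abs s <= 1 ==> w (z + s) <= W * w z" "!!z. w z >= 0" and e: "e \<in> ball 0 (R / 2)"
 shows "(ed n (D j) e has_vector_derivative ed n (D (Suc j)) e z) (at z)"
proof -
 have R: "R > 0" using e norm_ge_zero[of e] by (simp del: norm_ge_zero)
 obtain C where C: "C >= 0" "fam R w C (D (Suc (Suc j)))" using smfam_fam[OF D] by blast
 define K where "K = C * (W * w z)"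
 have b2: "norm (D (Suc (Suc j)) x s) <= K" if "x \<in> ball 0 R" "\<bar>s - z\<bar> <= 1" for x s
 proof -
  have "w s <= W * w z" using w(1)[of "s - z" z] that(2) by simp
  from order_trans[OF fam_bound[OF C(2) that(1), of s] mult_left_mono[OF this C(1)]] show ?thesis by (simp only: K_def)
 qed
 have K0: "K >= 0" using b2[of 0 z] R by (simp add: order_trans[OF norm_ge_zero])
 have seg: "\<bar>s - z\<bar> <= \<bar>h\<bar>" if "s \<in> closed_segment z (z + h)" for s h :: real
  using that by (auto simp: closed_segment_eq_real_ivl split: if_splits)
 have lip: "norm (D (Suc j) x s - D (Suc j) x z) <= abs h * K" if "x \<in> ball 0 R" "abs h <= 1" "\<bar>s - z\<bar> <= \<bar>h\<bar>" for x s h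
 proof -
  have "norm (D (Suc j) x s - D (Suc j) x z) <= norm (s - z) * K"
  proof -
   have "norm (D (Suc j) x s - D (Suc j) x z) <= K * norm (s - z)"
   proof (rule differentiable_bound[of "{z - abs h..z + abs h}" _ "\<lambda>t y. y *\<^sub>R D (Suc (Suc j)) x t"])
    show "(D (Suc j) x has_derivative (\<lambda>y. y *\<^sub>R D (Suc (Suc j)) x t)) (at t within {z - abs h..z + abs h})" for t
     using smfam_deriv[OF D that(1), of "Suc j" t] unfolding has_vector_derivative_def by (rule has_derivative_at_withinI)
    show "onorm (\<lambda>y. y *\<^sub>R D (Suc (Suc j)) x t) <= K" if t: "t \<in> {z - abs h..z + abs h}" for t
    proof (rule onorm_le)
     have "\<bar>t - z\<bar> <= 1" using t \<open>\<bar>h\<bar> <= 1\<close> by auto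
     from b2[OF \<open>x \<in> ball 0 R\<close> this] show "norm (y *\<^sub>R D (Suc (Suc j)) x t) <= K * norm y" for y
      using mult_left_mono[of "norm (D (Suc (Suc j)) x t)" K "abs y"] by (simp add: mult.commute)
    qed
   qed (use that(3) in auto)
   then show ?thesis by (simp only: mult.commute)
  qed
  also have "\<dots> <= abs h * K" using that(3) K0 by (intro mult_right_mono) auto
  finally show ?thesis .
 qed
 define g where "g h x = D j x (z + h) - D j x z - cx h * D (Suc j) x z" for h x
 have gb: "norm (g h x) <= abs h * (abs h * K)" if "x \<in> ball 0 R" "abs h <= 1" for h x
 proof -
  have "norm (D j x (z + h) - D j x z - (z + h - z) *\<^sub>R D (Suc j) x z) <= norm (z + h - z) * (abs h * K)"
  proof (rule vector_differentiable_bound_linearization[where S = "closed_segment z (z + h)"])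
   show "(D j x has_vector_derivative D (Suc j) x t) (at t within closed_segment z (z + h))" for t
    by (rule has_vector_derivative_at_within[OF smfam_deriv[OF D that(1)]])
   show "norm (D (Suc j) x t - D (Suc j) x z) <= abs h * K" if t: "t \<in> closed_segment z (z + h)" for t
    by (rule lip[OF \<open>x \<in> ball 0 R\<close> \<open>\<bar>h\<bar> <= 1\<close> seg[OF t]])
  qed auto
  then show ?thesis by (simp add: g_def scaleR_conv_of_real)
 qed
 have hol: "(\<lambda>x. D i x s) holomorphic_on ball 0 R" for i s using smfam_fam[OF D, of i] fam_hol by blast
 have eR: "e \<in> ball 0 R" using e R by simp
 have gn: "(deriv ^^ n) (g h) e = ed n (D j) e (z + h) - ed n (D j) e z - cx h * ed n (D (Suc j)) e z" for h
  unfolding g_def[abs_def] ed_def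
  by (simp only: higher_deriv_diff[OF holomorphic_on_diff[OF hol hol] holomorphic_on_mult[OF holomorphic_on_const hol] open_ball eR]
    higher_deriv_diff[OF hol hol open_ball eR] higher_deriv_cmult[OF hol eR open_ball])
 define M where "M = fact n * K / (R / 4) ^ n"
 have M0: "M >= 0" using K0 R by (simp add: M_def)
 have gn_b: "norm ((deriv ^^ n) (g h) e) <= h\<^sup>2 * M" if "abs h <= 1" for h
 proof -
  have "g h holomorphic_on ball 0 R" unfolding g_def[abs_def] by (intro holomorphic_intros hol)
  from higher_deriv_bound[OF this gb[OF _ that] e, of n] show ?thesis
   by (simp add: M_def power2_eq_square ac_simps abs_mult_self_eq flip: abs_mult)
 qed
 have "((\<lambda>h. (ed n (D j) e (z + h) - ed n (D j) e z - h *\<^sub>R ed n (D (Suc j)) e z) /\<^sub>R norm h) \<longlongrightarrow> 0) (at 0)"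
 proof (rule Lim_null_comparison)
  have "eventually (\<lambda>h::real. h \<in> ball 0 1) (at 0)" by (rule eventually_at_in_open') auto
  then show "\<forall>\<^sub>F h in at 0. norm ((ed n (D j) e (z + h) - ed n (D j) e z - h *\<^sub>R ed n (D (Suc j)) e z) /\<^sub>R norm h) <= abs h * M"
  proof eventually_elim
   case (elim h)
   then have "norm ((deriv ^^ n) (g h) e) <= abs h * (abs h * M)" using gn_b[of h] by (simp add: power2_eq_square flip: mult.assoc)
   then have "norm ((deriv ^^ n) (g h) e) / abs h <= abs h * M"
    using M0 by (cases "h = 0") (auto simp: divide_le_eq mult.commute)
   then show ?case by (simp add: gn scaleR_conv_of_real norm_mult norm_inverse divide_inverse mult.commute)
  qed
  have "((\<lambda>h::real. abs h * M) \<longlongrightarrow> abs 0 * M) (at 0)" by (intro tendsto_intros)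
  then show "((\<lambda>h::real. abs h * M) \<longlongrightarrow> 0) (at 0)" by simp
 qed
 from tendsto_norm_zero[OF this] show ?thesis
  unfolding has_vector_derivative_def has_derivative_at by (simp add: bounded_linear_scaleR_left divide_inverse_commute)
qed

lemma wt_shift_le: "abs s <= 1 ==> \<delta> >= 0 ==> wt \<beta> \<delta> (z + s) <= exp (abs \<beta> + \<delta>) * wt \<beta> \<delta> z"
proof -
 assume s: "abs s <= 1" and d: "\<delta> >= 0"
 have "\<bar>\<beta> * s\<bar> <= \<bar>\<beta>\<bar> * 1" unfolding abs_mult using s by (intro mult_left_mono) auto
 moreover have "\<delta> * abs z <= \<delta> * (\<bar>z + s\<bar> + 1)" using s d by (intro mult_left_mono) auto
 ultimately show ?thesis by (simp add: wt_def algebra_simps flip: exp_add)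
qed

text \<open>A pair of families restricted to a line \<open>e = \<theta> * \<eta>\<close> through 0:
  the modes use \<open>\<theta> = \<i>\<close> and the adjoint modes
  \<open>\<theta> = - \<i>\<close>.\<close>

locale smpair =
 fixes R \<beta> \<delta> :: real and D E :: "nat => complex => real => complex" and \<theta> :: complex
 assumes D: "smfam R (wt \<beta> \<delta>) D" and E: "smfam R (wt \<beta> \<delta>) E" and R: "R > 0" and d: "\<delta> > 0" and th: "norm \<theta> = 1"
begin

definition pr :: "nat => real => real => complex \<times> complex" where
 "pr n \<eta> z = (\<theta> ^ n * ed n (D 0) (\<theta> * cx \<eta>) z, \<theta> ^ n * ed n (E 0) (\<theta> * cx \<eta>) z)"

text \<open>The first-order remainder scaled by a free factor: \<open>r = 1 / (s - \<eta>)\<close>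
  gives the difference quotient for smoothness, and \<open>r = 1\<close> with base point 0 the error
  of the expansion.\<close>

abbreviation "rm r n s \<eta> \<equiv> (\<lambda>z. r *\<^sub>R (pr n s z - pr n \<eta> z) - r *\<^sub>R ((s - \<eta>) *\<^sub>R pr (Suc n) \<eta> z))"

lemma ball: "abs \<eta> <= R / 4 ==> \<theta> * cx \<eta> \<in> ball 0 (R / 2)"
 using R th by (simp add: norm_mult)

lemma ed_wsmooth:
 assumes X: "smfam R (wt \<beta> \<delta>) X" and e: "e \<in> ball 0 (R / 2)"
 shows "wsmooth \<beta> \<delta> (\<lambda>j. ed n (X j) e)"
 unfolding wsmooth_def
proof (intro conjI allI)
 show "(ed n (X j) e has_vector_derivative ed n (X (Suc j)) e x) (at x)" for j x
  by (rule smfam_ed_deriv[OF X wt_shift_le _ e]) (use d wt_pos[of \<beta> \<delta>] in \<open>auto simp: less_imp_le\<close>)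
 show "\<exists>C. \<forall>x. norm (ed n (X j) e x) <= C * wt \<beta> \<delta> x" for j
  using smfam_ed_bound[OF X R, of n j] e by blast
qed

lemma remainder:
 obtains C where "C >= 0" and
  "!!s \<eta> r. abs s <= R / 4 ==> abs \<eta> <= R / 4 ==> rm r n s \<eta> \<in> HHw k \<beta> \<and>
   HHw_norm k \<beta> (rm r n s \<eta>) <= C * abs r * (s - \<eta>)\<^sup>2"
proof -
 have "\<exists>C\<ge>0. \<forall>e\<in>ball 0 (R / 2). \<forall>e0\<in>ball 0 (R / 2). \<forall>z.
  norm (ed n (X j) e z - ed n (X j) e0 z - (e - e0) * ed (Suc n) (X j) e0 z) <= C * (norm (e - e0))\<^sup>2 * wt \<beta> \<delta> z"
  if "X = D \<or> X = E" for X j using that smfam_ed_taylor[OF D R] smfam_ed_taylor[OF E R] by blast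
 then obtain C where C: "!!X j. X = D \<or> X = E ==> C X j >= 0"
  "!!X j e e0 z. X = D \<or> X = E ==> e \<in> ball 0 (R / 2) ==> e0 \<in> ball 0 (R / 2) ==>
   norm (ed n (X j) e z - ed n (X j) e0 z - (e - e0) * ed (Suc n) (X j) e0 z) <= C X j * (norm (e - e0))\<^sup>2 * wt \<beta> \<delta> z" by metis
 define K where "K = C D 0 + C D k + C E 0 + C E (k - 1)"
 have K: "C D 0 <= K" "C D k <= K" "C E 0 <= K" "C E (k - 1) <= K" "K >= 0"
  using C(1)[of D 0] C(1)[of D k] C(1)[of E 0] C(1)[of E "k - 1"] by (auto simp: K_def)
 show ?thesis
 proof (rule that)
  show "4 * K * sqrt (1 / \<delta>) >= 0" using K(5) d by simp
  fix s \<eta> r :: real assume s: "abs s <= R / 4" "abs \<eta> <= R / 4"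
  \<comment> \<open>The coefficients 1 and 0 give the remainder the literal form of iterated
    \<open>wsmooth_add\<close>.\<close>
  define X where "X F j z = \<theta> ^ n * cx r * (1 * (1 * ed n (F j) (\<theta> * cx s) z + (- 1) * ed n (F j) (\<theta> * cx \<eta>) z)
   + (- (\<theta> * cx s - \<theta> * cx \<eta>)) * ed (Suc n) (F j) (\<theta> * cx \<eta>) z) + 0 * ed n (F j) (\<theta> * cx s) z" for F :: "nat => complex => real => complex" and j z
  have ws: "wsmooth \<beta> \<delta> (X F)" if "F = D \<or> F = E" for F
   unfolding X_def[abs_def] using that by (intro wsmooth_add ed_wsmooth ball s) (use D E in blast)+
  have bd: "norm (X F j z) <= K * abs r * (s - \<eta>)\<^sup>2 * wt \<beta> \<delta> z" if "F = D \<or> F = E" "C F j <= K" for F j z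
  proof -
   have n: "norm (\<theta> * cx s - \<theta> * cx \<eta>) = \<bar>s - \<eta>\<bar>"
    using th by (simp add: norm_mult flip: right_diff_distrib of_real_diff)
   have "X F j z = \<theta> ^ n * cx r * (ed n (F j) (\<theta> * cx s) z - ed n (F j) (\<theta> * cx \<eta>) z - (\<theta> * cx s - \<theta> * cx \<eta>) * ed (Suc n) (F j) (\<theta> * cx \<eta>) z)"
    by (simp add: X_def algebra_simps)
   then have "norm (X F j z) = abs r * norm (ed n (F j) (\<theta> * cx s) z - ed n (F j) (\<theta> * cx \<eta>) z - (\<theta> * cx s - \<theta> * cx \<eta>) * ed (Suc n) (F j) (\<theta> * cx \<eta>) z)"
    using th by (simp only: norm_mult norm_power norm_of_real power_one mult_1_left)
   also have "\<dots> <= abs r * (C F j * \<bar>s - \<eta>\<bar>\<^sup>2 * wt \<beta> \<delta> z)"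
    using C(2)[OF that(1) ball[OF s(1)] ball[OF s(2)], of j z] unfolding n by (rule mult_left_mono) simp
   also have "\<dots> <= abs r * (K * \<bar>s - \<eta>\<bar>\<^sup>2 * wt \<beta> \<delta> z)"
    using that(2) wt_pos[of \<beta> \<delta> z] by (intro mult_left_mono mult_right_mono) auto
   finally show ?thesis by (simp add: ac_simps)
  qed
  have eq: "rm r n s \<eta> = (\<lambda>z. (X D 0 z, X E 0 z))"
   by (rule ext) (simp add: pr_def X_def scaleR_conv_of_real algebra_simps)
  have "HHw_norm k \<beta> (\<lambda>z. (X D 0 z, X E 0 z)) <= 4 * (K * abs r * (s - \<eta>)\<^sup>2) * sqrt (1 / \<delta>)"
   by (rule HHw_norm_wsmooth[OF ws ws d _ bd bd bd bd]) (use K in auto)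
  moreover have "(\<lambda>z. (X D 0 z, X E 0 z)) \<in> HHw k \<beta>" by (rule wsmooth_HHw[OF ws ws d]) auto
  ultimately show "rm r n s \<eta> \<in> HHw k \<beta> \<and>
   HHw_norm k \<beta> (rm r n s \<eta>) <= 4 * K * sqrt (1 / \<delta>) * abs r * (s - \<eta>)\<^sup>2"
   unfolding eq by (simp add: ac_simps)
 qed
qed

lemma HHw_norm_nonneg: "HHw_norm k \<beta> u >= 0" by (simp add: HHw_norm_def)

lemma smooth: "smooth_HHw k \<beta> {- (R / 4)..R / 4} (pr 0)"
 unfolding smooth_HHw_def
proof (intro exI[of _ pr] conjI allI ballI refl)
 fix n \<eta> assume eta: "\<eta> \<in> {- (R / 4)..R / 4}"
 then have h: "abs \<eta> <= R / 4" by auto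
 have "wsmooth \<beta> \<delta> (\<lambda>j z. \<theta> ^ n * ed n (F j) (\<theta> * cx \<eta>) z + 0 * ed n (F j) (\<theta> * cx \<eta>) z)" if "F = D \<or> F = E" for F
  using that by (intro wsmooth_add ed_wsmooth ball h) (use D E in blast)+
 from wsmooth_HHw[OF this this d, of D E k] show "pr n \<eta> \<in> HHw k \<beta>" by (simp add: pr_def[abs_def])
 obtain C where C: "C >= 0" "!!s \<eta> r. abs s <= R / 4 ==> abs \<eta> <= R / 4 ==> rm r n s \<eta> \<in> HHw k \<beta> \<and>
   HHw_norm k \<beta> (rm r n s \<eta>) <= C * abs r * (s - \<eta>)\<^sup>2"
  by (rule remainder[of n k], rule that)
 show "((\<lambda>s. HHw_norm k \<beta> (\<lambda>z. (pr n s z - pr n \<eta> z) /\<^sub>R (s - \<eta>) - pr (Suc n) \<eta> z)) \<longlongrightarrow> 0) (at \<eta> within {- (R / 4)..R / 4})"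
 proof (rule Lim_null_comparison)
  show "\<forall>\<^sub>F s in at \<eta> within {- (R / 4)..R / 4}. norm (HHw_norm k \<beta> (\<lambda>z. (pr n s z - pr n \<eta> z) /\<^sub>R (s - \<eta>) - pr (Suc n) \<eta> z)) <= C * \<bar>s - \<eta>\<bar>"
   unfolding eventually_at_filter
  proof (intro always_eventually allI impI)
   fix s assume s: "s \<noteq> \<eta>" "s \<in> {- (R / 4)..R / 4}"
   then have sh: "abs s <= R / 4" by auto
   have i: "\<bar>inverse (s - \<eta>)\<bar> * (s - \<eta>)\<^sup>2 = \<bar>s - \<eta>\<bar>" 
   proof -
    have "(s - \<eta>)\<^sup>2 = \<bar>s - \<eta>\<bar> * \<bar>s - \<eta>\<bar>" by (simp add: power2_eq_square)
    moreover have "inverse x * (x * x) = x" if "x \<noteq> 0" for x :: real using that by (simp flip: mult.assoc)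
    from this[of "\<bar>s - \<eta>\<bar>"] have "inverse \<bar>s - \<eta>\<bar> * (\<bar>s - \<eta>\<bar> * \<bar>s - \<eta>\<bar>) = \<bar>s - \<eta>\<bar>" using s(1) by simp
    ultimately show ?thesis by (simp only: abs_inverse)
   qed
   have "HHw_norm k \<beta> (\<lambda>z. (pr n s z - pr n \<eta> z) /\<^sub>R (s - \<eta>) - pr (Suc n) \<eta> z) <= C * (\<bar>inverse (s - \<eta>)\<bar> * (s - \<eta>)\<^sup>2)"
    using C(2)[OF sh h, of "inverse (s - \<eta>)"] s(1) by (simp add: mult.assoc)
   then show "norm (HHw_norm k \<beta> (\<lambda>z. (pr n s z - pr n \<eta> z) /\<^sub>R (s - \<eta>) - pr (Suc n) \<eta> z)) <= C * \<bar>s - \<eta>\<bar>"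
    unfolding i using HHw_norm_nonneg by simp
  qed
  have "((\<lambda>s. C * \<bar>s - \<eta>\<bar>) \<longlongrightarrow> C * \<bar>\<eta> - \<eta>\<bar>) (at \<eta> within {- (R / 4)..R / 4})" by (intro tendsto_intros)
  then show "((\<lambda>s. C * \<bar>s - \<eta>\<bar>) \<longlongrightarrow> 0) (at \<eta> within {- (R / 4)..R / 4})" by simp
 qed
qed

lemma expansion:
 "abs \<eta> <= R / 4 ==> (\<lambda>z. pr 0 \<eta> z - (pr 0 0 z + \<eta> *\<^sub>R pr 1 0 z)) \<in> HHw k \<beta>"
 "(\<lambda>\<eta>. HHw_norm k \<beta> (\<lambda>z. pr 0 \<eta> z - (pr 0 0 z + \<eta> *\<^sub>R pr 1 0 z))) \<in> O[at 0](\<lambda>\<eta>. \<eta>\<^sup>2)"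
proof -
 obtain C where C: "C >= 0" "!!s \<eta> r. abs s <= R / 4 ==> abs \<eta> <= R / 4 ==> rm r 0 s \<eta> \<in> HHw k \<beta> \<and>
   HHw_norm k \<beta> (rm r 0 s \<eta>) <= C * abs r * (s - \<eta>)\<^sup>2"
  by (rule remainder[of 0 k], rule that)
 have m: "(\<lambda>z. pr 0 \<eta> z - (pr 0 0 z + \<eta> *\<^sub>R pr 1 0 z)) \<in> HHw k \<beta> \<and> HHw_norm k \<beta> (\<lambda>z. pr 0 \<eta> z - (pr 0 0 z + \<eta> *\<^sub>R pr 1 0 z)) <= C * \<eta>\<^sup>2"
  if "abs \<eta> <= R / 4" for \<eta>
  using C(2)[OF that, of 0 1] R by (simp add: diff_diff_eq)
 then show "abs \<eta> <= R / 4 ==> (\<lambda>z. pr 0 \<eta> z - (pr 0 0 z + \<eta> *\<^sub>R pr 1 0 z)) \<in> HHw k \<beta>" by blast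
 show "(\<lambda>\<eta>. HHw_norm k \<beta> (\<lambda>z. pr 0 \<eta> z - (pr 0 0 z + \<eta> *\<^sub>R pr 1 0 z))) \<in> O[at 0](\<lambda>\<eta>. \<eta>\<^sup>2)"
 proof (rule bigoI)
  have "eventually (\<lambda>\<eta>::real. \<eta> \<in> ball 0 (R / 4)) (at 0)" by (rule eventually_at_in_open') (use R in auto)
  then show "\<forall>\<^sub>F \<eta> in at 0. norm (HHw_norm k \<beta> (\<lambda>z. pr 0 \<eta> z - (pr 0 0 z + \<eta> *\<^sub>R pr 1 0 z))) <= C * norm (\<eta>\<^sup>2)"
   by eventually_elim (use m HHw_norm_nonneg in auto)
 qed
qed

end

lemma smooth_scalar_holomorphic:
 fixes f :: "complex => complex"
 assumes f: "f holomorphic_on ball 0 R" and r: "r < R"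
 shows "smooth_scalar {- r..r} (\<lambda>\<eta>. f (\<i> * cx \<eta>))"
 unfolding smooth_scalar_def
proof (intro exI[of _ "\<lambda>n \<eta>. \<i> ^ n * (deriv ^^ n) f (\<i> * cx \<eta>)"] conjI allI ballI)
 fix n \<eta> assume "\<eta> \<in> {- r..r}"
 then have "abs \<eta> <= r" by auto
 then have b: "\<i> * cx \<eta> \<in> ball 0 R" using r by (simp add: norm_mult)
 have "(deriv ^^ n) f holomorphic_on ball 0 R" by (rule holomorphic_higher_deriv[OF f]) simp
 then have "((deriv ^^ n) f has_field_derivative (deriv ^^ Suc n) f (\<i> * cx \<eta>)) (at (\<i> * cx \<eta>))"
  using b by (simp add: holomorphic_derivI[OF _ open_ball])
 moreover have "((\<lambda>\<eta>. \<i> * cx \<eta>) has_vector_derivative \<i>) (at \<eta> within {- r..r})"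
  by (auto intro!: derivative_eq_intros)
 ultimately have "(((deriv ^^ n) f \<circ> (\<lambda>\<eta>. \<i> * cx \<eta>)) has_vector_derivative \<i> * (deriv ^^ Suc n) f (\<i> * cx \<eta>)) (at \<eta> within {- r..r})"
  by (metis field_vector_diff_chain_within has_field_derivative_at_within)
 then have "((\<lambda>\<eta>. \<i> ^ n * ((deriv ^^ n) f \<circ> (\<lambda>\<eta>. \<i> * cx \<eta>)) \<eta>) has_vector_derivative \<i> ^ n * (\<i> * (deriv ^^ Suc n) f (\<i> * cx \<eta>))) (at \<eta> within {- r..r})"
  by (rule has_vector_derivative_mult_right)
 then show "((\<lambda>\<eta>. \<i> ^ n * (deriv ^^ n) f (\<i> * cx \<eta>)) has_vector_derivative \<i> ^ Suc n * (deriv ^^ Suc n) f (\<i> * cx \<eta>)) (at \<eta> within {- r..r})"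
  by (simp only: o_def power_Suc ac_simps)
qed simp

section \<open>The explicit part of the expansion\<close>

context benney_luke
begin

text \<open>\<open>M\<close> is the amplitude of the profile and \<open>Mp\<close> its derivative in
  \<open>c\<close>; \<open>j1\<close> is \<open>M\<close> times the logarithmic derivative of
  \<open>kp\<close> in \<open>c\<close>, and \<open>2 * j0\<close> is the integral of
  \<open>dc_q\<close> over the line. Both \<open>xi\<close> and \<open>be\<close> lie in
  \<open>(0, 1)\<close>, which turns the sign questions into polynomial ones.\<close>

definition "M = (c\<^sup>2 - 1) / c"
definition "xi = 1 / c\<^sup>2"
definition "be = b * kp\<^sup>2"
definition "Mp = 1 + xi"
definition "j1 = 1 - be"
definition "j0 = 2 / kp * (xi + be)"

definition "ph2 z = kp\<^sup>2 * (1 - 3 * S z) * ph z"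
definition "ph3 z = kp\<^sup>2 * (1 - 3 * S z) * ph1 z + 3 * kp ^ 3 * (ph z * ph z)"

lemma xi: "0 < xi" "xi < 1" "c * c * xi = 1" "M = c * (1 - xi)"
 using csq c1 by (auto simp: xi_def M_def field_simps power2_eq_square)

lemma Mc: "c * M = c * c - 1" "m * (kp * kp) = c * c - 1" "b * (kp * kp) = be" "M > 0"
proof -
 show "c * M = c * c - 1" using c1 by (simp add: M_def power2_eq_square)
 show "m * (kp * kp) = c * c - 1" using kpm by (simp add: power2_eq_square mult.commute)
 show "b * (kp * kp) = be" by (simp add: be_def power2_eq_square)
 show "M > 0" using c1 csq by (simp add: M_def)
qed

lemma aeq: "a * (kp * kp) = be * (c * c) - (c * c - 1)" "a = b * (c * c) - m"
proof -
 show 2: "a = b * (c * c) - m" by (simp add: m_def power2_eq_square)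
 show "a * (kp * kp) = be * (c * c) - (c * c - 1)"
 proof -
  have "a * (kp * kp) = (b * (c * c) - m) * (kp * kp)" by (rule arg_cong[OF 2])
  also have "\<dots> = (b * (kp * kp)) * (c * c) - m * (kp * kp)" by (simp add: algebra_simps)
  finally show ?thesis by (simp only: Mc)
 qed
qed

lemma be: "0 < be" "be < 1"
proof -
 show "0 < be" using a0 ab kp0 by (simp add: be_def)
 have "m * be = b * (m * (kp * kp))" by (simp add: be_def power2_eq_square)
 also have "\<dots> = b * (c * c - 1)" by (simp only: Mc)
 also have "\<dots> < m * 1" using ab by (simp add: m_def power2_eq_square algebra_simps)
 finally show "be < 1" using m0 by (simp only: mult_less_cancel_left_pos)
qed

lemma j0: "j0 > 0" "kp / 2 * j0 = xi + be" "kp * j0 = 2 * (xi + be)" using xi(1) be kp0 by (auto simp: j0_def)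

lemma ph1_deriv': "(ph1 has_real_derivative ph2 z) (at z)"
 using ph1_deriv[of z] by (simp add: ph2_def algebra_simps)

lemma ph2_deriv: "(ph2 has_real_derivative ph3 z) (at z)"
 unfolding ph2_def[abs_def] ph3_def
 by (rule derivative_eq_intros ph_deriv refl)+ (simp add: ph_def power3_eq_cube power2_eq_square algebra_simps)

definition q1 where "q1 z = - kp * M * ph z"
definition q2 where "q2 z = - kp * M * ph1 z"
definition q3 where "q3 z = - kp * M * ph2 z"
definition q4 where "q4 z = - kp * M * ph3 z"
text \<open>\<open>p\<close> is the derivative of the profile in \<open>c\<close> and
  \<open>u1\<close> its integral over the right half line. This identification is proved later in
  \<open>dc_q_eq\<close> and \<open>int_right\<close>; the equations below work with the
  formulas.\<close>

definition u1 where "u1 z = j0 * (1 - T z) - j1 * (z * S z)"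
definition p where "p z = Mp * S z - kp * j1 * (z * ph z)"
definition p1 where "p1 z = - kp * Mp * ph z - kp * j1 * (ph z + z * ph1 z)"
definition p2 where "p2 z = - kp * Mp * ph1 z - kp * j1 * (2 * ph1 z + z * ph2 z)"
definition p3 where "p3 z = - kp * Mp * ph2 z - kp * j1 * (3 * ph2 z + z * ph3 z)"

lemma qz_M: "qz z = M * S z" by (simp add: qz_def M_def)

lemma q_derivs: "(qz has_real_derivative q1 z) (at z)" "(q1 has_real_derivative q2 z) (at z)"
 "(q2 has_real_derivative q3 z) (at z)" "(q3 has_real_derivative q4 z) (at z)"
proof -
 show "(qz has_real_derivative q1 z) (at z)"
  unfolding qz_M[abs_def] q1_def ph_def by (rule derivative_eq_intros refl)+ simp
 show "(q1 has_real_derivative q2 z) (at z)" "(q2 has_real_derivative q3 z) (at z)" "(q3 has_real_derivative q4 z) (at z)"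
  unfolding q1_def[abs_def] q2_def[abs_def] q3_def[abs_def] q4_def
  by (rule DERIV_cmult, rule ph_deriv ph1_deriv' ph2_deriv)+
qed

lemma p_derivs: "(u1 has_real_derivative - p z) (at z)" "(p has_real_derivative p1 z) (at z)"
 "(p1 has_real_derivative p2 z) (at z)" "(p2 has_real_derivative p3 z) (at z)"
proof -
 have e: "kp / 2 * j0 + j1 = Mp" unfolding j0(2) Mp_def j1_def by simp
 have "(u1 has_real_derivative - (kp / 2 * j0 + j1) * S z + kp * j1 * (z * ph z)) (at z)"
  unfolding u1_def[abs_def] by (auto intro!: derivative_eq_intros simp: ph_def algebra_simps)
 then show "(u1 has_real_derivative - p z) (at z)" unfolding e by (simp add: p_def)
 have S': "(S has_real_derivative - (kp * ph z)) (at z)" using S_deriv[of z] by (simp add: ph_def mult.assoc)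
 show "(p has_real_derivative p1 z) (at z)"
  unfolding p_def[abs_def] p1_def
  by (rule DERIV_cong[OF DERIV_diff[OF DERIV_cmult[OF S'] DERIV_cmult[OF DERIV_mult[OF DERIV_ident ph_deriv]]]]) (simp add: algebra_simps)
 show "(p1 has_real_derivative p2 z) (at z)"
  unfolding p1_def[abs_def] p2_def
  by (rule DERIV_cong[OF DERIV_diff[OF DERIV_cmult[OF ph_deriv] DERIV_cmult[OF DERIV_add[OF ph_deriv DERIV_mult[OF DERIV_ident ph1_deriv']]]]]) (simp add: algebra_simps)
 show "(p2 has_real_derivative p3 z) (at z)"
  unfolding p2_def[abs_def] p3_def
  by (rule DERIV_cong[OF DERIV_diff[OF DERIV_cmult[OF ph1_deriv'] DERIV_cmult[OF DERIV_add[OF DERIV_cmult[OF ph1_deriv'] DERIV_mult[OF DERIV_ident ph2_deriv]]]]]) (simp add: algebra_simps)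
qed

text \<open>The profile equation differentiated once in \<open>z\<close>; it rests on
  \<open>m * kp^2 = c^2 - 1\<close> and \<open>c * M = c^2 - 1\<close>.\<close>

lemma soliton1: "m * q3 z = (c * c - 1) * q1 z - 3 * c * qz z * q1 z"
proof -
 have "m * q3 z = - kp * M * (m * (kp * kp) * (1 - 3 * S z) * ph z)" by (simp add: q3_def ph2_def power2_eq_square)
 also have "\<dots> = (c * c - 1) * q1 z - 3 * (c * M) * S z * q1 z" unfolding Mc by (simp add: q1_def algebra_simps)
 finally show ?thesis by (simp add: qz_M algebra_simps)
qed

text \<open>The \<open>z\<close>-derivative of \<open>soliton1\<close>, that is
  \<open>P0 q = 0\<close>: the part of order 0 in \<open>\<epsilon>\<close>.\<close>

lemma soliton2: "m * q4 z - (c * c - 1) * q2 z + 3 * c * (qz z * q2 z + q1 z * q1 z) = 0"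
proof -
 have "m * q4 z = - kp * M * ((m * (kp * kp)) * (1 - 3 * S z) * ph1 z + 3 * (m * (kp * kp)) * kp * (ph z * ph z))"
  by (simp add: q4_def ph3_def power3_eq_cube power2_eq_square algebra_simps)
 moreover have "3 * c * (qz z * q2 z + q1 z * q1 z) = - 3 * (c * M) * (kp * M) * S z * ph1 z + 3 * (c * M) * (kp * kp * M) * (ph z * ph z)"
  by (simp add: qz_M q1_def q2_def algebra_simps)
 ultimately show ?thesis unfolding Mc by (simp add: q2_def algebra_simps)
qed

text \<open>The \<open>c\<close>-derivative of \<open>soliton1\<close>. Since \<open>u1\<close> has
  derivative \<open>- p\<close>, it expresses the cancellation of the terms with the factor
  \<open>\<epsilon> * \<mu>\<close>.\<close>

lemma u1_equation: "- m * p3 z + (c * c - 1) * p1 z - 3 * c * (q1 z * p z + qz z * p1 z) = 2 * b * c * q3 z - 2 * c * q1 z + 3 * qz z * q1 z"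
proof -
 define N where "N = c * c - 1"
 have cM: "c * M = N" "m * (kp * kp) = N" using Mc by (simp_all add: N_def)
 have l: "- m * p3 z + N * p1 z - 3 * c * (q1 z * p z + qz z * p1 z) =
   kp * Mp * ((m * (kp * kp)) * (1 - 3 * S z) * ph z) + kp * j1 * (3 * ((m * (kp * kp)) * (1 - 3 * S z) * ph z)
    + z * ((m * (kp * kp)) * (1 - 3 * S z) * ph1 z + 3 * (m * (kp * kp)) * kp * (ph z * ph z)))
   - N * kp * Mp * ph z - N * kp * j1 * (ph z + z * ph1 z)
   + 3 * (c * M) * kp * ph z * (Mp * S z - kp * j1 * (z * ph z)) + 3 * (c * M) * S z * (kp * Mp * ph z + kp * j1 * (ph z + z * ph1 z))"
  by (simp add: p_def p1_def p3_def ph2_def ph3_def q1_def qz_M power3_eq_cube power2_eq_square algebra_simps)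
 also have "\<dots> = N * kp * ph z * (3 * Mp * S z + j1 * (2 - 6 * S z))"
  unfolding cM by (simp add: algebra_simps)
 finally have l': "- m * p3 z + N * p1 z - 3 * c * (q1 z * p z + qz z * p1 z) = N * kp * ph z * (3 * Mp * S z + j1 * (2 - 6 * S z))" .
 have "2 * b * c * q3 z - 2 * c * q1 z + 3 * qz z * q1 z = - 2 * (b * (kp * kp)) * (c * M) * kp * (1 - 3 * S z) * ph z + 2 * (c * M) * kp * ph z - 3 * kp * M * M * S z * ph z"
  by (simp add: q3_def q1_def qz_M ph2_def power2_eq_square algebra_simps)
 also have "M * M = N * (1 - xi)"
 proof -
  have "M * M = (c * M) * (1 - xi)" using xi(4) by simp
  then show ?thesis by (simp only: cM)
 qed
 then have "3 * kp * M * M * S z * ph z = 3 * kp * (N * (1 - xi)) * S z * ph z" by (simp add: mult.assoc)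
 also have "- 2 * (b * (kp * kp)) * (c * M) * kp * (1 - 3 * S z) * ph z + 2 * (c * M) * kp * ph z - 3 * kp * (N * (1 - xi)) * S z * ph z
   = N * kp * ph z * (3 * Mp * S z + j1 * (2 - 6 * S z))"
  unfolding Mc(3) cM by (simp add: Mp_def j1_def algebra_simps)
 finally show ?thesis using l' by (simp add: N_def)
qed

section \<open>Explicit functions as combinations of three generators\<close>

definition "BB = {\<lambda>(e::complex) z. cx (S z), \<lambda>e z. cx (z * S z), \<lambda>e z. cx (1 - T z)}"

text \<open>Quantifying over all bases above \<open>BB\<close> allows the same facts to be reused
  after the base is enlarged by the functions \<open>KK j f\<close>.\<close>

definition gr :: "(real => real) => bool" where
 "gr f \<longleftrightarrow> (\<forall>R B. BB \<subseteq> B \<longrightarrow> gen R T B (\<lambda>e z. cx (f z)))"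

definition pt :: "(real => real) => bool" where "pt h \<longleftrightarrow> (\<exists>P. \<forall>z. h z = poly P (T z))"

lemma ptI: "(!!z. h z = poly P (T z)) ==> pt h" by (auto simp: pt_def)

lemma pt_const: "pt (\<lambda>z. r)" by (rule ptI[of _ "[:r:]"]) simp
lemma pt_T: "pt T" by (rule ptI[of _ "[:0, 1:]"]) simp
lemma pt_add: "pt f ==> pt g ==> pt (\<lambda>z. f z + g z)" by (auto simp: pt_def simp flip: poly_add)
lemma pt_diff: "pt f ==> pt g ==> pt (\<lambda>z. f z - g z)" by (auto simp: pt_def simp flip: poly_diff)
lemma pt_mult: "pt f ==> pt g ==> pt (\<lambda>z. f z * g z)" by (auto simp: pt_def simp flip: poly_mult)
lemma pt_S: "pt S" unfolding S_def[abs_def] power2_eq_square by (intro pt_diff pt_const pt_mult pt_T)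
lemma pt_ph: "pt ph" "pt ph1" "pt ph2" "pt ph3"
proof -
 show 1: "pt ph" unfolding ph_def[abs_def] by (intro pt_mult pt_T pt_S)
 show 2: "pt ph1" unfolding ph1_def[abs_def] by (intro pt_mult pt_T pt_S pt_diff pt_const)
 show "pt ph2" unfolding ph2_def[abs_def] by (intro pt_mult pt_T pt_S pt_diff pt_const 1)
 show "pt ph3" unfolding ph3_def[abs_def] by (intro pt_add pt_mult pt_T pt_S pt_diff pt_const 1 2)
qed
lemma pt_q: "pt qz" "pt q1" "pt q2" "pt q3"
 unfolding qz_M[abs_def] q1_def[abs_def] q2_def[abs_def] q3_def[abs_def] by (intro pt_mult pt_const pt_S pt_ph)+

lemma gr_pt: "pt h ==> gr f ==> gr (\<lambda>z. h z * f z)"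
 unfolding gr_def pt_def by (auto intro!: gen_poly)
lemma gr_cmult: "gr f ==> gr (\<lambda>z. r * f z)" by (rule gr_pt[OF pt_const])
lemma gr_add: "gr f ==> gr g ==> gr (\<lambda>z. f z + g z)"
 unfolding gr_def of_real_add
proof (intro allI impI)
 fix R B assume "\<forall>R B. BB \<subseteq> B \<longrightarrow> gen R T B (\<lambda>e z. cx (f z))" "\<forall>R B. BB \<subseteq> B \<longrightarrow> gen R T B (\<lambda>e z. cx (g z))" "BB \<subseteq> B"
 then show "gen R T B (\<lambda>e z. cx (f z) + cx (g z))" by (intro gen_add) auto
qed
lemma gr_uminus: "gr f ==> gr (\<lambda>z. - f z)" using gr_cmult[of f "- 1"] by simp
lemma gr_diff: "gr f ==> gr g ==> gr (\<lambda>z. f z - g z)" using gr_add[OF _ gr_uminus] by simp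
lemma gr_basic: "gr S" "gr (\<lambda>z. z * S z)" "gr (\<lambda>z. 1 - T z)"
 unfolding gr_def by (auto intro!: gen_base simp: BB_def)
lemma gr_ptS: "pt h ==> gr (\<lambda>z. h z * S z)" by (intro gr_pt gr_basic)

lemma gr_ph: "gr ph" "gr ph1" "gr ph2" "gr ph3" and gr_zph: "gr (\<lambda>z. z * ph z)" "gr (\<lambda>z. z * ph1 z)" "gr (\<lambda>z. z * ph2 z)" "gr (\<lambda>z. z * ph3 z)"
proof -
 have e: "ph1 z = (kp * (1 / 2 * S z - T z * T z)) * S z" "ph2 z = (kp\<^sup>2 * (1 - 3 * S z) * T z) * S z"
  "ph3 z = (kp\<^sup>2 * (1 - 3 * S z) * (kp * (1 / 2 * S z - T z * T z)) + 3 * kp ^ 3 * (T z * ph z)) * S z" for z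
  by (auto simp: ph1_def ph2_def ph3_def ph_def algebra_simps)
 have pe: "pt (\<lambda>z. kp * (1 / 2 * S z - T z * T z))" "pt (\<lambda>z. kp\<^sup>2 * (1 - 3 * S z) * T z)"
  "pt (\<lambda>z. kp\<^sup>2 * (1 - 3 * S z) * (kp * (1 / 2 * S z - T z * T z)) + 3 * kp ^ 3 * (T z * ph z))"
  by (intro pt_add pt_mult pt_T pt_S pt_diff pt_const pt_ph)+
 have g: "gr (\<lambda>z. h z * S z)" "gr (\<lambda>z. z * (h z * S z))" if "pt h" for h
  using gr_ptS[OF that] gr_pt[OF that gr_basic(2)] by (simp_all add: ac_simps)
 show "gr ph" "gr (\<lambda>z. z * ph z)" using g[OF pt_T] by (simp_all only: ph_def[abs_def])
 show "gr ph1" "gr ph2" "gr ph3" "gr (\<lambda>z. z * ph1 z)" "gr (\<lambda>z. z * ph2 z)" "gr (\<lambda>z. z * ph3 z)"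
  using g[OF pe(1)] g[OF pe(2)] g[OF pe(3)] by (simp_all only: e[abs_def])
qed

lemma gr_explicit: "gr qz" "gr q1" "gr q2" "gr q3" "gr u1" "gr p" "gr p1" "gr p2"
 unfolding qz_M[abs_def] q1_def[abs_def] q2_def[abs_def] q3_def[abs_def] u1_def[abs_def] p_def[abs_def] p1_def[abs_def] p2_def[abs_def]
 by (intro gr_diff gr_add gr_cmult gr_basic gr_ph gr_zph)+

text \<open>At plus infinity \<open>1 - T\<close> decays at rate \<open>kp\<close>, faster than the
  weight. At minus infinity it tends to 2, but there the weight is at least 1.\<close>

lemma om_bound: "1 - T z <= 2 * w z"
proof -
 have eq: "1 - T z = S z / (1 + T z)" using T_abs[of z] by (simp add: S_def power2_eq_square field_simps)
 show ?thesis
 proof (cases "z >= 0")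
  case True
  then have "T z >= 0" using kp0 by (simp add: T_def tanh_real_nonneg_iff)
  have "S z <= 2 * exp (- kp * abs z) * (1 + T z)"
  proof -
   define E where "E = exp (- kp * z)"
   have E: "E > 0" "E <= 1" using kp0 True by (auto simp: E_def)
   have T: "T z = (1 - E) / (1 + E)" unfolding T_def tanh_real_altdef E_def by (simp add: mult.commute)
   have "1 - T z <= 2 * E" using E unfolding T by (simp add: field_simps)
   then have "(1 - T z) * (1 + T z) <= 2 * E * (1 + T z)" using \<open>T z >= 0\<close> by (intro mult_right_mono) auto
   then show ?thesis using True by (simp add: S_def E_def power2_eq_square algebra_simps)
  qed
  then have "1 - T z <= 2 * exp (- kp * abs z)" unfolding eq using \<open>T z >= 0\<close> by (simp add: divide_le_eq)
  then show ?thesis using exp_le_w(1)[of z] by linarith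
 next
  case False
  have "(\<alpha> - de) * abs z >= 0" using ade by simp
  then have "w z >= 1" using False by (simp add: wt_def algebra_simps)
  then show ?thesis using T_abs[of z] by (simp add: abs_less_iff)
 qed
qed

lemma exp_poly: "\<sigma> > 0 ==> abs z * exp (- \<sigma> * abs z) <= 1 / \<sigma>" for z :: real
proof -
 assume s: "\<sigma> > 0"
 have "\<sigma> * abs z <= exp (\<sigma> * abs z)" using exp_ge_add_one_self[of "\<sigma> * abs z"] by linarith
 then have "(\<sigma> * abs z) * exp (- (\<sigma> * abs z)) <= exp (\<sigma> * abs z) * exp (- (\<sigma> * abs z))" by (rule mult_right_mono) simp
 then have "(\<sigma> * abs z) * exp (- (\<sigma> * abs z)) <= 1" by (simp only: exp_minus_inverse)
 then show ?thesis using s by (simp add: field_simps)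
qed

lemma zS_w: "\<bar>z * S z\<bar> <= 4 / sg * w z"
proof -
 have "abs z * S z <= abs z * (4 * exp (- kp * abs z))" by (intro mult_left_mono S_exp) simp
 also have "\<dots> = 4 * (abs z * exp (- sg * abs z)) * exp (- (\<alpha> + de) * abs z)"
  by (simp add: sg_def algebra_simps flip: exp_add)
 also have "\<dots> <= 4 * (1 / sg) * w z"
 proof -
  have "\<alpha> * z <= \<alpha> * abs z" using al0 by (intro mult_left_mono) auto
  then have "exp (- (\<alpha> + de) * abs z) <= w z" by (simp add: wt_def algebra_simps)
  then show ?thesis using exp_poly[OF sg0, of z] sg0 by (intro mult_mono) auto
 qed
 finally show ?thesis using S_pos[of z] by (simp add: abs_mult)
qed

lemma BB_fam: "X \<in> BB ==> \<exists>C\<ge>0. fam R w C X"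
proof -
 have r: "\<exists>C\<ge>0. fam R w C (\<lambda>e z. cx (s z))" if "continuous_on UNIV s" "!!z. abs (s z) <= C * w z" "C >= 0" for s C
  using fam_real[OF that(1,2), of R] that(3) by blast
 have "\<exists>C\<ge>0. fam R w C (\<lambda>e z. cx (S z))"
  by (rule r[of _ 4]) (use S_w(1) S_continuous in \<open>auto simp: abs_of_pos[OF S_pos]\<close>)
 moreover have "\<exists>C\<ge>0. fam R w C (\<lambda>e z. cx (z * S z))"
  by (rule r[OF _ zS_w]) (use sg0 in \<open>auto intro!: continuous_intros S_continuous\<close>)
 moreover have "\<exists>C\<ge>0. fam R w C (\<lambda>e z. cx (1 - T z))"
 proof (rule r[of _ 2])
  have "1 - T z > 0" for z using T_abs[of z] by (simp add: abs_less_iff)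
  then show "\<bar>1 - T z\<bar> <= 2 * w z" for z using om_bound[of z] by (simp add: abs_of_pos)
 qed (auto intro!: continuous_intros T_continuous)
 ultimately show "X \<in> BB ==> \<exists>C\<ge>0. fam R w C X" unfolding BB_def by blast
qed

lemma T_le1: "abs (T z) <= 1" using T_abs[of z] by simp

lemma gr_bound:
 assumes "gr f"
 shows "\<exists>C\<ge>0. \<forall>z. abs (f z) <= C * w z" "continuous_on UNIV f"
proof -
 have "gen 1 T BB (\<lambda>e z. cx (f z))" using assms by (simp add: gr_def)
 from gen_fam[OF w_bounds T_continuous T_le1 BB_fam this]
 obtain C where C: "C >= 0" "fam 1 w C (\<lambda>e z. cx (f z))" by blast
 show "\<exists>C\<ge>0. \<forall>z. abs (f z) <= C * w z" using C(1) fam_bound[OF C(2), of 0] by (intro exI[of _ C]) auto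
 have "continuous_on UNIV (\<lambda>z. Re (cx (f z)))" by (intro continuous_intros fam_cont[OF C(2), of 0]) simp
 then show "continuous_on UNIV f" by simp
qed

lemma T_deriv': "(T has_real_derivative poly [:kp / 2, 0, - (kp / 2):] (T z)) (at z)"
 using T_deriv[of z] by (simp add: S_def power2_eq_square algebra_simps)

section \<open>Integrals of explicit functions\<close>

lemma S_int: "intg S"
proof -
 have i: "intg (\<lambda>s. 4 * exp (- kp * \<bar>0 - s\<bar>))"
  using exp_abs_shift[OF kp0, of 0] by (auto simp: has_bochner_integral_iff)
 show ?thesis
 proof (rule Bochner_Integration.integrable_bound[OF i])
  show "AE s in lborel. norm (S s) <= norm (4 * exp (- kp * \<bar>0 - s\<bar>))" using S_exp S_pos by (auto simp: less_imp_le)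
  show "S \<in> borel_measurable lborel" using borel_measurable_continuous_onI[OF S_continuous] by simp
 qed
qed

lemma S_mult_int:
 assumes "continuous_on UNIV h" "!!z. abs (h z) <= C"
 shows "intg (\<lambda>z. h z * S z)"
proof (rule Bochner_Integration.integrable_bound[OF integrable_mult_right[OF S_int, of C]])
 show "AE z in lborel. norm (h z * S z) <= norm (C * S z)"
  using mult_right_mono[OF assms(2) less_imp_le[OF S_pos]] S_pos order_trans[OF abs_ge_zero assms(2)]
  by (auto simp: abs_mult abs_of_pos)
 show "(\<lambda>z. h z * S z) \<in> borel_measurable lborel"
  using borel_measurable_continuous_onI[OF continuous_on_mult[OF assms(1) S_continuous]] by simp
qed

text \<open>Explicit integrands are brought to this form by \<open>T^2 = 1 - S\<close>. The terms
  with \<open>z\<close> are integrated by parts, \<open>T * S^n\<close> being a multiple of the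
  derivative of \<open>S^n\<close>, and the term with \<open>G\<close> is odd. What remains are the
  integrals \<open>4 / kp\<close>, \<open>8 / (3 * kp)\<close> and \<open>32 / (15 * kp)\<close> of
  \<open>S\<close>, \<open>S^2\<close> and \<open>S^3\<close>.\<close>

lemma int_form:
 "(LINT z|lborel. A1 * S z + A2 * (S z * S z) + A3 * (S z * S z * S z) + G * (T z * S z * S z) + B2 * (z * T z * S z * S z) + B3 * (z * T z * S z * S z * S z))
  = A1 * (4 / kp) + (A2 + B2 / (2 * kp)) * (8 / (3 * kp)) + (A3 + B3 / (3 * kp)) * (32 / (15 * kp))" (is "integral\<^sup>L lborel ?f = _")
proof -
 define F where "F z = (A1 * (2 / kp)) * T z + ((A2 + B2 / (2 * kp)) * (2 / kp)) * (T z - 1 / 3 * (T z * T z * T z))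
  + ((A3 + B3 / (3 * kp)) * (2 / kp)) * (T z - 2 / 3 * (T z * T z * T z) + 1 / 5 * (T z * T z * T z * T z * T z))
  - (G / (2 * kp)) * (S z * S z) - (B2 / (2 * kp)) * (z * S z * S z) - (B3 / (3 * kp)) * (z * S z * S z * S z)" for z
 have T3: "T z * S z = T z - T z * T z * T z" for z by (simp add: S_def power2_eq_square algebra_simps)
 have fz: "?f z = (A1 + A2 * S z + A3 * (S z * S z) + G * (T z * S z) + B2 * (T z * (z * S z)) + B3 * (T z * S z * (z * S z))) * S z" for z
  by (simp add: algebra_simps)
 have zb: "\<bar>z * S z\<bar> <= 4 / kp" for z
  using zS_bound[of z] S_pos[of z] kp0 by (simp add: abs_mult field_simps)
 have hb: "\<bar>A1 + A2 * S z + A3 * (S z * S z) + G * (T z * S z) + B2 * (T z * (z * S z)) + B3 * (T z * S z * (z * S z))\<bar>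
   <= abs A1 + abs A2 + abs A3 + abs G + abs B2 * (4 / kp) + abs B3 * (4 / kp)" for z
 proof -
  have s: "abs (S z) <= 1" "abs (T z) <= 1" using S_pos[of z] S_le1[of z] T_le1 by auto
  have s2: "abs (S z) * abs (S z) <= 1" "abs (T z) * abs (S z) <= 1" using mult_mono[OF s(1) s(1)] mult_mono[OF s(2) s(1)] by auto
  have s3: "abs (T z) * \<bar>z * S z\<bar> <= 1 * (4 / kp)" by (rule mult_mono[OF s(2) zb]) auto
  have s4: "abs (T z) * abs (S z) * \<bar>z * S z\<bar> <= 1 * (4 / kp)" by (rule mult_mono[OF s2(2) zb]) auto
  have ml: "\<bar>x * y\<bar> <= \<bar>x\<bar> * K" if "abs y <= K" for x y K :: real
   unfolding abs_mult by (rule mult_left_mono[OF that]) simp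
  have "\<bar>A2 * S z\<bar> <= \<bar>A2\<bar> * 1" by (rule ml[OF s(1)])
  moreover have "\<bar>A3 * (S z * S z)\<bar> <= abs A3 * 1" by (rule ml) (simp only: abs_mult s2)
  moreover have "\<bar>G * (T z * S z)\<bar> <= abs G * 1" by (rule ml) (simp only: abs_mult s2)
  moreover have "\<bar>B2 * (T z * (z * S z))\<bar> <= abs B2 * (4 / kp)" by (rule ml) (use s3 in \<open>simp only: abs_mult mult_1_left mult.assoc\<close>)
  moreover have "\<bar>B3 * (T z * S z * (z * S z))\<bar> <= abs B3 * (4 / kp)" by (rule ml) (use s4 in \<open>simp only: abs_mult mult_1_left mult.assoc\<close>)
  ultimately show ?thesis by (intro order_trans[OF abs_triangle_ineq] add_mono order_refl) (simp_all only: mult_1_right)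
 qed
 have i: "intg ?f" unfolding fz
  by (rule S_mult_int[OF _ hb]) (intro continuous_intros S_continuous T_continuous)
 have c: "continuous_on UNIV ?f" by (intro continuous_intros S_continuous T_continuous)
 have d: "(F has_real_derivative ?f z) (at z)" for z
 proof -
  have S2: "1 - T z * T z = S z" by (simp add: TT)
  have "(F has_real_derivative (A1 * (2 / kp)) * (kp / 2 * S z) + ((A2 + B2 / (2 * kp)) * (2 / kp)) * (kp / 2 * S z * (1 - T z * T z))
   + ((A3 + B3 / (3 * kp)) * (2 / kp)) * (kp / 2 * S z * ((1 - T z * T z) * (1 - T z * T z)))
   - (G / (2 * kp)) * (- 2 * kp * T z * S z * S z) - (B2 / (2 * kp)) * (S z * S z - 2 * kp * (z * T z * S z * S z))
   - (B3 / (3 * kp)) * (S z * S z * S z - 3 * kp * (z * T z * S z * S z * S z))) (at z)"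
   unfolding F_def[abs_def] by (rule derivative_eq_intros refl)+ (use kp0 in \<open>simp add: algebra_simps add_divide_distrib diff_divide_distrib\<close>)
  then show ?thesis unfolding S2 by (rule DERIV_cong) (use kp0 in \<open>simp add: field_simps\<close>)
 qed
 have S_lim: "(S \<longlongrightarrow> 0) at_top" "(S \<longlongrightarrow> 0) at_bot"
  unfolding S_def[abs_def] using tendsto_diff[OF tendsto_const tendsto_power[OF T_lim(1)], of 1 2] tendsto_diff[OF tendsto_const tendsto_power[OF T_lim(2)], of 1 2] by simp_all
 have zl: "((\<lambda>z. z * S z * S z) \<longlongrightarrow> 0) Q" if "(S \<longlongrightarrow> 0) Q" for Q
 proof (rule Lim_null_comparison[OF always_eventually tendsto_mult_right_zero[OF that, of "4 / kp"]], rule allI)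
  fix z show "norm (z * S z * S z) <= 4 / kp * S z"
   using mult_right_mono[OF zb[of z] less_imp_le[OF S_pos[of z]]] S_pos[of z] by (simp add: abs_mult)
 qed
 have zl3: "((\<lambda>z. z * S z * S z * S z) \<longlongrightarrow> 0) Q" if "(S \<longlongrightarrow> 0) Q" for Q
  using tendsto_mult[OF zl[OF that] that] by simp
 have lim: "(F \<longlongrightarrow> (A1 * (2 / kp)) * t + ((A2 + B2 / (2 * kp)) * (2 / kp)) * (t - 1 / 3 * (t * t * t))
  + ((A3 + B3 / (3 * kp)) * (2 / kp)) * (t - 2 / 3 * (t * t * t) + 1 / 5 * (t * t * t * t * t))
  - (G / (2 * kp)) * (0 * 0) - (B2 / (2 * kp)) * 0 - (B3 / (3 * kp)) * 0) Q" if "(T \<longlongrightarrow> t) Q" "(S \<longlongrightarrow> 0) Q" for t Q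
  unfolding F_def[abs_def] by (intro tendsto_intros that zl[OF that(2)] zl3[OF that(2)])
 show ?thesis
  by (rule trans[OF real_integral_line[OF d c i lim[OF T_lim(1) S_lim(1)] lim[OF T_lim(2) S_lim(2)]]]) (simp add: field_simps)
qed

end

section \<open>Existence of the branch\<close>

context benney_luke
begin

text \<open>Obtained by inserting \<open>q + \<epsilon> * \<mu> * u1 + \<epsilon>^2 * v\<close> into
  the scalar equation: \<open>A0f\<close> and \<open>B0f\<close> are the coefficients of
  \<open>\<epsilon>^2 * \<mu>^2\<close> and \<open>\<epsilon>^2\<close> without \<open>v\<close>,
  and \<open>Rc\<close> is the coefficient of \<open>\<eta>^2 D^2\<close> in the operator at
  \<open>\<lambda> = 0\<close>.\<close>

definition "Rc = 2 * a - b * c * c"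
definition A0f where "A0f z = 2 * b * c * p2 z - 2 * c * p z + 2 * qz z * p z - q1 z * u1 z + b * q2 z - qz z"
definition B0f where "B0f z = - (Rc * q2 z - qz z - c * (qz z * qz z))"
text \<open>\<open>Av\<close> and \<open>- Av * m0sq\<close> are the pairings of \<open>qz\<close>
  with \<open>A0f\<close> and \<open>B0f\<close>, computed in \<open>qA\<close> and
  \<open>qB0f\<close>; \<open>Ah\<close> is the polynomial part of \<open>Av\<close>. The root
  \<open>m00\<close> of \<open>m0sq\<close> becomes the first-order coefficient of the
  eigenvalue.\<close>

definition "Ah = 6 + 3 * xi + 7 * be + 3 * xi * be - be * be + 6 * (xi * xi)"
definition "Av = - (8 * (c * c) * (1 - xi) * Ah / (15 * kp))"
definition "m0sq = (1 - xi) * (2 * (c * c - 1) + 5 + be * (c * c)) / Ah"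
definition "m00 = sqrt m0sq"

lemma Ah0: "Ah > 0"
proof -
 have "be * be < 1 * 1" using be by (intro mult_strict_mono) auto
 moreover have "3 * xi * be > 0" "xi * xi > 0" using xi(1) be by simp_all
 ultimately show ?thesis unfolding Ah_def using xi(1) be by linarith
qed

lemma Av0: "Av < 0"
proof -
 have "8 * (c * c) * (1 - xi) * Ah / (15 * kp) > 0" using c1 xi Ah0 kp0 by simp
 then show ?thesis by (simp add: Av_def)
qed

lemma m0sq0: "m0sq > 0"
proof -
 have "c * c > 1" using csq by (simp add: power2_eq_square)
 moreover have "be * (c * c) > 0" using be c1 by simp
 ultimately show ?thesis unfolding m0sq_def using xi Ah0 by (intro divide_pos_pos mult_pos_pos) auto
qed

lemma m00: "m00 > 0" "m00\<^sup>2 = m0sq" using m0sq0 by (simp_all add: m00_def)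

lemma qA: "(LINT z|lborel. qz z * A0f z) = Av"
proof -
 define Y where "Y = c * M * be"
 have e: "qz z * A0f z = 0 * S z + (2 * Y * (Mp + 2 * j1) - 2 * c * M * Mp - M * M * (kp * j0) + be * M * M - M * M) * (S z * S z)
   + (- 3 * Y * (Mp + 2 * j1) + 2 * M * M * Mp + M * M * (kp * j0) - 3 / 2 * be * M * M) * (S z * S z * S z)
   + (M * M * (kp * j0)) * (T z * S z * S z)
   + (kp * (- 2 * Y * j1 + 2 * c * M * j1)) * (z * T z * S z * S z)
   + (kp * (6 * Y * j1 - 2 * M * M * j1 - M * M * j1)) * (z * T z * S z * S z * S z)" for z
 proof -
  \<comment> \<open>Each \<open>kp^2\<close> is kept next to \<open>b\<close>, so that the product
    can be replaced by \<open>be\<close>.\<close>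
  have x1: "2 * b * c * p2 z = 2 * c * (b * (kp * kp)) * (- Mp * (1 / 2 * (S z * S z) - T z * T z * S z) - j1 * (2 * (1 / 2 * (S z * S z) - T z * T z * S z) + kp * z * ((1 - 3 * S z) * (T z * S z))))"
   by (simp add: p2_def ph2_def ph1_def ph_def power2_eq_square algebra_simps)
  have x2: "b * q2 z = - (b * (kp * kp)) * M * (1 / 2 * (S z * S z) - T z * T z * S z)" by (simp add: q2_def ph1_def)
  have x3: "q1 z * u1 z = - M * T z * S z * ((kp * j0) * (1 - T z)) + kp * j1 * M * T z * S z * (z * S z)"
   by (simp add: q1_def ph_def u1_def algebra_simps)
  have x4: "p z = Mp * S z - kp * j1 * (z * (T z * S z))" by (simp add: p_def ph_def)
  show ?thesis
   unfolding A0f_def x1 x2 x3 x4 Mc(3) qz_M TT Y_def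
   by (simp add: algebra_simps add_divide_distrib diff_divide_distrib TT SSi_left)
 qed
 have k: "kp \<noteq> 0" using kp0 by simp
 have "(LINT z|lborel. qz z * A0f z) = Av"
  unfolding e int_form unfolding j0(3) Av_def Ah_def Y_def Mp_def j1_def xi(4)
  using k by (simp add: divide_simps) (simp add: algebra_simps)
 then show ?thesis .
qed

lemma qB0f: "(LINT z|lborel. qz z * B0f z) = - Av * m00\<^sup>2"
proof -
 have Rk: "Rc * (kp * kp) = be * (c * c) - 2 * (c * c - 1)"
 proof -
  have "Rc * (kp * kp) = 2 * (a * (kp * kp)) - (b * (kp * kp)) * (c * c)" by (simp add: Rc_def algebra_simps)
  then show ?thesis unfolding aeq(1) Mc(3) by simp
 qed
 have e: "qz z * B0f z = 0 * S z + (M * M * (Rc * (kp * kp)) * (- 1) + M * M) * (S z * S z) + (3 / 2 * (M * M * (Rc * (kp * kp))) + (c * M) * M * M) * (S z * S z * S z)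
   + 0 * (T z * S z * S z) + 0 * (z * T z * S z * S z) + 0 * (z * T z * S z * S z * S z)" for z
  by (simp add: B0f_def q2_def ph1_def qz_M TT algebra_simps add_divide_distrib diff_divide_distrib)
 have k: "kp \<noteq> 0" "Ah \<noteq> 0" using kp0 Ah0 by auto
 have "(LINT z|lborel. qz z * B0f z) = 8 * M * M / (15 * kp) * (2 * (c * c - 1) + 5 + be * (c * c))"
  unfolding e int_form unfolding Rk Mc(1) using k by (simp add: divide_simps) (simp add: algebra_simps)
 also have "\<dots> = 8 * (c * c) * ((1 - xi) * (1 - xi)) / (15 * kp) * (2 * (c * c - 1) + 5 + be * (c * c))"
  unfolding xi(4) by (simp add: algebra_simps)
 also have "\<dots> = - Av * m00\<^sup>2" unfolding m00 m0sq_def Av_def using k by (simp add: divide_simps)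
 finally show ?thesis .
qed

text \<open>The inhomogeneity is \<open>f = \<mu>\<^sup>2 A0f + B0f + \<epsilon> \<Xi>\<close>.  Row \<open>i\<close> of the following tables describes the
 term of \<open>\<Xi>\<close> with the factor \<open>\<epsilon>\<close> to the power \<open>ea i\<close> times \<open>\<mu>\<close> to the power \<open>eb i\<close>: its explicit
 part \<open>sl i\<close>, coming from \<open>q\<close> and \<open>u1\<close>, and the coefficients \<open>rl i j\<close> of \<open>KK j f\<close>, coming from the
 derivatives of \<open>v = - KK 0 f\<close>.\<close>

definition ea :: "nat => nat" where "ea i = [0, 0, 1, 1, 2, 2, 3, 3] ! i"
definition eb :: "nat => nat" where "eb i = [1, 3, 0, 2, 1, 3, 0, 2] ! i"

definition sl :: "nat => real => real" where
 "sl i = [\<lambda>z. Rc * p1 z + u1 z + c * (qz z * u1 z) - (2 * b * c) * q1 z, \<lambda>z. (- b) * p1 z - u1 z, \<lambda>z. (- a) * qz z,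
   \<lambda>z. (2 * b * c) * p z + b * qz z, \<lambda>z. (- a) * u1 z, \<lambda>z. b * u1 z, \<lambda>z. 0 * u1 z, \<lambda>z. 0 * u1 z] ! i"

definition rl :: "nat => nat => real => real" where
 "rl i j = [[q1, \<lambda>z. 2 * qz z - 2 * c, \<lambda>z. 0, \<lambda>z. 2 * b * c], [\<lambda>z. 0, \<lambda>z. 0, \<lambda>z. 0, \<lambda>z. 0],
   [\<lambda>z. - 1 - c * qz z, \<lambda>z. 0, \<lambda>z. Rc, \<lambda>z. 0], [\<lambda>z. 1, \<lambda>z. 0, \<lambda>z. - b, \<lambda>z. 0],
   [\<lambda>z. 0, \<lambda>z. 2 * b * c, \<lambda>z. 0, \<lambda>z. 0], [\<lambda>z. 0, \<lambda>z. 0, \<lambda>z. 0, \<lambda>z. 0],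
   [\<lambda>z. a, \<lambda>z. 0, \<lambda>z. 0, \<lambda>z. 0], [\<lambda>z. - b, \<lambda>z. 0, \<lambda>z. 0, \<lambda>z. 0]] ! i ! j"

lemma gr_sl: "i < 8 ==> gr (sl i)"
proof -
 have "\<forall>h\<in>set [\<lambda>z. Rc * p1 z + u1 z + c * (qz z * u1 z) - (2 * b * c) * q1 z, \<lambda>z. (- b) * p1 z - u1 z, \<lambda>z. (- a) * qz z,
   \<lambda>z. (2 * b * c) * p z + b * qz z, \<lambda>z. (- a) * u1 z, \<lambda>z. b * u1 z, \<lambda>z. 0 * u1 z, \<lambda>z. 0 * u1 z]. gr h"
  unfolding list.set ball_simps
  by (intro conjI TrueI gr_diff gr_add gr_cmult gr_explicit gr_pt[OF pt_q(1)])
 moreover assume "i < 8"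
 then have "sl i \<in> set [\<lambda>z. Rc * p1 z + u1 z + c * (qz z * u1 z) - (2 * b * c) * q1 z, \<lambda>z. (- b) * p1 z - u1 z, \<lambda>z. (- a) * qz z,
   \<lambda>z. (2 * b * c) * p z + b * qz z, \<lambda>z. (- a) * u1 z, \<lambda>z. b * u1 z, \<lambda>z. 0 * u1 z, \<lambda>z. 0 * u1 z]"
  unfolding sl_def by (intro nth_mem) simp
 ultimately show ?thesis by blast
qed

lemma pt_rl: assumes "i < 8" "j < 4" shows "pt (rl i j)"
proof -
 have "pt (\<lambda>z. 2 * qz z - 2 * c)" "pt (\<lambda>z. - 1 - c * qz z)" by (intro pt_diff pt_mult pt_const pt_q)+
 moreover have "i \<in> {0, 1, 2, 3, 4, 5, 6, 7}" "j \<in> {0, 1, 2, 3}" using assms by auto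
 ultimately show ?thesis using pt_q pt_const by (auto simp: rl_def)
qed

lemma gr_A0f: "gr A0f" and gr_B0f: "gr B0f"
 unfolding A0f_def[abs_def] B0f_def[abs_def] mult.assoc[of 2 "qz _"]
 by (intro gr_diff gr_add gr_cmult gr_explicit gr_uminus gr_pt[OF pt_q(1)] gr_pt[OF pt_q(2)])+

lemma pt_bound: assumes "pt h" shows "continuous_on UNIV h" "\<exists>C. \<forall>z. abs (h z) <= C"
proof -
 obtain P where P: "h = (\<lambda>z. poly P (T z))" using assms by (auto simp: pt_def)
 show "continuous_on UNIV h" unfolding P by (intro continuous_intros T_continuous)
 have "compact ((\<lambda>x. poly P x) ` {- 1..1::real})" by (intro compact_continuous_image continuous_intros compact_Icc)
 then obtain D where D: "!!x. x \<in> {- 1..1} ==> abs (poly P x) <= D"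
  by (force dest!: compact_imp_bounded simp: bounded_iff)
 have "abs (h z) <= D" for z unfolding P using T_le1[of z] by (intro D) (auto simp: abs_le_iff)
 then show "\<exists>C. \<forall>z. abs (h z) <= C" by blast
qed

definition Lx :: "nat => (real => complex) => real => complex" where
 "Lx i f z = cx (rl i 0 z) * KK 0 f z + cx (rl i 1 z) * KK 1 f z + cx (rl i 2 z) * KK 2 f z + cx (rl i 3 z) * KK 3 f z"

lemma opr_Lx: assumes "i < 8" shows "\<exists>k. opr w k (Lx i)"
proof -
 have "\<exists>k. opr w k (\<lambda>f z. cx (rl i j z) * KK j f z)" if j: "j < 4" for j
 proof -
  obtain C where C: "!!z. abs (rl i j z) <= C" using pt_bound(2)[OF pt_rl[OF assms j]] by blast
  show ?thesis by (rule exI, rule opr_mult[OF opr_KK pt_bound(1)[OF pt_rl[OF assms j]] C w_bounds])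
 qed
 from this[of 0] this[of 1] this[of 2] this[of 3]
 obtain k0 k1 k2 k3 where "opr w k0 (\<lambda>f z. cx (rl i 0 z) * KK 0 f z)" "opr w k1 (\<lambda>f z. cx (rl i 1 z) * KK 1 f z)"
  "opr w k2 (\<lambda>f z. cx (rl i 2 z) * KK 2 f z)" "opr w k3 (\<lambda>f z. cx (rl i 3 z) * KK 3 f z)" by auto
 from opr_add[OF opr_add[OF opr_add[OF this(1,2)] this(3)] this(4)] show ?thesis unfolding Lx_def[abs_def] by blast
qed

definition Frhs :: "complex => complex => (real => complex) => real => complex" where
 "Frhs e \<mu> f z = \<mu>\<^sup>2 * cx (A0f z) + cx (B0f z) + e * (\<Sum>i<8. e ^ ea i * \<mu> ^ eb i * (cx (sl i z) + Lx i f z))"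

theorem branch_Frhs:
 "\<exists>R mu f C. R > 0 \<and> R <= 1 \<and> C >= 0 \<and> hsym R mu \<and> fam R w C f \<and> (\<forall>e\<in>ball 0 R. norm (mu e) <= 2 * m00) \<and> mu 0 = cx m00 \<and>
   (\<forall>e\<in>ball 0 R. f e = Frhs e (mu e) (f e) \<and> lint qz (f e) = 0)"
proof -
 obtain k where k: "!!i. i < 8 ==> opr w (k i) (Lx i)" using opr_Lx by metis
 have "\<exists>C\<ge>0. \<forall>z. abs (g z) <= C * w z" if "g \<in> {A0f, B0f} \<union> sl ` {..<8}" for g
  using that gr_bound(1)[OF gr_A0f] gr_bound(1)[OF gr_B0f] gr_bound(1)[OF gr_sl] by auto
 then obtain C where C: "!!g. g \<in> {A0f, B0f} \<union> sl ` {..<8} ==> C g >= 0"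
  "!!g z. g \<in> {A0f, B0f} \<union> sl ` {..<8} ==> abs (g z) <= C g * w z" by metis
 \<comment> \<open>One constant for all explicit terms, as the locale \<open>branch\<close> asks for
   a common bound.\<close>
 define Sb where "Sb = (\<Sum>g\<in>{A0f, B0f} \<union> sl ` {..<8}. C g)"
 have Sb: "abs (g z) <= Sb * w z" if "g \<in> {A0f, B0f} \<union> sl ` {..<8}" for g z
 proof -
  have "C g <= Sb" unfolding Sb_def by (rule member_le_sum[OF that]) (use C(1) in auto)
  then show ?thesis using C(2)[OF that, of z] mult_right_mono[of "C g" Sb "w z"] w_bounds[of z] by linarith
 qed
 have Sb0: "Sb >= 0" unfolding Sb_def by (intro sum_nonneg C)
 interpret br: branch w 8 ea eb sl Lx k A0f B0f qz Sb Av m00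
 proof
  show "continuous_on UNIV (sl i)" if "i < 8" for i by (rule gr_bound(2)[OF gr_sl[OF that]])
  show "abs (sl i z) <= Sb * w z" if "i < 8" for i z using that by (intro Sb) auto
  show "abs (A0f z) <= Sb * w z" "abs (B0f z) <= Sb * w z" for z by (intro Sb; simp)+
  show "lint qz (\<lambda>z. cx (A0f z)) = cx Av" "lint qz (\<lambda>z. cx (B0f z)) = cx (- Av * m00\<^sup>2)"
   unfolding lint_def of_real_mult[symmetric] integral_complex_of_real qA qB0f by simp_all
 qed (use k w_continuous w_pos gr_bound(2)[OF gr_A0f] gr_bound(2)[OF gr_B0f] qz_measurable qz_int Av0 m00 Sb0 in auto)
 have F: "br.Fx = Frhs" by (intro ext) (simp add: br.Fx_def br.Xi_def Frhs_def)
 have "br.Cf0 >= 0" using br.cfacts(7) by simp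
 then show ?thesis using br.branch_exists unfolding F br.mm_def by blast
qed

end

text \<open>Ordered by powers of \<open>e\<close>, the difference of the two sides is the profile
  equation, plus \<open>e * mu\<close> times the equation of \<open>u\<close>, plus
  \<open>e * e\<close> times the equation of \<open>v\<close>. All remaining terms, including those
  of higher order in \<open>e\<close>, have been collected in \<open>f\<close>.\<close>

lemma fourth_order_ode:
 fixes q0 q1 q2 q3 q4 u p p1 p2 p3 v0 v1 v2 v3 v4 f e mu a b c m :: complex
 assumes m: "m = b * c * c - a"
  and q: "m * q4 - (c * c - 1) * q2 + 3 * c * (q0 * q2 + q1 * q1) = 0"
  and u: "- m * p3 + (c * c - 1) * p1 - 3 * c * (q1 * p + q0 * p1) = 2 * b * c * q3 - 2 * c * q1 + 3 * q0 * q1"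
  and v: "m * v4 - (c * c - 1) * v2 + 3 * c * (q1 * v1 + q0 * v2) = - f"
  and f: "f = mu * mu * (2 * b * c * p2 - 2 * c * p + 2 * q0 * p - q1 * u + b * q2 - q0) - ((2 * a - b * c * c) * q2 - q0 - c * (q0 * q0))
   + e * (mu * ((2 * a - b * c * c) * p1 + u + c * (q0 * u) - 2 * b * c * q1 + (- 2 * b * c * v3 + 2 * c * v1 - 2 * q0 * v1 - q1 * v0))
    + mu * mu * mu * (- b * p1 - u) + e * (- a * q0 - (2 * a - b * c * c) * v2 + v0 + c * q0 * v0)
    + e * mu * mu * (2 * b * c * p + b * q0 + b * v2 - v0) + e * e * mu * (- a * u - 2 * b * c * v1)
    + e * e * mu * mu * mu * b * u - e * e * e * a * v0 + e * e * e * mu * mu * b * v0)"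
  and U: "U0 = q0 + e * mu * u + e * e * v0" "U1 = q1 - e * mu * p + e * e * v1" "U2 = q2 - e * mu * p1 + e * e * v2"
   "U3 = q3 - e * mu * p2 + e * e * v3" "U4 = q4 - e * mu * p3 + e * e * v4"
  and E: "E = - (e * e)" "lam = e * mu"
 shows "(1 + a * E) * (U2 - E * U0) - a * (U4 - E * U2) + c * ((1 + b * E) * (lam * U1 - c * U2) - b * (lam * U3 - c * U4))
    - (- c * (2 * q1 * U1 + q0 * (U2 - E * U0)) + 2 * q0 * (lam * U1 - c * U2) + q1 * (lam * U0 - c * U1))
    = lam * ((1 + b * E) * (lam * U0 - c * U1) - b * (lam * U2 - c * U3))" (is "?L = ?R")
proof -
 have "?L - ?R = (m * q4 - (c * c - 1) * q2 + 3 * c * (q0 * q2 + q1 * q1))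
  + e * mu * ((- m * p3 + (c * c - 1) * p1 - 3 * c * (q1 * p + q0 * p1)) - (2 * b * c * q3 - 2 * c * q1 + 3 * q0 * q1))
  + e * e * ((m * v4 - (c * c - 1) * v2 + 3 * c * (q1 * v1 + q0 * v2)) + f)"
  unfolding f m U E by (simp add: algebra_simps)
 then show ?thesis unfolding q u v by simp
qed

text \<open>Reflection changes the sign of odd derivatives, as transposition does to the scalar
  operator. Eliminating \<open>K\<close> from the adjoint rows thus returns the original equation,
  up to the factor \<open>c\<close>. The values of \<open>q\<close> are taken at \<open>- z\<close>,
  which explains the sign of \<open>q1\<close> in \<open>K0\<close>.\<close>

lemma adjoint_ode:
 fixes q0 q1 q2 U0 U1 U2 U3 U4 E lam a b c :: complex
 assumes "(1 + a * E) * (U2 - E * U0) - a * (U4 - E * U2) + c * ((1 + b * E) * (lam * U1 - c * U2) - b * (lam * U3 - c * U4))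
    - (- c * (2 * q1 * U1 + q0 * (U2 - E * U0)) + 2 * q0 * (lam * U1 - c * U2) + q1 * (lam * U0 - c * U1))
    = lam * ((1 + b * E) * (lam * U0 - c * U1) - b * (lam * U2 - c * U3))" (is "?L = ?R")
  and H: "H0 = c * U0" "H1 = - c * U1" "H2 = c * U2" "H3 = - c * U3" "H4 = c * U4"
  and g: "g0 = (1 + b * E) * H0 - b * H2" "g1 = (1 + b * E) * H1 - b * H3" "g2 = (1 + b * E) * H2 - b * H4"
  and K: "K0 = lam * g0 + c * g1 - 2 * q0 * H1 + q1 * H0" "K1 = lam * g1 + c * g2 + 2 * q1 * H1 - 2 * q0 * H2 - q2 * H0 + q1 * H1"
 shows "- c * K1 + (1 + a * E) * (H2 - E * H0) - a * (H4 - E * H2) + c * (- q2 * H0 + q0 * H2 - E * q0 * H0) = lam * K0" (is "?L' = ?R'")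
proof -
 have "?L' - ?R' = c * (?L - ?R)" unfolding K g H by (simp add: algebra_simps)
 then show ?thesis using assms(1) by simp
qed

section \<open>The resonant modes\<close>

lemma gen_sum:
 assumes "finite I" "!!i. i \<in> I ==> gen R T B (X i)" "gen R T B Z"
 shows "gen R T B (\<lambda>e z. \<Sum>i\<in>I. X i e z)"
 using assms(1,2)
proof (induction I rule: finite_induct)
 case empty
 \<comment> \<open>The inductive rules provide no zero; scaling the auxiliary member
   \<open>Z\<close> by 0 supplies the empty sum.\<close>
 have "gen R T B (\<lambda>e z. 0 * Z e z)" by (rule gen_scale[OF assms(3), of _ 0]) (use hsym_const[of R 0] in auto)
 then show ?case by simp
next
 case (insert i I)
 then have "gen R T B (\<lambda>e z. X i e z + (\<Sum>i\<in>I. X i e z))" by (intro gen_add) auto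
 then show ?case using insert by simp
qed

lemma gen_const: "gen R T B X ==> gen R T B (\<lambda>e z. cx r * X e z)"
 by (rule gen_scale[where h = "\<lambda>e. cx r" and D = "abs r"]) (auto simp: hsym_const)

locale bl_branch = benney_luke +
 fixes R Cf :: real and mu :: "complex => complex" and f :: "complex => real => complex"
 assumes R: "R > 0" "R <= 1" and Cf: "Cf >= 0" and f: "fam R w Cf f"
  and mu: "hsym R mu" "!!e. e \<in> ball 0 R ==> norm (mu e) <= 2 * m00" "mu 0 = cx m00"
  and fp: "!!e. e \<in> ball 0 R ==> f e = Frhs e (mu e) (f e)" "!!e. e \<in> ball 0 R ==> lint qz (f e) = 0"
begin

definition "lam e = e * mu e"
text \<open>Differentiating \<open>KK 3 f\<close> brings back \<open>f\<close>, but by the fixed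
  point equation \<open>f\<close> is itself a combination of explicit functions and
  \<open>KK j f\<close> with \<open>j < 4\<close>. Hence derivatives of the base stay in the
  generated class, which gives smoothness of all orders in \<open>z\<close>.\<close>

definition "BV = BB \<union> (\<lambda>j e. KK j (f e)) ` {..<4}"

lemma gr_gen: "gr s ==> gen R T BV (\<lambda>e z. cx (s z))" by (auto simp: gr_def BV_def)
lemma pt_gen: "pt h ==> gen R T B X ==> gen R T B (\<lambda>e z. cx (h z) * X e z)"
 unfolding pt_def by (auto intro: gen_poly)
lemma KK_gen: "j < 4 ==> gen R T BV (\<lambda>e z. KK j (f e) z)" by (rule gen_base) (auto simp: BV_def)

lemma scale_gen: "gen R T B X ==> gen R T B (\<lambda>e z. (e ^ i * mu e ^ j) * X e z)"
proof (rule gen_scale)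
 show "hsym R (\<lambda>e. e ^ i * mu e ^ j)" by (intro hsym_mult hsym_power hsym_ident mu)
 show "norm (e ^ i * mu e ^ j) <= 1 * (2 * m00) ^ j" if "e \<in> ball 0 R" for e
  unfolding norm_mult norm_power using that R mu(2)[OF that] m00 by (intro mult_mono power_mono power_le_one) auto
 show "0 <= 1 * (2 * m00) ^ j" using m00 by simp
qed

lemma Lx_gen: "i < 8 ==> gen R T BV (\<lambda>e z. Lx i (f e) z)"
 unfolding Lx_def by (intro gen_add pt_gen pt_rl KK_gen) auto

lemma Frhs_gen: "gen R T BV (\<lambda>e z. Frhs e (mu e) (f e) z)"
proof -
 have "gen R T BV (\<lambda>e z. (e ^ 0 * mu e ^ 2) * cx (A0f z) + cx (B0f z) + (e ^ 1 * mu e ^ 0) * (\<Sum>i<8. (e ^ ea i * mu e ^ eb i) * (cx (sl i z) + Lx i (f e) z)))"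
  by (intro gen_add scale_gen gr_gen gr_A0f gr_B0f gen_sum[OF _ _ gr_gen[OF gr_A0f]] gr_sl Lx_gen) auto
 then show ?thesis by (simp add: Frhs_def)
qed

text \<open>From index 4 on this is the derivative of \<open>KK 3 (f e)\<close>, with
  \<open>pj (f e)\<close> replaced by the right-hand side of the fixed point equation; orthogonality
  makes the projection drop out.\<close>

definition "kd n e z = (if n < 4 then KK n (f e) z else cx (1 / m) * Frhs e (mu e) (f e) z
  + cx (3 * kp ^ 3 * (T z * S z)) * KK 1 (f e) z + cx (kp\<^sup>2 - 3 * kp\<^sup>2 * S z) * KK 2 (f e) z)"

lemma kd_gen: "gen R T BV (kd 4)"
proof -
 have "gen R T BV (\<lambda>e z. cx (1 / m) * Frhs e (mu e) (f e) z
  + cx (3 * kp ^ 3 * (T z * S z)) * KK 1 (f e) z + cx (kp\<^sup>2 - 3 * kp\<^sup>2 * S z) * KK 2 (f e) z)"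
  by (intro gen_add pt_gen pt_const pt_mult pt_diff pt_T pt_S Frhs_gen KK_gen) auto
 then show ?thesis by (simp add: kd_def[abs_def])
qed

lemma kd_deriv:
 assumes e: "e \<in> ball 0 R" and n: "n < 4"
 shows "(kd n e has_vector_derivative kd (Suc n) e z) (at z)"
proof -
 note d = KK_deriv[OF Cf f e, of z]
 have "n \<in> {0, 1, 2, 3}" using n by auto
 moreover have "pj (f e) z = Frhs e (mu e) (f e) z" using fp[OF e] by (simp add: pj_def)
 ultimately show ?thesis using d by (auto simp: kd_def[abs_def] numeral_2_eq_2 numeral_3_eq_3)
qed

lemma BV_fam: "X \<in> BV ==> \<exists>C\<ge>0. fam R w C X"
proof -
 have "\<exists>C\<ge>0. fam R w C (\<lambda>e. KK j (f e))" for j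
  using opr_fam[OF opr_KK Cf f, of j] opr_nonneg[OF opr_KK[of j]] Cf by (intro exI[of _ "kk j * Cf"]) simp
 then show "X \<in> BV ==> \<exists>C\<ge>0. fam R w C X" using BB_fam unfolding BV_def by auto
qed

lemma BV_deriv: "X \<in> BV ==> \<exists>Y. gen R T BV Y \<and> (\<forall>e\<in>ball 0 R. \<forall>z. (X e has_vector_derivative Y e z) (at z))"
proof -
 have r: "\<exists>Y. gen R T BV Y \<and> (\<forall>e\<in>ball 0 R. \<forall>z. ((\<lambda>z. cx (s z)) has_vector_derivative Y e z) (at z))"
  if "!!z. (s has_real_derivative s' z) (at z)" "gr s'" for s s'
  using has_vector_derivative_of_real'[OF that(1)] gr_gen[OF that(2)] by (intro exI[of _ "\<lambda>e z. cx (s' z)"]) auto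
 have "\<exists>Y. gen R T BV Y \<and> (\<forall>e\<in>ball 0 R. \<forall>z. ((\<lambda>z. cx (S z)) has_vector_derivative Y e z) (at z))"
  by (rule r[OF S_deriv]) (intro gr_pt pt_mult pt_const pt_T gr_basic)
 moreover have "((\<lambda>z. z * S z) has_real_derivative 1 * S z + (- kp * T z) * (z * S z)) (at z)" for z
  by (auto intro!: derivative_eq_intros)
 then have "\<exists>Y. gen R T BV Y \<and> (\<forall>e\<in>ball 0 R. \<forall>z. ((\<lambda>z. cx (z * S z)) has_vector_derivative Y e z) (at z))"
  by (rule r) (intro gr_add gr_cmult gr_pt[OF pt_mult[OF pt_const pt_T]] gr_basic)
 moreover have "((\<lambda>z. 1 - T z) has_real_derivative (- kp / 2) * S z) (at z)" for z
  by (auto intro!: derivative_eq_intros)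
 then have "\<exists>Y. gen R T BV Y \<and> (\<forall>e\<in>ball 0 R. \<forall>z. ((\<lambda>z. cx (1 - T z)) has_vector_derivative Y e z) (at z))"
  by (rule r) (intro gr_cmult gr_basic)
 moreover have "\<exists>Y. gen R T BV Y \<and> (\<forall>e\<in>ball 0 R. \<forall>z. (KK j (f e) has_vector_derivative Y e z) (at z))" if j: "j < 4" for j
 proof (intro exI conjI)
  show "gen R T BV (kd (Suc j))"
  proof (cases "Suc j < 4")
   case True
   then show ?thesis using KK_gen[OF True] by (simp add: kd_def[abs_def])
  next
   case False
   then have "Suc j = 4" using j by simp
   then show ?thesis using kd_gen by simp
  qed
  show "\<forall>e\<in>ball 0 R. \<forall>z. (KK j (f e) has_vector_derivative kd (Suc j) e z) (at z)"
   using kd_deriv[OF _ j] j by (simp add: kd_def[abs_def])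
 qed
 ultimately show "X \<in> BV ==> \<exists>Y. gen R T BV Y \<and> (\<forall>e\<in>ball 0 R. \<forall>z. (X e has_vector_derivative Y e z) (at z))"
  unfolding BV_def BB_def by auto
qed

lemmas BV_smfam = gen_smfam[OF w_bounds T_deriv' T_le1 BV_fam BV_deriv]

definition "qd n = [qz, q1, q2, q3, q4] ! n"
definition "pd n = [u1, \<lambda>z. - p z, \<lambda>z. - p1 z, \<lambda>z. - p2 z, \<lambda>z. - p3 z] ! n"
text \<open>The ansatz with \<open>v = - KK 0 (f e)\<close>, together with its derivatives up to
  order 4.\<close>

definition "Ux n e z = cx (qd n z) + lam e * cx (pd n z) - e * e * kd n e z"

lemma Ux_deriv:
 assumes e: "e \<in> ball 0 R" and n: "n < 4"
 shows "(Ux n e has_vector_derivative Ux (Suc n) e z) (at z)"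
proof -
 have "n \<in> {0, 1, 2, 3}" using n by auto
 then have "(qd n has_real_derivative qd (Suc n) z) (at z)" "(pd n has_real_derivative pd (Suc n) z) (at z)"
  using q_derivs[of z] p_derivs[of z] by (auto simp: qd_def pd_def numeral_2_eq_2 numeral_3_eq_3 intro: DERIV_minus)
 note h = this[THEN has_vector_derivative_of_real']
 show ?thesis unfolding Ux_def[abs_def]
  by (intro has_vector_derivative_add has_vector_derivative_diff has_vector_derivative_mult_right h kd_deriv e n)
qed

lemma U_gen: "gen R T BV (Ux 0)"
proof -
 have "gen R T BV (\<lambda>e z. cx (qz z) + (e ^ 1 * mu e ^ 1) * cx (u1 z) + (e ^ 2 * mu e ^ 0) * (cx (- 1) * KK 0 (f e) z))"
  by (intro gen_add scale_gen gr_gen gr_explicit gen_const KK_gen) auto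
 then show ?thesis by (simp add: Ux_def[abs_def] qd_def pd_def kd_def lam_def power2_eq_square)
qed

definition "UD = (SOME D. D 0 = Ux 0 \<and> smfam R w D)"

lemma UD: "UD 0 = Ux 0" "smfam R w UD"
 using someI_ex[OF BV_smfam[OF _ _ U_gen]] unfolding UD_def by auto

text \<open>Uniqueness of derivatives ties the sequence chosen by \<open>SOME\<close> to the
  explicit one, up to the order that the differential equation involves.\<close>

lemma UD_Ux: "e \<in> ball 0 R ==> n <= 4 ==> UD n e = Ux n e"
proof (induction n)
 case (Suc n)
 then have eq: "UD n e = Ux n e" by simp
 show ?case
 proof
  fix z
  have "(UD n e has_vector_derivative UD (Suc n) e z) (at z)" by (rule smfam_deriv[OF UD(2) Suc(2)])
  moreover have "(UD n e has_vector_derivative Ux (Suc n) e z) (at z)" unfolding eq using Suc by (intro Ux_deriv) auto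
  ultimately show "UD (Suc n) e z = Ux (Suc n) e z" by (rule vector_derivative_unique_at)
 qed
qed (simp add: UD)

lemma smfam_wsmooth: "smfam R (wt \<beta> \<delta>) D ==> e \<in> ball 0 R ==> wsmooth \<beta> \<delta> (\<lambda>n. D n e)"
 unfolding smfam_def wsmooth_def using fam_bound by blast

text \<open>The derivatives of the profile as polynomials in \<open>T\<close>, obtained by iterating
  the derivation that sends \<open>T\<close> to \<open>(kp/2) * (1 - T^2)\<close>; this supplies the
  complete sequence demanded by \<open>bsmooth\<close>.\<close>

definition "Qp n = ((\<lambda>P. pderiv P * [:kp / 2, 0, - (kp / 2):]) ^^ n) [:M, 0, - M:]"
definition "Qc n z = poly (Qp n) (T z)"

lemma Qc_deriv: "(Qc n has_real_derivative Qc (Suc n) z) (at z)"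
proof -
 have "Qp (Suc n) = pderiv (Qp n) * [:kp / 2, 0, - (kp / 2):]" by (simp only: Qp_def funpow.simps o_def)
 then show ?thesis using DERIV_chain2[OF poly_DERIV T_deriv', of "Qp n" z] by (simp only: Qc_def[abs_def] poly_mult)
qed

lemma Qc: "bsmooth Qc" "Qc 0 = qz" "Qc 1 = q1" "Qc 2 = q2"
proof -
 have "\<exists>C. \<forall>x. abs (Qc n x) <= C" for n by (rule pt_bound(2)) (auto simp: pt_def Qc_def)
 then show "bsmooth Qc" using Qc_deriv by (auto simp: bsmooth_def)
 show 0: "Qc 0 = qz" by (simp add: Qc_def[abs_def] Qp_def qz_M[abs_def] S_def power2_eq_square fun_eq_iff algebra_simps)
 have "Qc (Suc 0) z = q1 z" for z using Qc_deriv[of 0 z] q_derivs(1)[of z] unfolding 0 by (rule DERIV_unique)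
 then show 1: "Qc 1 = q1" by (simp add: fun_eq_iff)
 have "Qc (Suc 1) z = q2 z" for z using Qc_deriv[of 1 z] q_derivs(2)[of z] unfolding 1 by (rule DERIV_unique)
 then show "Qc 2 = q2" by (simp add: fun_eq_iff numeral_2_eq_2)
qed

text \<open>\<open>be < 1\<close> means \<open>kp^2 < 1 / b\<close>, so \<open>\<alpha> < kp\<close>
  lies below the decay rate \<open>sqrt (1 / b)\<close> of the Green function of
  \<open>B(0)\<close>.\<close>

lemma alpha_b: "b > 0" "abs \<alpha> < sqrt (1 / b)" "\<bar>- \<alpha>\<bar> < sqrt (1 / b)"
proof -
 show b: "b > 0" using a0 ab by simp
 have "\<alpha>\<^sup>2 < kp\<^sup>2" using al0 al1 by (intro power_strict_mono) (auto simp: kp_def)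
 also have "kp\<^sup>2 < 1 / b" using be(2) b by (simp add: be_def field_simps)
 finally show "abs \<alpha> < sqrt (1 / b)" using real_less_rsqrt[of "abs \<alpha>"] by simp
 then show "\<bar>- \<alpha>\<bar> < sqrt (1 / b)" by simp
qed

lemma kd_KK: "kd 0 e z = KK 0 (f e) z" "kd 1 e z = KK 1 (f e) z" "kd 2 e z = KK 2 (f e) z" "kd 3 e z = KK 3 (f e) z"
 by (simp_all add: kd_def)

lemma sum_8: "(\<Sum>i<8. g i) = g 0 + g 1 + g 2 + g 3 + g 4 + g 5 + g 6 + g 7" for g :: "nat => complex"
 by (simp add: eval_nat_numeral)

lemma U_ode:
 assumes e: "e \<in> ball 0 R" and E: "E = - (e * e)"
 shows "(1 + cx a * E) * (UD 2 e z - E * UD 0 e z) - cx a * (UD 4 e z - E * UD 2 e z)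
   + cx c * ((1 + cx b * E) * (lam e * UD 1 e z - cx c * UD 2 e z) - cx b * (lam e * UD 3 e z - cx c * UD 4 e z))
   - (- cx c * (2 * cx (q1 z) * UD 1 e z + cx (qz z) * (UD 2 e z - E * UD 0 e z)) + 2 * cx (qz z) * (lam e * UD 1 e z - cx c * UD 2 e z)
    + cx (q1 z) * (lam e * UD 0 e z - cx c * UD 1 e z))
   = lam e * ((1 + cx b * E) * (lam e * UD 0 e z - cx c * UD 1 e z) - cx b * (lam e * UD 2 e z - cx c * UD 3 e z))"
proof (rule fourth_order_ode[where m = "cx m" and e = e and mu = "mu e" and f = "f e z"])
 show "cx m = cx b * cx c * cx c - cx a" by (simp add: m_def power2_eq_square)
 have "cx (m * q4 z - (c * c - 1) * q2 z + 3 * c * (qz z * q2 z + q1 z * q1 z)) = 0" unfolding soliton2 by simp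
 then show "cx m * cx (q4 z) - (cx c * cx c - 1) * cx (q2 z) + 3 * cx c * (cx (qz z) * cx (q2 z) + cx (q1 z) * cx (q1 z)) = 0"
  by simp
 have "cx (- m * p3 z + (c * c - 1) * p1 z - 3 * c * (q1 z * p z + qz z * p1 z)) = cx (2 * b * c * q3 z - 2 * c * q1 z + 3 * qz z * q1 z)"
  unfolding u1_equation ..
 then show "- cx m * cx (p3 z) + (cx c * cx c - 1) * cx (p1 z) - 3 * cx c * (cx (q1 z) * cx (p z) + cx (qz z) * cx (p1 z))
  = 2 * cx b * cx c * cx (q3 z) - 2 * cx c * cx (q1 z) + 3 * cx (qz z) * cx (q1 z)" by simp
 have n: "(4::nat) = Suc 3" by simp
 show "UD 0 e z = cx (qz z) + e * mu e * cx (u1 z) + e * e * - kd 0 e z" "UD 1 e z = cx (q1 z) - e * mu e * cx (p z) + e * e * - kd 1 e z"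
  "UD 2 e z = cx (q2 z) - e * mu e * cx (p1 z) + e * e * - kd 2 e z" "UD 3 e z = cx (q3 z) - e * mu e * cx (p2 z) + e * e * - kd 3 e z"
  "UD 4 e z = cx (q4 z) - e * mu e * cx (p3 z) + e * e * - kd 4 e z"
  by (simp_all add: UD_Ux[OF e] Ux_def qd_def pd_def lam_def)
 show "E = - (e * e)" by (rule E)
 show "lam e = e * mu e" by (simp add: lam_def)
 have km: "cx m * cx (kp * kp) = cx (c * c - 1)" "cx c * cx M = cx (c * c - 1)"
  unfolding of_real_mult[symmetric] Mc(1,2) by simp_all
 have "cx m * kd 4 e z = f e z + cx m * cx (kp * kp) * (3 * cx (kp * (T z * S z)) * KK 1 (f e) z + cx (1 - 3 * S z) * KK 2 (f e) z)"
  using m0 by (simp add: kd_def fp(1)[OF e, symmetric] power3_eq_cube power2_eq_square algebra_simps)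
 note f1 = this[unfolded km]
 have "3 * cx c * (cx (q1 z) * KK 1 (f e) z + cx (qz z) * KK 2 (f e) z) = cx c * cx M * (3 * cx (S z) * KK 2 (f e) z - 3 * cx (kp * (T z * S z)) * KK 1 (f e) z)"
  by (simp add: q1_def qz_M ph_def algebra_simps)
 note f2 = this[unfolded km]
 have "cx m * - kd 4 e z - (cx c * cx c - 1) * - kd 2 e z + 3 * cx c * (cx (q1 z) * - kd 1 e z + cx (qz z) * - kd 2 e z)
  = - (cx m * kd 4 e z) + cx (c * c - 1) * KK 2 (f e) z - 3 * cx c * (cx (q1 z) * KK 1 (f e) z + cx (qz z) * KK 2 (f e) z)"
  unfolding kd_KK by (simp add: algebra_simps)
 then show "cx m * - kd 4 e z - (cx c * cx c - 1) * - kd 2 e z + 3 * cx c * (cx (q1 z) * - kd 1 e z + cx (qz z) * - kd 2 e z) = - f e z"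
  unfolding f1 f2 by (simp add: algebra_simps)
qed (rule trans[OF fun_cong[OF fp(1)[OF e]]], unfold Frhs_def sum_8 Lx_def,
  simp add: ea_def eb_def sl_def rl_def A0f_def B0f_def Rc_def kd_KK kd_KK(2)[unfolded One_nat_def] power2_eq_square power3_eq_cube algebra_simps)

lemma L_eq:
 assumes e: "e \<in> ball 0 R" and E: "cx (\<eta>\<^sup>2) = - (e * e)"
 shows "L_eq k a b c \<alpha> \<eta> (\<lambda>z. (UD 0 e z, lam e * UD 0 e z - c * UD 1 e z)) (\<lambda>z. cscale (lam e) (UD 0 e z, lam e * UD 0 e z - c * UD 1 e z))"
proof -
 have U: "wsmooth \<alpha> de (\<lambda>n. UD n e)" by (rule smfam_wsmooth[OF UD(2) e])
 have V: "wsmooth \<alpha> de (\<lambda>n z. lam e * UD n e z + (- cx c) * UD (n + 1) e z)" by (rule wsmooth_add[OF U wsmooth_shift[OF U]])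
 have "L_eq k a b c \<alpha> \<eta> (\<lambda>z. (UD 0 e z, lam e * UD 0 e z + (- cx c) * UD (0 + 1) e z)) (\<lambda>z. cscale (lam e) (UD 0 e z, lam e * UD 0 e z + (- cx c) * UD (0 + 1) e z))"
  by (rule L_eq_of_ode[OF U V de(1) alpha_b(1,2) Qc(1)])
   (use U_ode[OF e E] in \<open>simp_all add: Qc Qc(3)[unfolded One_nat_def] qz_eq numeral_2_eq_2[symmetric]\<close>)
 then show ?thesis by simp
qed

text \<open>The reflected mode and its derivatives; the factor \<open>c\<close> normalizes the
  adjoint mode so that at \<open>e = 0\<close> it starts with \<open>zeta2_star\<close>.\<close>

definition "Hn n e z = cx c * ((- 1) ^ n * UD n e (- z))"
definition "w' = wt (- \<alpha>) de"

lemma w'_eq: "w' z = w (- z)" by (simp add: w'_def wt_def)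

lemma Hn_fam: "\<exists>C\<ge>0. fam R w' C (Hn n)"
proof -
 obtain C where C: "C >= 0" "fam R w C (UD n)" using smfam_fam[OF UD(2)] by blast
 have "fam R w' (c * C) (Hn n)"
  unfolding fam_def
 proof (intro conjI ballI allI)
  fix e :: complex assume e: "e \<in> ball 0 R"
  have "continuous_on UNIV (\<lambda>z. UD n e (- z))"
   by (rule continuous_on_compose2[OF fam_cont[OF C(2) e, of UNIV]]) (auto intro: continuous_intros)
  then show "continuous_on UNIV (Hn n e)" unfolding Hn_def[abs_def] by (intro continuous_intros)
  show "norm (Hn n e z) <= c * C * w' z" for z
   using mult_left_mono[OF fam_bound[OF C(2) e, of "- z"], of c] c1 by (simp add: Hn_def norm_mult norm_power w'_eq)
 next
  show "hsym R (\<lambda>e. Hn n e z)" for z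
   unfolding Hn_def using hsym_const[of R "(- 1) ^ n"] by (intro hsym_mult hsym_const fam_hsym[OF C(2)]) simp
 qed
 then show ?thesis using C(1) c1 by (intro exI[of _ "c * C"]) simp
qed

lemma Hn_deriv: "e \<in> ball 0 R ==> (Hn n e has_vector_derivative Hn (Suc n) e z) (at z)"
proof -
 assume e: "e \<in> ball 0 R"
 have "((UD n e \<circ> uminus) has_vector_derivative (- 1) *\<^sub>R UD (Suc n) e (- z)) (at z)"
  by (rule vector_diff_chain_at[OF _ smfam_deriv[OF UD(2) e]]) (auto intro!: derivative_eq_intros)
 then have "((\<lambda>z. cx c * ((- 1) ^ n * (UD n e \<circ> uminus) z)) has_vector_derivative cx c * ((- 1) ^ n * ((- 1) *\<^sub>R UD (Suc n) e (- z)))) (at z)"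
  by (intro has_vector_derivative_mult_right)
 then show ?thesis by (simp add: Hn_def[abs_def] o_def)
qed

lemma Hn_wsmooth: "e \<in> ball 0 R ==> wsmooth (- \<alpha>) de (\<lambda>n. Hn n e)"
proof -
 assume e: "e \<in> ball 0 R"
 have "\<exists>C. \<forall>x. norm (Hn n e x) <= C * w' x" for n
 proof -
  obtain C where "fam R w' C (Hn n)" using Hn_fam by blast
  then show ?thesis using fam_bound[OF _ e] by blast
 qed
 then show ?thesis unfolding wsmooth_def w'_def[symmetric] using Hn_deriv[OF e] by simp
qed

lemma H_smfam: "gen R T (range Hn) X ==> \<exists>D. D 0 = X \<and> smfam R w' D"
proof (rule gen_smfam[OF _ T_deriv' T_le1])
 show "w' z >= 0" for z by (simp add: w'_eq w_bounds)
 show "\<exists>C\<ge>0. fam R w' C X" if "X \<in> range Hn" for X using that Hn_fam by blast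
 show "\<exists>Y. gen R T (range Hn) Y \<and> (\<forall>e\<in>ball 0 R. \<forall>z. (X e has_vector_derivative Y e z) (at z))" if "X \<in> range Hn" for X
  using that Hn_deriv by (blast intro: gen_base)
qed

definition "g2 n e z = (1 - cx b * (e * e)) * Hn n e z - cx b * Hn (n + 2) e z"
definition "Kx e z = lam e * g2 0 e z + cx c * g2 1 e z + cx (- 2 * qz z) * Hn 1 e z + cx (- q1 z) * Hn 0 e z"

lemma g2_gen: "gen R T (range Hn) (g2 n)"
proof -
 have "gen R T (range Hn) (\<lambda>e z. Hn n e z + cx (- b) * ((e ^ 2 * mu e ^ 0) * Hn n e z) + cx (- b) * Hn (n + 2) e z)"
  by (intro gen_add gen_const scale_gen gen_base) auto
 then show ?thesis by (simp add: g2_def[abs_def] power2_eq_square algebra_simps)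
qed

lemma Kx_gen: "gen R T (range Hn) Kx"
proof -
 have "gen R T (range Hn) (\<lambda>e z. (e ^ 1 * mu e ^ 1) * g2 0 e z + cx c * g2 1 e z + cx (- 2 * qz z) * Hn 1 e z + cx (- 1 * q1 z) * Hn 0 e z)"
  by (intro gen_add gen_const scale_gen g2_gen pt_gen pt_mult pt_const pt_q gen_base) auto
 then show ?thesis by (simp add: Kx_def[abs_def] lam_def)
qed

definition "GD = (SOME D. D 0 = g2 0 \<and> smfam R w' D)"
definition "KD = (SOME D. D 0 = Kx \<and> smfam R w' D)"
definition "Vx e z = lam e * UD 0 e z - cx c * UD 1 e z"
definition "VD = (SOME D. D 0 = Vx \<and> smfam R w D)"

lemma GD: "GD 0 = g2 0" "smfam R w' GD" and KD: "KD 0 = Kx" "smfam R w' KD"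
 using someI_ex[OF H_smfam[OF g2_gen[of 0]]] someI_ex[OF H_smfam[OF Kx_gen]] unfolding GD_def KD_def by auto

lemma VD: "VD 0 = Vx" "smfam R w VD"
proof -
 have "gen R T (range UD) (\<lambda>e z. (e ^ 1 * mu e ^ 1) * UD 0 e z + cx (- c) * UD 1 e z)"
  by (intro gen_add gen_const scale_gen gen_base) auto
 then have g: "gen R T (range UD) Vx" by (simp add: Vx_def[abs_def] lam_def)
 have "\<exists>D. D 0 = Vx \<and> smfam R w D"
 proof (rule gen_smfam[OF w_bounds T_deriv' T_le1 _ _ g])
  show "\<exists>C\<ge>0. fam R w C X" if "X \<in> range UD" for X using that smfam_fam[OF UD(2)] by blast
  show "\<exists>Y. gen R T (range UD) Y \<and> (\<forall>e\<in>ball 0 R. \<forall>z. (X e has_vector_derivative Y e z) (at z))" if "X \<in> range UD" for X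
   using that smfam_deriv[OF UD(2)] by (blast intro: gen_base)
 qed
 from someI_ex[OF this] show "VD 0 = Vx" "smfam R w VD" unfolding VD_def by auto
qed

lemma q_parity: "qz (- z) = qz z" "q1 (- z) = - q1 z" "q2 (- z) = q2 z"
 by (simp_all add: qz_M q1_def q2_def ph_def ph1_def S_minus T_minus)

lemma Lstar_eq:
 assumes e: "e \<in> ball 0 R" and E: "cx (\<eta>\<^sup>2) = - (e * e)" and k: "k >= 1"
 shows "Lstar_eq k a b c \<alpha> \<eta> (\<lambda>z. (cnj (KD 0 e z), cnj (GD 0 e z))) (\<lambda>z. cscale (cnj (lam e)) (cnj (KD 0 e z), cnj (GD 0 e z)))"
proof -
 note K = smfam_wsmooth[OF KD(2)[unfolded w'_def] e]
 have g: "g2 n e z = (1 + b * \<eta>\<^sup>2) * Hn n e z - b * Hn (n + 2) e z" for n z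
 proof -
  have "cx (1 + b * \<eta>\<^sup>2) = 1 - cx b * (e * e)" unfolding of_real_add of_real_mult E by simp
  then show ?thesis by (simp only: g2_def)
 qed
 have gd: "(g2 n e has_vector_derivative g2 (Suc n) e z) (at z)" for n z
  unfolding g2_def[abs_def] by (intro has_vector_derivative_diff has_vector_derivative_mult_right) (use Hn_deriv[OF e] in auto)
 have "(Kx e has_vector_derivative lam e * g2 1 e z + cx c * g2 2 e z + (cx (- 2 * qz z) * Hn 2 e z + cx (- 2 * q1 z) * Hn 1 e z)
  + (cx (- q1 z) * Hn 1 e z + cx (- q2 z) * Hn 0 e z)) (at z)" for z
 proof -
  have h: "((\<lambda>z. - 2 * qz z) has_real_derivative - 2 * q1 z) (at z)" "((\<lambda>z. - q1 z) has_real_derivative - q2 z) (at z)"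
   using q_derivs[of z] by (auto intro!: derivative_eq_intros)
  note h' = h[THEN has_vector_derivative_of_real']
  have i: "(2::nat) = Suc 1" "(1::nat) = Suc 0" by simp_all
  show ?thesis unfolding Kx_def[abs_def] i
   by (intro has_vector_derivative_add has_vector_derivative_mult[OF h'(1)] has_vector_derivative_mult[OF h'(2)] has_vector_derivative_mult_right gd Hn_deriv[OF e])
 qed
 then have K1: "KD 1 e z = lam e * g2 1 e z + cx c * g2 2 e z + (cx (- 2 * qz z) * Hn 2 e z + cx (- 2 * q1 z) * Hn 1 e z)
  + (cx (- q1 z) * Hn 1 e z + cx (- q2 z) * Hn 0 e z)" for z
  using smfam_deriv[OF KD(2) e, of 0 z] unfolding KD(1) by (auto dest: vector_derivative_unique_at)
 have "- cx c * KD 1 e z + (1 + cx a * cx (\<eta>\<^sup>2)) * (Hn 2 e z - cx (\<eta>\<^sup>2) * Hn 0 e z) - cx a * (Hn 4 e z - cx (\<eta>\<^sup>2) * Hn 2 e z)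
   + cx c * (- cx (q2 (- z)) * Hn 0 e z + cx (qz (- z)) * Hn 2 e z - cx (\<eta>\<^sup>2) * cx (qz (- z)) * Hn 0 e z) = lam e * KD 0 e z" for z
 proof (rule adjoint_ode[OF U_ode[OF e E, of "- z"], where ?g0.0 = "g2 0 e z" and ?g1.0 = "g2 1 e z" and ?g2.0 = "g2 2 e z"])
  show "KD 0 e z = lam e * g2 0 e z + cx c * g2 1 e z - 2 * cx (qz (- z)) * Hn 1 e z + cx (q1 (- z)) * Hn 0 e z"
   by (simp add: KD(1) Kx_def q_parity)
  show "KD 1 e z = lam e * g2 1 e z + cx c * g2 2 e z + 2 * cx (q1 (- z)) * Hn 1 e z - 2 * cx (qz (- z)) * Hn 2 e z - cx (q2 (- z)) * Hn 0 e z
    + cx (q1 (- z)) * Hn 1 e z" unfolding K1 by (simp add: q_parity)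
  show "g2 0 e z = (1 + cx b * cx (\<eta>\<^sup>2)) * Hn 0 e z - cx b * Hn 2 e z"
   "g2 1 e z = (1 + cx b * cx (\<eta>\<^sup>2)) * Hn 1 e z - cx b * Hn 3 e z"
   "g2 2 e z = (1 + cx b * cx (\<eta>\<^sup>2)) * Hn 2 e z - cx b * Hn 4 e z"
   unfolding g by (simp_all add: numeral_2_eq_2 numeral_3_eq_3 eval_nat_numeral)
 qed (simp_all add: Hn_def)
 note o = this
 have g': "g2 n e z = (1 + cx b * (cx \<eta>)\<^sup>2) * Hn n e z - cx b * Hn (n + 2) e z" for n z
  using g[of n z] by simp
 have "Lstar_eq k a b c \<alpha> \<eta> (\<lambda>z. (cnj (KD 0 e z), cnj (g2 0 e z))) (\<lambda>z. cscale (cnj (lam e)) (cnj (KD 0 e z), cnj (g2 0 e z)))"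
  by (rule Lstar_eq_of_ode[where H = "\<lambda>n. Hn n e" and K = "\<lambda>n. KD n e" and ?g2.0 = "\<lambda>n. g2 n e", OF Hn_wsmooth[OF e] K de(1) k alpha_b(1,2) Qc(1) _ g'])
   (use o in \<open>simp_all add: Qc Qc(3)[unfolded One_nat_def] qz_eq KD(1) Kx_def q_parity\<close>)
 then show ?thesis by (simp only: GD(1))
qed

end

section \<open>The second-order coefficient of the eigenvalue\<close>

context benney_luke
begin

lemma w_top: "(w \<longlongrightarrow> 0) at_top"
proof (rule Lim_null_comparison)
 show "\<forall>\<^sub>F z in at_top. norm (w z) <= exp (- (\<alpha> * z))"
  using eventually_ge_at_top[of 0]
 proof eventually_elim
  case (elim z)
  then show ?case using de by (simp add: wt_def)
 qed
 show "((\<lambda>z. exp (- (\<alpha> * z))) \<longlongrightarrow> 0) at_top"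
  by (rule filterlim_compose[OF exp_at_bot])
   (use al0 in \<open>simp add: filterlim_uminus_at_bot filterlim_tendsto_pos_mult_at_top[OF tendsto_const _ filterlim_ident]\<close>)
qed

lemma gr_top: "gr g ==> (g \<longlongrightarrow> 0) at_top"
proof -
 assume "gr g"
 then obtain C where C: "!!z. abs (g z) <= C * w z" using gr_bound(1) by blast
 show ?thesis by (rule Lim_null_comparison[OF always_eventually tendsto_mult_right_zero[OF w_top]]) (use C in auto)
qed

text \<open>The class dual to \<open>gr\<close>: since
  \<open>w z * w (- z) = exp (- 2 * de * abs z)\<close>, products of members of the two classes are
  integrable.\<close>

definition du :: "(real => real) => bool" where "du h \<longleftrightarrow> continuous_on UNIV h \<and> (\<exists>C. \<forall>z. abs (h z) <= C * w (- z))"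

lemma duI: "gr g ==> (!!z. h z = s * g (- z)) ==> du h"
proof -
 assume g: "gr g" and h: "!!z. h z = s * g (- z)"
 obtain C where C: "!!z. abs (g z) <= C * w z" using gr_bound(1)[OF g] by blast
 have "continuous_on UNIV (\<lambda>z. g (- z))" by (rule continuous_on_compose2[OF gr_bound(2)[OF g]]) (auto intro: continuous_intros)
 then have "continuous_on UNIV h" unfolding h[abs_def] by (intro continuous_intros)
 moreover have "abs (h z) <= (abs s * C) * w (- z)" for z unfolding h abs_mult using C[of "- z"] by (simp add: mult.assoc mult_left_mono)
 ultimately show "du h" unfolding du_def by blast
qed

text \<open>The reflection of \<open>u1\<close>, later identified with the left integral of
  \<open>dc_q\<close>. It decays at minus infinity only, as the dual weight allows.\<close>

definition "um z = u1 (- z)"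

lemma parity: "qz (- z) = qz z" "q1 (- z) = - q1 z" "q2 (- z) = q2 z" "p (- z) = p z" "p1 (- z) = - p1 z" "p2 (- z) = p2 z"
 by (simp_all add: qz_M q1_def q2_def p_def p1_def p2_def ph_def ph1_def ph2_def S_minus T_minus algebra_simps)

lemma du_explicit: "du qz" "du q1" "du q2" "du p" "du p1" "du p2" "du um"
 by (rule duI[OF gr_explicit(1), of _ 1] duI[OF gr_explicit(2), of _ "- 1"] duI[OF gr_explicit(3), of _ 1] duI[OF gr_explicit(6), of _ 1]
  duI[OF gr_explicit(7), of _ "- 1"] duI[OF gr_explicit(8), of _ 1] duI[OF gr_explicit(5), of _ 1]; simp add: parity um_def)+

lemma um: "um z = 2 * j0 - u1 z" "(um has_real_derivative p z) (at z)"
proof -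
 show 1: "um z = 2 * j0 - u1 z" for z by (simp add: um_def u1_def T_minus S_minus algebra_simps)
 show "(um has_real_derivative p z) (at z)" unfolding 1[abs_def] using p_derivs(1)[of z] by (auto intro!: derivative_eq_intros)
qed

lemma bot_lim: "(g \<longlongrightarrow> l) at_bot" if "((\<lambda>z. g (- z)) \<longlongrightarrow> l) at_top" for g :: "real => real"
 using that unfolding filterlim_at_bot_mirror .

lemma explicit_limits:
 "(qz \<longlongrightarrow> 0) at_top" "(q1 \<longlongrightarrow> 0) at_top" "(p \<longlongrightarrow> 0) at_top" "(p1 \<longlongrightarrow> 0) at_top" "(um \<longlongrightarrow> 2 * j0) at_top"
 "(qz \<longlongrightarrow> 0) at_bot" "(q1 \<longlongrightarrow> 0) at_bot" "(p \<longlongrightarrow> 0) at_bot" "(p1 \<longlongrightarrow> 0) at_bot" "(um \<longlongrightarrow> 0) at_bot"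
proof -
 note g = gr_explicit[THEN gr_top]
 show "(qz \<longlongrightarrow> 0) at_top" "(q1 \<longlongrightarrow> 0) at_top" "(p \<longlongrightarrow> 0) at_top" "(p1 \<longlongrightarrow> 0) at_top" by (rule g)+
 show "(um \<longlongrightarrow> 2 * j0) at_top" unfolding um(1)[abs_def] using tendsto_diff[OF tendsto_const g(5)] by simp
 show "(qz \<longlongrightarrow> 0) at_bot" "(p \<longlongrightarrow> 0) at_bot" by (rule bot_lim, simp add: parity g)+
 show "(q1 \<longlongrightarrow> 0) at_bot" "(p1 \<longlongrightarrow> 0) at_bot" using tendsto_minus[OF g(2)] tendsto_minus[OF g(7)] by (intro bot_lim; simp add: parity)+
 show "(um \<longlongrightarrow> 0) at_bot" by (rule bot_lim) (simp add: um_def g)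
qed

lemma du_int: "du h ==> intg (\<lambda>z. abs (h z) * w z)" "du h ==> h \<in> borel_measurable borel"
proof -
 assume h: "du h"
 then show m: "bmeas h" unfolding du_def by (intro borel_measurable_continuous_onI) simp
 obtain C where "!!z. abs (h z) <= C * w (- z)" using h unfolding du_def by blast
 from dual_integrable[OF m this] show "intg (\<lambda>z. abs (h z) * w z)" .
qed

lemma prod_int: assumes "du h" "gr g" shows "intg (\<lambda>z. h z * g z)"
proof -
 obtain C where C: "!!z. abs (g z) <= C * w z" using gr_bound(1)[OF assms(2)] by blast
 have m: "bmeas g" by (rule borel_measurable_continuous_onI[OF gr_bound(2)[OF assms(2)]])
 show ?thesis
 proof (rule Bochner_Integration.integrable_bound[OF integrable_mult_right[OF du_int(1)[OF assms(1)], of C]])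
  show "AE z in lborel. norm (h z * g z) <= norm (C * (abs (h z) * w z))"
  proof (rule AE_I2)
   fix z
   have "norm (h z * g z) <= abs (h z) * (C * w z)" unfolding real_norm_def abs_mult by (intro mult_left_mono C) simp
   also have "\<dots> = C * (abs (h z) * w z)" by simp
   also have "\<dots> <= norm (C * (abs (h z) * w z))" by (simp only: real_norm_def abs_ge_self)
   finally show "norm (h z * g z) <= norm (C * (abs (h z) * w z))" .
  qed
  show "(\<lambda>z. h z * g z) \<in> borel_measurable lborel" using m du_int(2)[OF assms(1)] by simp
 qed
qed

definition "Xv = 4 / kp * (M * (1 - m0sq)) + 8 / (3 * kp) * (c * M * M + m0sq * M * Mp - m0sq * M * j1 / 2) - m0sq * c * (2 * j0)"

text \<open>Expanding the difference of the two sides leaves a polynomial whose negative monomials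
  are dominated, on the unit square, by multiples of \<open>y\<close> and \<open>x * y\<close>. It
  is applied with \<open>x = xi\<close> and \<open>y = be\<close>.\<close>

lemma cubic_pos:
 fixes x y :: real
 assumes "0 < x" "x < 1" "0 < y" "y < 1"
 shows "(2 + 3 * x + y) * (2 + 2 * y + 2 * (x * x) - x + x * y) < (x + 2) * (6 + 3 * x + 7 * y + 3 * x * y - y * y + 6 * (x * x))"
proof -
 have "y * y <= y" "x * y * x <= x * y" "x * y * y <= x * y" "x * y > 0" "x * x > 0"
  using assms by (simp_all add: mult_left_le)
 then have "0 < 8 + 8 * x + 8 * y + 6 * (x * y) - 4 * (y * y) + 14 * (x * x) - 2 * (x * y * x) - 2 * (x * y * y)" using assms by linarith
 also have "\<dots> = (x + 2) * (6 + 3 * x + 7 * y + 3 * x * y - y * y + 6 * (x * x)) - (2 + 3 * x + y) * (2 + 2 * y + 2 * (x * x) - x + x * y)"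
  by (simp add: algebra_simps)
 finally show ?thesis by simp
qed

text \<open>Multiplication by \<open>kp / 4 * xi * Ah\<close> clears the denominators, including
  that of \<open>m0sq\<close>; what remains is a positive factor times the difference treated in
  \<open>cubic_pos\<close>.\<close>

lemma Xv0: "Xv > 0"
proof -
 have P: "m0sq * Ah * xi = (1 - xi) * (2 + 3 * xi + be)"
 proof -
  have "m0sq * Ah = (1 - xi) * (2 * (c * c - 1) + 5 + be * (c * c))" using Ah0 by (simp add: m0sq_def)
  then have "m0sq * Ah * xi = (1 - xi) * (2 * (c * c * xi - xi) + 5 * xi + be * (c * c * xi))"
   by (simp only:) (simp add: algebra_simps)
  then show ?thesis unfolding xi(3) by simp
 qed
 have "c * M * M * xi = (c * c * xi) * (c * ((1 - xi) * (1 - xi)))" unfolding xi(4) by simp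
 then have Q: "c * M * M * xi = c * ((1 - xi) * (1 - xi))" unfolding xi(3) by simp
 have "kp / 4 * Xv * xi * Ah = M * xi * Ah + 2 / 3 * (c * M * M * xi) * Ah - m0sq * Ah * xi * (M + c * (kp * j0 / 2) - 2 / 3 * (M * Mp) + 1 / 3 * (M * j1))"
  using kp0 by (simp add: Xv_def field_simps)
 also have "\<dots> = c * (1 - xi) / 3 * ((xi + 2) * Ah - (2 + 3 * xi + be) * (2 + 2 * be + 2 * (xi * xi) - xi + xi * be))"
  unfolding P Q j0(3) unfolding xi(4) Mp_def j1_def by (simp add: field_simps)
 also have "\<dots> > 0" using cubic_pos[OF xi(1,2) be] xi c1 by (intro mult_pos_pos divide_pos_pos) (auto simp: Ah_def)
 finally have "kp / 4 * Xv * xi * Ah > 0" .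
 then show ?thesis using kp0 xi(1) Ah0 by (simp add: zero_less_mult_iff)
qed

text \<open>Substituting \<open>u1 = 2 * j0 - um\<close> isolates the term
  \<open>2 * j0 * G\<close>. The rest is the derivative of \<open>F\<close> and contributes only
  through the limit of \<open>um^2\<close> at plus infinity, while \<open>G\<close> falls under
  \<open>int_form\<close>.\<close>

lemma explicit_pairing:
 "(LINT z|lborel. qz z * (sl 0 z + m0sq * sl 1 z) + um z * (m0sq * A0f z + B0f z)) = 2 * j0 * Xv"
proof -
 define I where "I z = qz z * (sl 0 z + m0sq * sl 1 z) + um z * (m0sq * A0f z + B0f z)" for z
 define G where "G z = qz z + c * (qz z * qz z) - m0sq * qz z + m0sq * (qz z * p z)" for z
 define F where "F z = (Rc - m0sq * b) * (qz z * p z - um z * q1 z) - b * c * (qz z * qz z)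
  + m0sq * (2 * b * c * (um z * p1 z - 1 / 2 * (p z * p z)) - c * (um z * um z) + qz z * (um z * um z) - 2 * j0 * (qz z * um z))" for z
 have s: "sl 0 z = Rc * p1 z + u1 z + c * (qz z * u1 z) - (2 * b * c) * q1 z" "sl 1 z = (- b) * p1 z - u1 z" for z by (simp_all add: sl_def)
 have u: "u1 z = 2 * j0 - um z" for z by (simp add: um)
 have iI: "intg I" unfolding I_def
  by (intro Bochner_Integration.integrable_add prod_int du_explicit gr_add gr_cmult gr_sl gr_A0f gr_B0f) auto
 have iG: "intg G" unfolding G_def
  using prod_int[OF du_explicit(1) gr_explicit(1)] prod_int[OF du_explicit(1) gr_explicit(6)] S_int by (simp add: qz_M)
 have cI: "continuous_on UNIV (\<lambda>z. I z - 2 * j0 * G z)" unfolding I_def G_def um(1)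
  by (intro continuous_intros gr_bound(2)[OF gr_explicit(1)] gr_bound(2)[OF gr_explicit(5)] gr_bound(2)[OF gr_explicit(6)]
   gr_bound(2)[OF gr_sl] gr_bound(2)[OF gr_A0f] gr_bound(2)[OF gr_B0f]) auto
 have d: "(F has_real_derivative I z - 2 * j0 * G z) (at z)" for z
  unfolding F_def[abs_def] by (rule derivative_eq_intros q_derivs um(2) p_derivs(2,3) refl)+
   (simp add: I_def G_def s s(2)[unfolded One_nat_def] A0f_def B0f_def u field_simps)
 have l: "(F \<longlongrightarrow> (Rc - m0sq * b) * (0 * 0 - t * 0) - b * c * (0 * 0) + m0sq * (2 * b * c * (t * 0 - 1 / 2 * (0 * 0)) - c * (t * t) + 0 * (t * t) - 2 * j0 * (0 * t))) Q"
  if "(qz \<longlongrightarrow> 0) Q" "(q1 \<longlongrightarrow> 0) Q" "(p \<longlongrightarrow> 0) Q" "(p1 \<longlongrightarrow> 0) Q" "(um \<longlongrightarrow> t) Q" for t Q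
  unfolding F_def[abs_def] by (intro tendsto_intros that) simp
 have "(LINT z|lborel. I z - 2 * j0 * G z) = - m0sq * c * (2 * j0 * (2 * j0))"
  by (rule trans[OF real_integral_line[OF d cI _ l[OF explicit_limits(1-5)] l[OF explicit_limits(6-10)]]]) (use iI iG in simp_all)
 then have "integral\<^sup>L lborel I = 2 * j0 * integral\<^sup>L lborel G - m0sq * c * (2 * j0 * (2 * j0))" using iI iG by simp
 moreover have "integral\<^sup>L lborel G = 4 / kp * (M * (1 - m0sq)) + 8 / (3 * kp) * (c * M * M + m0sq * M * Mp - m0sq * M * j1 / 2)"
 proof -
  have e: "G z = (M * (1 - m0sq)) * S z + (c * M * M + m0sq * M * Mp) * (S z * S z) + 0 * (S z * S z * S z) + 0 * (T z * S z * S z)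
   + (- m0sq * M * kp * j1) * (z * T z * S z * S z) + 0 * (z * T z * S z * S z * S z)" for z
   by (simp add: G_def qz_M p_def ph_def algebra_simps)
  show ?thesis unfolding e int_form using kp0 by (simp add: field_simps)
 qed
 ultimately show ?thesis unfolding I_def[symmetric] by (simp add: Xv_def algebra_simps)
qed

end

context bl_branch
begin

definition "Xi e z = (\<Sum>i<8. e ^ ea i * mu e ^ eb i * (cx (sl i z) + Lx i (f e) z))"

lemma Xi_fam: "\<exists>C\<ge>0. fam R w C Xi"
proof -
 have "gen R T BV Xi" unfolding Xi_def[abs_def]
  by (intro gen_sum[OF _ _ gr_gen[OF gr_A0f]] scale_gen gen_add gr_gen gr_sl Lx_gen) auto
 from gen_fam[OF w_bounds T_continuous T_le1 BV_fam this] show ?thesis .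
qed

lemma solvability: "e \<in> ball 0 R ==> cx Av * ((mu e)\<^sup>2 - cx m0sq) + e * lint qz (Xi e) = 0"
proof -
 assume e: "e \<in> ball 0 R"
 obtain C where C: "fam R w C Xi" using Xi_fam by blast
 have r: "intg (\<lambda>z. cx (qz z) * cx (g z))" if "gr g" for g
  using prod_int[OF du_explicit(1) that] by (simp flip: of_real_mult)
 have F: "f e = (\<lambda>z. (mu e)\<^sup>2 * cx (A0f z) + cx (B0f z) + e * Xi e z)"
  using fp(1)[OF e] by (simp add: Frhs_def[abs_def] Xi_def)
 have "lint qz (f e) = (LINT z|lborel. (mu e)\<^sup>2 * (cx (qz z) * cx (A0f z)) + cx (qz z) * cx (B0f z) + e * (cx (qz z) * Xi e z))"
  unfolding lint_def F by (intro Bochner_Integration.integral_cong refl) (simp add: algebra_simps)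
 also have "\<dots> = (mu e)\<^sup>2 * cx (LINT z|lborel. qz z * A0f z) + cx (LINT z|lborel. qz z * B0f z) + e * lint qz (Xi e)"
  using r[OF gr_A0f] r[OF gr_B0f] fam_lint_int[OF C e qz_measurable qz_int]
  by (simp add: lint_def flip: of_real_mult)
 finally show ?thesis unfolding qA qB0f using fp(2)[OF e] m00(2) by (simp add: algebra_simps)
qed

lemma zero_ball: "0 \<in> ball (0::complex) R" using R by simp

lemma mu_deriv: "(mu has_field_derivative deriv mu 0) (at 0)"
 using mu(1) zero_ball unfolding hsym_def by (intro holomorphic_derivI[of mu "ball 0 R"]) auto

text \<open>Differentiate the identity \<open>solvability\<close>, valid on the whole ball, at
  \<open>e = 0\<close>.\<close>

lemma deriv_mu: "2 * cx Av * cx m00 * deriv mu 0 = - lint qz (Xi 0)"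
proof -
 obtain C where C: "fam R w C Xi" using Xi_fam by blast
 have "(\<lambda>e. lint qz (Xi e)) holomorphic_on ball 0 R" using lint_hsym[OF C qz_measurable qz_int] by (simp add: hsym_def)
 then have h: "((\<lambda>e. lint qz (Xi e)) has_field_derivative deriv (\<lambda>e. lint qz (Xi e)) 0) (at 0)"
  by (rule holomorphic_derivI) (use zero_ball in auto)
 have "((\<lambda>e. cx Av * ((mu e)\<^sup>2 - cx m0sq) + e * lint qz (Xi e)) has_field_derivative 2 * cx Av * cx m00 * deriv mu 0 + lint qz (Xi 0)) (at 0)"
  by (rule derivative_eq_intros mu_deriv h refl)+ (simp add: mu(3))
 moreover have "((\<lambda>e. cx Av * ((mu e)\<^sup>2 - cx m0sq) + e * lint qz (Xi e)) has_field_derivative 0) (at 0)"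
  by (rule has_field_derivative_transform_within_open[OF DERIV_const open_ball zero_ball]) (simp add: solvability)
 ultimately have "2 * cx Av * cx m00 * deriv mu 0 + lint qz (Xi 0) = 0" by (rule DERIV_unique)
 then show ?thesis by (simp add: eq_neg_iff_add_eq_0)
qed

definition "kb n = kd n 0"

lemma kb_bound: "n < 4 ==> \<exists>C. \<forall>z. norm (kb n z) <= C * w z"
proof -
 assume n: "n < 4"
 have "(\<lambda>e z. KK n (f e) z) \<in> BV" using n by (auto simp: BV_def)
 then obtain C where C: "fam R w C (\<lambda>e z. KK n (f e) z)" using BV_fam by blast
 have "norm (kb n z) <= C * w z" for z using fam_bound[OF C zero_ball, of z] n by (simp add: kb_def kd_def)
 then show ?thesis by blast
qed

lemma du_kb_lim:
 assumes "du h" "n < 4" shows "((\<lambda>z. cx (h z) * kb n z) \<longlongrightarrow> 0) at_top" "((\<lambda>z. cx (h z) * kb n z) \<longlongrightarrow> 0) at_bot"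
proof -
 obtain C where C: "!!z. abs (h z) <= C * w (- z)" using assms(1) unfolding du_def by blast
 obtain D where D: "!!z. norm (kb n z) <= D * w z" using kb_bound[OF assms(2)] by blast
 have b: "norm (cx (h z) * kb n z) <= (C * D) * exp (- (2 * de) * abs z)" for z
 proof -
  have "norm (cx (h z) * kb n z) <= (C * w (- z)) * (D * w z)"
   unfolding norm_mult norm_of_real using C[of z] D[of z] by (intro mult_mono) (auto intro: order_trans[OF abs_ge_zero])
  also have "\<dots> = (C * D) * exp (- (2 * de) * abs z)" by (simp add: wt_def ac_simps flip: exp_add)
  finally show ?thesis .
 qed
 have l: "((\<lambda>z. (C * D) * exp (- (2 * de) * abs z)) \<longlongrightarrow> 0) F" if "filterlim (\<lambda>z::real. abs z) at_top F" for F
 proof -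
  have "filterlim (\<lambda>z. - (2 * de) * abs z) at_bot F"
   using de by (intro filterlim_tendsto_neg_mult_at_bot[OF tendsto_const _ that]) auto
  from tendsto_mult_right_zero[OF filterlim_compose[OF exp_at_bot this]] show ?thesis .
 qed
 have a: "filterlim (\<lambda>z::real. abs z) at_top at_top" by (rule filterlim_at_top_mono[OF filterlim_ident always_eventually]) (simp add: abs_ge_self)
 have a': "filterlim (\<lambda>z::real. abs z) at_top at_bot" by (rule filterlim_at_top_mono[OF filterlim_uminus_at_top_at_bot always_eventually]) (simp add: abs_ge_minus_self)
 show "((\<lambda>z. cx (h z) * kb n z) \<longlongrightarrow> 0) at_top" by (rule Lim_null_comparison[OF always_eventually l[OF a]]) (use b in blast)
 show "((\<lambda>z. cx (h z) * kb n z) \<longlongrightarrow> 0) at_bot" by (rule Lim_null_comparison[OF always_eventually l[OF a']]) (use b in blast)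
qed

text \<open>Lagrange's identity for the self-adjoint fourth-order operator, whose inverse applied to
 \<open>f 0\<close> enters \<open>Xi 0\<close>; the reflected profile \<open>um\<close> solves the adjoint equation.\<close>

lemma adjoint_pairing: "lint qz (Lx 0 (f 0)) = lint um (f 0)"
proof -
 note e = zero_ball
 \<comment> \<open>The boundary terms of both integrations by parts: those built on products with
   \<open>qz\<close> alone transpose \<open>Lx 0\<close>, and the later ones, starting from
   \<open>um\<close>, transpose \<open>P0\<close>. They vanish at both ends.\<close>
 define Bil where "Bil z = cx (2 * b * c) * (cx (qz z) * kb 2 z - cx (q1 z) * kb 1 z + cx (q2 z) * kb 0 z) - cx (2 * c) * (cx (qz z) * kb 0 z)
  + cx (2 * qz z) * (cx (qz z) * kb 0 z) - cx m * (cx (um z) * kb 3 z - cx (p z) * kb 2 z + cx (p1 z) * kb 1 z - cx (p2 z) * kb 0 z)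
  + cx (c * c - 1) * (cx (um z) * kb 1 z - cx (p z) * kb 0 z) - cx (3 * c * qz z) * (cx (um z) * kb 1 z - cx (p z) * kb 0 z)" for z
 have kd: "(kb n has_vector_derivative kb (Suc n) z) (at z)" if "n < 4" for n z unfolding kb_def by (rule kd_deriv[OF e that])
 have kds: "(kb 0 has_vector_derivative kb 1 z) (at z)" "(kb 1 has_vector_derivative kb 2 z) (at z)" "(kb 2 has_vector_derivative kb 3 z) (at z)" "(kb 3 has_vector_derivative kb 4 z) (at z)" for z
  using kd[of 0 z] kd[of 1 z] kd[of 2 z] kd[of 3 z] by (simp_all add: numeral_2_eq_2 numeral_3_eq_3 eval_nat_numeral)
 have P0: "cx m * kb 4 z = f 0 z + cx (c * c - 1) * kb 2 z - cx (3 * c) * (cx (q1 z) * kb 1 z + cx (qz z) * kb 2 z)" for z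
 proof -
  have km: "cx m * cx (kp * kp) = cx (c * c - 1)" "cx c * cx M = cx (c * c - 1)"
   unfolding of_real_mult[symmetric] Mc(1,2) by simp_all
  have k: "kb 1 z = KK 1 (f 0) z" "kb 2 z = KK 2 (f 0) z" by (simp_all add: kb_def kd_def)
  have "cx m * kb 4 z = f 0 z + cx m * cx (kp * kp) * (3 * cx (kp * (T z * S z)) * KK 1 (f 0) z + cx (1 - 3 * S z) * KK 2 (f 0) z)"
   using m0 by (simp add: kb_def kd_def fp(1)[OF e, symmetric] power3_eq_cube power2_eq_square algebra_simps)
  note f1 = this[unfolded km]
    have "cx (3 * c) * (cx (q1 z) * KK 1 (f 0) z + cx (qz z) * KK 2 (f 0) z) = cx c * cx M * (3 * cx (S z) * KK 2 (f 0) z - 3 * cx (kp * (T z * S z)) * KK 1 (f 0) z)"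
   by (simp add: q1_def qz_M ph_def algebra_simps)
  note f2 = this[unfolded km]
  show ?thesis unfolding k f1 f2 by (simp add: algebra_simps)
 qed
 have ue: "cx m * cx (p3 z) = cx (c * c - 1) * cx (p1 z) - cx (3 * c) * (cx (q1 z) * cx (p z) + cx (qz z) * cx (p1 z))
   - (cx (2 * b * c) * cx (q3 z) - cx (2 * c) * cx (q1 z) + 3 * cx (qz z) * cx (q1 z))" for z
 proof -
  have "m * p3 z = (c * c - 1) * p1 z - (3 * c) * (q1 z * p z + qz z * p1 z) - ((2 * b * c) * q3 z - (2 * c) * q1 z + 3 * qz z * q1 z)"
   using u1_equation[of z] by simp
  from arg_cong[OF this, of cx] show ?thesis by simp
 qed
 have d: "(Bil has_vector_derivative cx (qz z) * Lx 0 (f 0) z - cx (um z) * f 0 z) (at z)" for z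
 proof -
  note v = has_vector_derivative_of_real'
  have hs: "((\<lambda>z. 2 * qz z) has_real_derivative 2 * q1 z) (at z)" "((\<lambda>z. 3 * c * qz z) has_real_derivative 3 * c * q1 z) (at z)"
   by (rule DERIV_cmult[OF q_derivs(1)])+
  note D = has_vector_derivative_mult[OF v[OF q_derivs(1)]] has_vector_derivative_mult[OF v[OF q_derivs(2)]] has_vector_derivative_mult[OF v[OF q_derivs(3)]]
   has_vector_derivative_mult[OF v[OF um(2)]] has_vector_derivative_mult[OF v[OF p_derivs(2)]] has_vector_derivative_mult[OF v[OF p_derivs(3)]]
   has_vector_derivative_mult[OF v[OF p_derivs(4)]] has_vector_derivative_mult[OF v[OF hs(1)]] has_vector_derivative_mult[OF v[OF hs(2)]]
  have L: "Lx 0 (f 0) z = cx (q1 z) * kb 0 z + cx (2 * qz z - 2 * c) * kb 1 z + cx (2 * b * c) * kb 3 z"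
   by (simp add: Lx_def rl_def kb_def kd_def)
  have "cx m * ((cx (um z) * kb 4 z + cx (p z) * kb 3 z) - (cx (p z) * kb 3 z + cx (p1 z) * kb 2 z) + (cx (p1 z) * kb 2 z + cx (p2 z) * kb 1 z) - (cx (p2 z) * kb 1 z + cx (p3 z) * kb 0 z))
    = cx (um z) * (cx m * kb 4 z) - (cx m * cx (p3 z)) * kb 0 z" by (simp add: algebra_simps)
  note key = this[unfolded P0 ue]
  show ?thesis unfolding Bil_def[abs_def]
   by (rule has_vector_derivative_eq_rhs, (rule has_vector_derivative_add has_vector_derivative_diff has_vector_derivative_mult_right D kds)+,
    simp only: key L) (simp add: algebra_simps)
 qed
 obtain kL where "opr w kL (Lx 0)" using opr_Lx[of 0] by auto
 from opr_fam[OF this Cf f] have Lf: "fam R w (kL * Cf) (\<lambda>e. Lx 0 (f e))" .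
 note i = fam_lint_int[OF Lf e du_int(2,1)[OF du_explicit(1)]] fam_lint_int[OF f e du_int(2,1)[OF du_explicit(7)]]
 have q0: "((\<lambda>z. cx (qz z)) \<longlongrightarrow> 0) at_top" "((\<lambda>z. cx (qz z)) \<longlongrightarrow> 0) at_bot"
  using tendsto_of_real[OF explicit_limits(1)] tendsto_of_real[OF explicit_limits(6)] by (simp_all only: of_real_0)
 have lim: "(Bil \<longlongrightarrow> cx (2 * b * c) * (0 - 0 + 0) - cx (2 * c) * 0 + 2 * 0 * 0 - cx m * (0 - 0 + 0 - 0) + cx (c * c - 1) * (0 - 0) - cx (3 * c) * 0 * (0 - 0)) F"
  if "!!h n. du h ==> n < 4 ==> ((\<lambda>z. cx (h z) * kb n z) \<longlongrightarrow> 0) F" "((\<lambda>z. cx (qz z)) \<longlongrightarrow> 0) F" for F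
  unfolding Bil_def[abs_def] of_real_mult[of 2 "qz _"] of_real_mult[of "3 * c" "qz _"] of_real_numeral
  by (intro tendsto_intros that du_explicit) auto
 have c: "continuous_on UNIV (\<lambda>z. cx (qz z) * Lx 0 (f 0) z - cx (um z) * f 0 z)"
  using du_explicit(1,7) unfolding du_def by (intro continuous_intros fam_cont[OF Lf e] fam_cont[OF f e]) auto
 have "(LINT z|lborel. cx (qz z) * Lx 0 (f 0) z - cx (um z) * f 0 z) = 0"
  by (rule trans[OF integral_derivative_line[OF d c _ lim lim]]) (use i du_kb_lim q0 in simp_all)
 then show ?thesis using i by (simp add: lint_def)
qed

text \<open>At \<open>e = 0\<close> rows 0 and 1 of the tables survive, and of these only row 0
  involves \<open>f\<close>; \<open>adjoint_pairing\<close> shifts its contribution onto the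
  explicit \<open>f 0\<close>. Because \<open>\<epsilon>^2 = - \<eta>^2\<close>, the value found is
  the coefficient \<open>\<lambda>2\<close>.\<close>

theorem deriv_mu_pos: "deriv mu 0 = cx (j0 * Xv / (- Av))" "j0 * Xv / (- Av) > 0"
proof -
 show "j0 * Xv / (- Av) > 0" using j0(1) Xv0 Av0 by (intro divide_pos_pos mult_pos_pos) auto
 have X: "Xi 0 z = cx m00 * (cx (sl 0 z + m0sq * sl 1 z) + Lx 0 (f 0) z)" for z
  unfolding Xi_def sum_8 by (simp add: ea_def eb_def mu(3) Lx_def[of 1] rl_def[of 1] m00(2)[symmetric] power2_eq_square power3_eq_cube algebra_simps
   Lx_def[of "Suc 0"] rl_def[of "Suc 0"])
 have F: "f 0 z = cx (m0sq * A0f z + B0f z)" for z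
  using fun_cong[OF fp(1)[OF zero_ball], of z] by (simp add: Frhs_def mu(3) m00(2)[symmetric])
 obtain kL where "opr w kL (Lx 0)" using opr_Lx[of 0] by auto
 from opr_fam[OF this Cf f] have Lf: "fam R w (kL * Cf) (\<lambda>e. Lx 0 (f e))" .
 note i = fam_lint_int[OF Lf zero_ball qz_measurable qz_int]
 have g: "gr (\<lambda>z. sl 0 z + m0sq * sl 1 z)" "gr (\<lambda>z. m0sq * A0f z + B0f z)" by (intro gr_add gr_cmult gr_sl gr_A0f gr_B0f; simp)+
 note j = prod_int[OF du_explicit(1) g(1)] prod_int[OF du_explicit(7) g(2)]
 have "lint qz (Xi 0) = cx m00 * (LINT z|lborel. cx (qz z * (sl 0 z + m0sq * sl 1 z)) + cx (qz z) * Lx 0 (f 0) z)"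
  unfolding lint_def X integral_mult_right_zero[symmetric] by (intro Bochner_Integration.integral_cong refl) (simp add: algebra_simps)
 also have "(LINT z|lborel. cx (qz z * (sl 0 z + m0sq * sl 1 z)) + cx (qz z) * Lx 0 (f 0) z)
   = cx (LINT z|lborel. qz z * (sl 0 z + m0sq * sl 1 z)) + lint qz (Lx 0 (f 0))"
  using i j by (subst Bochner_Integration.integral_add) (simp_all only: integrable_of_real integral_complex_of_real lint_def)
 also have "lint qz (Lx 0 (f 0)) = cx (LINT z|lborel. um z * (m0sq * A0f z + B0f z))"
 proof -
  have "lint um (f 0) = cx (LINT z|lborel. um z * (m0sq * A0f z + B0f z))"
   unfolding lint_def F of_real_mult[symmetric] integral_complex_of_real ..
  then show ?thesis using adjoint_pairing by simp
 qed
 also have "cx (LINT z|lborel. qz z * (sl 0 z + m0sq * sl 1 z)) + cx (LINT z|lborel. um z * (m0sq * A0f z + B0f z)) = cx (2 * j0 * Xv)"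
  unfolding explicit_pairing[symmetric] using j by (simp flip: of_real_add)
 finally have L: "lint qz (Xi 0) = cx m00 * cx (2 * j0 * Xv)" .
 have "2 * cx Av * cx m00 * deriv mu 0 = - (cx m00 * cx (2 * j0 * Xv))" using deriv_mu unfolding L .
 note L1 = this
 have L2: "2 * (cx m00 * (cx Av * deriv mu 0 + cx (j0 * Xv))) = 2 * cx Av * cx m00 * deriv mu 0 + cx m00 * cx (2 * j0 * Xv)"
  by (simp only: of_real_mult of_real_numeral distrib_left ac_simps)
 have "2 * (cx m00 * (cx Av * deriv mu 0 + cx (j0 * Xv))) = 0" unfolding L2 L1 by (rule left_minus)
 then have "cx Av * deriv mu 0 + cx (j0 * Xv) = 0" using m00(1) by (simp only: mult_eq_0_iff of_real_eq_0_iff) simp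
 then have "cx Av * deriv mu 0 = - cx (j0 * Xv)" by (simp only: add_eq_0_iff2)
 then show "deriv mu 0 = cx (j0 * Xv / (- Av))" using Av0 by (simp add: field_simps)
qed

end

section \<open>Derivatives in the wave speed\<close>

lemma inverse_cosh_square: "(1 / cosh y)\<^sup>2 = 1 - (tanh y)\<^sup>2" for y :: real
proof -
 have "1 - (tanh y)\<^sup>2 = ((cosh y)\<^sup>2 - (sinh y)\<^sup>2) / (cosh y)\<^sup>2"
  using cosh_real_pos[of y] by (simp add: tanh_def power_divide diff_divide_distrib)
 also have "(cosh y)\<^sup>2 - (sinh y)\<^sup>2 = 1" by (simp add: cosh_square_eq)
 finally show ?thesis by (simp add: power_divide)
qed

context benney_luke
begin

lemma alpha_c_deriv: "((\<lambda>s. alpha_c a b s) has_real_derivative kp * j1 / M) (at c)"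
proof -
 have g: "((\<lambda>s. (s\<^sup>2 - 1) / (b * s\<^sup>2 - a)) has_real_derivative 2 * c * (b - a) / (m * m)) (at c)"
 proof -
  have "((\<lambda>s. (s\<^sup>2 - 1) / (b * s\<^sup>2 - a)) has_real_derivative ((2 * c) * m - (c * c - 1) * (b * (2 * c))) / (m * m)) (at c)"
   using m0 by (auto intro!: derivative_eq_intros simp: m_def power2_eq_square)
  moreover have "(2 * c) * m - (c * c - 1) * (b * (2 * c)) = 2 * c * (b - a)" by (simp add: m_def power2_eq_square algebra_simps)
  ultimately show ?thesis by simp
 qed
 have k: "sqrt ((c\<^sup>2 - 1) / (b * c\<^sup>2 - a)) = kp" by (simp add: kp_def alpha_c_def)
 have pos: "(c\<^sup>2 - 1) / (b * c\<^sup>2 - a) > 0" using csq m0 by (simp add: m_def)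
 have "((\<lambda>s. sqrt ((s\<^sup>2 - 1) / (b * s\<^sup>2 - a))) has_real_derivative inverse kp / 2 * (2 * c * (b - a) / (m * m))) (at c)"
  using DERIV_chain2[OF DERIV_real_sqrt[OF pos] g] unfolding k .
 moreover have "inverse kp / 2 * (2 * c * (b - a) / (m * m)) = kp * j1 / M"
 proof -
  have f1: "m * j1 = b - a"
  proof -
   have "m * j1 = m - b * (m * (kp * kp))" by (simp add: j1_def be_def power2_eq_square algebra_simps)
   then show ?thesis unfolding Mc(2) by (simp add: m_def power2_eq_square algebra_simps)
  qed
  have f2: "c * M = m * (kp * kp)" using Mc by simp
  have "c * (b - a) * M = (m * j1) * (c * M)" unfolding f1 by simp
  then have "c * (b - a) * M = kp * j1 * (m * m * kp)" unfolding f2 by (simp only: ac_simps)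
  then show ?thesis using m0 kp0 Mc(4) by (simp add: field_simps)
 qed
 ultimately show ?thesis by (simp add: alpha_c_def[abs_def])
qed

lemma q_c_deriv: "((\<lambda>s. q_c a b s z) has_real_derivative p z) (at c)"
proof -
 have y: "((\<lambda>s. alpha_c a b s * z / 2) has_real_derivative kp * j1 / M * (z / 2)) (at c)"
  using DERIV_cmult_right[OF alpha_c_deriv, of "z / 2"] by simp
 have co: "cosh (alpha_c a b c * z / 2) \<noteq> 0" using cosh_real_pos[of "alpha_c a b c * z / 2"] by simp
 have t: "((\<lambda>s. tanh (alpha_c a b s * z / 2)) has_real_derivative (1 - (T z)\<^sup>2) * (kp * j1 / M * (z / 2))) (at c)"
  using has_field_derivative_tanh[OF co y] by (simp add: T_def kp_def)
 have M: "((\<lambda>s. (s\<^sup>2 - 1) / s) has_real_derivative Mp) (at c)"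
  using c1 by (auto intro!: derivative_eq_intros simp: Mp_def xi_def field_simps power2_eq_square)
 have "((\<lambda>s. (s\<^sup>2 - 1) / s * (1 - tanh (alpha_c a b s * z / 2) * tanh (alpha_c a b s * z / 2))) has_real_derivative
   Mp * (1 - tanh (alpha_c a b c * z / 2) * tanh (alpha_c a b c * z / 2)) + (0 - (S z * (kp * j1 / M * (z / 2)) * tanh (alpha_c a b c * z / 2) + S z * (kp * j1 / M * (z / 2)) * tanh (alpha_c a b c * z / 2))) * ((c\<^sup>2 - 1) / c)) (at c)"
  by (rule DERIV_mult[OF M DERIV_diff[OF DERIV_const DERIV_mult[OF t[folded S_def] t[folded S_def]]]])
 moreover have "tanh (alpha_c a b c * z / 2) = T z" "(c\<^sup>2 - 1) / c = M" by (simp_all add: T_def kp_def M_def)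
 ultimately have "((\<lambda>s. (s\<^sup>2 - 1) / s * (1 - tanh (alpha_c a b s * z / 2) * tanh (alpha_c a b s * z / 2))) has_real_derivative
   Mp * (1 - T z * T z) + (0 - (S z * (kp * j1 / M * (z / 2)) * T z + S z * (kp * j1 / M * (z / 2)) * T z)) * M) (at c)"
  by (simp only:)
 moreover have "Mp * (1 - T z * T z) + (0 - (S z * (kp * j1 / M * (z / 2)) * T z + S z * (kp * j1 / M * (z / 2)) * T z)) * M = p z"
  using Mc(4) by (simp add: TT p_def ph_def field_simps)
 moreover have "q_c a b s z = (s\<^sup>2 - 1) / s * (1 - tanh (alpha_c a b s * z / 2) * tanh (alpha_c a b s * z / 2))" for s
  by (simp only: q_c_def inverse_cosh_square power2_eq_square[of "tanh _"])
 ultimately show ?thesis by (simp only:)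
qed

lemma dc_q_eq: "dc_q a b c = p"
 unfolding dc_q_def[abs_def] using DERIV_imp_deriv[OF q_c_deriv] by (simp add: fun_eq_iff)

lemma dc_r_eq: "dc_r a b c = (\<lambda>z. - qz z - c * p z)"
proof
 fix z
 have "((\<lambda>s. - s * q_c a b s z) has_real_derivative - 1 * q_c a b c z + p z * (- c)) (at c)"
  by (rule DERIV_mult[OF DERIV_minus[OF DERIV_ident] q_c_deriv])
 then show "dc_r a b c z = - qz z - c * p z" unfolding dc_r_def r_c_def by (simp add: DERIV_imp_deriv qz_eq)
qed

lemma deriv_q: "deriv qz = q1" "deriv q1 = q2" "deriv q2 = q3" "deriv p = p1" "deriv p1 = p2" "deriv um = p"
 using q_derivs p_derivs um(2) by (auto simp: fun_eq_iff intro!: DERIV_imp_deriv)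

lemma r_c_eq: "r_c a b c = (\<lambda>z. - c * qz z)" by (simp add: r_c_def fun_eq_iff qz_eq)

text \<open>Both sides have derivative \<open>- p\<close> and vanish at plus infinity.\<close>

lemma int_right: "int_right_dc_q a b c z = u1 z"
proof -
 define P where "P s = cx (p s)" for s
 obtain C where C: "C >= 0" "!!z. abs (p z) <= C * w z" using gr_bound(1)[OF gr_explicit(6)] by blast
 have Pc: "continuous_on UNIV P" unfolding P_def[abs_def] by (intro continuous_intros gr_bound(2)[OF gr_explicit(6)])
 have Pb: "norm (P s) <= C * w s" for s using C(2) by (simp add: P_def)
 have d: "((\<lambda>z. tail P z - cx (u1 z)) has_vector_derivative 0) (at z within UNIV)" for z
  using has_vector_derivative_diff[OF tail_deriv[OF Pc Pb] has_vector_derivative_of_real'[OF p_derivs(1)], of z] by (simp add: P_def[abs_def])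
 then obtain K where K: "!!z. tail P z - cx (u1 z) = K"
  using has_vector_derivative_zero_constant[of UNIV "\<lambda>z. tail P z - cx (u1 z)"] by auto
 have tb: "norm (tail P z) <= (C * (2 / (\<alpha> - de))) * w z" for z
 proof -
  have "norm (tail P z) <= C * (LINT s|lborel. \<bar>indicat_real {z..} s\<bar> * w s)"
   unfolding tail_def by (rule lint_bound(2)[OF borel_measurable_continuous_onI[OF Pc] Pb ind_measurable tail_int(1)[OF ade]])
  also have "\<dots> <= C * (w z * (2 / (\<alpha> - de)))" by (intro mult_left_mono tail_int(2)[OF ade] C)
  finally show ?thesis by (simp add: ac_simps)
 qed
 have "((\<lambda>z. tail P z) \<longlongrightarrow> 0) at_top"
  by (rule Lim_null_comparison[OF always_eventually tendsto_mult_right_zero[OF w_top]]) (use tb in blast)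
 moreover have "((\<lambda>z. cx (u1 z)) \<longlongrightarrow> 0) at_top" using tendsto_of_real[OF gr_top[OF gr_explicit(5)]] by simp
 ultimately have "((\<lambda>z. tail P z - cx (u1 z)) \<longlongrightarrow> 0 - 0) at_top" by (rule tendsto_diff)
 then have "((\<lambda>z::real. K) \<longlongrightarrow> 0) at_top" unfolding K by simp
 then have "K = 0" by (simp add: tendsto_const_iff)
 then have "tail P z = cx (u1 z)" using K[of z] by simp
 moreover have "tail P z = cx (int_right_dc_q a b c z)"
  by (simp add: tail_def lint_def P_def int_right_dc_q_def dc_q_eq set_lebesgue_integral_def flip: of_real_mult)
 ultimately show ?thesis by simp
qed

lemma int_left: "int_left_dc_q a b c = um"
proof
 fix z
 have "int_left_dc_q a b c z = (LINT y|lborel. indicator {..z} y * p y)"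
  by (simp add: int_left_dc_q_def dc_q_eq set_lebesgue_integral_def)
 also have "\<dots> = (LINT y|lborel. indicator {..z} (0 + - 1 * y) * p (0 + - 1 * y))"
  by (subst lborel_integral_real_affine[of "- 1" _ 0]) simp_all
 also have "\<dots> = (LINT y|lborel. indicator {- z..} y * p y)"
  by (intro Bochner_Integration.integral_cong refl) (auto simp: indicator_def parity)
 also have "\<dots> = int_right_dc_q a b c (- z)"
  by (simp add: int_right_dc_q_def dc_q_eq set_lebesgue_integral_def)
 finally show "int_left_dc_q a b c z = um z" by (simp add: int_right um_def)
qed

lemma q3_parity: "q3 (- z) = - q3 z" by (simp add: q3_def ph2_def ph_def S_minus T_minus)

lemma zeta_explicit:
 "zeta1 a b c z = (cx (qz z), cx (- c * q1 z))"
 "zeta2 a b c z = (cx (u1 z), cx (qz z + c * p z))"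
 "zeta1_star a b c z = (cx (c * ((qz z + c * p z) - b * (q2 z + c * p2 z) - 2 * qz z * p z - q1 z * um z)), cx (c * (um z - b * p1 z)))"
 "zeta2_star a b c z = (cx (q1 z - a * q3 z), cx (c * (qz z - b * q2 z)))"
proof -
 have r1: "deriv (\<lambda>z. - c * qz z) = (\<lambda>z. - c * q1 z)" "deriv (\<lambda>z. - c * q1 z) = (\<lambda>z. - c * q2 z)"
  by (intro ext DERIV_imp_deriv DERIV_cmult q_derivs)+
 have r2: "deriv (\<lambda>z. - qz z - c * p z) = (\<lambda>z. - q1 z - c * p1 z)" "deriv (\<lambda>z. - q1 z - c * p1 z) = (\<lambda>z. - q2 z - c * p2 z)"
  by (intro ext DERIV_imp_deriv DERIV_diff DERIV_minus DERIV_cmult q_derivs p_derivs)+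
 note e = zeta1_def zeta2_def zeta1_star_def zeta2_star_def ellip0_def qz_eq r_c_eq dc_r_eq dc_q_eq int_left int_right deriv_q r1 r1[unfolded mult_minus_left] r2 numeral_2_eq_2
 show "zeta1 a b c z = (cx (qz z), cx (- c * q1 z))"
  "zeta2 a b c z = (cx (u1 z), cx (qz z + c * p z))"
  "zeta1_star a b c z = (cx (c * ((qz z + c * p z) - b * (q2 z + c * p2 z) - 2 * qz z * p z - q1 z * um z)), cx (c * (um z - b * p1 z)))"
  "zeta2_star a b c z = (cx (q1 z - a * q3 z), cx (c * (qz z - b * q2 z)))"
  by (simp_all add: e algebra_simps)
qed

end

section \<open>Expansion of the modes\<close>

lemma imaginary_square: "(\<i> * cx x) * (\<i> * cx x) = - cx (x\<^sup>2)"
proof -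
 have "(\<i> * cx x) * (\<i> * cx x) = (\<i> * \<i>) * (cx x * cx x)" by (simp only: ac_simps)
 then show ?thesis by (simp add: power2_eq_square)
qed

context bl_branch
begin

lemma lam_hol: "lam holomorphic_on ball 0 R"
 using mu(1) unfolding lam_def[abs_def] hsym_def by (intro holomorphic_intros) auto

lemma lam_cnj: "e \<in> ball 0 R ==> cnj (lam e) = lam (cnj e)"
 using mu(1) by (simp add: lam_def hsym_def)

lemma lam0: "lam 0 = 0" by (simp add: lam_def)

lemma lam_deriv: "(lam has_field_derivative cx m00) (at 0)"
 unfolding lam_def[abs_def] by (rule derivative_eq_intros mu_deriv refl)+ (simp add: mu(3))

text \<open>In \<open>lam e = e * mu e\<close> the extra factor \<open>e\<close> raises the
  quadratic Taylor error of \<open>mu\<close> to a cubic one; the minus sign of the second term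
  comes from \<open>e * e = - \<eta>^2\<close>.\<close>

lemma lam_expansion:
 "(\<lambda>\<eta>. lam (\<i> * cx \<eta>) - (\<i> * cx (m00 * \<eta>) - cx (j0 * Xv / (- Av) * \<eta>\<^sup>2))) \<in> O[at 0](\<lambda>\<eta>. cx (\<eta> ^ 3))"
proof (rule bigoI)
 define C where "C = fact 2 * (2 * m00) / (R / 4)\<^sup>2"
 have "eventually (\<lambda>\<eta>::real. \<eta> \<in> ball 0 (R / 2)) (at 0)" by (rule eventually_at_in_open') (use R in auto)
 then show "\<forall>\<^sub>F \<eta> in at 0. norm (lam (\<i> * cx \<eta>) - (\<i> * cx (m00 * \<eta>) - cx (j0 * Xv / (- Av) * \<eta>\<^sup>2))) <= C * norm (cx (\<eta> ^ 3))"
 proof eventually_elim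
  case (elim \<eta>)
  define e where "e = \<i> * cx \<eta>"
  have e: "e \<in> ball 0 (R / 2)" "0 \<in> ball (0::complex) (R / 2)" using elim R by (auto simp: e_def norm_mult)
  have "mu holomorphic_on ball 0 R" using mu(1) by (simp add: hsym_def)
  from higher_deriv_taylor[OF this mu(2) e, of 0]
  have t: "norm (mu e - cx m00 - e * deriv mu 0) <= C * (norm e)\<^sup>2" by (simp add: C_def mu(3) numeral_2_eq_2)
  have ee: "e * e = - cx (\<eta>\<^sup>2)" unfolding e_def by (rule imaginary_square)
  have "lam e - (\<i> * cx (m00 * \<eta>) - cx (j0 * Xv / (- Av) * \<eta>\<^sup>2)) = e * mu e - e * cx m00 - (e * e) * deriv mu 0"
   unfolding ee deriv_mu_pos(1) by (simp add: lam_def e_def)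
  also have "\<dots> = e * (mu e - cx m00 - e * deriv mu 0)" by (simp add: algebra_simps)
  finally have "norm (lam e - (\<i> * cx (m00 * \<eta>) - cx (j0 * Xv / (- Av) * \<eta>\<^sup>2))) = norm e * norm (mu e - cx m00 - e * deriv mu 0)"
   by (simp only: norm_mult)
  also have "\<dots> <= norm e * (C * (norm e)\<^sup>2)" by (intro mult_left_mono t) simp
  also have "\<dots> = C * norm (cx (\<eta> ^ 3))" by (simp add: e_def norm_mult norm_power power2_eq_square power3_eq_cube)
  finally show ?case by (simp only: e_def)
 qed
qed

text \<open>The correction \<open>e * e * kd n e\<close> has vanishing first derivative at 0, so
  only \<open>lam e\<close> times the derivatives of \<open>u1\<close> contributes.\<close>

lemma UD_deriv0: "n < 4 ==> ((\<lambda>e. UD n e z) has_field_derivative cx (m00 * pd n z)) (at 0)"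
proof -
 assume n: "n < 4"
 have "(\<lambda>e z. KK n (f e) z) \<in> BV" using n by (auto simp: BV_def)
 then obtain C where C: "fam R w C (\<lambda>e z. KK n (f e) z)" using BV_fam by blast
 have "((\<lambda>e. KK n (f e) z) has_field_derivative deriv (\<lambda>e. KK n (f e) z) 0) (at 0)"
  by (rule holomorphic_derivI[OF fam_hol[OF C] open_ball zero_ball])
 then have k: "((\<lambda>e. kd n e z) has_field_derivative deriv (\<lambda>e. KK n (f e) z) 0) (at 0)" using n by (simp add: kd_def)
 have "((\<lambda>e. Ux n e z) has_field_derivative cx (m00 * pd n z)) (at 0)"
  unfolding Ux_def by (rule derivative_eq_intros lam_deriv k refl)+ simp
 then show ?thesis
  by (rule has_field_derivative_transform_within_open[OF _ open_ball zero_ball]) (use n in \<open>simp add: UD_Ux\<close>)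
qed

lemma UD_at0: "n < 4 ==> UD n 0 z = cx (qd n z)"
 using UD_Ux[OF zero_ball, of n] by (simp add: Ux_def lam0)

lemma nless: "(0::nat) < 4" "(1::nat) < 4" "(2::nat) < 4" "(3::nat) < 4" by simp_all

lemma Vx_deriv0: "((\<lambda>e. Vx e z) has_field_derivative cx (m00 * (qz z + c * p z))) (at 0)"
 unfolding Vx_def
 by (rule derivative_eq_intros lam_deriv UD_deriv0[OF nless(1)] UD_deriv0[OF nless(2)] refl)+
  (simp add: UD_at0 lam0 qd_def pd_def algebra_simps)

definition "hx n z = c * ((- 1) ^ n * (m00 * pd n (- z)))"

lemma Hn_deriv0: "n < 4 ==> ((\<lambda>e. Hn n e z) has_field_derivative cx (hx n z)) (at 0)"
 unfolding Hn_def hx_def using UD_deriv0[of n "- z"] by (auto intro!: DERIV_cmult simp: of_real_mult)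

lemma Hn_at0: "n < 4 ==> Hn n 0 z = cx (c * ((- 1) ^ n * qd n (- z)))"
 by (simp add: Hn_def UD_at0)

lemma hx_eq: "hx 0 z = c * m00 * um z" "hx 1 z = c * m00 * p z" "hx 2 z = c * m00 * p1 z" "hx 3 z = c * m00 * p2 z"
 by (simp_all add: hx_def pd_def um_def parity)

lemma Hn_at0_eq: "Hn 0 0 z = cx (c * qz z)" "Hn 1 0 z = cx (c * q1 z)" "Hn 2 0 z = cx (c * q2 z)" "Hn 3 0 z = cx (c * q3 z)"
 using Hn_at0[of 0 z] Hn_at0[of 1 z] Hn_at0[of 2 z] Hn_at0[of 3 z] by (simp_all add: qd_def parity q3_parity)

lemma g2_deriv0: "((\<lambda>e. g2 0 e z) has_field_derivative cx (hx 0 z - b * hx 2 z)) (at 0)"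
 "((\<lambda>e. g2 1 e z) has_field_derivative cx (hx 1 z - b * hx 3 z)) (at 0)"
proof -
 have s: "0 + 2 = (2::nat)" "1 + 2 = (3::nat)" by simp_all
 show "((\<lambda>e. g2 0 e z) has_field_derivative cx (hx 0 z - b * hx 2 z)) (at 0)"
  unfolding g2_def s by (rule derivative_eq_intros Hn_deriv0[OF nless(1)] Hn_deriv0[OF nless(3)] refl)+ simp
 show "((\<lambda>e. g2 1 e z) has_field_derivative cx (hx 1 z - b * hx 3 z)) (at 0)"
  unfolding g2_def s by (rule derivative_eq_intros Hn_deriv0[OF nless(2)] Hn_deriv0[OF nless(4)] refl)+ simp
qed

lemma g2_at0: "g2 0 0 z = cx (c * (qz z - b * q2 z))" "g2 1 0 z = cx (c * (q1 z - b * q3 z))"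
 by (simp_all add: g2_def Hn_at0_eq Hn_at0_eq(2)[unfolded One_nat_def] numeral_2_eq_2[symmetric] numeral_3_eq_3[symmetric] algebra_simps)

lemma Kx_deriv0: "((\<lambda>e. Kx e z) has_field_derivative cx (m00 * (c * ((qz z + c * p z) - b * (q2 z + c * p2 z) - 2 * qz z * p z - q1 z * um z)))) (at 0)"
 unfolding Kx_def
 by (rule derivative_eq_intros lam_deriv g2_deriv0 Hn_deriv0[OF nless(1)] Hn_deriv0[OF nless(2)] refl)+
  (simp add: lam0 g2_at0 hx_eq hx_eq(2)[unfolded One_nat_def] algebra_simps)

text \<open>The construction yields an expression in \<open>b\<close>, \<open>c\<close> and the
  profile; \<open>soliton1\<close> converts it into \<open>A0\<close> applied to the derivative of
  the profile.\<close>

lemma Kx_at0: "Kx 0 z = cx (q1 z - a * q3 z)"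
proof -
 have "(b * (c * c) - a) * q3 z = (c * c - 1) * q1 z - 3 * c * qz z * q1 z" using soliton1[of z] by (simp add: m_def power2_eq_square)
 then have "c * (c * (q1 z - b * q3 z)) - 2 * qz z * (c * q1 z) - q1 z * (c * qz z) = q1 z - a * q3 z" by (simp add: algebra_simps)
 from arg_cong[OF this, of cx] show ?thesis
  by (simp add: Kx_def lam0 g2_at0(2) Hn_at0_eq Hn_at0_eq(2)[unfolded One_nat_def] g2_at0(2)[unfolded One_nat_def])
qed

lemma ed_simps: "ed 0 X e z = X e z" by (simp add: ed_def)

lemma ed_first: "ed (Suc 0) (UD 0) 0 z = cx (m00 * u1 z)" "ed (Suc 0) Vx 0 z = cx (m00 * (qz z + c * p z))"
 "ed (Suc 0) (g2 0) 0 z = cx (hx 0 z - b * hx 2 z)"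
 "ed (Suc 0) Kx 0 z = cx (m00 * (c * ((qz z + c * p z) - b * (q2 z + c * p2 z) - 2 * qz z * p z - q1 z * um z)))"
 using UD_deriv0[OF nless(1), of z] Vx_deriv0[of z] g2_deriv0(1)[of z] Kx_deriv0[of z] unfolding ed_def
 by (simp_all add: DERIV_imp_deriv pd_def del: of_real_mult of_real_add of_real_diff)

end

theorem theorem2p1:
  fixes a b c \<alpha> :: real and k :: nat
  assumes "0 < a" and "a < b" and "1 \<le> k" and "1 < c"
    and "0 < \<alpha>" and "\<alpha> < alpha_c a b c"
  shows "\<exists>\<eta>\<^sub>0 > 0. \<exists>(lam :: real \<Rightarrow> complex)
           (\<zeta> :: real \<Rightarrow> real \<Rightarrow> complex \<times> complex) (\<zeta>s :: real \<Rightarrow> real \<Rightarrow> complex \<times> complex).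
         \<exists>l1 > (0::real). \<exists>l2 > (0::real).
     smooth_scalar {-\<eta>\<^sub>0..\<eta>\<^sub>0} lam \<and>
     smooth_HHw k \<alpha> {-\<eta>\<^sub>0..\<eta>\<^sub>0} \<zeta> \<and>
     smooth_HHw k (- \<alpha>) {-\<eta>\<^sub>0..\<eta>\<^sub>0} \<zeta>s \<and>
     (\<forall>\<eta>\<in>{-\<eta>\<^sub>0..\<eta>\<^sub>0}. \<forall>\<sigma>\<in>{1, -1}.
        L_eq k a b c \<alpha> \<eta> (\<zeta> (\<sigma> * \<eta>)) (\<lambda>z. cscale (lam (\<sigma> * \<eta>)) (\<zeta> (\<sigma> * \<eta>) z)) \<and>
        Lstar_eq k a b c \<alpha> \<eta> (\<zeta>s (\<sigma> * \<eta>)) (\<lambda>z. cscale (lam (- \<sigma> * \<eta>)) (\<zeta>s (\<sigma> * \<eta>) z))) \<and>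
     (\<lambda>\<eta>. lam \<eta> - (\<i> * of_real (l1 * \<eta>) - of_real (l2 * \<eta>\<^sup>2)))
        \<in> O[at 0](\<lambda>\<eta>. of_real (\<eta> ^ 3)) \<and>
     (\<forall>\<eta>\<in>{-\<eta>\<^sub>0..\<eta>\<^sub>0}.
        (\<lambda>z. \<zeta> \<eta> z - (zeta1 a b c z + cscale (\<i> * of_real (l1 * \<eta>)) (zeta2 a b c z)))
          \<in> HHw k \<alpha>) \<and>
     (\<lambda>\<eta>. HHw_norm k \<alpha>
        (\<lambda>z. \<zeta> \<eta> z - (zeta1 a b c z + cscale (\<i> * of_real (l1 * \<eta>)) (zeta2 a b c z))))
        \<in> O[at 0](\<lambda>\<eta>. \<eta>\<^sup>2) \<and>
     (\<forall>\<eta>\<in>{-\<eta>\<^sub>0..\<eta>\<^sub>0}.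
        (\<lambda>z. \<zeta>s \<eta> z - (zeta2_star a b c z - cscale (\<i> * of_real (l1 * \<eta>)) (zeta1_star a b c z)))
          \<in> HHw k (- \<alpha>)) \<and>
     (\<lambda>\<eta>. HHw_norm k (- \<alpha>)
        (\<lambda>z. \<zeta>s \<eta> z - (zeta2_star a b c z - cscale (\<i> * of_real (l1 * \<eta>)) (zeta1_star a b c z))))
        \<in> O[at 0](\<lambda>\<eta>. \<eta>\<^sup>2) \<and>
     (\<forall>\<eta>\<in>{-\<eta>\<^sub>0..\<eta>\<^sub>0}. cnj (lam \<eta>) = lam (- \<eta>) \<and>
        (\<forall>z. map_prod cnj cnj (\<zeta> \<eta> z) = \<zeta> (- \<eta>) z \<and>
             map_prod cnj cnj (\<zeta>s \<eta> z) = \<zeta>s (- \<eta>) z))"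
proof -
 interpret benney_luke a b c \<alpha> using assms by unfold_locales
 obtain R mu f C where "R > 0" "R <= 1" "C >= 0" "hsym R mu" "fam R (wt \<alpha> de) C f" "\<forall>e\<in>ball 0 R. norm (mu e) <= 2 * m00"
  "mu 0 = cx m00" "\<forall>e\<in>ball 0 R. f e = Frhs e (mu e) (f e) \<and> lint qz (f e) = 0"
  using branch_Frhs by blast
 then interpret bl_branch a b c \<alpha> R C mu f by unfold_locales auto
 interpret Z: smpair R \<alpha> de UD VD \<i> by standard (use UD VD R de in auto)
 \<comment> \<open>Along \<open>e = - \<i> * \<eta>\<close> the reality symmetry turns the families
   into the conjugates of their values at \<open>\<i> * \<eta>\<close>, the form required by the
   sesquilinear adjoint.\<close>
 interpret Y: smpair R "- \<alpha>" de KD GD "- \<i>" by standard (use KD GD R de in \<open>auto simp: w'_def[abs_def]\<close>)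
 have b: "\<i> * cx \<eta> \<in> ball 0 R" if "\<eta> \<in> {- (R / 4)..R / 4}" for \<eta>
  using that R by (auto simp: norm_mult abs_if)
 have Zpr: "Z.pr 0 \<eta> z = (UD 0 (\<i> * cx \<eta>) z, VD 0 (\<i> * cx \<eta>) z)" for \<eta> z by (simp add: Z.pr_def ed_simps)
 have Ypr: "Y.pr 0 \<eta> z = (KD 0 (- \<i> * cx \<eta>) z, GD 0 (- \<i> * cx \<eta>) z)" for \<eta> z by (simp add: Y.pr_def ed_simps)
 have cn: "D n (cnj e) z = cnj (D n e z)" if "smfam R v D" "e \<in> ball 0 R" for v D n e z
  using smfam_fam[OF that(1), of n] fam_cnj that(2) by blast
 have Ypr': "Y.pr 0 \<eta> z = (cnj (KD 0 (\<i> * cx \<eta>) z), cnj (GD 0 (\<i> * cx \<eta>) z))" if "\<eta> \<in> {- (R / 4)..R / 4}" for \<eta> z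
  using cn[OF KD(2) b[OF that], of 0 z] cn[OF GD(2) b[OF that], of 0 z] by (simp add: Ypr)
 have zeta: "zeta1 a b c z + cscale (\<i> * cx (m00 * \<eta>)) (zeta2 a b c z) = Z.pr 0 0 z + \<eta> *\<^sub>R Z.pr 1 0 z" for \<eta> z
  unfolding zeta_explicit Z.pr_def VD(1)
  by (simp add: ed_simps ed_first UD_at0 Vx_def lam0 qd_def pd_def scaleR_conv_of_real algebra_simps)
 have zetas: "zeta2_star a b c z - cscale (\<i> * cx (m00 * \<eta>)) (zeta1_star a b c z) = Y.pr 0 0 z + \<eta> *\<^sub>R Y.pr 1 0 z" for \<eta> z
  unfolding zeta_explicit Y.pr_def KD(1) GD(1)
  by (simp add: ed_simps ed_first Kx_at0 g2_at0 hx_eq scaleR_conv_of_real algebra_simps)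
 have eig: "L_eq k a b c \<alpha> \<eta> (Z.pr 0 (\<sigma> * \<eta>)) (\<lambda>z. cscale (lam (\<i> * cx (\<sigma> * \<eta>))) (Z.pr 0 (\<sigma> * \<eta>) z)) \<and>
   Lstar_eq k a b c \<alpha> \<eta> (Y.pr 0 (\<sigma> * \<eta>)) (\<lambda>z. cscale (lam (\<i> * cx (- \<sigma> * \<eta>))) (Y.pr 0 (\<sigma> * \<eta>) z))"
  if "\<eta> \<in> {- (R / 4)..R / 4}" "\<sigma> \<in> {1, - 1}" for \<eta> \<sigma> :: real
 proof -
  have s: "\<sigma> * \<eta> \<in> {- (R / 4)..R / 4}" using that by auto
  define e where "e = \<i> * cx (\<sigma> * \<eta>)"
  have e: "e \<in> ball 0 R" using b[OF s] by (simp add: e_def)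
  \<comment> \<open>Both signs of \<open>\<sigma>\<close> give the same square, so the operator at
    \<open>\<eta>\<close> serves the modes with parameter \<open>\<eta>\<close> and
    \<open>- \<eta>\<close>.\<close>
  have E: "cx (\<eta>\<^sup>2) = - (e * e)" using that(2) unfolding e_def imaginary_square by auto
  have l: "lam (\<i> * cx (- \<sigma> * \<eta>)) = cnj (lam e)" unfolding lam_cnj[OF e] by (simp add: e_def)
  have Z: "Z.pr 0 (\<sigma> * \<eta>) = (\<lambda>z. (UD 0 e z, lam e * UD 0 e z - cx c * UD 1 e z))"
   by (rule ext) (simp only: Zpr VD(1) Vx_def e_def)
  have Y: "Y.pr 0 (\<sigma> * \<eta>) = (\<lambda>z. (cnj (KD 0 e z), cnj (GD 0 e z)))"
   by (rule ext) (simp only: Ypr'[OF s] e_def)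
  show ?thesis unfolding l Z Y e_def[symmetric] using L_eq[OF e E] Lstar_eq[OF e E \<open>1 <= k\<close>] by blast
 qed
 have cz: "cnj (lam (\<i> * cx \<eta>)) = lam (\<i> * cx (- \<eta>)) \<and>
   (\<forall>z. map_prod cnj cnj (Z.pr 0 \<eta> z) = Z.pr 0 (- \<eta>) z \<and> map_prod cnj cnj (Y.pr 0 \<eta> z) = Y.pr 0 (- \<eta>) z)"
  if "\<eta> \<in> {- (R / 4)..R / 4}" for \<eta>
  using lam_cnj[OF b[OF that]] cn[OF UD(2) b[OF that]] cn[OF VD(2) b[OF that]] Ypr'[OF that] Ypr[of "- \<eta>"]
  by (simp add: Zpr)
 have ex: "(\<lambda>z. Z.pr 0 \<eta> z - (zeta1 a b c z + cscale (\<i> * cx (m00 * \<eta>)) (zeta2 a b c z))) \<in> HHw k \<alpha>"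
  "(\<lambda>z. Y.pr 0 \<eta> z - (zeta2_star a b c z - cscale (\<i> * cx (m00 * \<eta>)) (zeta1_star a b c z))) \<in> HHw k (- \<alpha>)"
  if "\<eta> \<in> {- (R / 4)..R / 4}" for \<eta>
  unfolding zeta zetas using that by (intro Z.expansion(1) Y.expansion(1); auto)+
 have ex2: "(\<lambda>\<eta>. HHw_norm k \<alpha> (\<lambda>z. Z.pr 0 \<eta> z - (zeta1 a b c z + cscale (\<i> * cx (m00 * \<eta>)) (zeta2 a b c z)))) \<in> O[at 0](\<lambda>\<eta>. \<eta>\<^sup>2)"
  "(\<lambda>\<eta>. HHw_norm k (- \<alpha>) (\<lambda>z. Y.pr 0 \<eta> z - (zeta2_star a b c z - cscale (\<i> * cx (m00 * \<eta>)) (zeta1_star a b c z)))) \<in> O[at 0](\<lambda>\<eta>. \<eta>\<^sup>2)"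
  unfolding zeta zetas by (rule Z.expansion(2), rule Y.expansion(2))
 show ?thesis
  \<comment> \<open>The estimates for parameter derivatives hold for \<open>e\<close> of modulus
    below \<open>R / 2\<close>, so the closed interval of radius \<open>R / 4\<close> lies safely
    inside.\<close>
  by (rule exI[of _ "R / 4"], rule conjI, use R in simp, rule exI[of _ "\<lambda>\<eta>. lam (\<i> * cx \<eta>)"], rule exI[of _ "Z.pr 0"], rule exI[of _ "Y.pr 0"],
   rule exI[of _ m00], rule conjI[OF m00(1)], rule exI[of _ "j0 * Xv / (- Av)"], rule conjI[OF deriv_mu_pos(2)],
   intro conjI ballI allI smooth_scalar_holomorphic[OF lam_hol] Z.smooth Y.smooth lam_expansion eig[THEN conjunct1] eig[THEN conjunct2] ex ex2
    cz[THEN conjunct1] cz[THEN conjunct2, rule_format, THEN conjunct1] cz[THEN conjunct2, rule_format, THEN conjunct2])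
   (use R in simp_all)
qed

end
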